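(* Let $p\in(1,\infty)$, $p'=\frac{p}{p-1}$ and $$\alpha_p:=\frac12\Big[2\cos\Big(\frac{\pi}{2p}\Big)\Gamma\Big(\frac1p\Big)\Big]^{p'},\qquad \Gamma(z)=\int_0^\infty t^{z-1}e^{-t}\,dt.$$ Then there is a constant $C_p<\infty$ depending only on $p$ such that for every bounded open interval $I\subset\mathbb R$ and every $\alpha\le\alpha_p$, $$\sup\Big\{\int_I\big(e^{\alpha|u|^{p'}}-1\big)dx\;:\;u\in\tilde H^{\frac1p,p}(I),\ \|(-\Delta)^{\frac1{2p}}u\|_{L^p(I)}\le1\Big\}\le C_p|I|.$$ Moreover $\alpha_p$ is optimal in the following strong sense: for every bounded open interval $I$ and every function $h:[0,\infty)\to[0,\infty)$ with $\lim_{t\to\infty}h(t)=\infty$, $$\sup\Big\{\int_I h(|u|)\big(e^{\alpha_p|u|^{p'}}-1\big)dx\;:\;u\in\tilde H^{\frac1p,p}(I),\ \|(-\Delta)^{\frac1{2p}}u\|_{L^p(I)}\le1\Big\}=+\infty.$$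
   Context: For $s\in(0,1)$ and $\varphi$ in the Schwartz space $\mathcal S$, $(-\Delta)^s\varphi:=\mathcal F^{-1}(|\xi|^{2s}\hat\varphi)$, with $\hat\varphi(\xi)=(2\pi)^{-1/2}\int_{\mathbb R}e^{-ix\xi}\varphi(x)dx$. For $u\in L^1_{loc}(\mathbb R)$ with $\int_{\mathbb R}\frac{|u(x)|}{1+|x|^{1+2s}}dx<\infty$, $(-\Delta)^su$ is the tempered distribution $\langle(-\Delta)^su,\varphi\rangle:=\int_{\mathbb R}u\,(-\Delta)^s\varphi\,dx$, $\varphi\in\mathcal S$. For $s\in(0,1)$ and $p\in[1,\infty)$, $H^{s,p}(\mathbb R):=\{u\in L^p(\mathbb R):(-\Delta)^{s/2}u\in L^p(\mathbb R)\}$ with norm $\|u\|^p_{H^{s,p}(\mathbb R)}=\|u\|^p_{L^p(\mathbb R)}+\|(-\Delta)^{s/2}u\|^p_{L^p(\mathbb R)}$, and for a bounded open interval $I$, $\tilde H^{s,p}(I):=\{u\in H^{s,p}(\mathbb R):u=0\text{ a.e. in }\mathbb R\setminus I\}$ with the same norm. Note that the constraint uses the $L^p$ norm of $(-\Delta)^{\frac1{2p}}u$ over $I$ only. *)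

theory Defs
  imports "HOL-Analysis.Analysis"
begin

fun vderivs :: "nat \<Rightarrow> (real \<Rightarrow> complex) \<Rightarrow> real \<Rightarrow> complex" where
  "vderivs 0 f = f"
| "vderivs (Suc n) f = (\<lambda>x. vector_derivative (vderivs n f) (at x))"

definition schwartz :: "(real \<Rightarrow> complex) \<Rightarrow> bool" where
  "schwartz \<phi> \<longleftrightarrow>
     (\<forall>n x. (vderivs n \<phi> has_vector_derivative vderivs (Suc n) \<phi> x) (at x)) \<and>
     (\<forall>k n. \<exists>M. \<forall>x. \<bar>x\<bar> ^ k * norm (vderivs n \<phi> x) \<le> M)"

definition fourier :: "(real \<Rightarrow> complex) \<Rightarrow> real \<Rightarrow> complex" where
  "fourier \<phi> \<xi> = complex_of_real (1 / sqrt (2 * pi)) *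
      (\<integral>x. cis (- (x * \<xi>)) * \<phi> x \<partial>lborel)"

definition inv_fourier :: "(real \<Rightarrow> complex) \<Rightarrow> real \<Rightarrow> complex" where
  "inv_fourier \<psi> x = complex_of_real (1 / sqrt (2 * pi)) *
      (\<integral>\<xi>. cis (x * \<xi>) * \<psi> \<xi> \<partial>lborel)"

definition fraclap :: "real \<Rightarrow> (real \<Rightarrow> complex) \<Rightarrow> real \<Rightarrow> complex" where
  "fraclap s \<phi> = inv_fourier (\<lambda>\<xi>. complex_of_real (\<bar>\<xi>\<bar> powr (2 * s)) * fourier \<phi> \<xi>)"

text \<open>\<open>fraclap_dist s u g\<close>: u satisfies the weighted integrability condition, and the tempered
  distribution (-Delta)^s u is the (locally integrable) function g, i.e.
  for all Schwartz phi: integral of u * (-Delta)^s phi = integral of g * phi.\<close>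
definition fraclap_dist :: "real \<Rightarrow> (real \<Rightarrow> real) \<Rightarrow> (real \<Rightarrow> real) \<Rightarrow> bool" where
  "fraclap_dist s u g \<longleftrightarrow>
     integrable lborel (\<lambda>x. \<bar>u x\<bar> / (1 + \<bar>x\<bar> powr (1 + 2 * s))) \<and>
     (\<forall>\<phi>. schwartz \<phi> \<longrightarrow>
        (\<integral>x. complex_of_real (u x) * fraclap s \<phi> x \<partial>lborel) =
        (\<integral>x. complex_of_real (g x) * \<phi> x \<partial>lborel))"

definition Lp :: "real \<Rightarrow> (real \<Rightarrow> real) \<Rightarrow> bool" where
  "Lp p u \<longleftrightarrow> u \<in> borel_measurable lborel \<and> integrable lborel (\<lambda>x. \<bar>u x\<bar> powr p)"

definition Hsp :: "real \<Rightarrow> real \<Rightarrow> (real \<Rightarrow> real) \<Rightarrow> bool" where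
  "Hsp s p u \<longleftrightarrow> Lp p u \<and> (\<exists>g. Lp p g \<and> fraclap_dist (s / 2) u g)"

definition Hsp_tilde :: "real \<Rightarrow> real \<Rightarrow> real \<Rightarrow> real \<Rightarrow> (real \<Rightarrow> real) \<Rightarrow> bool" where
  "Hsp_tilde s p a b u \<longleftrightarrow> Hsp s p u \<and> (AE x in lborel. x \<notin> {a<..<b} \<longrightarrow> u x = 0)"

definition admissible :: "real \<Rightarrow> real \<Rightarrow> real \<Rightarrow> (real \<Rightarrow> real) \<Rightarrow> bool" where
  "admissible p a b u \<longleftrightarrow> Hsp_tilde (1 / p) p a b u \<and>
     (\<exists>g. Lp p g \<and> fraclap_dist (1 / (2 * p)) u g \<and>
          (\<integral>\<^sup>+ x \<in> {a<..<b}. ennreal (\<bar>g x\<bar> powr p) \<partial>lborel) \<le> 1)"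

definition alpha_p :: "real \<Rightarrow> real" where
  "alpha_p p = 1 / 2 * (2 * cos (pi / (2 * p)) * Gamma (1 / p)) powr (p / (p - 1))"

end

theory Submission
  imports Defs "HOL-Probability.Probability" "HOL-Real_Asymp.Real_Asymp"
begin

text \<open>
  Put \<open>s = 1 / p\<close>. On test functions \<open>(-\<Delta>)\<close> to the power \<open>s / 2\<close> is the singular integral \<open>fl s\<close>, and convolution
  with \<open>|x| powr (s - 1)\<close> inverts it up to the factor \<open>kap s = 2 * cos (pi * s / 2) * Gamma s\<close>, whose power
  \<open>p / (p - 1)\<close> is \<open>2 * alpha_p p\<close>.

  Upper bound: if \<open>u\<close> vanishes off \<open>I\<close> then, although \<open>fl s u\<close> is uncontrolled outside \<open>I\<close>, a maximum principle
  shows that \<open>kap s * u\<close> is at most the Riesz potential of \<open>|fl s u|\<close> restricted to \<open>I\<close>; this takes the place of the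
  Green function of \<open>I\<close>. After mollification the claim becomes the inequality of Adams for Riesz potentials on the
  line. There the mean of the potential over a set of measure \<open>t\<close> is controlled by the decreasing rearrangement of
  the density, and a one-dimensional lemma of Garsia finishes the proof.

  Optimality: superposing the dilates of a bump by \<open>exp t\<close>, \<open>0 \<le> t \<le> \<Lambda>\<close>, gives a truncated logarithm of height
  \<open>\<Lambda> - O(1)\<close> on \<open>|x| \<le> exp (- \<Lambda>)\<close> for which the \<open>p\<close>-th power of the norm of \<open>fl s\<close> over \<open>(-1, 1)\<close> is at most
  \<open>2 * (kap s / 2) powr p * \<Lambda> + O(1)\<close>. Normalised, it makes the exponential integral at \<open>alpha_p p\<close> bounded away
  from zero while its values go to infinity.
\<close>

subsection \<open>Integration on the line\<close>

text \<open>The critical constant rests on one computation. A set of measure t is best placed as an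
  interval of half-length t / 2, so |x| powr (s - 1) rearranges to (\<tau> / 2) powr (s - 1), and
  since (s - 1) * q = -1 the q-th power of this is exactly 2 / \<tau>. Hoelder's inequality on (t,
  L) therefore costs (2 * ln (L / t)) powr (1 / q), and this 2 is the 1 / 2 in
  \<open>alpha_p\<close>; in the lower bound the same 2 counts the two half-lines of the logarithmic
  profile. Hoelder alone bounds the exponential by a multiple of L / t, which just fails to be
  integrable at 0. Garsia's argument recovers this loss: near-equality with a given deficit can
  occur only in a range of ln (L / t) whose length is linear in the deficit. Admissibility is
  distributional and the maximum principle pointwise. Mollification mediates, at the price of
  enlarging I by multiples of the width; the norm outside I is not small, but it is finite, and this
  makes the norms over the enlarged intervals converge to the norm over I.\<close>

lemma nn_integral_abs:
  fixes f :: "real \<Rightarrow> ennreal"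
  assumes [measurable]: "f \<in> borel_measurable borel"
  shows "(\<integral>\<^sup>+x. f \<bar>x\<bar> \<partial>lborel) = 2 * (\<integral>\<^sup>+x\<in>{0<..}. f x \<partial>lborel)"
proof -
  have "(\<integral>\<^sup>+x. f \<bar>x\<bar> \<partial>lborel) = (\<integral>\<^sup>+x. f \<bar>x\<bar> * indicator {0<..} x + f \<bar>x\<bar> * indicator {..<0} x \<partial>lborel)"
    by (intro nn_integral_cong_AE AE_I[of _ _ "{0}"]) (auto simp: indicator_def)
  also have "\<dots> = (\<integral>\<^sup>+x. f \<bar>x\<bar> * indicator {0<..} x \<partial>lborel) + (\<integral>\<^sup>+x. f \<bar>x\<bar> * indicator {..<0} x \<partial>lborel)"
    by (rule nn_integral_add) auto
  also have "(\<integral>\<^sup>+x. f \<bar>x\<bar> * indicator {..<0} x \<partial>lborel) = (\<integral>\<^sup>+x. f \<bar>x\<bar> * indicator {0<..} x \<partial>lborel)"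
    by (subst nn_integral_real_affine[where c="-1" and t=0])
       (auto intro!: nn_integral_cong simp: indicator_def)
  also have "(\<integral>\<^sup>+x. f \<bar>x\<bar> * indicator {0<..} x \<partial>lborel) = (\<integral>\<^sup>+x\<in>{0<..}. f x \<partial>lborel)"
    by (intro nn_integral_cong) (auto simp: indicator_def)
  finally show ?thesis by (simp add: mult_2)
qed

lemma nn_integral_powr_0:
  assumes "0 < a" "0 \<le> R"
  shows "(\<integral>\<^sup>+x\<in>{0..R}. ennreal (x powr (a - 1)) \<partial>lborel) = ennreal (R powr a / a)"
  using has_integral_powr_from_0[of "a - 1" R] assms
  by (subst nn_integral_has_integral_lebesgue'[of "{0..R}" "\<lambda>x. x powr (a - 1)" "R powr a / a"]) auto

lemma nn_integral_powr_inf: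
  assumes "0 < a" "0 < R"
  shows "(\<integral>\<^sup>+x\<in>{R..}. ennreal (x powr (-1 - a)) \<partial>lborel) = ennreal (R powr (-a) / a)"
  using has_integral_powr_to_inf[of "-1 - a" R] assms
  by (subst nn_integral_has_integral_lebesgue'[of "{R..}" "\<lambda>x. x powr (-1 - a)" "R powr (-a) / a"])
     (auto simp: field_simps)

lemma nn_integral_abs_powr_0:
  assumes "0 < a" "0 \<le> R"
  shows "(\<integral>\<^sup>+x. ennreal (\<bar>x\<bar> powr (a - 1)) * indicator {-R..R} x \<partial>lborel) = ennreal (2 * R powr a / a)"
proof -
  have "(\<integral>\<^sup>+x. ennreal (\<bar>x\<bar> powr (a - 1)) * indicator {-R..R} x \<partial>lborel)
      = (\<integral>\<^sup>+x. ennreal (\<bar>x\<bar> powr (a - 1)) * indicator {..R} \<bar>x\<bar> \<partial>lborel)"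
    by (intro nn_integral_cong) (auto simp: indicator_def)
  also have "\<dots> = 2 * (\<integral>\<^sup>+x\<in>{0<..}. ennreal (x powr (a - 1)) * indicator {..R} x \<partial>lborel)"
    by (rule nn_integral_abs) auto
  also have "(\<integral>\<^sup>+x\<in>{0<..}. ennreal (x powr (a - 1)) * indicator {..R} x \<partial>lborel) = (\<integral>\<^sup>+x\<in>{0..R}. ennreal (x powr (a - 1)) \<partial>lborel)"
    by (intro nn_integral_cong) (auto simp: indicator_def)
  also have "\<dots> = ennreal (R powr a / a)" by (rule nn_integral_powr_0) fact+
  also have "2 * ennreal (R powr a / a) = ennreal (2 * R powr a / a)"
    using assms by (simp add: ennreal_mult'[of 2, simplified] flip: times_divide_eq_right)
  finally show ?thesis .
qed

lemma nn_integral_abs_powr_inf: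
  assumes "0 < a" "0 < R"
  shows "(\<integral>\<^sup>+x. ennreal (\<bar>x\<bar> powr (-1 - a)) * indicator {R..} \<bar>x\<bar> \<partial>lborel) = ennreal (2 * R powr (-a) / a)"
proof -
  have "(\<integral>\<^sup>+x. ennreal (\<bar>x\<bar> powr (-1 - a)) * indicator {R..} \<bar>x\<bar> \<partial>lborel)
      = 2 * (\<integral>\<^sup>+x\<in>{0<..}. ennreal (x powr (-1 - a)) * indicator {R..} x \<partial>lborel)"
    by (rule nn_integral_abs) auto
  also have "(\<integral>\<^sup>+x\<in>{0<..}. ennreal (x powr (-1 - a)) * indicator {R..} x \<partial>lborel) = (\<integral>\<^sup>+x\<in>{R..}. ennreal (x powr (-1 - a)) \<partial>lborel)"
    using assms by (intro nn_integral_cong) (auto simp: indicator_def)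
  also have "\<dots> = ennreal (R powr (-a) / a)" by (rule nn_integral_powr_inf) fact+
  also have "2 * ennreal (R powr (-a) / a) = ennreal (2 * R powr (-a) / a)"
    using assms by (simp add: ennreal_mult'[of 2, simplified] flip: times_divide_eq_right)
  finally show ?thesis .
qed

lemma integrable_nonneg_bound:
  fixes f :: "'a \<Rightarrow> real"
  assumes "f \<in> borel_measurable M" "\<And>x. 0 \<le> f x" "(\<integral>\<^sup>+x. ennreal (f x) \<partial>M) < \<infinity>"
  shows "integrable M f"
  using assms by (intro integrableI_bounded) auto

lemma integrable_abs_powr_near_0:
  assumes "0 < a"
  shows "integrable lborel (\<lambda>x::real. \<bar>x\<bar> powr (a - 1) * indicator {-R..R} x)"
proof (rule integrable_nonneg_bound)
  have "(\<integral>\<^sup>+x. ennreal (\<bar>x\<bar> powr (a - 1) * indicator {-R..R} x) \<partial>lborel)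
     \<le> (\<integral>\<^sup>+x. ennreal (\<bar>x\<bar> powr (a - 1)) * indicator {-\<bar>R\<bar>..\<bar>R\<bar>} x \<partial>lborel)"
    by (intro nn_integral_mono) (auto simp: indicator_def)
  also have "\<dots> < \<infinity>" using assms by (subst nn_integral_abs_powr_0) auto
  finally show "(\<integral>\<^sup>+x. ennreal (\<bar>x\<bar> powr (a - 1) * indicator {-R..R} x) \<partial>lborel) < \<infinity>" .
qed auto

lemma integrable_abs_powr_near_inf:
  assumes "0 < a" "0 < R"
  shows "integrable lborel (\<lambda>x::real. \<bar>x\<bar> powr (-1 - a) * indicator {R..} \<bar>x\<bar>)"
proof (rule integrable_nonneg_bound)
  have "(\<integral>\<^sup>+x. ennreal (\<bar>x\<bar> powr (-1 - a) * indicator {R..} \<bar>x\<bar>) \<partial>lborel)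
     = (\<integral>\<^sup>+x. ennreal (\<bar>x\<bar> powr (-1 - a)) * indicator {R..} \<bar>x\<bar> \<partial>lborel)"
    by (intro nn_integral_cong) (auto simp: indicator_def)
  also have "\<dots> < \<infinity>" using assms by (subst nn_integral_abs_powr_inf) auto
  finally show "(\<integral>\<^sup>+x. ennreal (\<bar>x\<bar> powr (-1 - a) * indicator {R..} \<bar>x\<bar>) \<partial>lborel) < \<infinity>" .
qed auto

lemma integrable_decay:
  fixes f :: "real \<Rightarrow> 'b::{banach, second_countable_topology}"
  assumes "f \<in> borel_measurable borel" "\<And>x. norm (f x) \<le> C / (1 + \<bar>x\<bar> powr (1 + a))" "0 < a"
  shows "integrable lborel f"
proof (rule Bochner_Integration.integrable_bound)
  \<comment> \<open>\<open>0 powr 0 = 0\<close>, so the factor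
    \<open>\<bar>x\<bar> powr (1 - 1)\<close> is 1 except at the origin; the indicator of
    \<open>{0..0}\<close> repairs that point, making the majorant valid everywhere.\<close>
  show "integrable lborel (\<lambda>x::real. \<bar>C\<bar> * (\<bar>x\<bar> powr (1 - 1) * indicator {-1..1} x + \<bar>x\<bar> powr (-1 - a) * indicator {1..} \<bar>x\<bar> + indicator {0..0} x))"
    using assms(3) by (intro integrable_mult_right Bochner_Integration.integrable_add integrable_abs_powr_near_0 integrable_abs_powr_near_inf)
      (auto intro!: integrable_real_indicator)
  show "AE x in lborel. norm (f x) \<le> norm (\<bar>C\<bar> * (\<bar>x\<bar> powr (1 - 1) * indicator {-1..1} x + \<bar>x\<bar> powr (-1 - a) * indicator {1..} \<bar>x\<bar> + indicator {0..0} x))"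
  proof (rule AE_I2)
    fix x :: real
    have n: "norm (f x) \<le> \<bar>C\<bar> / (1 + \<bar>x\<bar> powr (1 + a))"
      by (rule order.trans[OF assms(2)]) (auto intro!: divide_right_mono add_nonneg_nonneg)
    have "1 / (1 + \<bar>x\<bar> powr (1 + a)) \<le> \<bar>x\<bar> powr (1 - 1) * indicator {-1..1} x + \<bar>x\<bar> powr (-1 - a) * indicator {1..} \<bar>x\<bar> + indicator {0..0} x"
    proof (cases "\<bar>x\<bar> \<le> 1")
      case True
      have "1 / (1 + \<bar>x\<bar> powr (1 + a)) \<le> 1" by (simp add: divide_le_eq add_pos_nonneg)
      then show ?thesis using True by (auto simp: indicator_def abs_le_iff intro: add_increasing2)
    next
      case False
      then have "1 / (1 + \<bar>x\<bar> powr (1 + a)) \<le> 1 / \<bar>x\<bar> powr (1 + a)"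
        by (intro divide_left_mono) (auto intro!: mult_pos_pos add_pos_nonneg)
      also have "\<dots> = \<bar>x\<bar> powr (-1 - a)" using powr_minus_divide[of "\<bar>x\<bar>" "1 + a"] by simp
      finally show ?thesis using False by (auto simp: indicator_def)
    qed
    from mult_left_mono[OF this, of "\<bar>C\<bar>"] n show "norm (f x) \<le> norm (\<bar>C\<bar> * (\<bar>x\<bar> powr (1 - 1) * indicator {-1..1} x + \<bar>x\<bar> powr (-1 - a) * indicator {1..} \<bar>x\<bar> + indicator {0..0} x))"
      by (auto simp: abs_mult)
  qed
qed (use assms in auto)

text \<open>Along a null sequence the mean value theorem bounds every difference quotient by
  \<open>w\<close>, so dominated convergence applies; the limit at 0 is then characterised by
  sequences.\<close>

lemma DERIV_under_integral:
  fixes K K' :: "real \<Rightarrow> 'a \<Rightarrow> real"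
  assumes int: "\<And>x. \<bar>x - x0\<bar> < 1 \<Longrightarrow> integrable M (K x)"
    and der: "\<And>x y. \<bar>x - x0\<bar> < 1 \<Longrightarrow> y \<in> space M \<Longrightarrow> ((\<lambda>x. K x y) has_real_derivative K' x y) (at x)"
    and bd: "\<And>x y. \<bar>x - x0\<bar> < 1 \<Longrightarrow> y \<in> space M \<Longrightarrow> \<bar>K' x y\<bar> \<le> w y" and w: "integrable M w"
  shows "((\<lambda>x. \<integral>y. K x y \<partial>M) has_real_derivative (\<integral>y. K' x0 y \<partial>M)) (at x0)"
    and "integrable M (K' x0)"
proof -
  have A: "integrable M (K' x0) \<and>
      (\<lambda>n. ((\<integral>y. K (x0 + X n) y \<partial>M) - (\<integral>y. K x0 y \<partial>M)) / X n) \<longlonglongrightarrow> (\<integral>y. K' x0 y \<partial>M)"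
    if X: "\<And>n. X n \<noteq> 0" "\<And>n. \<bar>X n\<bar> < 1" "X \<longlonglongrightarrow> 0" for X
  proof -
    define q where "q n y = (K (x0 + X n) y - K x0 y) / X n" for n y
    have qi: "integrable M (q n)" for n
      unfolding q_def using int[of "x0 + X n"] int[of x0] X(2)[of n] by auto
    have lim: "(\<lambda>n. q n y) \<longlonglongrightarrow> K' x0 y" if "y \<in> space M" for y
    proof -
      have "((\<lambda>h. (K (x0 + h) y - K x0 y) / h) \<longlongrightarrow> K' x0 y) (at 0)"
        using der[of x0 y] that by (simp add: DERIV_def)
      then show ?thesis unfolding q_def
        using X by (auto simp: tendsto_at_iff_sequentially comp_def)
    qed
    have bound: "norm (q n y) \<le> w y" if y: "y \<in> space M" for n y
    proof -
      define a b where "a = min x0 (x0 + X n)" and "b = max x0 (x0 + X n)"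
      have ab: "a < b" using X(1)[of n] by (auto simp: a_def b_def min_def max_def)
      have "\<exists>z. a < z \<and> z < b \<and> K b y - K a y = (b - a) * K' z y"
      proof (rule MVT2[OF ab])
        fix z assume "a \<le> z" "z \<le> b"
        then have "\<bar>z - x0\<bar> < 1" using X(2)[of n] by (auto simp: a_def b_def min_def max_def split: if_splits)
        then show "((\<lambda>x. K x y) has_real_derivative K' z y) (at z)" by (rule der) fact
      qed
      then obtain z where z: "a < z" "z < b" "K b y - K a y = (b - a) * K' z y" by blast
      have "\<bar>z - x0\<bar> < 1" using z X(2)[of n] by (auto simp: a_def b_def min_def max_def split: if_splits)
      then have "\<bar>K' z y\<bar> \<le> w y" by (rule bd) fact
      moreover have "q n y = K' z y"
        using z(3) X(1)[of n] by (auto simp: q_def a_def b_def min_def max_def field_simps split: if_splits)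
      ultimately show ?thesis by simp
    qed
    \<comment> \<open>Measurability of \<open>K' x0\<close> is inherited from the difference
      quotients, whose pointwise limit it is.\<close>
    have m: "K' x0 \<in> borel_measurable M"
      by (rule borel_measurable_LIMSEQ_real[of M q, OF lim]) (use qi in auto)
    have i: "integrable M (K' x0)"
      by (rule integrable_dominated_convergence[OF m _ w, of q]) (use qi lim bound in auto)
    have "(\<lambda>n. \<integral>y. q n y \<partial>M) \<longlonglongrightarrow> (\<integral>y. K' x0 y \<partial>M)"
      by (rule integral_dominated_convergence[OF m _ w, of q]) (use qi lim bound in auto)
    moreover have "(\<integral>y. q n y \<partial>M) = ((\<integral>y. K (x0 + X n) y \<partial>M) - (\<integral>y. K x0 y \<partial>M)) / X n" for n
      unfolding q_def using int[of "x0 + X n"] int[of x0] X(2)[of n] by simp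
    ultimately show ?thesis using i by simp
  qed
  \<comment> \<open>One concrete null sequence, nonzero and below 1 in modulus (hence the 2), yields
    integrability of \<open>K' x0\<close>.\<close>
  have "(\<lambda>n. 1 / (real n + 2)) \<longlonglongrightarrow> 0" by real_asymp
  from A[of "\<lambda>n. 1 / (real n + 2)", OF _ _ this] show "integrable M (K' x0)" by auto
  show "((\<lambda>x. \<integral>y. K x y \<partial>M) has_real_derivative (\<integral>y. K' x0 y \<partial>M)) (at x0)"
    unfolding DERIV_def tendsto_at_iff_sequentially comp_def
  proof safe
    fix X :: "nat \<Rightarrow> real" assume X: "\<forall>i. X i \<in> UNIV - {0}" "X \<longlonglongrightarrow> 0"
    from X(2) have "eventually (\<lambda>n. \<bar>X n\<bar> < 1) sequentially"
      by (metis (no_types, lifting) LIMSEQ_iff abs_minus_commute diff_zero eventually_sequentially real_norm_def zero_less_one)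
    then obtain N where N: "\<And>n. n \<ge> N \<Longrightarrow> \<bar>X n\<bar> < 1" by (auto simp: eventually_sequentially)
    have "(\<lambda>n. X (n + N)) \<longlonglongrightarrow> 0" using X(2) by (rule LIMSEQ_ignore_initial_segment)
    from A[of "\<lambda>n. X (n + N)", OF _ _ this] have "(\<lambda>n. ((\<integral>y. K (x0 + X (n + N)) y \<partial>M) - (\<integral>y. K x0 y \<partial>M)) / X (n + N)) \<longlonglongrightarrow> (\<integral>y. K' x0 y \<partial>M)"
      using X(1) N by auto
    then show "(\<lambda>n. ((\<integral>y. K (x0 + X n) y \<partial>M) - (\<integral>y. K x0 y \<partial>M)) / X n) \<longlonglongrightarrow> (\<integral>y. K' x0 y \<partial>M)"
      by (rule LIMSEQ_offset)
  qed
qed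

lemma lborel_Fubini:
  fixes f :: "real \<Rightarrow> real \<Rightarrow> 'b::{banach, second_countable_topology}"
  assumes [measurable]: "case_prod f \<in> borel_measurable (borel \<Otimes>\<^sub>M borel)"
    and fin: "(\<integral>\<^sup>+x. \<integral>\<^sup>+y. ennreal (norm (f x y)) \<partial>lborel \<partial>lborel) < \<infinity>"
  shows "(\<integral>x. \<integral>y. f x y \<partial>lborel \<partial>lborel) = (\<integral>y. \<integral>x. f x y \<partial>lborel \<partial>lborel)"
    and "integrable lborel (\<lambda>x. \<integral>y. f x y \<partial>lborel)" and "integrable lborel (\<lambda>y. \<integral>x. f x y \<partial>lborel)"
proof -
  have m: "case_prod f \<in> borel_measurable (lborel \<Otimes>\<^sub>M lborel)"
    by (simp add: measurable_cong_sets[OF sets_pair_measure_cong[OF sets_lborel sets_lborel] refl])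
  have "integrable (lborel \<Otimes>\<^sub>M lborel) (case_prod f)"
  proof (rule integrableI_bounded[OF m])
    have "(\<integral>\<^sup>+z. ennreal (norm (case_prod f z)) \<partial>(lborel \<Otimes>\<^sub>M lborel)) = (\<integral>\<^sup>+x. \<integral>\<^sup>+y. ennreal (norm (f x y)) \<partial>lborel \<partial>lborel)"
      using m by (subst lborel.nn_integral_fst[symmetric]) auto
    then show "(\<integral>\<^sup>+z. ennreal (norm (case_prod f z)) \<partial>(lborel \<Otimes>\<^sub>M lborel)) < \<infinity>" using fin by simp
  qed
  from lborel_pair.Fubini_integral[OF this] lborel_pair.integrable_fst'[OF this] lborel_pair.integrable_snd[OF this]
  show "(\<integral>x. \<integral>y. f x y \<partial>lborel \<partial>lborel) = (\<integral>y. \<integral>x. f x y \<partial>lborel \<partial>lborel)"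
    "integrable lborel (\<lambda>x. \<integral>y. f x y \<partial>lborel)" "integrable lborel (\<lambda>y. \<integral>x. f x y \<partial>lborel)" by auto
qed

lemma lborel_Tonelli:
  fixes f :: "real \<Rightarrow> real \<Rightarrow> ennreal"
  assumes [measurable]: "case_prod f \<in> borel_measurable (borel \<Otimes>\<^sub>M borel)"
  shows "(\<integral>\<^sup>+x. \<integral>\<^sup>+y. f x y \<partial>lborel \<partial>lborel) = (\<integral>\<^sup>+y. \<integral>\<^sup>+x. f x y \<partial>lborel \<partial>lborel)"
proof -
  have "case_prod f \<in> borel_measurable (lborel \<Otimes>\<^sub>M lborel)"
    by (simp add: measurable_cong_sets[OF sets_pair_measure_cong[OF sets_lborel sets_lborel] refl])
  then show ?thesis using lborel_pair.Fubini'[of f] by simp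
qed

lemma nn_integral_shift:
  fixes f :: "real \<Rightarrow> ennreal"
  assumes [measurable]: "f \<in> borel_measurable borel"
  shows "(\<integral>\<^sup>+x. f (t + x) \<partial>lborel) = (\<integral>\<^sup>+x. f x \<partial>lborel)" "(\<integral>\<^sup>+x. f (x + t) \<partial>lborel) = (\<integral>\<^sup>+x. f x \<partial>lborel)"
    "(\<integral>\<^sup>+x. f (x - t) \<partial>lborel) = (\<integral>\<^sup>+x. f x \<partial>lborel)" "(\<integral>\<^sup>+x. f (t - x) \<partial>lborel) = (\<integral>\<^sup>+x. f x \<partial>lborel)"
    "(\<integral>\<^sup>+x. f (- x) \<partial>lborel) = (\<integral>\<^sup>+x. f x \<partial>lborel)"
  using nn_integral_real_affine[of f 1 t] nn_integral_real_affine[of f 1 "-t"]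
    nn_integral_real_affine[of f "-1" t] nn_integral_real_affine[of f "-1" 0]
  by (auto simp: algebra_simps)

lemma integral_shift:
  fixes f :: "real \<Rightarrow> 'b::{banach, second_countable_topology}"
  shows "(\<integral>x. f (t + x) \<partial>lborel) = (\<integral>x. f x \<partial>lborel)" "(\<integral>x. f (x + t) \<partial>lborel) = (\<integral>x. f x \<partial>lborel)"
    "(\<integral>x. f (x - t) \<partial>lborel) = (\<integral>x. f x \<partial>lborel)" "(\<integral>x. f (t - x) \<partial>lborel) = (\<integral>x. f x \<partial>lborel)"
    "(\<integral>x. f (- x) \<partial>lborel) = (\<integral>x. f x \<partial>lborel)"
  using lborel_integral_real_affine[of 1 f t] lborel_integral_real_affine[of 1 f "-t"]
    lborel_integral_real_affine[of "-1" f t] lborel_integral_real_affine[of "-1" f 0]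
  by (auto simp: algebra_simps)

lemma integrable_shift:
  fixes f :: "real \<Rightarrow> 'b::{banach, second_countable_topology}"
  shows "integrable lborel (\<lambda>x. f (t + x)) \<longleftrightarrow> integrable lborel f" "integrable lborel (\<lambda>x. f (x + t)) \<longleftrightarrow> integrable lborel f"
    "integrable lborel (\<lambda>x. f (x - t)) \<longleftrightarrow> integrable lborel f" "integrable lborel (\<lambda>x. f (t - x)) \<longleftrightarrow> integrable lborel f"
    "integrable lborel (\<lambda>x. f (- x)) \<longleftrightarrow> integrable lborel f"
  using lborel_integrable_real_affine_iff[of 1 f t] lborel_integrable_real_affine_iff[of 1 f "-t"]
    lborel_integrable_real_affine_iff[of "-1" f t] lborel_integrable_real_affine_iff[of "-1" f 0]
  by (auto simp: algebra_simps)

subsection \<open>Test functions\<close>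

definition test_fun :: "(real \<Rightarrow> real) \<Rightarrow> bool" where
  "test_fun f \<longleftrightarrow> (\<forall>n x. ((deriv ^^ n) f) differentiable at x) \<and> (\<exists>R. \<forall>x. R < \<bar>x\<bar> \<longrightarrow> f x = 0)"

lemma test_fun_DERIV: "test_fun f \<Longrightarrow> (f has_real_derivative deriv f x) (at x)"
  unfolding test_fun_def
  by (metis (no_types, lifting) DERIV_deriv_iff_real_differentiable funpow_0)

lemma test_fun_deriv:
  assumes "test_fun f" shows "test_fun (deriv f)"
proof -
  from assms obtain R where R: "\<And>x. R < \<bar>x\<bar> \<Longrightarrow> f x = 0" by (auto simp: test_fun_def)
  have "deriv f x = 0" if "R < \<bar>x\<bar>" for x
  proof -
    have "(f has_real_derivative 0) (at x)"
    proof (rule has_field_derivative_transform_within_open[of "\<lambda>x. 0" _ _ "{x. R < \<bar>x\<bar>}"])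
      show "open {x. R < \<bar>x\<bar>}" by (intro open_Collect_less continuous_intros)
    qed (use that R in auto)
    then show ?thesis by (rule DERIV_imp_deriv)
  qed
  moreover have "(deriv ^^ n) (deriv f) differentiable at x" for n x
    using assms unfolding test_fun_def by (metis funpow_Suc_right comp_apply)
  ultimately show ?thesis unfolding test_fun_def by blast
qed

text \<open>A class of functions closed under differentiation consists of smooth functions;
  exhibiting such a class \<open>S\<close> avoids any formula for the n-th derivative.\<close>

lemma test_funI:
  assumes "f \<in> S" "\<And>g. g \<in> S \<Longrightarrow> \<exists>g'\<in>S. \<forall>x. (g has_real_derivative g' x) (at x)"
    and "\<And>x. R < \<bar>x\<bar> \<Longrightarrow> f x = 0"
  shows "test_fun f"
proof -
  have d: "deriv g \<in> S \<and> (\<forall>x. g differentiable at x)" if "g \<in> S" for g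
  proof -
    from assms(2)[OF that] obtain g' where g': "g' \<in> S" "\<And>x. (g has_real_derivative g' x) (at x)" by blast
    then have "deriv g = g'" by (auto intro!: ext DERIV_imp_deriv)
    then show ?thesis using g' by (auto simp: real_differentiable_def)
  qed
  have "(deriv ^^ n) f \<in> S" for n by (induction n) (use assms(1) d in auto)
  then show ?thesis unfolding test_fun_def using d assms(3) by blast
qed

lemma test_fun_continuous: "test_fun f \<Longrightarrow> continuous_on A f"
  by (meson DERIV_isCont continuous_at_imp_continuous_on test_fun_DERIV)

lemma test_fun_measurable [measurable_dest]: "test_fun f \<Longrightarrow> f \<in> borel_measurable borel"
  by (intro borel_measurable_continuous_onI test_fun_continuous)

lemma test_fun_support:
  assumes "test_fun f" obtains R where "0 < R" "\<And>x. R < \<bar>x\<bar> \<Longrightarrow> f x = 0"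
proof -
  from assms obtain R where "\<And>x. R < \<bar>x\<bar> \<Longrightarrow> f x = 0" by (auto simp: test_fun_def)
  then show ?thesis by (intro that[of "max 1 R"]) auto
qed

lemma test_fun_bounded:
  assumes "test_fun f" obtains M where "0 < M" "\<And>x. \<bar>f x\<bar> \<le> M"
proof -
  obtain R where R: "0 < R" "\<And>x. R < \<bar>x\<bar> \<Longrightarrow> f x = 0" using test_fun_support[OF assms] by blast
  have "compact (f ` {-R..R})"
    by (intro compact_continuous_image test_fun_continuous assms) auto
  then have "bounded (f ` {-R..R})" by (rule compact_imp_bounded)
  then obtain M where M: "0 < M" "\<And>x. x \<in> {-R..R} \<Longrightarrow> \<bar>f x\<bar> \<le> M" by (auto simp: bounded_pos)
  have "\<bar>f x\<bar> \<le> M" for x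
    using M R(2)[of x] by (cases "R < \<bar>x\<bar>") (auto simp: abs_le_iff not_less)
  with M(1) that show ?thesis by blast
qed

lemma test_fun_integrable:
  assumes "test_fun f" shows "integrable lborel f"
proof -
  obtain R where R: "0 < R" "\<And>x. R < \<bar>x\<bar> \<Longrightarrow> f x = 0" using test_fun_support[OF assms] by blast
  have "set_integrable lborel {-R..R} f"
    by (rule borel_integrable_atLeastAtMost') (rule test_fun_continuous[OF assms])
  then have "integrable lborel (\<lambda>x. indicator {-R..R} x *\<^sub>R f x)" by (simp add: set_integrable_def)
  moreover have "(\<lambda>x. indicator {-R..R} x *\<^sub>R f x) = f"
  proof
    fix x show "indicator {-R..R} x *\<^sub>R f x = f x"
      using R(2)[of x] by (cases "R < \<bar>x\<bar>") (auto simp: indicator_def)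
  qed
  ultimately show ?thesis by simp
qed

lemma test_fun_bounded_integrable_mult:
  assumes "test_fun f" "integrable lborel u"
  shows "integrable lborel (\<lambda>y. u y * f (a + b * y))"
proof -
  obtain M where M: "\<And>x. \<bar>f x\<bar> \<le> M" using test_fun_bounded[OF assms(1)] by blast
  note [measurable] = test_fun_measurable[OF assms(1)] borel_measurable_integrable[OF assms(2)]
  show ?thesis
  proof (rule Bochner_Integration.integrable_bound[of _ "\<lambda>y. M * u y"])
    show "integrable lborel (\<lambda>y. M * u y)" using assms(2) by simp
    show "AE y in lborel. norm (u y * f (a + b * y)) \<le> norm (M * u y)"
      using M by (auto simp: abs_mult mult.commute[of M] intro!: AE_I2 mult_left_mono order.trans[OF M])
  qed measurable
qed

lemma test_fun_lipschitz:
  assumes "test_fun f" obtains M where "0 < M" "\<And>x y. \<bar>f x - f y\<bar> \<le> M * \<bar>x - y\<bar>"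
proof -
  obtain M where M: "0 < M" "\<And>x. \<bar>deriv f x\<bar> \<le> M" using test_fun_bounded[OF test_fun_deriv[OF assms]] by blast
  have "norm (f x - f y) \<le> M * norm (x - y)" for x y
    by (rule field_differentiable_bound[of UNIV f "deriv f"])
       (use M test_fun_DERIV[OF assms] in auto)
  with M(1) that show ?thesis by auto
qed

lemma test_fun_affine:
  assumes "test_fun f" "b \<noteq> 0" shows "test_fun (\<lambda>x. c * f (a + b * x))"
proof -
  obtain R where R: "0 < R" "\<And>x. R < \<bar>x\<bar> \<Longrightarrow> f x = 0" using test_fun_support[OF assms(1)] by blast
  show ?thesis
  proof (rule test_funI[of _ "{\<lambda>x. c * f (a + b * x) | c f. test_fun f}" "(R + \<bar>a\<bar>) / \<bar>b\<bar>"])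
    fix g assume "g \<in> {\<lambda>x. c * f (a + b * x) | c f. test_fun f}"
    then obtain c f where g: "g = (\<lambda>x. c * f (a + b * x))" "test_fun f" by blast
    show "\<exists>g'\<in>{\<lambda>x. c * f (a + b * x) | c f. test_fun f}. \<forall>x. (g has_real_derivative g' x) (at x)"
    proof (intro bexI[of _ "\<lambda>x. (c * b) * deriv f (a + b * x)"] allI)
      fix x show "(g has_real_derivative (c * b) * deriv f (a + b * x)) (at x)"
        unfolding g(1) by (rule derivative_eq_intros DERIV_chain2[OF test_fun_DERIV[OF g(2)]] refl | simp)+
      show "(\<lambda>x. (c * b) * deriv f (a + b * x)) \<in> {\<lambda>x. c * f (a + b * x) | c f. test_fun f}"
        using test_fun_deriv[OF g(2)] by blast
    qed
  next
    fix x assume "(R + \<bar>a\<bar>) / \<bar>b\<bar> < \<bar>x\<bar>"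
    then have "R + \<bar>a\<bar> < \<bar>b * x\<bar>" using assms(2) by (simp add: field_simps abs_mult)
    then have "R < \<bar>a + b * x\<bar>" by linarith
    then show "c * f (a + b * x) = 0" by (simp add: R)
  qed (use assms in blast)
qed

lemma test_fun_uminus: "test_fun f \<Longrightarrow> test_fun (\<lambda>x. - f x)"
  using test_fun_affine[of f 1 "-1" 0] by simp

text \<open>Each derivative in x brings down one factor \<open>b y\<close>, so the integrals with
  weight \<open>c y * b y ^ n\<close> form a class as in \<open>test_funI\<close>; boundedness of
  \<open>b\<close> keeps these weights integrable. The affine argument covers both convolution (b =
  1) and the superposition of dilates in \<open>Ulog\<close>.\<close>

lemma test_fun_integral:
  fixes a b c :: "'a \<Rightarrow> real"
  assumes f: "test_fun f" and [measurable]: "a \<in> borel_measurable M" "b \<in> borel_measurable M"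
    and c: "integrable M c" and B: "\<And>y. y \<in> space M \<Longrightarrow> \<bar>b y\<bar> \<le> B"
    and supp: "\<And>x. R < \<bar>x\<bar> \<Longrightarrow> (\<integral>y. c y * f (a y + b y * x) \<partial>M) = 0"
  shows "test_fun (\<lambda>x. \<integral>y. c y * f (a y + b y * x) \<partial>M)"
proof (rule test_funI[of _ "{\<lambda>x. \<integral>y. c y * b y ^ n * g (a y + b y * x) \<partial>M | n g. test_fun g}" R])
  note [measurable] = borel_measurable_integrable[OF c]
  have "(\<lambda>x. \<integral>y. c y * f (a y + b y * x) \<partial>M) = (\<lambda>x. \<integral>y. c y * b y ^ 0 * f (a y + b y * x) \<partial>M)" by simp
  then show "(\<lambda>x. \<integral>y. c y * f (a y + b y * x) \<partial>M) \<in> {\<lambda>x. \<integral>y. c y * b y ^ n * g (a y + b y * x) \<partial>M | n g. test_fun g}"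
    using f by blast
  fix h assume "h \<in> {\<lambda>x. \<integral>y. c y * b y ^ n * g (a y + b y * x) \<partial>M | n g. test_fun g}"
  then obtain n g where h: "h = (\<lambda>x. \<integral>y. c y * b y ^ n * g (a y + b y * x) \<partial>M)" and g: "test_fun g" by blast
  have bd: "integrable M (\<lambda>y. c y * b y ^ n * g (a y + b y * x))" if g: "test_fun g" for n g x
  proof -
    note [measurable] = test_fun_measurable[OF g]
    obtain K where K: "0 < K" "\<And>x. \<bar>g x\<bar> \<le> K" using test_fun_bounded[OF g] by blast
    show ?thesis
    proof (rule Bochner_Integration.integrable_bound[of _ "\<lambda>y. c y * (\<bar>B\<bar> ^ n * K)"])
      show "AE y in M. norm (c y * b y ^ n * g (a y + b y * x)) \<le> norm (c y * (\<bar>B\<bar> ^ n * K))"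
      proof (rule AE_I2)
        fix y assume "y \<in> space M"
        then have "\<bar>b y\<bar> \<le> \<bar>B\<bar>" using B[of y] by linarith
        then have "\<bar>b y\<bar> ^ n * \<bar>g (a y + b y * x)\<bar> \<le> \<bar>B\<bar> ^ n * K"
          using K by (intro mult_mono power_mono) auto
        from mult_left_mono[OF this, of "\<bar>c y\<bar>"] show "norm (c y * b y ^ n * g (a y + b y * x)) \<le> norm (c y * (\<bar>B\<bar> ^ n * K))"
          using K(1) by (simp add: abs_mult power_abs mult.assoc)
      qed
    qed (use c in auto)
  qed
  show "\<exists>h'\<in>{\<lambda>x. \<integral>y. c y * b y ^ n * g (a y + b y * x) \<partial>M | n g. test_fun g}. \<forall>x. (h has_real_derivative h' x) (at x)"
  proof (intro bexI[of _ "\<lambda>x. \<integral>y. c y * b y ^ Suc n * deriv g (a y + b y * x) \<partial>M"] allI)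
    fix x0
    obtain K where K: "0 < K" "\<And>x. \<bar>deriv g x\<bar> \<le> K" using test_fun_bounded[OF test_fun_deriv[OF g]] by blast
    show "(h has_real_derivative (\<integral>y. c y * b y ^ Suc n * deriv g (a y + b y * x0) \<partial>M)) (at x0)"
      unfolding h
    proof (rule DERIV_under_integral(1)[where w="\<lambda>y. \<bar>c y\<bar> * (\<bar>B\<bar> ^ Suc n * K)"])
      fix x y assume y: "y \<in> space M"
      show "((\<lambda>x. c y * b y ^ n * g (a y + b y * x)) has_real_derivative c y * b y ^ Suc n * deriv g (a y + b y * x)) (at x)"
        by (rule derivative_eq_intros DERIV_chain2[OF test_fun_DERIV[OF g]] refl | simp)+
      have "\<bar>b y\<bar> \<le> \<bar>B\<bar>" using B[OF y] by linarith
      then have "\<bar>b y\<bar> ^ Suc n * \<bar>deriv g (a y + b y * x)\<bar> \<le> \<bar>B\<bar> ^ Suc n * K"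
        using K by (intro mult_mono power_mono) auto
      from mult_left_mono[OF this, of "\<bar>c y\<bar>"]
      show "\<bar>c y * b y ^ Suc n * deriv g (a y + b y * x)\<bar> \<le> \<bar>c y\<bar> * (\<bar>B\<bar> ^ Suc n * K)"
        by (simp add: abs_mult power_abs mult.assoc)
    qed (use bd[OF g] c in auto)
    show "(\<lambda>x. \<integral>y. c y * b y ^ Suc n * deriv g (a y + b y * x) \<partial>M) \<in> {\<lambda>x. \<integral>y. c y * b y ^ n * g (a y + b y * x) \<partial>M | n g. test_fun g}"
      using test_fun_deriv[OF g] by blast
  qed
qed (rule supp)

lemma test_fun_convolution:
  assumes f: "test_fun f" and u: "integrable lborel u" and supp: "\<And>x. R < \<bar>x\<bar> \<Longrightarrow> u x = 0"
  shows "test_fun (\<lambda>x. \<integral>y. u y * f (x - y) \<partial>lborel)"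
proof -
  obtain Q where Q: "0 < Q" "\<And>x. Q < \<bar>x\<bar> \<Longrightarrow> f x = 0" using test_fun_support[OF f] by blast
  have "test_fun (\<lambda>x. \<integral>y. u y * f (- y + 1 * x) \<partial>lborel)"
  proof (rule test_fun_integral[OF f _ _ u, of _ _ 1 "R + Q"])
    fix x assume "R + Q < \<bar>x\<bar>"
    then have "u y * f (- y + 1 * x) = 0" for y
      using supp[of y] Q(2)[of "x - y"] by (cases "R < \<bar>y\<bar>") auto
    then have "(\<lambda>y. u y * f (- y + 1 * x)) = (\<lambda>y. 0)" by blast
    then show "(\<integral>y. u y * f (- y + 1 * x) \<partial>lborel) = 0" by simp
  qed auto
  then show ?thesis by (simp add: algebra_simps)
qed

lemma power_le_fact_exp:
  assumes "0 \<le> (y::real)" shows "y ^ n \<le> fact n * exp y"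
proof -
  have "(\<Sum>i\<in>{n}. y ^ i /\<^sub>R fact i) \<le> (\<Sum>i. y ^ i /\<^sub>R fact i)"
    using assms by (intro sum_le_suminf summable_exp_generic) auto
  then show ?thesis by (simp add: exp_def field_simps)
qed

text \<open>The classical exp (-1 / (1 - x^2)). Its derivatives stay in the family
  \<open>E k P\<close>, a polynomial over a power of 1 - x^2 times the exponential; the delicate
  point is differentiability at |x| = 1.\<close>

lemma bump_exists:
  obtains \<rho> :: "real \<Rightarrow> real" where "test_fun \<rho>" "\<And>x. 0 \<le> \<rho> x" "\<rho> 0 = 1" "\<And>x. \<rho> (- x) = \<rho> x" "\<And>x. 1 \<le> \<bar>x\<bar> \<Longrightarrow> \<rho> x = 0"
proof -
  define E where "E k P x = (if \<bar>x\<bar> < 1 then poly P x / (1 - x\<^sup>2) ^ k * exp (- 1 / (1 - x\<^sup>2)) else 0)" for k P and x :: real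
  have lt: "0 < 1 - x\<^sup>2" if "\<bar>x\<bar> < 1" for x :: real using that by (simp add: abs_square_less_1)
  \<comment> \<open>The square is what makes the difference quotient at |x| = 1 vanish. It comes
    from (1 / w) ^ (k + 2) \<le> fact (k + 2) * exp (1 / w) with w = 1 - x^2.\<close>
  have bound: "\<exists>C\<ge>0. \<forall>x. \<bar>E k P x\<bar> \<le> C * (max 0 (1 - x\<^sup>2))\<^sup>2" for k P
  proof -
    have "compact (poly P ` {-1..1})" by (intro compact_continuous_image continuous_intros) auto
    then obtain B where B: "0 < B" "\<And>x. x \<in> {-1..1} \<Longrightarrow> \<bar>poly P x\<bar> \<le> B"
      using compact_imp_bounded[of "poly P ` {-1..1}"] by (auto simp: bounded_pos)
    have "\<bar>E k P x\<bar> \<le> (B * fact (k + 2)) * (max 0 (1 - x\<^sup>2))\<^sup>2" for x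
    proof (cases "\<bar>x\<bar> < 1")
      case True
      define w where "w = 1 - x\<^sup>2"
      have w: "0 < w" using lt[OF True] by (simp add: w_def)
      have "(1 / w) ^ (k + 2) \<le> fact (k + 2) * exp (1 / w)" by (rule power_le_fact_exp) (use w in simp)
      then have "1 / w ^ k * exp (- 1 / w) \<le> fact (k + 2) * w\<^sup>2"
        using w by (simp add: field_simps power_add exp_minus power2_eq_square)
      moreover have "\<bar>poly P x\<bar> \<le> B" using B(2)[of x] True by fastforce
      ultimately have "\<bar>poly P x\<bar> * (1 / w ^ k * exp (- 1 / w)) \<le> B * (fact (k + 2) * w\<^sup>2)"
        using B(1) w mult_mono[of "\<bar>poly P x\<bar>" B "1 / w ^ k * exp (- 1 / w)" "fact (k + 2) * w\<^sup>2"] by simp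
      moreover have "\<bar>E k P x\<bar> = \<bar>poly P x\<bar> * (1 / w ^ k * exp (- 1 / w))"
        using True w by (simp add: E_def abs_mult w_def[symmetric])
      moreover have "max 0 (1 - x\<^sup>2) = w" using w by (simp add: w_def)
      ultimately show ?thesis by (simp only: mult.assoc)
    qed (use B in \<open>auto simp: E_def\<close>)
    then show ?thesis using B(1) by (intro exI[of _ "B * fact (k + 2)"]) auto
  qed
  have der: "\<exists>P'. \<forall>x. (E k P has_real_derivative E (k + 2) P' x) (at x)" for k P
  proof -
    \<comment> \<open>The numerator of the quotient rule over the common denominator (1 - x^2) ^ (k
      + 2); the last term comes from the inner derivative of -1 / (1 - x^2).\<close>
    define P' where "P' = pderiv P * [:1,0,-1:]^2 + smult (2 * of_nat k) ([:0,1:] * P * [:1,0,-1:]) - [:0,2:] * P"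
    have "(E k P has_real_derivative E (k + 2) P' x) (at x)" for x
    proof (cases "\<bar>x\<bar> < 1")
      case True
      define w where "w = 1 - x\<^sup>2"
      have w: "0 < w" "w \<noteq> 0" using lt[OF True] by (auto simp: w_def)
      have P': "poly P' x = poly (pderiv P) x * w\<^sup>2 + 2 * real k * (x * poly P x * w) - 2 * x * poly P x"
        by (simp add: P'_def w_def power2_eq_square algebra_simps)
      have "((\<lambda>x. poly P x / (1 - x\<^sup>2) ^ k * exp (- 1 / (1 - x\<^sup>2))) has_real_derivative
          (poly (pderiv P) x * w ^ k - poly P x * (real k * w ^ (k - 1) * (- (2 * x)))) / (w ^ k * w ^ k) * exp (- 1 / w)
            + exp (- 1 / w) * (- (2 * x) / (w * w)) * (poly P x / w ^ k)) (at x)"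
        by (rule derivative_eq_intros refl | use w in \<open>simp add: w_def power2_eq_square\<close>)+
      also have "(poly (pderiv P) x * w ^ k - poly P x * (real k * w ^ (k - 1) * (- (2 * x)))) / (w ^ k * w ^ k) * exp (- 1 / w)
            + exp (- 1 / w) * (- (2 * x) / (w * w)) * (poly P x / w ^ k) = poly P' x / w ^ (k + 2) * exp (- 1 / w)"
      proof (cases k)
        case 0
        then show ?thesis using w by (simp add: P' field_simps power2_eq_square)
      next
        case (Suc j)
        then show ?thesis using w by (simp add: P' field_simps power2_eq_square)
      qed
      also have "\<dots> = E (k + 2) P' x" using True by (simp add: E_def w_def)
      finally show ?thesis
      proof (rule has_field_derivative_transform_within_open)
        show "open {x::real. \<bar>x\<bar> < 1}" by (intro open_Collect_less continuous_intros)
      qed (use True in \<open>auto simp: E_def\<close>)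
    next
      case False
      \<comment> \<open>Here x may be a boundary point. As 1 - x^2 \<le> 0, the positive part of 1 -
        (x + h)^2 is at most |h| * |2 * x + h|, so the quadratic bound leaves a factor |h| in the
        quotient.\<close>
      obtain C where C: "0 \<le> C" "\<And>x. \<bar>E k P x\<bar> \<le> C * (max 0 (1 - x\<^sup>2))\<^sup>2" using bound by blast
      have "((\<lambda>h. (E k P (x + h) - E k P x) / h) \<longlongrightarrow> 0) (at 0)"
      proof (rule Lim_null_comparison)
        show "\<forall>\<^sub>F h in at 0. norm ((E k P (x + h) - E k P x) / h) \<le> C * \<bar>h\<bar> * (2 * x + h)\<^sup>2"
        proof (rule eventually_at_filter[THEN iffD2], rule always_eventually, safe)
          fix h :: real assume h: "h \<noteq> 0"
          have "1 \<le> x\<^sup>2" using False by (simp add: abs_square_less_1 not_less[symmetric])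
          then have "max 0 (1 - (x + h)\<^sup>2) \<le> \<bar>x\<^sup>2 - (x + h)\<^sup>2\<bar>" by auto
          also have "\<dots> = \<bar>h\<bar> * \<bar>2 * x + h\<bar>" unfolding abs_mult[symmetric]
            by (simp add: power2_eq_square algebra_simps flip: abs_minus_cancel[of "x * x - _"]) 
          finally have "(max 0 (1 - (x + h)\<^sup>2))\<^sup>2 \<le> (\<bar>h\<bar> * \<bar>2 * x + h\<bar>)\<^sup>2" by (intro power_mono) auto
          then have "C * (max 0 (1 - (x + h)\<^sup>2))\<^sup>2 \<le> C * (\<bar>h\<bar> * \<bar>2 * x + h\<bar>)\<^sup>2" using C(1) by (rule mult_left_mono)
          then have "\<bar>E k P (x + h)\<bar> \<le> C * (\<bar>h\<bar> * \<bar>2 * x + h\<bar>)\<^sup>2" using C(2)[of "x + h"] by linarith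
          then have "\<bar>E k P (x + h)\<bar> / \<bar>h\<bar> \<le> C * (\<bar>h\<bar> * \<bar>2 * x + h\<bar>)\<^sup>2 / \<bar>h\<bar>" by (rule divide_right_mono) simp
          also have "C * (\<bar>h\<bar> * \<bar>2 * x + h\<bar>)\<^sup>2 / \<bar>h\<bar> = C * \<bar>h\<bar> * (2 * x + h)\<^sup>2"
            using h by (simp add: power2_eq_square field_simps)
          finally show "norm ((E k P (x + h) - E k P x) / h) \<le> C * \<bar>h\<bar> * (2 * x + h)\<^sup>2"
            using False by (simp add: E_def)
        qed
        have "((\<lambda>h. C * \<bar>h\<bar> * (2 * x + h)\<^sup>2) \<longlongrightarrow> C * \<bar>0\<bar> * (2 * x + 0)\<^sup>2) (at 0)" by (intro tendsto_intros)
        then show "((\<lambda>h. C * \<bar>h\<bar> * (2 * x + h)\<^sup>2) \<longlongrightarrow> 0) (at 0)" by simp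
      qed
      moreover have "E (k + 2) P' x = 0" using False by (simp add: E_def)
      ultimately show ?thesis by (simp add: DERIV_def)
    qed
    then show ?thesis by blast
  qed
  \<comment> \<open>The constant polynomial exp 1 cancels exp (-1) and normalises the value at 0 to
    1.\<close>
  define \<rho> where "\<rho> = E 0 [:exp 1:]"
  have "test_fun \<rho>"
  proof (rule test_funI[of _ "{E k P | k P. True}" 1])
    show "\<rho> \<in> {E k P | k P. True}" unfolding \<rho>_def by blast
    show "\<exists>g'\<in>{E k P | k P. True}. \<forall>x. (g has_real_derivative g' x) (at x)" if "g \<in> {E k P | k P. True}" for g
      using that der by blast
  qed (auto simp: \<rho>_def E_def)
  moreover have "\<rho> 0 = 1" by (simp add: \<rho>_def E_def flip: exp_add)
  ultimately show ?thesis by (intro that[of \<rho>]) (auto simp: \<rho>_def E_def)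
qed

lemma vderivs_test_fun:
  assumes "test_fun f" shows "vderivs n (\<lambda>x. complex_of_real (f x)) = (\<lambda>x. complex_of_real ((deriv ^^ n) f x)) \<and> test_fun ((deriv ^^ n) f)"
proof (induction n)
  case (Suc n)
  then show ?case
    by (auto intro!: vector_derivative_at has_vector_derivative_of_real test_fun_deriv
        simp: has_real_derivative_iff_has_vector_derivative[symmetric] test_fun_DERIV)
qed (use assms in simp)

lemma test_fun_schwartz:
  assumes "test_fun f" shows "schwartz (\<lambda>x. complex_of_real (f x))"
  unfolding schwartz_def
proof (intro conjI allI)
  fix n x
  show "(vderivs n (\<lambda>x. complex_of_real (f x)) has_vector_derivative vderivs (Suc n) (\<lambda>x. complex_of_real (f x)) x) (at x)"
    using vderivs_test_fun[OF assms, of n] vderivs_test_fun[OF assms, of "Suc n"] test_fun_DERIV[of "(deriv ^^ n) f" x]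
    by (auto intro!: has_vector_derivative_of_real simp: has_real_derivative_iff_has_vector_derivative simp del: vderivs.simps)
next
  fix k n
  note v = vderivs_test_fun[OF assms, of n]
  then have t: "test_fun ((deriv ^^ n) f)" by simp
  obtain M where M: "0 < M" "\<And>x. \<bar>(deriv ^^ n) f x\<bar> \<le> M" using test_fun_bounded[OF t] by blast
  obtain R where R: "0 < R" "\<And>x. R < \<bar>x\<bar> \<Longrightarrow> (deriv ^^ n) f x = 0" using test_fun_support[OF t] by blast
  have "\<bar>x\<bar> ^ k * \<bar>(deriv ^^ n) f x\<bar> \<le> R ^ k * M" for x
  proof (cases "R < \<bar>x\<bar>")
    case False
    then show ?thesis using M R by (intro mult_mono power_mono) auto
  qed (use M R in auto)
  then show "\<exists>M. \<forall>x. \<bar>x\<bar> ^ k * norm (vderivs n (\<lambda>x. complex_of_real (f x)) x) \<le> M"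
    using v by auto
qed

subsection \<open>The Fourier transform of Schwartz functions\<close>

lemma continuous_on_cis [continuous_intros]:
  "continuous_on A f \<Longrightarrow> continuous_on A (\<lambda>x. cis (f x))"
  unfolding cis_conv_exp by (intro continuous_intros)

lemma measurable_cis [measurable]: "cis \<in> borel_measurable borel"
  by (intro borel_measurable_continuous_onI continuous_intros)

lemma vderivs_add: "vderivs n (vderivs m f) = vderivs (n + m) f"
  by (induction n) auto

lemma schwartz_vderivs: "schwartz \<phi> \<Longrightarrow> schwartz (vderivs m \<phi>)"
  unfolding schwartz_def vderivs_add add_Suc by blast

lemma schwartz_vd: "schwartz \<phi> \<Longrightarrow> (\<phi> has_vector_derivative vderivs 1 \<phi> x) (at x)"
  unfolding schwartz_def by (metis One_nat_def vderivs.simps(1))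

lemma schwartz_continuous: "schwartz \<phi> \<Longrightarrow> continuous_on A \<phi>"
  by (meson continuous_at_imp_continuous_on has_vector_derivative_continuous schwartz_vd)

lemma schwartz_measurable [measurable_dest]: "schwartz \<phi> \<Longrightarrow> \<phi> \<in> borel_measurable borel"
  by (intro borel_measurable_continuous_onI schwartz_continuous)

lemma schwartz_bounded: assumes "schwartz \<phi>" obtains M where "0 < M" "\<And>x. norm (\<phi> x) \<le> M"
proof -
  from assms have "\<exists>M. \<forall>x. \<bar>x\<bar> ^ 0 * norm (vderivs 0 \<phi> x) \<le> M" unfolding schwartz_def by blast
  then obtain M where M: "\<And>x. norm (\<phi> x) \<le> M" by auto
  show ?thesis by (rule that[of "max 1 M"]) (use M in \<open>auto simp: le_max_iff_disj\<close>)
qed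

lemma schwartz_decay:
  assumes "schwartz \<phi>" obtains C where "0 < C" "\<And>x. norm (\<phi> x) \<le> C / (1 + \<bar>x\<bar> powr (1 + 1))"
proof -
  obtain M where M: "0 < M" "\<And>x. norm (\<phi> x) \<le> M" using schwartz_bounded[OF assms] by blast
  from assms have "\<exists>M. \<forall>x. \<bar>x\<bar> ^ 2 * norm (vderivs 0 \<phi> x) \<le> M" unfolding schwartz_def by blast
  then obtain N where N: "\<And>x. x\<^sup>2 * norm (\<phi> x) \<le> N" by auto
  have "norm (\<phi> x) \<le> (M + \<bar>N\<bar>) / (1 + \<bar>x\<bar> powr (1 + 1))" for x
  proof -
    have "\<bar>x\<bar> powr (1 + 1) = x\<^sup>2" using powr_numeral[of "\<bar>x\<bar>" "num.Bit0 num.One"] by (cases "x = 0") auto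
    moreover have "(1 + x\<^sup>2) * norm (\<phi> x) \<le> M + \<bar>N\<bar>" using M(2)[of x] N[of x] by (simp add: algebra_simps)
    moreover have "0 < 1 + x\<^sup>2" by (simp add: add_pos_nonneg)
    ultimately show ?thesis by (simp add: pos_le_divide_eq mult.commute)
  qed
  then show ?thesis using M(1) by (intro that[of "M + \<bar>N\<bar>"]) auto
qed

lemma schwartz_integrable: "schwartz \<phi> \<Longrightarrow> integrable lborel \<phi>"
  using schwartz_decay[of \<phi>] integrable_decay[of \<phi> _ 1] schwartz_measurable[of \<phi>] by (metis zero_less_one)

lemma integral_deriv_eq_0:
  fixes F f :: "real \<Rightarrow> complex"
  assumes "\<And>x. (F has_vector_derivative f x) (at x)" "continuous_on UNIV f" "integrable lborel f"
    and "(F \<longlongrightarrow> 0) at_top" "(F \<longlongrightarrow> 0) at_bot"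
  shows "(\<integral>x. f x \<partial>lborel) = 0"
proof -
  have "(LBINT x=-\<infinity>..\<infinity>. f x) = 0 - 0"
    by (rule interval_integral_FTC_integrable[of _ _ F])
       (use assms in \<open>auto simp: ereal_tendsto_simps continuous_on_eq_continuous_at set_integrable_def\<close>)
  then show ?thesis by (simp add: interval_lebesgue_integral_def set_lebesgue_integral_def)
qed

lemma schwartz_tendsto_0:
  assumes "schwartz \<phi>" shows "(\<phi> \<longlongrightarrow> 0) at_top" "(\<phi> \<longlongrightarrow> 0) at_bot"
proof -
  obtain C where C: "0 < C" "\<And>x. norm (\<phi> x) \<le> C / (1 + \<bar>x\<bar> powr (1 + 1))" using schwartz_decay[OF assms] by blast
  show "(\<phi> \<longlongrightarrow> 0) at_top"
    by (rule Lim_null_comparison[OF always_eventually[OF allI[OF C(2)]]]) real_asymp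
  have "((\<lambda>x. \<phi> (- x)) \<longlongrightarrow> 0) at_top"
  proof (rule Lim_null_comparison[OF always_eventually[OF allI]])
    show "norm (\<phi> (- x)) \<le> C / (1 + \<bar>x\<bar> powr (1 + 1))" for x using C(2)[of "-x"] by simp
  qed real_asymp
  then show "(\<phi> \<longlongrightarrow> 0) at_bot" by (simp add: filterlim_at_bot_mirror)
qed

lemma integrable_cis_mult:
  assumes "integrable lborel f" shows "integrable lborel (\<lambda>x. cis (a * x + b) * f x)"
proof -
  note [measurable] = borel_measurable_integrable[OF assms]
  show ?thesis by (rule Bochner_Integration.integrable_bound[OF assms]) (auto simp: norm_mult)
qed

lemma fourier_int_deriv:
  assumes "schwartz \<phi>"
  shows "(\<integral>x. cis (- (x * \<xi>)) * vderivs 1 \<phi> x \<partial>lborel) = \<i> * \<xi> * (\<integral>x. cis (- (x * \<xi>)) * \<phi> x \<partial>lborel)"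
proof -
  have d: "((\<lambda>x. cis (- (x * \<xi>))) has_vector_derivative - (\<i> * \<xi>) * cis (- (x * \<xi>))) (at x)" for x
    unfolding cis_conv_exp
    by (rule derivative_eq_intros has_vector_derivative_real_field refl | simp add: algebra_simps)+
  have i1: "integrable lborel (\<lambda>x. cis (- (x * \<xi>)) * vderivs 1 \<phi> x)"
    using integrable_cis_mult[OF schwartz_integrable[OF schwartz_vderivs[OF assms, of 1]], of "-\<xi>" 0] by (simp add: mult.commute)
  have i2: "integrable lborel (\<lambda>x. cis (- (x * \<xi>)) * \<phi> x)"
    using integrable_cis_mult[OF schwartz_integrable[OF assms], of "-\<xi>" 0] by (simp add: mult.commute)
  have "(\<integral>x. cis (- (x * \<xi>)) * vderivs 1 \<phi> x - \<i> * \<xi> * (cis (- (x * \<xi>)) * \<phi> x) \<partial>lborel) = 0"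
  proof (rule integral_deriv_eq_0[of "\<lambda>x. cis (- (x * \<xi>)) * \<phi> x"])
    show "((\<lambda>x. cis (- (x * \<xi>)) * \<phi> x) has_vector_derivative cis (- (x * \<xi>)) * vderivs 1 \<phi> x - \<i> * \<xi> * (cis (- (x * \<xi>)) * \<phi> x)) (at x)" for x
      by (rule has_vector_derivative_eq_rhs[OF has_vector_derivative_mult[OF d schwartz_vd[OF assms]]]) (simp add: algebra_simps)
    show "continuous_on UNIV (\<lambda>x. cis (- (x * \<xi>)) * vderivs 1 \<phi> x - \<i> * \<xi> * (cis (- (x * \<xi>)) * \<phi> x))"
      by (intro continuous_intros schwartz_continuous schwartz_vderivs assms)
    show "integrable lborel (\<lambda>x. cis (- (x * \<xi>)) * vderivs 1 \<phi> x - \<i> * \<xi> * (cis (- (x * \<xi>)) * \<phi> x))"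
      using i1 i2 by auto
    have n: "norm (cis (- (x * \<xi>)) * \<phi> x) \<le> norm (\<phi> x)" for x by (simp add: norm_mult)
    show "((\<lambda>x. cis (- (x * \<xi>)) * \<phi> x) \<longlongrightarrow> 0) at_top" "((\<lambda>x. cis (- (x * \<xi>)) * \<phi> x) \<longlongrightarrow> 0) at_bot"
      by (rule Lim_null_comparison[OF always_eventually[OF allI[OF n]] tendsto_norm_zero[OF schwartz_tendsto_0(1)[OF assms]]])
         (rule Lim_null_comparison[OF always_eventually[OF allI[OF n]] tendsto_norm_zero[OF schwartz_tendsto_0(2)[OF assms]]])
  qed
  then show ?thesis using i1 i2 by simp
qed

lemma fourier_measurable [measurable]:
  assumes [measurable]: "\<phi> \<in> borel_measurable borel" shows "fourier \<phi> \<in> borel_measurable borel"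
proof -
  have "(\<lambda>\<xi>. \<integral>x. cis (- (x * \<xi>)) * \<phi> x \<partial>lborel) \<in> borel_measurable borel"
    by (rule lborel.borel_measurable_lebesgue_integral) measurable
  then show ?thesis unfolding fourier_def[abs_def] by measurable
qed

text \<open>Two integrations by parts: the transform of the second derivative is - \<xi>^2 times the
  transform. This order of decay is enough later, since multiplication by |\<xi>| powr s with s < 1
  leaves the transform integrable.\<close>

lemma fourier_decay:
  assumes "schwartz \<phi>" obtains C where "0 < C" "\<And>\<xi>. norm (fourier \<phi> \<xi>) \<le> C / (1 + \<xi>\<^sup>2)"
proof -
  define J where "J \<phi> \<xi> = (\<integral>x. cis (- (x * \<xi>)) * \<phi> x \<partial>lborel)" for \<phi> and \<xi> :: real
  have J: "norm (J \<phi> \<xi>) \<le> (\<integral>x. norm (\<phi> x) \<partial>lborel)" for \<phi> \<xi>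
    unfolding J_def by (rule integral_norm_bound[THEN order.trans]) (simp add: norm_mult)
  have "J (vderivs 2 \<phi>) \<xi> = \<i> * \<xi> * (\<i> * \<xi> * J \<phi> \<xi>)" for \<xi>
    using fourier_int_deriv[OF assms, of \<xi>] fourier_int_deriv[OF schwartz_vderivs[OF assms, of 1], of \<xi>]
    unfolding J_def vderivs_add numeral_2_eq_2 by simp
  then have "norm (J (vderivs 2 \<phi>) \<xi>) = \<xi>\<^sup>2 * norm (J \<phi> \<xi>)" for \<xi>
    by (simp add: norm_mult power2_eq_square)
  \<comment> \<open>The added 1 makes the constant positive even for the zero function.\<close>
  then have "(1 + \<xi>\<^sup>2) * norm (J \<phi> \<xi>) \<le> (\<integral>x. norm (\<phi> x) \<partial>lborel) + (\<integral>x. norm (vderivs 2 \<phi> x) \<partial>lborel) + 1" for \<xi>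
    using J[of \<phi> \<xi>] J[of "vderivs 2 \<phi>" \<xi>] by (simp add: algebra_simps)
  moreover have "0 < 1 + \<xi>\<^sup>2" for \<xi> :: real by (simp add: add_pos_nonneg)
  ultimately have K: "norm (J \<phi> \<xi>) \<le> ((\<integral>x. norm (\<phi> x) \<partial>lborel) + (\<integral>x. norm (vderivs 2 \<phi> x) \<partial>lborel) + 1) / (1 + \<xi>\<^sup>2)" for \<xi>
    by (simp add: pos_le_divide_eq mult.commute)
  have "norm (fourier \<phi> \<xi>) = 1 / sqrt (2 * pi) * norm (J \<phi> \<xi>)" for \<xi>
    by (simp add: fourier_def J_def norm_mult norm_divide)
  then have "norm (fourier \<phi> \<xi>) \<le> 1 / sqrt (2 * pi) * (((\<integral>x. norm (\<phi> x) \<partial>lborel) + (\<integral>x. norm (vderivs 2 \<phi> x) \<partial>lborel) + 1) / (1 + \<xi>\<^sup>2))" for \<xi>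
    using K[of \<xi>] by (metis mult_left_mono real_sqrt_ge_zero divide_nonneg_nonneg zero_le_one pi_ge_zero mult_nonneg_nonneg zero_le_numeral)
  moreover have "0 < 1 / sqrt (2 * pi) * ((\<integral>x. norm (\<phi> x) \<partial>lborel) + (\<integral>x. norm (vderivs 2 \<phi> x) \<partial>lborel) + 1)"
    by (intro mult_pos_pos add_nonneg_pos add_nonneg_nonneg integral_nonneg_AE) auto
  ultimately show ?thesis
    by (intro that[of "1 / sqrt (2 * pi) * ((\<integral>x. norm (\<phi> x) \<partial>lborel) + (\<integral>x. norm (vderivs 2 \<phi> x) \<partial>lborel) + 1)"]) auto
qed

lemma powr_fourier_integrable:
  assumes "schwartz \<phi>" "0 \<le> s" "s < 1"
  shows "integrable lborel (\<lambda>\<xi>. complex_of_real (\<bar>\<xi>\<bar> powr s) * fourier \<phi> \<xi>)"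
proof -
  obtain C where C: "0 < C" "\<And>\<xi>. norm (fourier \<phi> \<xi>) \<le> C / (1 + \<xi>\<^sup>2)" using fourier_decay[OF assms(1)] by blast
  note [measurable] = schwartz_measurable[OF assms(1)]
  show ?thesis
  proof (rule integrable_decay[where C="2 * C" and a="1 - s"])
    fix \<xi> :: real
    have sq: "\<bar>\<xi>\<bar> powr s * \<bar>\<xi>\<bar> powr (1 + (1 - s)) = \<xi>\<^sup>2"
      using powr_numeral[of "\<bar>\<xi>\<bar>" "num.Bit0 num.One"] by (cases "\<xi> = 0") (auto simp flip: powr_add)
    have "\<bar>\<xi>\<bar> powr s \<le> 1 + \<xi>\<^sup>2"
    proof (cases "\<bar>\<xi>\<bar> \<le> 1")
      case True
      then have "\<bar>\<xi>\<bar> powr s \<le> 1" using assms(2) by (intro powr_le1) auto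
      then show ?thesis by (simp add: add_increasing2)
    next
      case False
      then have "\<bar>\<xi>\<bar> powr s \<le> \<bar>\<xi>\<bar> powr 2" using assms(3) by (intro powr_mono) auto
      then show ?thesis using False by simp
    qed
    then have "\<bar>\<xi>\<bar> powr s * (1 + \<bar>\<xi>\<bar> powr (1 + (1 - s))) \<le> 2 * (1 + \<xi>\<^sup>2)" using sq by (simp add: algebra_simps)
    moreover have "0 < 1 + \<xi>\<^sup>2" "0 < 1 + \<bar>\<xi>\<bar> powr (1 + (1 - s))" by (simp_all add: add_pos_nonneg)
    ultimately have "\<bar>\<xi>\<bar> powr s / (1 + \<xi>\<^sup>2) \<le> 2 / (1 + \<bar>\<xi>\<bar> powr (1 + (1 - s)))"
      by (simp add: field_simps)
    then have "C * (\<bar>\<xi>\<bar> powr s / (1 + \<xi>\<^sup>2)) \<le> C * (2 / (1 + \<bar>\<xi>\<bar> powr (1 + (1 - s))))"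
      using C(1) by (intro mult_left_mono) auto
    moreover have "\<bar>\<xi>\<bar> powr s * norm (fourier \<phi> \<xi>) \<le> \<bar>\<xi>\<bar> powr s * (C / (1 + \<xi>\<^sup>2))"
      by (intro mult_left_mono C) auto
    ultimately show "norm (complex_of_real (\<bar>\<xi>\<bar> powr s) * fourier \<phi> \<xi>) \<le> 2 * C / (1 + \<bar>\<xi>\<bar> powr (1 + (1 - s)))"
      by (simp add: norm_mult mult_ac)
  qed (use assms in auto)
qed

lemma fourier_integrable: "schwartz \<phi> \<Longrightarrow> integrable lborel (fourier \<phi>)"
proof -
  assume "schwartz \<phi>"
  then have "integrable lborel (\<lambda>\<xi>. complex_of_real (\<bar>\<xi>\<bar> powr 0) * fourier \<phi> \<xi>)" by (rule powr_fourier_integrable) auto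
  \<comment> \<open>\<open>0 powr 0 = 0\<close>, so the two functions can differ at the
    origin.\<close>
  moreover have "AE \<xi> in lborel. complex_of_real (\<bar>\<xi>\<bar> powr 0) * fourier \<phi> \<xi> = fourier \<phi> \<xi>"
    by (intro AE_I[of _ _ "{0}"]) auto
  moreover have "fourier \<phi> \<in> borel_measurable lborel" using schwartz_measurable[OF \<open>schwartz \<phi>\<close>] by simp
  ultimately show ?thesis using integrable_cong_AE_imp by blast
qed

section \<open>Gaussians and Fourier inversion\<close>

lemma gaussian_integrable: "integrable lborel (\<lambda>x::real. exp (- x\<^sup>2 / 2))"
proof -
  have "integrable lborel (\<lambda>x. sqrt (2 * pi) * std_normal_density x)"
    by (intro integrable_mult_right integrable_normal_density) simp
  then show ?thesis by (simp add: std_normal_density_def)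
qed

text \<open>Up to the factor sqrt (2 * pi) the integral is the characteristic function of the
  standard normal law.\<close>

lemma gaussian_fourier_std:
  "(\<integral>x. cis (t * x) * complex_of_real (exp (- x\<^sup>2 / 2)) \<partial>lborel) = sqrt (2 * pi) * exp (- t\<^sup>2 / 2)"
proof -
  have "char std_normal_distribution t = (\<integral>x. std_normal_density x *\<^sub>R cis (t * x) \<partial>lborel)"
    unfolding char_def by (subst integral_density) (auto simp: cis_conv_exp)
  also have "\<dots> = (\<integral>x. complex_of_real (1 / sqrt (2 * pi)) * (cis (t * x) * complex_of_real (exp (- x\<^sup>2 / 2))) \<partial>lborel)"
    by (intro Bochner_Integration.integral_cong refl) (simp add: std_normal_density_def scaleR_conv_of_real)
  also have "\<dots> = complex_of_real (1 / sqrt (2 * pi)) * (\<integral>x. cis (t * x) * complex_of_real (exp (- x\<^sup>2 / 2)) \<partial>lborel)"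
    by simp
  finally show ?thesis by (simp add: char_std_normal_distribution field_simps)
qed

lemma gaussian_scaled_integrable:
  assumes "0 < a" shows "integrable lborel (\<lambda>x::real. exp (- (a * x\<^sup>2)))"
proof -
  have "integrable lborel (\<lambda>x::real. exp (- (0 + sqrt (2 * a) * x)\<^sup>2 / 2))"
    using lborel_integrable_real_affine_iff[of "sqrt (2 * a)" "\<lambda>x. exp (- x\<^sup>2 / 2)" 0] gaussian_integrable assms by simp
  then show ?thesis using assms by (simp add: power_mult_distrib)
qed

lemma gaussian_fourier:
  assumes "0 < a"
  shows "(\<integral>x. cis (t * x) * complex_of_real (exp (- (a * x\<^sup>2))) \<partial>lborel) = sqrt (pi / a) * exp (- t\<^sup>2 / (4 * a))"
proof -
  define c where "c = sqrt (2 * a)"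
  have c: "0 < c" "c\<^sup>2 = 2 * a" using assms by (auto simp: c_def)
  have "(\<integral>x. cis (t / c * x) * complex_of_real (exp (- x\<^sup>2 / 2)) \<partial>lborel)
     = \<bar>c\<bar> *\<^sub>R (\<integral>x. cis (t / c * (0 + c * x)) * complex_of_real (exp (- (0 + c * x)\<^sup>2 / 2)) \<partial>lborel)"
    by (rule lborel_integral_real_affine) (use c in simp)
  also have "(\<lambda>x. cis (t / c * (0 + c * x)) * complex_of_real (exp (- (0 + c * x)\<^sup>2 / 2)))
      = (\<lambda>x. cis (t * x) * complex_of_real (exp (- (a * x\<^sup>2))))"
    using c by (auto simp: power_mult_distrib)
  finally have "complex_of_real c * (\<integral>x. cis (t * x) * complex_of_real (exp (- (a * x\<^sup>2))) \<partial>lborel) = sqrt (2 * pi) * exp (- (t / c)\<^sup>2 / 2)"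
    unfolding gaussian_fourier_std using c(1) by (simp add: scaleR_conv_of_real)
  moreover have "sqrt (2 * pi) = c * sqrt (pi / a)"
    using assms by (simp add: c_def flip: real_sqrt_mult)
  moreover have "(t / c)\<^sup>2 / 2 = t\<^sup>2 / (4 * a)" using c by (simp add: power_divide)
  ultimately have "complex_of_real c * (\<integral>x. cis (t * x) * complex_of_real (exp (- (a * x\<^sup>2))) \<partial>lborel) = complex_of_real c * (sqrt (pi / a) * exp (- t\<^sup>2 / (4 * a)))"
    by simp
  then show ?thesis using c(1) by simp
qed

text \<open>Gauss summation: a factor exp (- \<xi>^2 / (2 * (n + 1))) makes Fubini applicable and
  turns the inversion integral into a Gaussian average of \<phi> around x with variance 1 / (n + 1).
  Both sides converge by dominated convergence, the right one because \<phi> is bounded and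
  continuous.\<close>

lemma fourier_inversion:
  fixes \<phi> :: "real \<Rightarrow> complex"
  assumes \<phi>: "schwartz \<phi>"
  shows "(\<integral>\<xi>. cis (x * \<xi>) * fourier \<phi> \<xi> \<partial>lborel) = complex_of_real (sqrt (2 * pi)) * \<phi> x"
proof -
  obtain M where M: "0 < M" "\<And>x. norm (\<phi> x) \<le> M" using schwartz_bounded[OF \<phi>] by blast
  note [measurable] = schwartz_measurable[OF \<phi>]
  note [measurable] = borel_measurable_integrable[OF fourier_integrable[OF \<phi>]]
  define g where "g n \<xi> = exp (- (1 / (2 * (real n + 1)) * \<xi>\<^sup>2))" for n and \<xi> :: real
  have g: "0 \<le> g n \<xi>" "g n \<xi> \<le> 1" for n \<xi> by (auto simp: g_def)
  have gm[measurable]: "g n \<in> borel_measurable borel" for n unfolding g_def by measurable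
  have "(\<lambda>n. \<integral>\<xi>. complex_of_real (g n \<xi>) * (cis (x * \<xi>) * fourier \<phi> \<xi>) \<partial>lborel) \<longlonglongrightarrow> (\<integral>\<xi>. cis (x * \<xi>) * fourier \<phi> \<xi> \<partial>lborel)"
  proof (rule integral_dominated_convergence[where w="\<lambda>\<xi>. norm (fourier \<phi> \<xi>)"])
    show "AE \<xi> in lborel. (\<lambda>n. complex_of_real (g n \<xi>) * (cis (x * \<xi>) * fourier \<phi> \<xi>)) \<longlonglongrightarrow> cis (x * \<xi>) * fourier \<phi> \<xi>"
    proof (rule AE_I2)
      fix \<xi> :: real
      have "(\<lambda>n. g n \<xi>) \<longlonglongrightarrow> 1" unfolding g_def by real_asymp
      then have "(\<lambda>n. complex_of_real (g n \<xi>) * (cis (x * \<xi>) * fourier \<phi> \<xi>)) \<longlonglongrightarrow> complex_of_real 1 * (cis (x * \<xi>) * fourier \<phi> \<xi>)"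
        by (intro tendsto_intros)
      then show "(\<lambda>n. complex_of_real (g n \<xi>) * (cis (x * \<xi>) * fourier \<phi> \<xi>)) \<longlonglongrightarrow> cis (x * \<xi>) * fourier \<phi> \<xi>" by simp
    qed
    show "AE \<xi> in lborel. norm (complex_of_real (g n \<xi>) * (cis (x * \<xi>) * fourier \<phi> \<xi>)) \<le> norm (fourier \<phi> \<xi>)" for n
      using g by (auto simp: norm_mult intro!: AE_I2 mult_left_le_one_le)
  qed (use fourier_integrable[OF \<phi>] in auto)
  moreover have "(\<integral>\<xi>. complex_of_real (g n \<xi>) * (cis (x * \<xi>) * fourier \<phi> \<xi>) \<partial>lborel)
      = (\<integral>t. \<phi> (x - t / sqrt (real n + 1)) * complex_of_real (exp (- t\<^sup>2 / 2)) \<partial>lborel)" for n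
  proof -
    \<comment> \<open>With this a the transform of the Gaussian factor is a Gaussian in x - y;
      \<open>r\<close> is its inverse standard deviation and serves for the substitution y = x - t /
      r.\<close>
    define a where "a = 1 / (2 * (real n + 1))"
    have a: "0 < a" "g n = (\<lambda>\<xi>. exp (- (a * \<xi>\<^sup>2)))" by (auto simp: a_def g_def)
    define r where "r = sqrt (real n + 1)"
    have r: "0 < r" "r\<^sup>2 = real n + 1" by (auto simp: r_def)
    define K where "K \<xi> y = (1 / sqrt (2 * pi)) * (complex_of_real (g n \<xi>) * cis ((x - y) * \<xi>) * \<phi> y)" for \<xi> y
    have [measurable]: "case_prod K \<in> borel_measurable (borel \<Otimes>\<^sub>M borel)" unfolding K_def by measurable
    have "(\<integral>\<^sup>+\<xi>. \<integral>\<^sup>+y. ennreal (norm (K \<xi> y)) \<partial>lborel \<partial>lborel) = (\<integral>\<^sup>+\<xi>. \<integral>\<^sup>+y. ennreal (1 / sqrt (2 * pi)) * (ennreal (g n \<xi>) * ennreal (norm (\<phi> y))) \<partial>lborel \<partial>lborel)"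
      using g by (auto simp: K_def norm_mult norm_divide ennreal_mult[symmetric] intro!: nn_integral_cong)
    also have "\<dots> = ennreal (1 / sqrt (2 * pi)) * ((\<integral>\<^sup>+\<xi>. ennreal (g n \<xi>) \<partial>lborel) * (\<integral>\<^sup>+y. ennreal (norm (\<phi> y)) \<partial>lborel))"
      by (simp add: nn_integral_cmult nn_integral_multc)
    also have "\<dots> < \<infinity>"
      using gaussian_scaled_integrable[OF a(1)] schwartz_integrable[OF \<phi>] g
      by (auto simp: a(2) integrable_iff_bounded ennreal_mult_less_top)
    finally have fin: "(\<integral>\<^sup>+\<xi>. \<integral>\<^sup>+y. ennreal (norm (K \<xi> y)) \<partial>lborel \<partial>lborel) < \<infinity>" .
    have "(\<integral>\<xi>. complex_of_real (g n \<xi>) * (cis (x * \<xi>) * fourier \<phi> \<xi>) \<partial>lborel) = (\<integral>\<xi>. \<integral>y. K \<xi> y \<partial>lborel \<partial>lborel)"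
    proof (rule Bochner_Integration.integral_cong[OF refl])
      fix \<xi> :: real
      have "(\<integral>y. K \<xi> y \<partial>lborel) = (\<integral>y. (complex_of_real (1 / sqrt (2 * pi)) * complex_of_real (g n \<xi>) * cis (x * \<xi>)) * (cis (- (y * \<xi>)) * \<phi> y) \<partial>lborel)"
        by (intro Bochner_Integration.integral_cong refl) (simp add: K_def cis_mult algebra_simps)
      also have "\<dots> = (complex_of_real (1 / sqrt (2 * pi)) * complex_of_real (g n \<xi>) * cis (x * \<xi>)) * (\<integral>y. cis (- (y * \<xi>)) * \<phi> y \<partial>lborel)"
        by (rule integral_mult_right_zero)
      finally show "complex_of_real (g n \<xi>) * (cis (x * \<xi>) * fourier \<phi> \<xi>) = (\<integral>y. K \<xi> y \<partial>lborel)"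
        by (simp add: fourier_def)
    qed
    also have "\<dots> = (\<integral>y. \<integral>\<xi>. K \<xi> y \<partial>lborel \<partial>lborel)" by (rule lborel_Fubini(1)) (use fin in auto)
    also have "\<dots> = (\<integral>y. \<phi> y * complex_of_real (r * exp (- (x - y)\<^sup>2 * r\<^sup>2 / 2)) \<partial>lborel)"
    proof (rule Bochner_Integration.integral_cong[OF refl])
      fix y :: real
      have "(\<integral>\<xi>. K \<xi> y \<partial>lborel) = (\<integral>\<xi>. (complex_of_real (1 / sqrt (2 * pi)) * \<phi> y) * (cis ((x - y) * \<xi>) * complex_of_real (exp (- (a * \<xi>\<^sup>2)))) \<partial>lborel)"
        by (intro Bochner_Integration.integral_cong refl) (simp add: K_def a(2))
      also have "\<dots> = (complex_of_real (1 / sqrt (2 * pi)) * \<phi> y) * complex_of_real (sqrt (pi / a) * exp (- (x - y)\<^sup>2 / (4 * a)))"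
        by (simp add: gaussian_fourier[OF a(1)])
      also have "sqrt (pi / a) = sqrt (2 * pi) * r" unfolding r_def a_def by (simp flip: real_sqrt_mult add: mult_ac)
      also have "- (x - y)\<^sup>2 / (4 * a) = - (x - y)\<^sup>2 * r\<^sup>2 / 2" unfolding r(2) a_def by simp
      finally show "(\<integral>\<xi>. K \<xi> y \<partial>lborel) = \<phi> y * complex_of_real (r * exp (- (x - y)\<^sup>2 * r\<^sup>2 / 2))"
        using a_def r(2) by (simp add: field_simps)
    qed
    also have "\<dots> = \<bar>- (1 / r)\<bar> *\<^sub>R (\<integral>t. \<phi> (x + - (1 / r) * t) * complex_of_real (r * exp (- (x - (x + - (1 / r) * t))\<^sup>2 * r\<^sup>2 / 2)) \<partial>lborel)"
      by (rule lborel_integral_real_affine) (use r in simp)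
    also have "(\<integral>t. \<phi> (x + - (1 / r) * t) * complex_of_real (r * exp (- (x - (x + - (1 / r) * t))\<^sup>2 * r\<^sup>2 / 2)) \<partial>lborel)
        = (\<integral>t. complex_of_real r * (\<phi> (x - t / r) * complex_of_real (exp (- t\<^sup>2 / 2))) \<partial>lborel)"
      using r(1) by (intro Bochner_Integration.integral_cong refl) (simp add: power_divide)
    also have "\<bar>- (1 / r)\<bar> *\<^sub>R \<dots> = (\<integral>t. \<phi> (x - t / r) * complex_of_real (exp (- t\<^sup>2 / 2)) \<partial>lborel)"
      using r(1) by (simp add: scaleR_conv_of_real)
    finally show ?thesis by (simp add: r_def)
  qed
  moreover have "(\<lambda>n. \<integral>t. \<phi> (x - t / sqrt (real n + 1)) * complex_of_real (exp (- t\<^sup>2 / 2)) \<partial>lborel) \<longlonglongrightarrow> (\<integral>t. \<phi> x * complex_of_real (exp (- t\<^sup>2 / 2)) \<partial>lborel)"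
  proof (rule integral_dominated_convergence[where w="\<lambda>t. M * exp (- t\<^sup>2 / 2)"])
    show "AE t in lborel. (\<lambda>n. \<phi> (x - t / sqrt (real n + 1)) * complex_of_real (exp (- t\<^sup>2 / 2))) \<longlonglongrightarrow> \<phi> x * complex_of_real (exp (- t\<^sup>2 / 2))"
    proof (rule AE_I2, intro tendsto_mult tendsto_const)
      fix t :: real
      have "isCont \<phi> x" using schwartz_continuous[OF \<phi>, of UNIV] by (simp add: continuous_on_eq_continuous_at)
      moreover have "(\<lambda>n. x - t / sqrt (real n + 1)) \<longlonglongrightarrow> x" by real_asymp
      ultimately show "(\<lambda>n. \<phi> (x - t / sqrt (real n + 1))) \<longlonglongrightarrow> \<phi> x" by (rule isCont_tendsto_compose)
    qed
    show "AE t in lborel. norm (\<phi> (x - t / sqrt (real n + 1)) * complex_of_real (exp (- t\<^sup>2 / 2))) \<le> M * exp (- t\<^sup>2 / 2)" for n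
      using M by (auto simp: norm_mult intro!: AE_I2 mult_right_mono)
  qed (use gaussian_integrable in auto)
  ultimately have "(\<integral>\<xi>. cis (x * \<xi>) * fourier \<phi> \<xi> \<partial>lborel) = (\<integral>t. \<phi> x * complex_of_real (exp (- t\<^sup>2 / 2)) \<partial>lborel)"
    by (simp add: LIMSEQ_unique)
  also have "\<dots> = complex_of_real (sqrt (2 * pi)) * \<phi> x" using gaussian_fourier_std[of 0] by simp
  finally show ?thesis .
qed

text \<open>On the frequency side both pairings are the integral of |\<xi>| powr s against a product
  of two transforms taken with opposite signs of \<xi>; the reflection of \<xi> swaps their roles
  because the multiplier is even. This is what identifies the distribution attached to a test
  function with its pointwise fractional Laplacian.\<close>

lemma fraclap_symmetric:
  assumes \<phi>: "schwartz \<phi>" and \<psi>: "schwartz \<psi>" and s: "0 < s" "s < 1"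
  shows "(\<integral>x. \<psi> x * fraclap (s / 2) \<phi> x \<partial>lborel) = (\<integral>x. fraclap (s / 2) \<psi> x * \<phi> x \<partial>lborel)"
proof -
  define T where "T \<phi> \<xi> = complex_of_real (\<bar>\<xi>\<bar> powr s) * fourier \<phi> \<xi>" for \<phi> \<xi>
  define c where "c = complex_of_real (1 / sqrt (2 * pi))"
  define A where "A \<psi> \<xi> = (\<integral>x. cis (x * \<xi>) * \<psi> x \<partial>lborel)" for \<psi> and \<xi> :: real
  define B where "B \<phi> \<xi> = (\<integral>y. cis (- (y * \<xi>)) * \<phi> y \<partial>lborel)" for \<phi> and \<xi> :: real
  have AB: "(\<integral>x. \<psi> x * fraclap (s / 2) \<phi> x \<partial>lborel) = c * c * (\<integral>\<xi>. complex_of_real (\<bar>\<xi>\<bar> powr s) * (A \<psi> \<xi> * B \<phi> \<xi>) \<partial>lborel)"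
    if \<phi>: "schwartz \<phi>" and \<psi>: "schwartz \<psi>" for \<phi> \<psi>
  proof -
    have T: "integrable lborel (T \<phi>)" unfolding T_def by (rule powr_fourier_integrable[OF \<phi>]) (use s in auto)
    note [measurable] = schwartz_measurable[OF \<phi>] schwartz_measurable[OF \<psi>] borel_measurable_integrable[OF T]
    define K where "K x \<xi> = \<psi> x * (cis (x * \<xi>) * T \<phi> \<xi>)" for x \<xi>
    have [measurable]: "case_prod K \<in> borel_measurable (borel \<Otimes>\<^sub>M borel)" unfolding K_def by measurable
    have "(\<integral>\<^sup>+x. \<integral>\<^sup>+\<xi>. ennreal (norm (K x \<xi>)) \<partial>lborel \<partial>lborel) = (\<integral>\<^sup>+x. \<integral>\<^sup>+\<xi>. ennreal (norm (\<psi> x)) * ennreal (norm (T \<phi> \<xi>)) \<partial>lborel \<partial>lborel)"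
      by (intro nn_integral_cong) (auto simp: K_def norm_mult ennreal_mult)
    also have "\<dots> = (\<integral>\<^sup>+x. ennreal (norm (\<psi> x)) \<partial>lborel) * (\<integral>\<^sup>+\<xi>. ennreal (norm (T \<phi> \<xi>)) \<partial>lborel)"
      by (simp add: nn_integral_cmult nn_integral_multc)
    also have "\<dots> < \<infinity>"
      using T schwartz_integrable[OF \<psi>] by (auto simp: integrable_iff_bounded ennreal_mult_less_top)
    finally have fin: "(\<integral>\<^sup>+x. \<integral>\<^sup>+\<xi>. ennreal (norm (K x \<xi>)) \<partial>lborel \<partial>lborel) < \<infinity>" .
    have "(\<integral>x. \<psi> x * fraclap (s / 2) \<phi> x \<partial>lborel) = (\<integral>x. c * (\<integral>\<xi>. K x \<xi> \<partial>lborel) \<partial>lborel)"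
      by (simp add: fraclap_def inv_fourier_def K_def T_def c_def mult_ac)
    also have "\<dots> = c * (\<integral>x. \<integral>\<xi>. K x \<xi> \<partial>lborel \<partial>lborel)" by simp
    also have "(\<integral>x. \<integral>\<xi>. K x \<xi> \<partial>lborel \<partial>lborel) = (\<integral>\<xi>. \<integral>x. K x \<xi> \<partial>lborel \<partial>lborel)"
      by (rule lborel_Fubini(1)) (use fin in auto)
    also have "\<dots> = (\<integral>\<xi>. c * (complex_of_real (\<bar>\<xi>\<bar> powr s) * (A \<psi> \<xi> * B \<phi> \<xi>)) \<partial>lborel)"
    proof (rule Bochner_Integration.integral_cong[OF refl])
      fix \<xi>
      have "(\<integral>x. K x \<xi> \<partial>lborel) = (\<integral>x. (c * complex_of_real (\<bar>\<xi>\<bar> powr s) * B \<phi> \<xi>) * (cis (x * \<xi>) * \<psi> x) \<partial>lborel)"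
        by (intro Bochner_Integration.integral_cong refl) (simp add: K_def T_def fourier_def c_def B_def)
      then show "(\<integral>x. K x \<xi> \<partial>lborel) = c * (complex_of_real (\<bar>\<xi>\<bar> powr s) * (A \<psi> \<xi> * B \<phi> \<xi>))"
        by (simp add: A_def)
    qed
    finally show ?thesis by (simp add: mult.assoc)
  qed
  have "(\<integral>\<xi>. complex_of_real (\<bar>\<xi>\<bar> powr s) * (A \<psi> \<xi> * B \<phi> \<xi>) \<partial>lborel)
      = (\<integral>\<xi>. complex_of_real (\<bar>- \<xi>\<bar> powr s) * (A \<psi> (- \<xi>) * B \<phi> (- \<xi>)) \<partial>lborel)"
    by (rule integral_shift(5)[symmetric])
  also have "\<dots> = (\<integral>\<xi>. complex_of_real (\<bar>\<xi>\<bar> powr s) * (A \<phi> \<xi> * B \<psi> \<xi>) \<partial>lborel)"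
    by (simp add: A_def B_def mult.commute)
  finally show ?thesis using AB[OF \<phi> \<psi>] AB[OF \<psi> \<phi>] by (simp add: mult.commute)
qed

subsection \<open>The fractional Laplacian of test functions as a singular integral\<close>

text \<open>Symmetrising gives the real symbol 2 - 2 * cos (y * \<xi>) and an integrand of order y^2
  at the origin, so that the singular integral converges absolutely.\<close>

definition second_diff :: "(real \<Rightarrow> real) \<Rightarrow> real \<Rightarrow> real \<Rightarrow> real" where
  "second_diff f x y = 2 * f x - f (x + y) - f (x - y)"

text \<open>The denominator normalises the symbol of \<open>fl s\<close> to \<open>|\<xi>| powr s\<close>.\<close>

definition fl :: "real \<Rightarrow> (real \<Rightarrow> real) \<Rightarrow> real \<Rightarrow> real" where
  "fl s f x = (\<integral>y. second_diff f x y * \<bar>y\<bar> powr (-1 - s) \<partial>lborel) / (\<integral>y. (2 - 2 * cos y) * \<bar>y\<bar> powr (-1 - s) \<partial>lborel)"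

definition kap :: "real \<Rightarrow> real" where
  "kap s = 2 * cos (pi * s / 2) * Gamma s"

lemma square_mult_abs_powr: "y\<^sup>2 * \<bar>y\<bar> powr a = \<bar>y::real\<bar> powr (2 + a)"
proof (cases "y = 0")
  case False
  then have "y\<^sup>2 = \<bar>y\<bar> powr 2" by (simp add: powr_numeral)
  then show ?thesis by (simp add: powr_add)
qed simp

lemma integrable_min_powr:
  fixes s :: real
  assumes "0 < s" "s < 1"
  shows "integrable lborel (\<lambda>y::real. min 1 (y\<^sup>2) * \<bar>y\<bar> powr (-1 - s))"
proof (rule Bochner_Integration.integrable_bound)
  show "integrable lborel (\<lambda>y::real. \<bar>y\<bar> powr ((2 - s) - 1) * indicator {-1..1} y + \<bar>y\<bar> powr (-1 - s) * indicator {1..} \<bar>y\<bar>)"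
    using assms by (intro Bochner_Integration.integrable_add integrable_abs_powr_near_0 integrable_abs_powr_near_inf) auto
  show "AE y in lborel. norm (min 1 (y\<^sup>2) * \<bar>y\<bar> powr (-1 - s)) \<le> norm (\<bar>y\<bar> powr ((2 - s) - 1) * indicator {-1..1} y + \<bar>y\<bar> powr (-1 - s) * indicator {1..} \<bar>y\<bar>)"
  proof (rule AE_I2)
    fix y :: real
    have sq: "y\<^sup>2 * \<bar>y\<bar> powr (-1 - s) = \<bar>y\<bar> powr ((2 - s) - 1)"
      by (simp add: square_mult_abs_powr)
    show "norm (min 1 (y\<^sup>2) * \<bar>y\<bar> powr (-1 - s)) \<le> norm (\<bar>y\<bar> powr ((2 - s) - 1) * indicator {-1..1} y + \<bar>y\<bar> powr (-1 - s) * indicator {1..} \<bar>y\<bar>)"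
    proof (cases "\<bar>y\<bar> \<le> 1")
      case True
      then have "norm (min 1 (y\<^sup>2) * \<bar>y\<bar> powr (-1 - s)) = \<bar>y\<bar> powr ((2 - s) - 1)"
        using sq abs_square_le_1[of y] by (simp add: min_def abs_mult)
      then show ?thesis using True by (auto simp: indicator_def abs_le_iff)
    next
      case False
      then have "1 \<le> y\<^sup>2" using abs_square_less_1[of y] by linarith
      then show ?thesis using False by (auto simp: indicator_def min_def)
    qed
  qed
qed measurable

lemma cos_powr_integrable:
  fixes s :: real
  assumes "0 < s" "s < 1"
  shows "integrable lborel (\<lambda>y::real. (2 - 2 * cos y) * \<bar>y\<bar> powr (-1 - s))"
proof (rule Bochner_Integration.integrable_bound[of _ "\<lambda>y. 4 * (min 1 (y\<^sup>2) * \<bar>y\<bar> powr (-1 - s))"])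
  show "integrable lborel (\<lambda>y::real. 4 * (min 1 (y\<^sup>2) * \<bar>y\<bar> powr (-1 - s)))"
    using integrable_min_powr[OF assms] by (rule integrable_mult_right)
  show "AE y in lborel. norm ((2 - 2 * cos y) * \<bar>y\<bar> powr (-1 - s)) \<le> norm (4 * (min 1 (y\<^sup>2) * \<bar>y\<bar> powr (-1 - s)))"
  proof (rule AE_I2)
    fix y :: real
    have "2 - 2 * cos y \<le> 4" using cos_ge_minus_one[of y] by linarith
    moreover have "2 - 2 * cos y \<le> y\<^sup>2"
    proof -
      have "cos y = 1 - 2 * (sin (y / 2))\<^sup>2" using cos_double_sin[of "y / 2"] by simp
      moreover have "(sin (y / 2))\<^sup>2 \<le> (y / 2)\<^sup>2" using abs_sin_x_le_abs_x[of "y / 2"] abs_le_square_iff by blast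
      ultimately show ?thesis by (simp add: power_divide)
    qed
    ultimately have "2 - 2 * cos y \<le> 4 * min 1 (y\<^sup>2)" using zero_le_power2[of y] by (smt (verit))
    moreover have "0 \<le> 2 - 2 * cos y" by simp
    ultimately show "norm ((2 - 2 * cos y) * \<bar>y\<bar> powr (-1 - s)) \<le> norm (4 * (min 1 (y\<^sup>2) * \<bar>y\<bar> powr (-1 - s)))"
      by (simp add: abs_mult mult.assoc[symmetric] mult_right_mono min_def)
  qed
qed measurable

lemma cos_powr_pos:
  fixes s :: real
  assumes "0 < s" "s < 1"
  shows "0 < (\<integral>y. (2 - 2 * cos y) * \<bar>y\<bar> powr (-1 - s) \<partial>lborel)"
proof -
  have nn: "0 \<le> (\<integral>y. (2 - 2 * cos y) * \<bar>y\<bar> powr (-1 - s) \<partial>lborel)" by (intro integral_nonneg_AE) auto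
  have "(\<integral>y. (2 - 2 * cos y) * \<bar>y\<bar> powr (-1 - s) \<partial>lborel) \<noteq> 0"
  proof
    assume "(\<integral>y. (2 - 2 * cos y) * \<bar>y\<bar> powr (-1 - s) \<partial>lborel) = 0"
    then have "AE y in lborel. (2 - 2 * cos (y::real)) * \<bar>y\<bar> powr (-1 - s) = 0"
      by (subst (asm) integral_nonneg_eq_0_iff_AE) (use cos_powr_integrable[OF assms] in auto)
    moreover have "(2 - 2 * cos y) * \<bar>y\<bar> powr (-1 - s) \<noteq> 0" if "y \<in> {0<..1}" for y :: real
      using that cos_monotone_0_pi[of 0 y] pi_gt3 by auto
    ultimately have "AE y in lborel. (y::real) \<notin> {0<..1}" by (auto elim!: eventually_mono)
    then have "emeasure lborel {0<..1::real} = 0"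
      by (subst (asm) AE_iff_measurable[OF _ refl]) (auto simp: greaterThanAtMost_def greaterThan_def atMost_def Collect_conj_eq[symmetric])
    then show False by simp
  qed
  with nn show ?thesis by linarith
qed

text \<open>Rescaling y by \<xi> turns the average of the symbols 2 - 2 * cos (y * \<xi>) into a
  homogeneous function of degree s; this is the reason for the exponent -1 - s.\<close>

lemma cos_powr_scale:
  fixes s :: real
  assumes "0 < s" "s < 1"
  shows "(\<integral>y. (2 - 2 * cos (y * \<xi>)) * \<bar>y\<bar> powr (-1 - s) \<partial>lborel) = \<bar>\<xi>\<bar> powr s * (\<integral>y. (2 - 2 * cos y) * \<bar>y\<bar> powr (-1 - s) \<partial>lborel)"
  and "integrable lborel (\<lambda>y::real. (2 - 2 * cos (y * \<xi>)) * \<bar>y\<bar> powr (-1 - s))"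
proof -
  have e: "\<bar>\<xi>\<bar> powr s * (\<bar>\<xi>\<bar> * ((2 - 2 * cos (0 + \<xi> * y)) * \<bar>0 + \<xi> * y\<bar> powr (-1 - s))) = (2 - 2 * cos (y * \<xi>)) * \<bar>y\<bar> powr (-1 - s)" if "\<xi> \<noteq> 0" for y
  proof -
    have "\<bar>\<xi>\<bar> powr s * (\<bar>\<xi>\<bar> * \<bar>\<xi>\<bar> powr (-1 - s)) = 1"
      using that powr_mult_base[of "\<bar>\<xi>\<bar>" "-1 - s"] by (simp flip: powr_add)
    then show ?thesis by (simp add: abs_mult powr_mult mult_ac)
  qed
  show "(\<integral>y. (2 - 2 * cos (y * \<xi>)) * \<bar>y\<bar> powr (-1 - s) \<partial>lborel) = \<bar>\<xi>\<bar> powr s * (\<integral>y. (2 - 2 * cos y) * \<bar>y\<bar> powr (-1 - s) \<partial>lborel)"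
  proof (cases "\<xi> = 0")
    case False
    have "\<bar>\<xi>\<bar> powr s * (\<integral>y. (2 - 2 * cos y) * \<bar>y\<bar> powr (-1 - s) \<partial>lborel) = \<bar>\<xi>\<bar> powr s * (\<bar>\<xi>\<bar> *\<^sub>R (\<integral>y. (2 - 2 * cos (0 + \<xi> * y)) * \<bar>0 + \<xi> * y\<bar> powr (-1 - s) \<partial>lborel))"
      by (subst lborel_integral_real_affine[OF False, of _ 0]) simp
    also have "\<dots> = (\<integral>y. \<bar>\<xi>\<bar> powr s * (\<bar>\<xi>\<bar> * ((2 - 2 * cos (0 + \<xi> * y)) * \<bar>0 + \<xi> * y\<bar> powr (-1 - s))) \<partial>lborel)" by simp
    finally show ?thesis by (simp only: e[OF False])
  qed simp
  show "integrable lborel (\<lambda>y::real. (2 - 2 * cos (y * \<xi>)) * \<bar>y\<bar> powr (-1 - s))"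
  proof (cases "\<xi> = 0")
    case False
    have "integrable lborel (\<lambda>y. \<bar>\<xi>\<bar> powr s * (\<bar>\<xi>\<bar> * ((2 - 2 * cos (0 + \<xi> * y)) * \<bar>0 + \<xi> * y\<bar> powr (-1 - s))))"
      by (intro integrable_mult_right lborel_integrable_real_affine cos_powr_integrable assms False)
    then show ?thesis by (simp only: e[OF False])
  qed simp
qed

lemma second_diff_bound:
  assumes "test_fun f" obtains M where "0 < M" "\<And>x y. \<bar>second_diff f x y\<bar> \<le> M * min 1 (y\<^sup>2)"
proof -
  obtain B where B: "0 < B" "\<And>x. \<bar>f x\<bar> \<le> B" using test_fun_bounded[OF assms] by blast
  obtain L where L: "0 < L" "\<And>x y. \<bar>deriv f x - deriv f y\<bar> \<le> L * \<bar>x - y\<bar>" using test_fun_lipschitz[OF test_fun_deriv[OF assms]] by blast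
  have "\<bar>second_diff f x y\<bar> \<le> 2 * L * y\<^sup>2" for x y
  proof -
    have d: "((\<lambda>t. second_diff f x t) has_real_derivative deriv f (x - t) - deriv f (x + t)) (at t)" for t
      unfolding second_diff_def
      by (rule derivative_eq_intros DERIV_chain2[OF test_fun_DERIV[OF assms]] refl | simp)+
    have "norm (second_diff f x y - second_diff f x 0) \<le> (2 * L * \<bar>y\<bar>) * norm (y - 0)"
    proof (rule field_differentiable_bound[of "{-\<bar>y\<bar>..\<bar>y\<bar>}" "second_diff f x" "\<lambda>t. deriv f (x - t) - deriv f (x + t)"])
      show "norm (deriv f (x - t) - deriv f (x + t)) \<le> 2 * L * \<bar>y\<bar>" if "t \<in> {-\<bar>y\<bar>..\<bar>y\<bar>}" for t
      proof -
        have "\<bar>deriv f (x - t) - deriv f (x + t)\<bar> \<le> L * \<bar>(x - t) - (x + t)\<bar>" by (rule L)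
        also have "\<dots> \<le> L * (2 * \<bar>y\<bar>)" using that L(1) by (intro mult_left_mono) auto
        finally show ?thesis by simp
      qed
    qed (auto intro: d DERIV_subset)
    then show ?thesis by (simp add: second_diff_def power2_eq_square mult_ac)
  qed
  moreover have "\<bar>second_diff f x y\<bar> \<le> 4 * B" for x y
    using B(2)[of x] B(2)[of "x + y"] B(2)[of "x - y"] unfolding second_diff_def by linarith
  ultimately have "\<bar>second_diff f x y\<bar> \<le> (2 * L + 4 * B) * min 1 (y\<^sup>2)" for x y
    using B(1) L(1) by (auto simp: min_def algebra_simps intro: order.trans add_increasing add_increasing2)
  then show ?thesis using B(1) L(1) by (intro that[of "2 * L + 4 * B"]) auto
qed

lemma second_diff_measurable [measurable]:
  assumes [measurable]: "f \<in> borel_measurable borel" "g \<in> borel_measurable M" "h \<in> borel_measurable M"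
  shows "(\<lambda>x. second_diff f (g x) (h x)) \<in> borel_measurable M"
  unfolding second_diff_def by measurable

lemma second_diff_integrable:
  assumes "test_fun f" "0 < s" "s < 1"
  shows "integrable lborel (\<lambda>y. second_diff f x y * \<bar>y\<bar> powr (-1 - s))"
proof -
  note [measurable] = test_fun_measurable[OF assms(1)]
  obtain M where M: "0 < M" "\<And>x y. \<bar>second_diff f x y\<bar> \<le> M * min 1 (y\<^sup>2)" using second_diff_bound[OF assms(1)] by blast
  show ?thesis
  proof (rule Bochner_Integration.integrable_bound[of _ "\<lambda>y. M * (min 1 (y\<^sup>2) * \<bar>y\<bar> powr (-1 - s))"])
    show "AE y in lborel. norm (second_diff f x y * \<bar>y\<bar> powr (-1 - s)) \<le> norm (M * (min 1 (y\<^sup>2) * \<bar>y\<bar> powr (-1 - s)))"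
      using M by (auto simp: abs_mult mult.assoc[symmetric] min_def intro!: AE_I2 mult_right_mono M(2)[THEN order.trans])
  qed (use integrable_min_powr[OF assms(2,3)] in auto)
qed

text \<open>Far from the support f x = 0 and only increments y reaching back to the support count;
  these satisfy |y| \<ge> |x| / 2, so the kernel is at most (|x| / 2) powr (-1 - s) and the L1 norm
  of f does the rest. Absolute values are integrated because the bound also feeds Fubini in
  \<open>fl_convolution\<close>.\<close>

lemma second_diff_decay:
  assumes f: "test_fun f" and s: "0 < s" "s < 1"
  obtains C where "0 < C" "\<And>x. (\<integral>\<^sup>+y. ennreal (\<bar>second_diff f x y\<bar> * \<bar>y\<bar> powr (-1 - s)) \<partial>lborel) \<le> ennreal (C / (1 + \<bar>x\<bar> powr (1 + s)))"
proof -
  note [measurable] = test_fun_measurable[OF f]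
  obtain M where M: "0 < M" "\<And>x y. \<bar>second_diff f x y\<bar> \<le> M * min 1 (y\<^sup>2)" using second_diff_bound[OF f] by blast
  obtain R0 where R0: "0 < R0" "\<And>x. R0 < \<bar>x\<bar> \<Longrightarrow> f x = 0" using test_fun_support[OF f] by blast
  \<comment> \<open>R at least 1 ensures |x| \<ge> 1 in the far case, so that \<open>w x\<close> is
    at most twice |x| powr (1 + s).\<close>
  define R where "R = max 1 R0"
  have R: "1 \<le> R" "\<And>x. R < \<bar>x\<bar> \<Longrightarrow> f x = 0" using R0 by (auto simp: R_def)
  define J where "J = (\<integral>y. min 1 (y\<^sup>2) * \<bar>y\<bar> powr (-1 - s) \<partial>lborel)"
  define N where "N = (\<integral>y. \<bar>f y\<bar> \<partial>lborel)"
  have J: "0 \<le> J" unfolding J_def by (intro integral_nonneg_AE) auto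
  have N: "0 \<le> N" unfolding N_def by (intro integral_nonneg_AE) auto
  have nnN: "(\<integral>\<^sup>+y. ennreal \<bar>f y\<bar> \<partial>lborel) = ennreal N"
    unfolding N_def using test_fun_integrable[OF f] by (intro nn_integral_eq_integral) auto
  define w where "w x = 1 + \<bar>x\<bar> powr (1 + s)" for x :: real
  have w: "0 < w x" for x by (simp add: w_def add_pos_nonneg)
  \<comment> \<open>The first summand serves |x| \<le> 2 * R. In the second, 2 powr (1 + s) comes
    from halving |x|, and 4 from the two shifts times the factor 2 in the estimate of
    \<open>w x\<close>; the last summand gives positivity.\<close>
  define C where "C = M * J * w (2 * R) + 2 powr (1 + s) * 4 * N + 1"
  have C: "0 < C" unfolding C_def using M J N w[of "2 * R"] by (intro add_nonneg_pos add_nonneg_nonneg mult_nonneg_nonneg) auto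
  have "(\<integral>\<^sup>+y. ennreal (\<bar>second_diff f x y\<bar> * \<bar>y\<bar> powr (-1 - s)) \<partial>lborel) \<le> ennreal (C / w x)" for x
  proof (cases "\<bar>x\<bar> \<le> 2 * R")
    case True
    have "(\<integral>\<^sup>+y. ennreal (\<bar>second_diff f x y\<bar> * \<bar>y\<bar> powr (-1 - s)) \<partial>lborel) \<le> (\<integral>\<^sup>+y. ennreal (M * (min 1 (y\<^sup>2) * \<bar>y\<bar> powr (-1 - s))) \<partial>lborel)"
      using M(2) by (intro nn_integral_mono ennreal_leI) (auto simp: mult.assoc[symmetric] intro!: mult_right_mono)
    also have "\<dots> = ennreal (M * J)"
      using integrable_min_powr[OF s] M(1) by (subst nn_integral_eq_integral) (auto simp: J_def min_def)
    also have "M * J \<le> C / w x"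
    proof -
      have "w x \<le> w (2 * R)" unfolding w_def using True s R(1) by (intro add_left_mono powr_mono2) auto
      then have "M * J * w x \<le> M * J * w (2 * R)" using M(1) J by (intro mult_left_mono) auto
      also have "\<dots> \<le> C" unfolding C_def using N by simp
      finally show ?thesis using w[of x] by (simp add: pos_le_divide_eq)
    qed
    finally show ?thesis by (simp add: ennreal_leI)
  next
    case False
    define k where "k = (\<bar>x\<bar> / 2) powr (-1 - s)"
    have k: "0 \<le> k" by (simp add: k_def)
    have bd: "\<bar>f (x + y)\<bar> * \<bar>y\<bar> powr (-1 - s) \<le> \<bar>f (x + y)\<bar> * k" for y
    proof (cases "R < \<bar>x + y\<bar>")
      case F: False
      have "\<bar>x\<bar> / 2 \<le> \<bar>y\<bar>" using F False by linarith
      then have "\<bar>y\<bar> powr (-1 - s) \<le> k" unfolding k_def using False R(1) s by (intro powr_mono2') auto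
      then show ?thesis by (intro mult_left_mono) auto
    qed (simp add: R)
    have "f x = 0" using False R by auto
    then have "\<bar>second_diff f x y\<bar> * \<bar>y\<bar> powr (-1 - s) \<le> \<bar>f (x + y)\<bar> * k + \<bar>f (x + - y)\<bar> * k" for y
    proof -
      have "\<bar>second_diff f x y\<bar> \<le> \<bar>f (x + y)\<bar> + \<bar>f (x + - y)\<bar>" unfolding second_diff_def \<open>f x = 0\<close> by simp
      then have "\<bar>second_diff f x y\<bar> * \<bar>y\<bar> powr (-1 - s) \<le> (\<bar>f (x + y)\<bar> + \<bar>f (x + - y)\<bar>) * \<bar>y\<bar> powr (-1 - s)" by (intro mult_right_mono) auto
      then show ?thesis using bd[of y] bd[of "-y"] by (simp add: algebra_simps)
    qed
    then have "(\<integral>\<^sup>+y. ennreal (\<bar>second_diff f x y\<bar> * \<bar>y\<bar> powr (-1 - s)) \<partial>lborel) \<le> (\<integral>\<^sup>+y. ennreal \<bar>f (x + y)\<bar> * ennreal k + ennreal \<bar>f (x - y)\<bar> * ennreal k \<partial>lborel)"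
      using k by (intro nn_integral_mono) (simp add: ennreal_mult[symmetric] ennreal_plus[symmetric] ennreal_leI del: ennreal_plus)
    also have "\<dots> = ennreal N * ennreal k + ennreal N * ennreal k"
      using nn_integral_shift(1)[of "\<lambda>y. ennreal \<bar>f y\<bar>" x] nn_integral_shift(4)[of "\<lambda>y. ennreal \<bar>f y\<bar>" x]
      by (simp add: nn_integral_add nn_integral_multc nnN)
    also have "\<dots> = ennreal (2 * N * k)" using N k by (simp flip: ennreal_mult ennreal_plus)
    also have "2 * N * k \<le> C / w x"
    proof -
      have x1: "1 \<le> \<bar>x\<bar>" using False R(1) by linarith
      have "w x \<le> 2 * \<bar>x\<bar> powr (1 + s)" using ge_one_powr_ge_zero[OF x1, of "1 + s"] s by (simp add: w_def)
      moreover have "k = 2 powr (1 + s) / \<bar>x\<bar> powr (1 + s)"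
        using x1 by (simp add: k_def powr_divide powr_minus_divide[of _ "1 + s", simplified])
      ultimately have "k * w x \<le> 2 powr (1 + s) / \<bar>x\<bar> powr (1 + s) * (2 * \<bar>x\<bar> powr (1 + s))" using k mult_left_mono by blast
      also have "\<dots> = 2 powr (1 + s) * 2" using x1 by simp
      finally have "2 * N * (k * w x) \<le> 2 * N * (2 powr (1 + s) * 2)" using N by (intro mult_left_mono) auto
      also have "\<dots> \<le> C" unfolding C_def using M(1) J w[of "2 * R"] by (simp add: add_nonneg_nonneg)
      finally show ?thesis using w[of x] by (simp add: pos_le_divide_eq mult.assoc)
    qed
    finally show ?thesis by (simp add: ennreal_leI)
  qed
  with C that show ?thesis unfolding w_def by blast
qed

lemma fl_measurable [measurable]:
  assumes [measurable]: "f \<in> borel_measurable borel" shows "fl s f \<in> borel_measurable borel"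
proof -
  have "(\<lambda>x. \<integral>y. second_diff f x y * \<bar>y\<bar> powr (-1 - s) \<partial>lborel) \<in> borel_measurable borel"
    by (rule lborel.borel_measurable_lebesgue_integral) measurable
  then show ?thesis unfolding fl_def[abs_def] by measurable
qed

lemma fl_decay:
  assumes f: "test_fun f" and s: "0 < s" "s < 1"
  obtains C where "0 < C" "\<And>x. \<bar>fl s f x\<bar> \<le> C / (1 + \<bar>x\<bar> powr (1 + s))"
proof -
  note [measurable] = test_fun_measurable[OF f]
  define B where "B = (\<integral>y. (2 - 2 * cos y) * \<bar>y\<bar> powr (-1 - s) \<partial>lborel)"
  have B: "0 < B" unfolding B_def by (rule cos_powr_pos[OF s])
  obtain C where C: "0 < C" "\<And>x. (\<integral>\<^sup>+y. ennreal (\<bar>second_diff f x y\<bar> * \<bar>y\<bar> powr (-1 - s)) \<partial>lborel) \<le> ennreal (C / (1 + \<bar>x\<bar> powr (1 + s)))"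
    using second_diff_decay[OF f s] by blast
  have "\<bar>fl s f x\<bar> \<le> C / B / (1 + \<bar>x\<bar> powr (1 + s))" for x
  proof -
    have "ennreal \<bar>\<integral>y. second_diff f x y * \<bar>y\<bar> powr (-1 - s) \<partial>lborel\<bar> \<le> (\<integral>\<^sup>+y. ennreal (\<bar>second_diff f x y\<bar> * \<bar>y\<bar> powr (-1 - s)) \<partial>lborel)"
      using integral_norm_bound_ennreal[OF second_diff_integrable[OF f s, of x]] by (simp add: abs_mult)
    also note C(2)
    finally have "\<bar>\<integral>y. second_diff f x y * \<bar>y\<bar> powr (-1 - s) \<partial>lborel\<bar> \<le> C / (1 + \<bar>x\<bar> powr (1 + s))"
      using C(1) by (subst (asm) ennreal_le_iff) (auto intro!: divide_nonneg_nonneg add_nonneg_nonneg)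
    then have "\<bar>\<integral>y. second_diff f x y * \<bar>y\<bar> powr (-1 - s) \<partial>lborel\<bar> / B \<le> C / (1 + \<bar>x\<bar> powr (1 + s)) / B"
      using B by (intro divide_right_mono) auto
    then show ?thesis using B unfolding fl_def B_def[symmetric] by (simp add: mult.commute)
  qed
  then show ?thesis using C(1) B by (intro that[of "C / B"]) auto
qed

lemma fl_translate_reflect: "fl s (\<lambda>y. f (x - y)) z = fl s f (x - z)"
  by (simp add: fl_def second_diff_def algebra_simps)

lemma fl_mult: "fl s (\<lambda>y. c * f y) z = c * fl s f z"
proof -
  have "(\<integral>y. second_diff (\<lambda>y. c * f y) z y * \<bar>y\<bar> powr (-1 - s) \<partial>lborel) = (\<integral>y. c * (second_diff f z y * \<bar>y\<bar> powr (-1 - s)) \<partial>lborel)"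
    by (simp add: second_diff_def algebra_simps)
  then show ?thesis by (simp add: fl_def)
qed

lemma fl_scale:
  assumes "0 < r" shows "fl s (\<lambda>x. f ((x - m) / r)) x = r powr (- s) * fl s f ((x - m) / r)"
proof -
  have "(\<integral>y. second_diff (\<lambda>x. f ((x - m) / r)) x y * \<bar>y\<bar> powr (-1 - s) \<partial>lborel)
      = \<bar>r\<bar> *\<^sub>R (\<integral>y. second_diff (\<lambda>x. f ((x - m) / r)) x (0 + r * y) * \<bar>0 + r * y\<bar> powr (-1 - s) \<partial>lborel)"
    by (rule lborel_integral_real_affine) (use assms in simp)
  also have "(\<lambda>y. second_diff (\<lambda>x. f ((x - m) / r)) x (0 + r * y) * \<bar>0 + r * y\<bar> powr (-1 - s))
     = (\<lambda>y. r powr (-1 - s) * (second_diff f ((x - m) / r) y * \<bar>y\<bar> powr (-1 - s)))"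
    using assms by (auto simp: second_diff_def abs_mult powr_mult field_simps)
  finally have "(\<integral>y. second_diff (\<lambda>x. f ((x - m) / r)) x y * \<bar>y\<bar> powr (-1 - s) \<partial>lborel)
    = (r * r powr (-1 - s)) * (\<integral>y. second_diff f ((x - m) / r) y * \<bar>y\<bar> powr (-1 - s) \<partial>lborel)"
    using assms by simp
  also have "r * r powr (-1 - s) = r powr (- s)" using powr_mult_base[of r "-1 - s"] assms by simp
  finally show ?thesis by (simp add: fl_def)
qed

text \<open>The scaling identity writes |\<xi>| powr s as an average of 2 - 2 * cos (y * \<xi>).
  After the integrals are exchanged, 2 * cos (y * \<xi>) * cis (x * \<xi>) splits into the
  characters at x + y and x - y, and Fourier inversion at the three points reproduces
  \<open>second_diff\<close>.\<close>

lemma fraclap_singular_integral: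
  assumes f: "test_fun f" and s: "0 < s" "s < 1"
  shows "fraclap (s / 2) (\<lambda>x. complex_of_real (f x)) x = complex_of_real (fl s f x)"
proof -
  define B where "B = (\<integral>y. (2 - 2 * cos y) * \<bar>y\<bar> powr (-1 - s) \<partial>lborel)"
  have B: "0 < B" unfolding B_def by (rule cos_powr_pos[OF s])
  define \<phi> where "\<phi> x = complex_of_real (f x)" for x
  have \<phi>: "schwartz \<phi>" using test_fun_schwartz[OF f] unfolding \<phi>_def .
  have Fi: "integrable lborel (fourier \<phi>)" by (rule fourier_integrable[OF \<phi>])
  note [measurable] = borel_measurable_integrable[OF Fi]
  define K where "K \<xi> y = complex_of_real ((2 - 2 * cos (y * \<xi>)) * \<bar>y\<bar> powr (-1 - s)) * (cis (x * \<xi>) * fourier \<phi> \<xi>)" for \<xi> y :: real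
  have [measurable]: "case_prod K \<in> borel_measurable (borel \<Otimes>\<^sub>M borel)" unfolding K_def by measurable
  have "(\<integral>\<^sup>+\<xi>. \<integral>\<^sup>+y. ennreal (norm (K \<xi> y)) \<partial>lborel \<partial>lborel) = (\<integral>\<^sup>+\<xi>. ennreal (norm (complex_of_real B * (complex_of_real (\<bar>\<xi>\<bar> powr s) * fourier \<phi> \<xi>))) \<partial>lborel)"
  proof (rule nn_integral_cong)
    fix \<xi> :: real
    have "(\<integral>\<^sup>+y. ennreal (norm (K \<xi> y)) \<partial>lborel) = (\<integral>\<^sup>+y. ennreal ((2 - 2 * cos (y * \<xi>)) * \<bar>y\<bar> powr (-1 - s)) * ennreal (norm (fourier \<phi> \<xi>)) \<partial>lborel)"
      by (intro nn_integral_cong) (simp add: K_def norm_mult ennreal_mult' abs_of_nonneg del: of_real_mult)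
    also have "\<dots> = (\<integral>\<^sup>+y. ennreal ((2 - 2 * cos (y * \<xi>)) * \<bar>y\<bar> powr (-1 - s)) \<partial>lborel) * ennreal (norm (fourier \<phi> \<xi>))"
      by (rule nn_integral_multc) measurable
    also have "(\<integral>\<^sup>+y. ennreal ((2 - 2 * cos (y * \<xi>)) * \<bar>y\<bar> powr (-1 - s)) \<partial>lborel) = ennreal (\<bar>\<xi>\<bar> powr s * B)"
      using cos_powr_scale[OF s, of \<xi>] unfolding B_def by (subst nn_integral_eq_integral) auto
    finally show "(\<integral>\<^sup>+y. ennreal (norm (K \<xi> y)) \<partial>lborel) = ennreal (norm (complex_of_real B * (complex_of_real (\<bar>\<xi>\<bar> powr s) * fourier \<phi> \<xi>)))"
      using B by (simp add: norm_mult ennreal_mult'[symmetric] mult_ac)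
  qed
  also have "\<dots> < \<infinity>"
    using integrable_mult_right[OF powr_fourier_integrable[OF \<phi>, of s], of "complex_of_real B"] s by (simp add: integrable_iff_bounded)
  finally have fin: "(\<integral>\<^sup>+\<xi>. \<integral>\<^sup>+y. ennreal (norm (K \<xi> y)) \<partial>lborel \<partial>lborel) < \<infinity>" .
  have "complex_of_real B * (\<integral>\<xi>. cis (x * \<xi>) * (complex_of_real (\<bar>\<xi>\<bar> powr s) * fourier \<phi> \<xi>) \<partial>lborel) = (\<integral>\<xi>. \<integral>y. K \<xi> y \<partial>lborel \<partial>lborel)"
  proof -
    have "(\<integral>y. K \<xi> y \<partial>lborel) = complex_of_real B * (cis (x * \<xi>) * (complex_of_real (\<bar>\<xi>\<bar> powr s) * fourier \<phi> \<xi>))" for \<xi>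
    proof -
      have "(\<integral>y. K \<xi> y \<partial>lborel) = (\<integral>y. complex_of_real ((2 - 2 * cos (y * \<xi>)) * \<bar>y\<bar> powr (-1 - s)) \<partial>lborel) * (cis (x * \<xi>) * fourier \<phi> \<xi>)"
        unfolding K_def by (rule integral_mult_left_zero)
      also have "(\<integral>y. complex_of_real ((2 - 2 * cos (y * \<xi>)) * \<bar>y\<bar> powr (-1 - s)) \<partial>lborel) = complex_of_real (\<bar>\<xi>\<bar> powr s * B)"
        unfolding integral_complex_of_real cos_powr_scale(1)[OF s] B_def ..
      finally show ?thesis by simp
    qed
    then show ?thesis by simp
  qed
  also have "\<dots> = (\<integral>y. \<integral>\<xi>. K \<xi> y \<partial>lborel \<partial>lborel)" by (rule lborel_Fubini(1)) (use fin in auto)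
  also have "\<dots> = (\<integral>y. complex_of_real (sqrt (2 * pi)) * complex_of_real (second_diff f x y * \<bar>y\<bar> powr (-1 - s)) \<partial>lborel)"
  proof (rule Bochner_Integration.integral_cong[OF refl])
    fix y :: real
    have i: "integrable lborel (\<lambda>\<xi>. cis (a * \<xi>) * fourier \<phi> \<xi>)" for a using integrable_cis_mult[OF Fi, of a 0] by simp
    have "(\<integral>\<xi>. K \<xi> y \<partial>lborel) = (\<integral>\<xi>. complex_of_real (\<bar>y\<bar> powr (-1 - s)) * (2 * (cis (x * \<xi>) * fourier \<phi> \<xi>) - cis ((x + y) * \<xi>) * fourier \<phi> \<xi> - cis ((x - y) * \<xi>) * fourier \<phi> \<xi>) \<partial>lborel)"
    proof (rule Bochner_Integration.integral_cong[OF refl])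
      fix \<xi> :: real
      have "complex_of_real (2 * cos (y * \<xi>)) = cis (y * \<xi>) + cis (- (y * \<xi>))"
        by (simp add: complex_eq_iff)
      then have "complex_of_real (2 * cos (y * \<xi>)) * cis (x * \<xi>) = cis ((x + y) * \<xi>) + cis ((x - y) * \<xi>)"
        by (simp add: distrib_right cis_mult algebra_simps)
      then have "complex_of_real (2 - 2 * cos (y * \<xi>)) * cis (x * \<xi>) = 2 * cis (x * \<xi>) - cis ((x + y) * \<xi>) - cis ((x - y) * \<xi>)"
        by (simp add: left_diff_distrib)
      then show "K \<xi> y = complex_of_real (\<bar>y\<bar> powr (-1 - s)) * (2 * (cis (x * \<xi>) * fourier \<phi> \<xi>) - cis ((x + y) * \<xi>) * fourier \<phi> \<xi> - cis ((x - y) * \<xi>) * fourier \<phi> \<xi>)"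
        unfolding K_def of_real_mult by algebra
    qed
    also have "\<dots> = complex_of_real (\<bar>y\<bar> powr (-1 - s)) * (2 * (\<integral>\<xi>. cis (x * \<xi>) * fourier \<phi> \<xi> \<partial>lborel) - (\<integral>\<xi>. cis ((x + y) * \<xi>) * fourier \<phi> \<xi> \<partial>lborel) - (\<integral>\<xi>. cis ((x - y) * \<xi>) * fourier \<phi> \<xi> \<partial>lborel))"
      using i by simp
    also have "\<dots> = complex_of_real (sqrt (2 * pi)) * complex_of_real (second_diff f x y * \<bar>y\<bar> powr (-1 - s))"
      unfolding fourier_inversion[OF \<phi>] by (simp add: \<phi>_def second_diff_def algebra_simps)
    finally show "(\<integral>\<xi>. K \<xi> y \<partial>lborel) = complex_of_real (sqrt (2 * pi)) * complex_of_real (second_diff f x y * \<bar>y\<bar> powr (-1 - s))" .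
  qed
  also have "\<dots> = complex_of_real (sqrt (2 * pi)) * complex_of_real (B * fl s f x)"
    using B by (simp add: fl_def B_def[symmetric] del: of_real_mult)
  finally show ?thesis using B unfolding fraclap_def inv_fourier_def \<phi>_def[abs_def] by (simp add: field_simps)
qed

subsection \<open>The Riesz kernel inverts the fractional Laplacian\<close>

lemma nn_integral_Gamma:
  assumes "0 < b" "0 < c"
  shows "(\<integral>\<^sup>+t. ennreal (indicator {0<..} t * (t powr (b - 1) * exp (- (c * t)))) \<partial>lborel) = ennreal (Gamma b * c powr (- b))"
proof -
  have "ennreal (Gamma b) = (\<integral>\<^sup>+t. ennreal (indicator {0..} t * t powr (b - 1) / exp t) \<partial>lborel)"
    by (rule Gamma_conv_nn_integral_real[OF assms(1)])
  also have "\<dots> = ennreal \<bar>c\<bar> * (\<integral>\<^sup>+t. ennreal (indicator {0..} (0 + c * t) * (0 + c * t) powr (b - 1) / exp (0 + c * t)) \<partial>lborel)"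
    by (rule nn_integral_real_affine) (use assms in auto)
  also have "\<dots> = (\<integral>\<^sup>+t. ennreal \<bar>c\<bar> * ennreal (indicator {0..} (0 + c * t) * (0 + c * t) powr (b - 1) / exp (0 + c * t)) \<partial>lborel)"
    by (rule nn_integral_cmult[symmetric]) auto
  also have "\<dots> = (\<integral>\<^sup>+t. ennreal (c powr b) * ennreal (indicator {0<..} t * (t powr (b - 1) * exp (- (c * t)))) \<partial>lborel)"
  proof (rule nn_integral_cong)
    fix t :: real
    have "c * (indicator {0..} (0 + c * t) * (0 + c * t) powr (b - 1) / exp (0 + c * t)) = c powr b * (indicator {0<..} t * (t powr (b - 1) * exp (- (c * t))))"
    proof (cases "0 < t")
      case True
      then have "c * (c * t) powr (b - 1) = c powr b * t powr (b - 1)"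
        using assms powr_mult_base[of c "b - 1"] by (simp add: powr_mult)
      then show ?thesis using True assms by (simp add: exp_minus field_simps)
    next
      case False
      then show ?thesis using assms by (cases "t = 0") (auto simp: zero_le_mult_iff)
    qed
    then show "ennreal \<bar>c\<bar> * ennreal (indicator {0..} (0 + c * t) * (0 + c * t) powr (b - 1) / exp (0 + c * t)) = ennreal (c powr b) * ennreal (indicator {0<..} t * (t powr (b - 1) * exp (- (c * t))))"
      using assms by (simp add: ennreal_mult'[symmetric])
  qed
  also have "\<dots> = ennreal (c powr b) * (\<integral>\<^sup>+t. ennreal (indicator {0<..} t * (t powr (b - 1) * exp (- (c * t)))) \<partial>lborel)"
    by (rule nn_integral_cmult) auto
  finally have "ennreal (c powr (- b)) * ennreal (Gamma b) = ennreal (c powr (- b)) * (ennreal (c powr b) * (\<integral>\<^sup>+t. ennreal (indicator {0<..} t * (t powr (b - 1) * exp (- (c * t)))) \<partial>lborel))"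
    by simp
  also have "\<dots> = (\<integral>\<^sup>+t. ennreal (indicator {0<..} t * (t powr (b - 1) * exp (- (c * t)))) \<partial>lborel)"
    using assms by (simp add: mult.assoc[symmetric] ennreal_mult'[symmetric] powr_minus)
  finally show ?thesis using assms by (simp add: ennreal_mult'[symmetric] mult.commute Gamma_real_nonneg)
qed

text \<open>The substitution of 1 / t for t in the Gamma integral. It is needed because the Fourier
  transform exchanges the Gaussian parameter t with its inverse.\<close>

lemma nn_integral_inverse_Gamma:
  assumes "0 < b" "0 < c"
  shows "(\<integral>\<^sup>+t. ennreal (indicator {0<..} t * (t powr (- b - 1) * exp (- (c / t)))) \<partial>lborel) = ennreal (Gamma b * c powr (- b))"
proof -
  define f where "f t = t powr (b - 1) * exp (- (c * t))" for t :: real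
  define I where "I = Gamma b * c powr (- b)"
  have I: "0 \<le> I" using assms by (simp add: I_def Gamma_real_nonneg)
  have "((\<lambda>t. indicator {0<..} t * f t) has_integral I) UNIV"
    using nn_integral_Gamma[OF assms] I unfolding f_def I_def by (intro nn_integral_has_integral) auto
  moreover have "(\<lambda>t. indicator {0<..} t * f t) = (\<lambda>t. if t \<in> {0<..} then f t else 0)" by (auto simp: indicator_def)
  ultimately have hi: "(f has_integral I) {0<..}" by (simp only: has_integral_restrict_UNIV)
  have im: "(\<lambda>t::real. 1 / t) ` {0<..} = {0<..}"
  proof safe
    fix x :: real assume "0 < x" then show "x \<in> (\<lambda>t. 1 / t) ` {0<..}" by (intro image_eqI[of _ _ "1 / x"]) auto
  qed auto
  have "f absolutely_integrable_on {0<..}"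
    using hi by (intro nonnegative_absolutely_integrable_1) (auto simp: f_def)
  with hi have "f absolutely_integrable_on ((\<lambda>t::real. 1 / t) ` {0<..}) \<and> integral ((\<lambda>t::real. 1 / t) ` {0<..}) f = I"
    unfolding im by (simp add: integral_unique)
  then have "(\<lambda>t. \<bar>- 1 / t\<^sup>2\<bar> * f (1 / t)) absolutely_integrable_on {0<..} \<and> integral {0<..} (\<lambda>t. \<bar>- 1 / t\<^sup>2\<bar> * f (1 / t)) = I"
    by (subst has_absolute_integral_change_of_variables_1')
       (auto intro!: derivative_eq_intros simp: inj_on_def power2_eq_square)
  then have "((\<lambda>t. \<bar>- 1 / t\<^sup>2\<bar> * f (1 / t)) has_integral I) {0<..}"
    by (metis absolutely_integrable_on_def has_integral_integral)
  then have "(\<integral>\<^sup>+t. ennreal (\<bar>- 1 / t\<^sup>2\<bar> * f (1 / t)) * indicator {0<..} t \<partial>lborel) = ennreal I"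
    by (intro nn_integral_has_integral_lebesgue') (auto simp: f_def)
  moreover have "ennreal (\<bar>- 1 / t\<^sup>2\<bar> * f (1 / t)) * indicator {0<..} t = ennreal (indicator {0<..} t * (t powr (- b - 1) * exp (- (c / t))))" for t :: real
  proof (cases "0 < t")
    case True
    have "1 / t\<^sup>2 * (1 / t) powr (b - 1) = t powr (- b - 1)"
    proof -
      have "1 / t\<^sup>2 = t powr (-2)" using True by (simp add: powr_minus_divide powr_numeral)
      moreover have "(1 / t) powr (b - 1) = t powr (- (b - 1))" using True powr_minus_divide[of t "b - 1"] by (simp add: powr_divide)
      ultimately have "1 / t\<^sup>2 * (1 / t) powr (b - 1) = t powr (-2 + - (b - 1))" by (simp only: powr_add)
      also have "-2 + - (b - 1) = - b - 1" by simp
      finally show ?thesis .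
    qed
    then show ?thesis using True by (simp add: f_def mult.assoc[symmetric])
  qed simp
  ultimately show ?thesis unfolding I_def by simp
qed

lemma cos_half_pi_pos:
  fixes s :: real assumes "0 < s" "s < 1" shows "0 < cos (pi * s / 2)"
proof -
  have "0 < pi * s" "pi * s < pi * 1" using assms by (auto intro!: mult_strict_left_mono)
  then show ?thesis using pi_gt_zero by (intro cos_gt_zero_pi) linarith+
qed

text \<open>The left side is what the superposition of Gaussians produces, the right side the form
  in which \<open>alpha_p\<close> is given. Legendre duplication at s / 2 and Euler reflection at (1
  + s) / 2 enter through the common factor Gamma ((1 + s) / 2).\<close>

lemma Gamma_constant:
  fixes s :: real
  assumes "0 < s" "s < 1"
  shows "sqrt pi * Gamma (s / 2) * 2 powr s / Gamma ((1 - s) / 2) = kap s"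
proof -
  have G: "0 < Gamma ((1 - s) / 2)" "0 < Gamma ((1 + s) / 2)" using assms by (auto intro!: Gamma_real_pos)
  have c: "0 < cos (pi * s / 2)" by (rule cos_half_pi_pos[OF assms])
  have nz: "complex_of_real t \<notin> \<int>\<^sub>\<le>\<^sub>0" if "0 < t" for t
  proof
    assume "complex_of_real t \<in> \<int>\<^sub>\<le>\<^sub>0"
    then obtain n :: int where n: "complex_of_real t = of_int n" "n \<le> 0" by (auto elim: nonpos_Ints_cases)
    from n(1) have "t = real_of_int n" by (metis of_real_eq_iff of_real_of_int_eq)
    then show False using n(2) that by simp
  qed
  have e: "complex_of_real (s / 2) + 1 / 2 = complex_of_real ((1 + s) / 2)" "2 * complex_of_real (s / 2) = complex_of_real s"
    "(1 - complex_of_real s) * complex_of_real (ln 2) = complex_of_real ((1 - s) * ln 2)"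
    by (simp_all add: add_divide_distrib)
  have "Gamma (complex_of_real (s / 2)) * Gamma (complex_of_real (s / 2) + 1 / 2) =
      exp ((1 - 2 * complex_of_real (s / 2)) * complex_of_real (ln 2)) * complex_of_real (sqrt pi) * Gamma (2 * complex_of_real (s / 2))"
    by (rule Gamma_legendre_duplication) (unfold e, (rule nz, use assms in simp)+)
  then have "complex_of_real (Gamma (s / 2) * Gamma ((1 + s) / 2)) = complex_of_real (exp ((1 - s) * ln 2) * sqrt pi * Gamma s)"
    by (simp only: e Gamma_complex_of_real exp_of_real[symmetric] of_real_mult)
  then have dup: "Gamma (s / 2) * Gamma ((1 + s) / 2) = 2 powr (1 - s) * sqrt pi * Gamma s"
    unfolding of_real_eq_iff by (simp add: powr_def)
  have "complex_of_real (Gamma ((1 + s) / 2)) * complex_of_real (Gamma (1 - (1 + s) / 2)) = of_real pi / sin (of_real pi * of_real ((1 + s) / 2))"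
    using Gamma_reflection_complex[of "complex_of_real ((1 + s) / 2)"] by (simp flip: Gamma_complex_of_real)
  then have "complex_of_real (Gamma ((1 + s) / 2) * Gamma (1 - (1 + s) / 2)) = of_real (pi / sin (pi * ((1 + s) / 2)))"
    by (simp only: of_real_mult of_real_divide sin_of_real[symmetric])
  then have "Gamma ((1 + s) / 2) * Gamma (1 - (1 + s) / 2) = pi / sin (pi * ((1 + s) / 2))"
    by (simp only: of_real_eq_iff)
  moreover have "sin (pi * ((1 + s) / 2)) = cos (pi * s / 2)"
    using cos_sin_eq[of "pi * s / 2"] sin_cos_eq[of "pi * ((1 + s) / 2)"] by (simp add: field_simps cos_diff sin_add sin_diff)
  moreover have "1 - (1 + s) / 2 = (1 - s) / 2" by (simp add: field_simps)
  ultimately have refl: "Gamma ((1 + s) / 2) * Gamma ((1 - s) / 2) = pi / cos (pi * s / 2)" by simp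
  have "sqrt pi * Gamma (s / 2) * 2 powr s * Gamma ((1 + s) / 2) = (2 powr s * 2 powr (1 - s)) * (sqrt pi * sqrt pi) * Gamma s"
    using dup by (simp add: mult_ac)
  also have "\<dots> = 2 * pi * Gamma s" by (simp flip: powr_add)
  also have "\<dots> = kap s * (Gamma ((1 + s) / 2) * Gamma ((1 - s) / 2))" unfolding refl kap_def using c by simp
  finally have "sqrt pi * Gamma (s / 2) * 2 powr s = kap s * Gamma ((1 - s) / 2)"
    using G(2) by (simp add: mult_ac) 
  then show ?thesis using G(1) by simp
qed

lemma kap_pos: "0 < s \<Longrightarrow> s < 1 \<Longrightarrow> 0 < kap s"
  unfolding kap_def by (intro mult_pos_pos cos_half_pi_pos Gamma_real_pos) auto

text \<open>Near 0 the kernel is integrable because s > 0; for |z| > 1 it is at most 1 and the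
  decaying factor takes over. This is the convergence hypothesis of \<open>fl_convolution\<close>
  for the Riesz kernel.\<close>

lemma riesz_decay_integrable:
  fixes s x :: real
  assumes "0 < s" "s < 1"
  shows "integrable lborel (\<lambda>z. \<bar>z\<bar> powr (s - 1) * (1 / (1 + \<bar>x - z\<bar> powr (1 + s))))"
proof -
  have i1: "integrable lborel (\<lambda>z. 1 / (1 + \<bar>x - z\<bar> powr (1 + s)))"
    unfolding integrable_shift(4)[of "\<lambda>z. 1 / (1 + \<bar>z\<bar> powr (1 + s))" x]
    using assms by (intro integrable_decay[of _ 1 s]) (auto simp: add_nonneg_nonneg)
  show ?thesis
  proof (rule Bochner_Integration.integrable_bound)
    show "integrable lborel (\<lambda>z. \<bar>z\<bar> powr (s - 1) * indicator {-1..1} z + 1 / (1 + \<bar>x - z\<bar> powr (1 + s)))"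
      by (intro Bochner_Integration.integrable_add integrable_abs_powr_near_0 i1 assms)
    show "AE z in lborel. norm (\<bar>z\<bar> powr (s - 1) * (1 / (1 + \<bar>x - z\<bar> powr (1 + s)))) \<le> norm (\<bar>z\<bar> powr (s - 1) * indicator {-1..1} z + 1 / (1 + \<bar>x - z\<bar> powr (1 + s)))"
    proof (rule AE_I2)
      fix z :: real
      have p: "0 < 1 + \<bar>x - z\<bar> powr (1 + s)" by (simp add: add_pos_nonneg)
      have le: "\<bar>z\<bar> powr (s - 1) * (1 / (1 + \<bar>x - z\<bar> powr (1 + s))) \<le> \<bar>z\<bar> powr (s - 1) * indicator {-1..1} z + 1 / (1 + \<bar>x - z\<bar> powr (1 + s))"
      proof (cases "\<bar>z\<bar> \<le> 1")
        case True
        have "1 / (1 + \<bar>x - z\<bar> powr (1 + s)) \<le> 1" using p by (simp add: divide_le_eq)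
        then have "\<bar>z\<bar> powr (s - 1) * (1 / (1 + \<bar>x - z\<bar> powr (1 + s))) \<le> \<bar>z\<bar> powr (s - 1) * 1" by (intro mult_left_mono) auto
        then show ?thesis using True p by (auto simp: indicator_def abs_le_iff intro: add_increasing2)
      next
        case False
        then have "\<bar>z\<bar> powr (s - 1) \<le> 1" using powr_mono2'[of "s - 1" 1 "\<bar>z\<bar>"] assms by simp
        then have "\<bar>z\<bar> powr (s - 1) * (1 / (1 + \<bar>x - z\<bar> powr (1 + s))) \<le> 1 * (1 / (1 + \<bar>x - z\<bar> powr (1 + s)))"
          using p by (intro mult_right_mono) auto
        then show ?thesis by (auto intro: add_increasing)
      qed
      show "norm (\<bar>z\<bar> powr (s - 1) * (1 / (1 + \<bar>x - z\<bar> powr (1 + s)))) \<le> norm (\<bar>z\<bar> powr (s - 1) * indicator {-1..1} z + 1 / (1 + \<bar>x - z\<bar> powr (1 + s)))"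
        using le p by (subst (1 2) real_norm_def, subst (1 2) abs_of_nonneg) (auto intro!: add_nonneg_nonneg mult_nonneg_nonneg)
    qed
  qed measurable
qed

lemma riesz_fl_integrable:
  assumes f: "test_fun f" and s: "0 < s" "s < 1"
  shows "integrable lborel (\<lambda>z. \<bar>z\<bar> powr (s - 1) * fl s f (x - z))"
proof -
  note [measurable] = fl_measurable[OF test_fun_measurable[OF f]]
  obtain C where C: "0 < C" "\<And>x. \<bar>fl s f x\<bar> \<le> C / (1 + \<bar>x\<bar> powr (1 + s))" using fl_decay[OF f s] by blast
  show ?thesis
  proof (rule Bochner_Integration.integrable_bound)
    show "integrable lborel (\<lambda>z. C * (\<bar>z\<bar> powr (s - 1) * (1 / (1 + \<bar>x - z\<bar> powr (1 + s)))))"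
      by (intro integrable_mult_right riesz_decay_integrable s)
    show "AE z in lborel. norm (\<bar>z\<bar> powr (s - 1) * fl s f (x - z)) \<le> norm (C * (\<bar>z\<bar> powr (s - 1) * (1 / (1 + \<bar>x - z\<bar> powr (1 + s)))))"
    proof (rule AE_I2)
      fix z
      have "\<bar>z\<bar> powr (s - 1) * \<bar>fl s f (x - z)\<bar> \<le> \<bar>z\<bar> powr (s - 1) * (C / (1 + \<bar>x - z\<bar> powr (1 + s)))" by (intro mult_left_mono C) auto
      also have "\<dots> = \<bar>C * (\<bar>z\<bar> powr (s - 1) * (1 / (1 + \<bar>x - z\<bar> powr (1 + s))))\<bar>"
        using C(1) by (subst abs_of_nonneg) (auto intro!: mult_nonneg_nonneg divide_nonneg_nonneg add_nonneg_nonneg)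
      finally show "norm (\<bar>z\<bar> powr (s - 1) * fl s f (x - z)) \<le> norm (C * (\<bar>z\<bar> powr (s - 1) * (1 / (1 + \<bar>x - z\<bar> powr (1 + s)))))"
        by (simp add: abs_mult)
    qed
  qed measurable
qed

text \<open>Both \<open>|z| powr (s - 1)\<close> and \<open>|\<xi>| powr (- s)\<close> are superpositions of Gaussians; since the Fourier
  transform of a Gaussian is a Gaussian, the Riesz kernel has the reciprocal symbol of the fractional Laplacian.\<close>

theorem riesz_inverse:
  assumes f: "test_fun f" and s: "0 < s" "s < 1"
  shows "(\<integral>z. \<bar>z\<bar> powr (s - 1) * fl s f (x - z) \<partial>lborel) = kap s * f x"
proof -
  define \<phi> where "\<phi> x = complex_of_real (f x)" for x
  have \<phi>: "schwartz \<phi>" using test_fun_schwartz[OF f] unfolding \<phi>_def .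
  define T where "T \<xi> = complex_of_real (\<bar>\<xi>\<bar> powr s) * fourier \<phi> \<xi>" for \<xi>
  have T: "integrable lborel T" unfolding T_def by (rule powr_fourier_integrable[OF \<phi>]) (use s in auto)
  have Fi: "integrable lborel (fourier \<phi>)" by (rule fourier_integrable[OF \<phi>])
  define c where "c = complex_of_real (1 / sqrt (2 * pi))"
  define H where "H x = complex_of_real (fl s f x)" for x
  have H: "H x = c * (\<integral>\<xi>. cis (x * \<xi>) * T \<xi> \<partial>lborel)" for x
    unfolding H_def fraclap_singular_integral[OF f s, symmetric] fraclap_def inv_fourier_def c_def T_def \<phi>_def[abs_def] by simp
  note [measurable] = fl_measurable[OF test_fun_measurable[OF f]] borel_measurable_integrable[OF T] borel_measurable_integrable[OF Fi]
  have [measurable]: "H \<in> borel_measurable borel" unfolding H_def[abs_def] by measurable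
  \<comment> \<open>With this exponent (z^2) powr (- a) = |z| powr (s - 1), so the weight
    \<open>e\<close> superposes the Gaussians exp (- t * z^2) to Gamma a times the Riesz
    kernel.\<close>
  define a where "a = (1 - s) / 2"
  have a: "0 < a" "Gamma a > 0" using s by (auto simp: a_def intro!: Gamma_real_pos)
  define e where "e t = indicator {0<..} t * t powr (a - 1)" for t :: real
  have e0: "0 \<le> e t" for t by (simp add: e_def)
  have em[measurable]: "e \<in> borel_measurable borel" unfolding e_def[abs_def] by measurable
  have gz: "(\<integral>\<^sup>+t. ennreal (e t * exp (- (t * z\<^sup>2))) \<partial>lborel) = ennreal (Gamma a * \<bar>z\<bar> powr (s - 1))" if "z \<noteq> 0" for z
  proof -
    have "(z\<^sup>2) powr (- a) = (\<bar>z\<bar> powr 2) powr (- a)" using that by (simp add: powr_numeral)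
    also have "\<dots> = \<bar>z\<bar> powr (2 * - a)" by (rule powr_powr)
    also have "2 * - a = s - 1" by (simp add: a_def field_simps)
    finally have "(z\<^sup>2) powr (- a) = \<bar>z\<bar> powr (s - 1)" .
    then show ?thesis using nn_integral_Gamma[OF a(1), of "z\<^sup>2"] that by (simp add: e_def mult_ac)
  qed
  have gz': "(\<integral>t. e t * exp (- (t * z\<^sup>2)) \<partial>lborel) = Gamma a * \<bar>z\<bar> powr (s - 1)" if "z \<noteq> 0" for z
    using gz[OF that] a(2) e0 by (subst integral_eq_nn_integral) (auto simp: measurable_completion)
  define K where "K z t = complex_of_real (e t * exp (- (t * z\<^sup>2))) * H (x - z)" for z t :: real
  have [measurable]: "case_prod K \<in> borel_measurable (borel \<Otimes>\<^sub>M borel)" unfolding K_def by measurable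
  define R where "R = (\<integral>\<xi>. \<integral>t. complex_of_real (e t * (sqrt (pi / t) * exp (- (\<xi>\<^sup>2 / 4 / t)))) * (c * cis (x * \<xi>) * T \<xi>) \<partial>lborel \<partial>lborel)"
  have ae0: "AE z in lborel. (z::real) \<noteq> 0" by (rule AE_lborel_singleton)
  have "(\<integral>\<^sup>+z. \<integral>\<^sup>+t. ennreal (norm (K z t)) \<partial>lborel \<partial>lborel) = (\<integral>\<^sup>+z. ennreal (norm (Gamma a * (\<bar>z\<bar> powr (s - 1) * fl s f (x - z)))) \<partial>lborel)"
  proof (rule nn_integral_cong_AE, use ae0 in eventually_elim)
    fix z :: real assume z: "z \<noteq> 0"
    have "(\<integral>\<^sup>+t. ennreal (norm (K z t)) \<partial>lborel) = (\<integral>\<^sup>+t. ennreal (e t * exp (- (t * z\<^sup>2))) * ennreal (norm (H (x - z))) \<partial>lborel)"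
      using e0 by (intro nn_integral_cong) (simp add: K_def norm_mult ennreal_mult' abs_mult)
    also have "\<dots> = (\<integral>\<^sup>+t. ennreal (e t * exp (- (t * z\<^sup>2))) \<partial>lborel) * ennreal (norm (H (x - z)))"
      by (rule nn_integral_multc) measurable
    finally show "(\<integral>\<^sup>+t. ennreal (norm (K z t)) \<partial>lborel) = ennreal (norm (Gamma a * (\<bar>z\<bar> powr (s - 1) * fl s f (x - z))))"
      using a(2) by (simp add: gz[OF z] H_def ennreal_mult'[symmetric] abs_mult mult.assoc)
  qed
  also have "\<dots> < \<infinity>"
    using integrable_mult_right[OF riesz_fl_integrable[OF f s, of x], of "Gamma a"] unfolding integrable_iff_bounded by simp
  finally have fin1: "(\<integral>\<^sup>+z. \<integral>\<^sup>+t. ennreal (norm (K z t)) \<partial>lborel \<partial>lborel) < \<infinity>" .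
  define R where "R = (\<integral>\<xi>. \<integral>t. complex_of_real (e t * (sqrt (pi / t) * exp (- (\<xi>\<^sup>2 / 4 / t)))) * (c * cis (x * \<xi>) * T \<xi>) \<partial>lborel \<partial>lborel)"
  have RA: "(\<integral>t. \<integral>\<xi>. complex_of_real (e t * (sqrt (pi / t) * exp (- (\<xi>\<^sup>2 / 4 / t)))) * (c * cis (x * \<xi>) * T \<xi>) \<partial>lborel \<partial>lborel) = R"
    and R: "R = (\<integral>\<xi>. complex_of_real (sqrt pi * Gamma (s / 2) * 2 powr s) * (c * (cis (x * \<xi>) * fourier \<phi> \<xi>)) \<partial>lborel)"
  proof -
    define g where "g \<xi> t = e t * (sqrt (pi / t) * exp (- (\<xi>\<^sup>2 / 4 / t)))" for \<xi> t :: real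
    have g0: "0 \<le> g \<xi> t" for \<xi> t by (cases "0 < t") (auto simp: g_def e_def)
    have [measurable]: "case_prod g \<in> borel_measurable (borel \<Otimes>\<^sub>M borel)" unfolding g_def by measurable
    \<comment> \<open>Transforming the Gaussian contributes sqrt (pi / t), which turns the weight t
      powr (a - 1) into sqrt pi * t powr (- s / 2 - 1); the inverse Gamma integral then gives a
      multiple of |\<xi>| powr (- s), cancelling the multiplier in \<open>T\<close>.\<close>
    have G: "(\<integral>\<^sup>+t. ennreal (g \<xi> t) \<partial>lborel) = ennreal (sqrt pi * Gamma (s / 2) * 2 powr s * \<bar>\<xi>\<bar> powr (- s))" if "\<xi> \<noteq> 0" for \<xi>
    proof -
      have "g \<xi> t = sqrt pi * (indicator {0<..} t * (t powr (- (s / 2) - 1) * exp (- (\<xi>\<^sup>2 / 4 / t))))" for t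
      proof (cases "0 < t")
        case True
        have "t powr (a - 1) * sqrt (pi / t) = sqrt pi * (t powr (a - 1) * t powr (- (1 / 2)))"
          using True by (simp add: real_sqrt_divide powr_minus_divide powr_half_sqrt)
        also have "t powr (a - 1) * t powr (- (1 / 2)) = t powr (- (s / 2) - 1)"
          unfolding powr_add[symmetric] by (rule arg_cong[where f="\<lambda>u. t powr u"]) (simp add: a_def field_simps)
        finally show ?thesis using True by (simp add: g_def e_def mult.assoc[symmetric])
      qed (simp add: g_def e_def)
      then have "(\<integral>\<^sup>+t. ennreal (g \<xi> t) \<partial>lborel) = ennreal (sqrt pi) * (\<integral>\<^sup>+t. ennreal (indicator {0<..} t * (t powr (- (s / 2) - 1) * exp (- (\<xi>\<^sup>2 / 4 / t)))) \<partial>lborel)"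
        by (simp add: ennreal_mult' nn_integral_cmult)
      also have "\<dots> = ennreal (sqrt pi) * ennreal (Gamma (s / 2) * (\<xi>\<^sup>2 / 4) powr (- (s / 2)))"
        using nn_integral_inverse_Gamma[of "s / 2" "\<xi>\<^sup>2 / 4"] s that by simp
      also have "(\<xi>\<^sup>2 / 4) powr (- (s / 2)) = 2 powr s * \<bar>\<xi>\<bar> powr (- s)"
      proof -
        have "(\<xi>\<^sup>2 / 4) powr (- (s / 2)) = ((\<bar>\<xi>\<bar> / 2) powr 2) powr (- (s / 2))" using that by (simp add: powr_numeral power_divide)
        also have "\<dots> = (\<bar>\<xi>\<bar> / 2) powr (2 * - (s / 2))" by (rule powr_powr)
        also have "2 * - (s / 2) = - s" by simp
        also have "(\<bar>\<xi>\<bar> / 2) powr (- s) = 2 powr s * \<bar>\<xi>\<bar> powr (- s)" by (simp add: powr_divide powr_minus field_simps)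
        finally show ?thesis .
      qed
      finally show ?thesis by (simp add: ennreal_mult'[symmetric] mult.assoc)
    qed
    define Q where "Q t \<xi> = complex_of_real (g \<xi> t) * (c * cis (x * \<xi>) * T \<xi>)" for t \<xi>
    have [measurable]: "case_prod Q \<in> borel_measurable (borel \<Otimes>\<^sub>M borel)" unfolding Q_def by measurable
    have [measurable]: "(\<lambda>(\<xi>, t). Q t \<xi>) \<in> borel_measurable (borel \<Otimes>\<^sub>M borel)" unfolding Q_def by measurable
    have aex: "AE \<xi> in lborel. (\<xi>::real) \<noteq> 0" by (rule AE_lborel_singleton)
    have "(\<integral>\<^sup>+t. \<integral>\<^sup>+\<xi>. ennreal (norm (Q t \<xi>)) \<partial>lborel \<partial>lborel) = (\<integral>\<^sup>+\<xi>. \<integral>\<^sup>+t. ennreal (norm (Q t \<xi>)) \<partial>lborel \<partial>lborel)"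
      by (rule lborel_Tonelli) measurable
    also have "\<dots> = (\<integral>\<^sup>+\<xi>. ennreal (norm ((sqrt pi * Gamma (s / 2) * 2 powr s) * (c * fourier \<phi> \<xi>))) \<partial>lborel)"
    proof (rule nn_integral_cong_AE, use aex in eventually_elim)
      fix \<xi> :: real assume \<xi>: "\<xi> \<noteq> 0"
      have "(\<integral>\<^sup>+t. ennreal (norm (Q t \<xi>)) \<partial>lborel) = (\<integral>\<^sup>+t. ennreal (g \<xi> t) * ennreal (norm (c * T \<xi>)) \<partial>lborel)"
        using g0 by (intro nn_integral_cong) (simp add: Q_def norm_mult ennreal_mult'[symmetric])
      also have "\<dots> = (\<integral>\<^sup>+t. ennreal (g \<xi> t) \<partial>lborel) * ennreal (norm (c * T \<xi>))" by (rule nn_integral_multc) measurable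
      also have "\<dots> = ennreal (sqrt pi * Gamma (s / 2) * 2 powr s * \<bar>\<xi>\<bar> powr (- s) * norm (c * T \<xi>))"
        by (simp add: G[OF \<xi>] ennreal_mult'')
      also have "sqrt pi * Gamma (s / 2) * 2 powr s * \<bar>\<xi>\<bar> powr (- s) * norm (c * T \<xi>) = norm ((sqrt pi * Gamma (s / 2) * 2 powr s) * (c * fourier \<phi> \<xi>))"
        using \<xi> s Gamma_real_nonneg[of "s / 2"] by (simp add: T_def norm_mult powr_minus field_simps abs_mult)
      finally show "(\<integral>\<^sup>+t. ennreal (norm (Q t \<xi>)) \<partial>lborel) = ennreal (norm ((sqrt pi * Gamma (s / 2) * 2 powr s) * (c * fourier \<phi> \<xi>)))" .
    qed
    also have "\<dots> < \<infinity>"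
      using integrable_mult_right[OF integrable_mult_right[OF Fi, of c], of "complex_of_real (sqrt pi * Gamma (s / 2) * 2 powr s)"]
      by (simp add: integrable_iff_bounded)
    finally have fin: "(\<integral>\<^sup>+t. \<integral>\<^sup>+\<xi>. ennreal (norm (Q t \<xi>)) \<partial>lborel \<partial>lborel) < \<infinity>" .
    have "(\<integral>t. \<integral>\<xi>. Q t \<xi> \<partial>lborel \<partial>lborel) = (\<integral>\<xi>. \<integral>t. Q t \<xi> \<partial>lborel \<partial>lborel)"
      by (rule lborel_Fubini(1)) (use fin in auto)
    then show "(\<integral>t. \<integral>\<xi>. complex_of_real (e t * (sqrt (pi / t) * exp (- (\<xi>\<^sup>2 / 4 / t)))) * (c * cis (x * \<xi>) * T \<xi>) \<partial>lborel \<partial>lborel) = R"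
      unfolding R_def Q_def g_def .
    have "(\<integral>\<xi>. \<integral>t. Q t \<xi> \<partial>lborel \<partial>lborel) = (\<integral>\<xi>. complex_of_real (sqrt pi * Gamma (s / 2) * 2 powr s) * (c * (cis (x * \<xi>) * fourier \<phi> \<xi>)) \<partial>lborel)"
    proof (rule integral_cong_AE)
      show "AE \<xi> in lborel. (\<integral>t. Q t \<xi> \<partial>lborel) = complex_of_real (sqrt pi * Gamma (s / 2) * 2 powr s) * (c * (cis (x * \<xi>) * fourier \<phi> \<xi>))"
        using aex
      proof eventually_elim
        fix \<xi> :: real assume \<xi>: "\<xi> \<noteq> 0"
        have "(\<integral>t. g \<xi> t \<partial>lborel) = sqrt pi * Gamma (s / 2) * 2 powr s * \<bar>\<xi>\<bar> powr (- s)"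
          using G[OF \<xi>] g0 s Gamma_real_nonneg[of "s / 2"] by (subst integral_eq_nn_integral) auto
        moreover have "(\<integral>t. Q t \<xi> \<partial>lborel) = (\<integral>t. complex_of_real (g \<xi> t) \<partial>lborel) * (c * cis (x * \<xi>) * T \<xi>)"
          unfolding Q_def by (rule integral_mult_left_zero)
        ultimately have "(\<integral>t. Q t \<xi> \<partial>lborel) = complex_of_real (sqrt pi * Gamma (s / 2) * 2 powr s) * complex_of_real (\<bar>\<xi>\<bar> powr (- s)) * (c * cis (x * \<xi>) * T \<xi>)"
          by (simp only: integral_complex_of_real of_real_mult)
        moreover have "complex_of_real (\<bar>\<xi>\<bar> powr (- s)) * T \<xi> = fourier \<phi> \<xi>"
          using \<xi> unfolding T_def mult.assoc[symmetric] of_real_mult[symmetric] by (simp add: powr_minus)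
        ultimately show "(\<integral>t. Q t \<xi> \<partial>lborel) = complex_of_real (sqrt pi * Gamma (s / 2) * 2 powr s) * (c * (cis (x * \<xi>) * fourier \<phi> \<xi>))"
          by (metis (no_types, lifting) mult.assoc mult.left_commute)
      qed
      show "(\<lambda>\<xi>. \<integral>t. Q t \<xi> \<partial>lborel) \<in> borel_measurable lborel"
        using lborel.borel_measurable_lebesgue_integral[of "\<lambda>\<xi> t. Q t \<xi>" borel] by simp
    qed measurable
    then show "R = (\<integral>\<xi>. complex_of_real (sqrt pi * Gamma (s / 2) * 2 powr s) * (c * (cis (x * \<xi>) * fourier \<phi> \<xi>)) \<partial>lborel)"
      unfolding R_def Q_def g_def .
  qed
  have "complex_of_real (Gamma a * (\<integral>z. \<bar>z\<bar> powr (s - 1) * fl s f (x - z) \<partial>lborel)) = (\<integral>z. complex_of_real (Gamma a * \<bar>z\<bar> powr (s - 1)) * H (x - z) \<partial>lborel)"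
    unfolding H_def of_real_mult[symmetric] integral_complex_of_real by (simp add: mult.assoc)
  also have "\<dots> = (\<integral>z. \<integral>t. K z t \<partial>lborel \<partial>lborel)"
  proof (rule integral_cong_AE)
    show "AE z in lborel. complex_of_real (Gamma a * \<bar>z\<bar> powr (s - 1)) * H (x - z) = (\<integral>t. K z t \<partial>lborel)"
      using ae0
    proof eventually_elim
      fix z :: real assume z: "z \<noteq> 0"
      have "(\<integral>t. K z t \<partial>lborel) = (\<integral>t. complex_of_real (e t * exp (- (t * z\<^sup>2))) \<partial>lborel) * H (x - z)"
        unfolding K_def by (rule integral_mult_left_zero)
      then show "complex_of_real (Gamma a * \<bar>z\<bar> powr (s - 1)) * H (x - z) = (\<integral>t. K z t \<partial>lborel)"
        unfolding integral_complex_of_real gz'[OF z] ..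
    qed
    show "(\<lambda>z. \<integral>t. K z t \<partial>lborel) \<in> borel_measurable lborel"
      using lborel.borel_measurable_lebesgue_integral[of K borel] by simp
  qed measurable
  also have "\<dots> = (\<integral>t. \<integral>z. K z t \<partial>lborel \<partial>lborel)" by (rule lborel_Fubini(1)) (use fin1 in auto)
  \<comment> \<open>For each t > 0 the convolution with the Gaussian is evaluated by inserting the
    Fourier representation of \<open>H\<close>; for other t the weight \<open>e\<close>
    vanishes.\<close>
  also have "\<dots> = (\<integral>t. \<integral>\<xi>. complex_of_real (e t * (sqrt (pi / t) * exp (- (\<xi>\<^sup>2 / 4 / t)))) * (c * cis (x * \<xi>) * T \<xi>) \<partial>lborel \<partial>lborel)"
  proof (rule Bochner_Integration.integral_cong[OF refl])
    fix t :: real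
    show "(\<integral>z. K z t \<partial>lborel) = (\<integral>\<xi>. complex_of_real (e t * (sqrt (pi / t) * exp (- (\<xi>\<^sup>2 / 4 / t)))) * (c * cis (x * \<xi>) * T \<xi>) \<partial>lborel)"
    proof (cases "0 < t")
      case True
      define L where "L z \<xi> = complex_of_real (exp (- (t * z\<^sup>2))) * (cis ((x - z) * \<xi>) * T \<xi>)" for z \<xi> :: real
      have [measurable]: "case_prod L \<in> borel_measurable (borel \<Otimes>\<^sub>M borel)" unfolding L_def by measurable
      have "(\<integral>\<^sup>+z. \<integral>\<^sup>+\<xi>. ennreal (norm (L z \<xi>)) \<partial>lborel \<partial>lborel) = (\<integral>\<^sup>+z. ennreal (exp (- (t * z\<^sup>2))) \<partial>lborel) * (\<integral>\<^sup>+\<xi>. ennreal (norm (T \<xi>)) \<partial>lborel)"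
        by (simp add: L_def norm_mult ennreal_mult' nn_integral_cmult nn_integral_multc)
      also have "\<dots> < \<infinity>"
        using gaussian_scaled_integrable[OF True] T by (auto simp: integrable_iff_bounded ennreal_mult_less_top)
      finally have fin: "(\<integral>\<^sup>+z. \<integral>\<^sup>+\<xi>. ennreal (norm (L z \<xi>)) \<partial>lborel \<partial>lborel) < \<infinity>" .
      have "(\<integral>z. K z t \<partial>lborel) = (\<integral>z. (complex_of_real (e t) * c) * (\<integral>\<xi>. L z \<xi> \<partial>lborel) \<partial>lborel)"
        by (intro Bochner_Integration.integral_cong refl) (simp add: K_def H L_def)
      also have "\<dots> = (complex_of_real (e t) * c) * (\<integral>z. \<integral>\<xi>. L z \<xi> \<partial>lborel \<partial>lborel)" by (rule integral_mult_right_zero)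
      also have "(\<integral>z. \<integral>\<xi>. L z \<xi> \<partial>lborel \<partial>lborel) = (\<integral>\<xi>. \<integral>z. L z \<xi> \<partial>lborel \<partial>lborel)" by (rule lborel_Fubini(1)) (use fin in auto)
      also have "\<dots> = (\<integral>\<xi>. complex_of_real (sqrt (pi / t) * exp (- (\<xi>\<^sup>2 / 4 / t))) * (cis (x * \<xi>) * T \<xi>) \<partial>lborel)"
      proof (rule Bochner_Integration.integral_cong[OF refl])
        fix \<xi> :: real
        have "(\<integral>z. L z \<xi> \<partial>lborel) = (\<integral>z. (cis (x * \<xi>) * T \<xi>) * (cis (- \<xi> * z) * complex_of_real (exp (- (t * z\<^sup>2)))) \<partial>lborel)"
        proof (rule Bochner_Integration.integral_cong[OF refl])
          fix z :: real
          have "cis ((x - z) * \<xi>) = cis (x * \<xi>) * cis (- \<xi> * z)" by (simp add: cis_mult algebra_simps)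
          then show "L z \<xi> = (cis (x * \<xi>) * T \<xi>) * (cis (- \<xi> * z) * complex_of_real (exp (- (t * z\<^sup>2))))" by (simp add: L_def)
        qed
        also have "\<dots> = (cis (x * \<xi>) * T \<xi>) * complex_of_real (sqrt (pi / t) * exp (- (- \<xi>)\<^sup>2 / (4 * t)))"
          by (subst integral_mult_right_zero) (simp only: gaussian_fourier[OF True] of_real_mult)
        finally show "(\<integral>z. L z \<xi> \<partial>lborel) = complex_of_real (sqrt (pi / t) * exp (- (\<xi>\<^sup>2 / 4 / t))) * (cis (x * \<xi>) * T \<xi>)"
          by (simp add: mult.commute)
      qed
      also have "(complex_of_real (e t) * c) * \<dots> = (\<integral>\<xi>. (complex_of_real (e t) * c) * (complex_of_real (sqrt (pi / t) * exp (- (\<xi>\<^sup>2 / 4 / t))) * (cis (x * \<xi>) * T \<xi>)) \<partial>lborel)"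
        by (rule integral_mult_right_zero[symmetric])
      finally show ?thesis by (simp add: mult_ac)
    qed (simp add: K_def e_def)
  qed
  also have "\<dots> = R" by (rule RA)
  also note R
  also have "(\<integral>\<xi>. complex_of_real (sqrt pi * Gamma (s / 2) * 2 powr s) * (c * (cis (x * \<xi>) * fourier \<phi> \<xi>)) \<partial>lborel)
      = complex_of_real (sqrt pi * Gamma (s / 2) * 2 powr s) * (c * (\<integral>\<xi>. cis (x * \<xi>) * fourier \<phi> \<xi> \<partial>lborel))"
    by (simp only: integral_mult_right_zero)
  also have "\<dots> = complex_of_real (sqrt pi * Gamma (s / 2) * 2 powr s * f x)"
    unfolding fourier_inversion[OF \<phi>] by (simp add: c_def \<phi>_def)
  finally have "Gamma a * (\<integral>z. \<bar>z\<bar> powr (s - 1) * fl s f (x - z) \<partial>lborel) = sqrt pi * Gamma (s / 2) * 2 powr s * f x"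
    by (simp only: of_real_eq_iff)
  moreover have "sqrt pi * Gamma (s / 2) * 2 powr s = Gamma a * kap s"
    using Gamma_constant[OF s] a(2) unfolding a_def[symmetric] by (simp add: field_simps)
  ultimately have "Gamma a * (\<integral>z. \<bar>z\<bar> powr (s - 1) * fl s f (x - z) \<partial>lborel) = (Gamma a * kap s) * f x"
    by metis
  then show ?thesis using a(2) by simp
qed

subsection \<open>Comparison with the Riesz potential\<close>

lemma integrable_mult_decay:
  fixes \<kappa> g :: "real \<Rightarrow> real"
  assumes "integrable lborel (\<lambda>z. \<kappa> z * (1 / (1 + \<bar>x - z\<bar> powr (1 + s))))"
    and [measurable]: "\<kappa> \<in> borel_measurable borel" "g \<in> borel_measurable borel"
    and g: "\<And>x. \<bar>g x\<bar> \<le> C / (1 + \<bar>x\<bar> powr (1 + s))"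
  shows "integrable lborel (\<lambda>z. \<kappa> z * g (x - z))"
proof (rule Bochner_Integration.integrable_bound)
  show "integrable lborel (\<lambda>z. C * (\<kappa> z * (1 / (1 + \<bar>x - z\<bar> powr (1 + s)))))"
    by (intro integrable_mult_right assms)
  show "AE z in lborel. norm (\<kappa> z * g (x - z)) \<le> norm (C * (\<kappa> z * (1 / (1 + \<bar>x - z\<bar> powr (1 + s)))))"
  proof (rule AE_I2)
    fix z
    have "\<bar>g (x - z)\<bar> \<le> \<bar>C / (1 + \<bar>x - z\<bar> powr (1 + s))\<bar>" using g[of "x - z"] by linarith
    then have "\<bar>\<kappa> z\<bar> * \<bar>g (x - z)\<bar> \<le> \<bar>\<kappa> z\<bar> * \<bar>C / (1 + \<bar>x - z\<bar> powr (1 + s))\<bar>" by (intro mult_left_mono) auto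
    then show "norm (\<kappa> z * g (x - z)) \<le> norm (C * (\<kappa> z * (1 / (1 + \<bar>x - z\<bar> powr (1 + s)))))"
      by (simp add: abs_mult mult_ac)
  qed
qed measurable

lemma test_fun_decay:
  assumes "test_fun f" "0 < s" obtains C where "0 < C" "\<And>x. \<bar>f x\<bar> \<le> C / (1 + \<bar>x\<bar> powr (1 + s))"
proof -
  obtain M where M: "0 < M" "\<And>x. \<bar>f x\<bar> \<le> M" using test_fun_bounded[OF assms(1)] by blast
  obtain R where R: "0 < R" "\<And>x. R < \<bar>x\<bar> \<Longrightarrow> f x = 0" using test_fun_support[OF assms(1)] by blast
  have "\<bar>f x\<bar> \<le> (M * (1 + R powr (1 + s))) / (1 + \<bar>x\<bar> powr (1 + s))" for x
  proof (cases "R < \<bar>x\<bar>")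
    case False
    have p: "0 < 1 + \<bar>x\<bar> powr (1 + s)" by (simp add: add_pos_nonneg)
    have "\<bar>x\<bar> powr (1 + s) \<le> R powr (1 + s)" using False assms(2) by (intro powr_mono2) auto
    then have "\<bar>f x\<bar> * (1 + \<bar>x\<bar> powr (1 + s)) \<le> M * (1 + R powr (1 + s))" using M by (intro mult_mono) auto
    then show ?thesis using p by (simp add: pos_le_divide_eq)
  next
    case True
    then show ?thesis using R M by (auto intro!: divide_nonneg_nonneg mult_nonneg_nonneg add_nonneg_nonneg)
  qed
  moreover have "0 < M * (1 + R powr (1 + s))" using M by (simp add: add_pos_nonneg)
  ultimately show ?thesis using that by blast
qed

text \<open>Fubini, justified by \<open>second_diff_decay\<close>. The kernel is left general to
  serve twice: as |z| powr (s - 1) in the maximum principle and as the function to be mollified in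
  \<open>fl_mollified\<close>. The second claim secures the singular integral of the convolution,
  which need not have compact support.\<close>

lemma fl_convolution:
  fixes \<kappa> :: "real \<Rightarrow> real"
  assumes f: "test_fun f" and s: "0 < s" "s < 1"
    and \<kappa>[measurable]: "\<kappa> \<in> borel_measurable borel"
    and int: "\<And>x. integrable lborel (\<lambda>z. \<kappa> z * (1 / (1 + \<bar>x - z\<bar> powr (1 + s))))"
  shows "fl s (\<lambda>x. \<integral>z. \<kappa> z * f (x - z) \<partial>lborel) x = (\<integral>z. \<kappa> z * fl s f (x - z) \<partial>lborel)"
    and "integrable lborel (\<lambda>y. second_diff (\<lambda>x. \<integral>z. \<kappa> z * f (x - z) \<partial>lborel) x y * \<bar>y\<bar> powr (-1 - s))"
proof -
  note [measurable] = test_fun_measurable[OF f]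
  obtain C0 where C0: "0 < C0" "\<And>x. \<bar>f x\<bar> \<le> C0 / (1 + \<bar>x\<bar> powr (1 + s))" using test_fun_decay[OF f s(1)] by blast
  obtain C where C: "0 < C" "\<And>x. (\<integral>\<^sup>+y. ennreal (\<bar>second_diff f x y\<bar> * \<bar>y\<bar> powr (-1 - s)) \<partial>lborel) \<le> ennreal (C / (1 + \<bar>x\<bar> powr (1 + s)))"
    using second_diff_decay[OF f s] by blast
  have i: "integrable lborel (\<lambda>z. \<kappa> z * f (x - z))" for x
    by (rule integrable_mult_decay[OF int \<kappa> _ C0(2)]) measurable
  define K where "K z y = \<kappa> z * (second_diff f (x - z) y * \<bar>y\<bar> powr (-1 - s))" for z y
  have [measurable]: "case_prod K \<in> borel_measurable (borel \<Otimes>\<^sub>M borel)" unfolding K_def by measurable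
  have sd: "second_diff (\<lambda>x. \<integral>z. \<kappa> z * f (x - z) \<partial>lborel) x y * \<bar>y\<bar> powr (-1 - s) = (\<integral>z. K z y \<partial>lborel)" for y
  proof -
    have "(\<integral>z. K z y \<partial>lborel) = (\<integral>z. \<bar>y\<bar> powr (-1 - s) * (2 * (\<kappa> z * f (x - z)) - \<kappa> z * f ((x + y) - z) - \<kappa> z * f ((x - y) - z)) \<partial>lborel)"
      by (intro Bochner_Integration.integral_cong refl) (simp add: K_def second_diff_def algebra_simps)
    also have "\<dots> = \<bar>y\<bar> powr (-1 - s) * (2 * (\<integral>z. \<kappa> z * f (x - z) \<partial>lborel) - (\<integral>z. \<kappa> z * f ((x + y) - z) \<partial>lborel) - (\<integral>z. \<kappa> z * f ((x - y) - z) \<partial>lborel))"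
      using i[of x] i[of "x + y"] i[of "x - y"] by simp
    finally show ?thesis by (simp add: second_diff_def mult.commute)
  qed
  have "(\<integral>\<^sup>+z. \<integral>\<^sup>+y. ennreal (norm (K z y)) \<partial>lborel \<partial>lborel) \<le> (\<integral>\<^sup>+z. ennreal (norm (C * (\<kappa> z * (1 / (1 + \<bar>x - z\<bar> powr (1 + s)))))) \<partial>lborel)"
  proof (rule nn_integral_mono)
    fix z
    have "(\<integral>\<^sup>+y. ennreal (norm (K z y)) \<partial>lborel) = (\<integral>\<^sup>+y. ennreal \<bar>\<kappa> z\<bar> * ennreal (\<bar>second_diff f (x - z) y\<bar> * \<bar>y\<bar> powr (-1 - s)) \<partial>lborel)"
      by (intro nn_integral_cong) (simp add: K_def abs_mult ennreal_mult')
    also have "\<dots> = ennreal \<bar>\<kappa> z\<bar> * (\<integral>\<^sup>+y. ennreal (\<bar>second_diff f (x - z) y\<bar> * \<bar>y\<bar> powr (-1 - s)) \<partial>lborel)"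
      by (rule nn_integral_cmult) measurable
    also have "\<dots> \<le> ennreal \<bar>\<kappa> z\<bar> * ennreal (C / (1 + \<bar>x - z\<bar> powr (1 + s)))" by (intro mult_left_mono C) auto
    also have "\<dots> = ennreal (norm (C * (\<kappa> z * (1 / (1 + \<bar>x - z\<bar> powr (1 + s))))))"
    proof -
      have "0 < 1 + \<bar>x - z\<bar> powr (1 + s)" by (simp add: add_pos_nonneg)
      then show ?thesis using C(1) by (simp add: ennreal_mult'[symmetric] abs_mult mult_ac)
    qed
    finally show "(\<integral>\<^sup>+y. ennreal (norm (K z y)) \<partial>lborel) \<le> ennreal (norm (C * (\<kappa> z * (1 / (1 + \<bar>x - z\<bar> powr (1 + s))))))" .
  qed
  also have "\<dots> < \<infinity>"
    using integrable_mult_right[OF int[of x], of C] unfolding integrable_iff_bounded by blast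
  finally have fin: "(\<integral>\<^sup>+z. \<integral>\<^sup>+y. ennreal (norm (K z y)) \<partial>lborel \<partial>lborel) < \<infinity>" .
  have F: "(\<integral>z. \<integral>y. K z y \<partial>lborel \<partial>lborel) = (\<integral>y. \<integral>z. K z y \<partial>lborel \<partial>lborel)" "integrable lborel (\<lambda>y. \<integral>z. K z y \<partial>lborel)"
    using lborel_Fubini(1)[of K, OF _ fin] lborel_Fubini(3)[of K, OF _ fin] by auto
  define B where "B = (\<integral>y. (2 - 2 * cos y) * \<bar>y\<bar> powr (-1 - s) \<partial>lborel)"
  have "fl s (\<lambda>x. \<integral>z. \<kappa> z * f (x - z) \<partial>lborel) x = (\<integral>z. \<integral>y. K z y \<partial>lborel \<partial>lborel) / B"
    unfolding fl_def B_def[symmetric] sd F(1) ..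
  also have "(\<integral>z. \<integral>y. K z y \<partial>lborel \<partial>lborel) = (\<integral>z. B * (\<kappa> z * fl s f (x - z)) \<partial>lborel)"
    using cos_powr_pos[OF s] by (simp add: K_def fl_def B_def[symmetric])
  finally show "fl s (\<lambda>x. \<integral>z. \<kappa> z * f (x - z) \<partial>lborel) x = (\<integral>z. \<kappa> z * fl s f (x - z) \<partial>lborel)"
    using cos_powr_pos[OF s] by (simp add: B_def)
  show "integrable lborel (\<lambda>y. second_diff (\<lambda>x. \<integral>z. \<kappa> z * f (x - z) \<partial>lborel) x y * \<bar>y\<bar> powr (-1 - s))"
    unfolding sd by (rule F(2))
qed

text \<open>Differentiability, with the derivative falling on the smooth factor h and not on the
  singular kernel. Continuity serves to attain the minimum in the maximum principle.\<close>

lemma riesz_potential_continuous: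
  fixes s :: real
  assumes h: "test_fun h" and s: "0 < s" "s < 1"
  shows "continuous_on A (\<lambda>x. \<integral>z. \<bar>z\<bar> powr (s - 1) * h (x - z) \<partial>lborel)"
proof -
  note [measurable] = test_fun_measurable[OF h]
  obtain C0 where C0: "0 < C0" "\<And>x. \<bar>h x\<bar> \<le> C0 / (1 + \<bar>x\<bar> powr (1 + s))" using test_fun_decay[OF h s(1)] by blast
  have i: "integrable lborel (\<lambda>z. \<bar>z\<bar> powr (s - 1) * h (x - z))" for x
    by (rule integrable_mult_decay[OF riesz_decay_integrable[OF s] _ _ C0(2)]) measurable
  obtain M where M: "0 < M" "\<And>x. \<bar>deriv h x\<bar> \<le> M" using test_fun_bounded[OF test_fun_deriv[OF h]] by blast
  obtain R where R: "0 < R" "\<And>x. R < \<bar>x\<bar> \<Longrightarrow> deriv h x = 0" using test_fun_support[OF test_fun_deriv[OF h]] by blast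
  have "((\<lambda>x. \<integral>z. \<bar>z\<bar> powr (s - 1) * h (x - z) \<partial>lborel) has_real_derivative (\<integral>z. \<bar>z\<bar> powr (s - 1) * deriv h (x0 - z) \<partial>lborel)) (at x0)" for x0
  \<comment> \<open>For |x - x0| < 1 the argument x - z lies in the support of
    \<open>deriv h\<close> only if z is in this window.\<close>
  proof (rule DERIV_under_integral(1)[where w="\<lambda>z. M * (\<bar>z\<bar> powr (s - 1) * indicator {-(\<bar>x0\<bar> + R + 1)..\<bar>x0\<bar> + R + 1} z)"])
    fix x z :: real assume x: "\<bar>x - x0\<bar> < 1"
    show "((\<lambda>x. \<bar>z\<bar> powr (s - 1) * h (x - z)) has_real_derivative \<bar>z\<bar> powr (s - 1) * deriv h (x - z)) (at x)"
      by (rule derivative_eq_intros DERIV_chain2[OF test_fun_DERIV[OF h]] refl | simp)+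
    have "\<bar>deriv h (x - z)\<bar> \<le> M * indicator {-(\<bar>x0\<bar> + R + 1)..\<bar>x0\<bar> + R + 1} z"
      using M(2)[of "x - z"] R(2)[of "x - z"] x by (cases "R < \<bar>x - z\<bar>") (auto simp: indicator_def M(1) less_imp_le)
    then have "\<bar>z\<bar> powr (s - 1) * \<bar>deriv h (x - z)\<bar> \<le> \<bar>z\<bar> powr (s - 1) * (M * indicator {-(\<bar>x0\<bar> + R + 1)..\<bar>x0\<bar> + R + 1} z)"
      by (intro mult_left_mono) auto
    then show "\<bar>\<bar>z\<bar> powr (s - 1) * deriv h (x - z)\<bar> \<le> M * (\<bar>z\<bar> powr (s - 1) * indicator {-(\<bar>x0\<bar> + R + 1)..\<bar>x0\<bar> + R + 1} z)"
      by (simp add: abs_mult mult_ac)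
  next
    show "integrable lborel (\<lambda>z. M * (\<bar>z\<bar> powr (s - 1) * indicator {-(\<bar>x0\<bar> + R + 1)..\<bar>x0\<bar> + R + 1} z))"
      by (intro integrable_mult_right integrable_abs_powr_near_0 s)
  qed (rule i)
  then show ?thesis by (meson DERIV_isCont continuous_at_imp_continuous_on)
qed

text \<open>Maximum principle: \<open>W - kap s * U\<close> cannot have a negative minimum, because there its
  fractional Laplacian would be strictly negative.\<close>

theorem riesz_comparison:
  assumes U: "test_fun U" and h: "test_fun h" and s: "0 < s" "s < 1"
    and supp: "\<And>x. x \<notin> {A..B} \<Longrightarrow> U x = 0" and h0: "\<And>x. 0 \<le> h x"
    and le: "\<And>x. x \<in> {A..B} \<Longrightarrow> fl s U x \<le> h x"
  shows "kap s * U x \<le> (\<integral>z. \<bar>z\<bar> powr (s - 1) * h (x - z) \<partial>lborel)"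
proof (rule ccontr)
  define W where "W x = (\<integral>z. \<bar>z\<bar> powr (s - 1) * h (x - z) \<partial>lborel)" for x
  define Z where "Z x = W x - kap s * U x" for x
  assume "\<not> kap s * U x \<le> (\<integral>z. \<bar>z\<bar> powr (s - 1) * h (x - z) \<partial>lborel)"
  then have zx: "Z x < 0" by (simp add: Z_def W_def)
  have W0: "0 \<le> W x" for x unfolding W_def using h0 by (intro integral_nonneg_AE) auto
  have out: "0 \<le> Z x" if "x \<notin> {A..B}" for x using that W0 supp by (simp add: Z_def)
  then have xAB: "x \<in> {A..B}" using zx by (meson not_less)
  have Zc: "continuous_on {A..B} Z"
    unfolding Z_def W_def by (intro continuous_intros riesz_potential_continuous[OF h s] test_fun_continuous[OF U])
  obtain x0 where x0: "x0 \<in> {A..B}" "\<And>y. y \<in> {A..B} \<Longrightarrow> Z x0 \<le> Z y"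
    using continuous_attains_inf[OF _ _ Zc] xAB by (metis compact_Icc empty_iff)
  have neg: "Z x0 < 0" using x0(2)[OF xAB] zx by simp
  \<comment> \<open>Outside [A, B] the function \<open>Z\<close> is nonnegative, so the negative
    minimum over the compact interval is global.\<close>
  have min: "Z x0 \<le> Z y" for y using x0(2)[of y] out[of y] neg by (cases "y \<in> {A..B}") auto
  define D where "D y = - (second_diff Z x0 y * \<bar>y\<bar> powr (-1 - s))" for y
  have D0: "0 \<le> D y" for y
  proof -
    have "second_diff Z x0 y \<le> 0" using min[of "x0 + y"] min[of "x0 - y"] by (simp add: second_diff_def)
    then show ?thesis by (simp add: D_def mult_nonpos_nonneg)
  qed
  have iW: "integrable lborel (\<lambda>y. second_diff W x0 y * \<bar>y\<bar> powr (-1 - s))"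
    unfolding W_def by (rule fl_convolution(2)[OF h s _ riesz_decay_integrable[OF s]]) measurable
  have iU: "integrable lborel (\<lambda>y. second_diff U x0 y * \<bar>y\<bar> powr (-1 - s))" by (rule second_diff_integrable[OF U s])
  have Deq: "D y = kap s * (second_diff U x0 y * \<bar>y\<bar> powr (-1 - s)) - second_diff W x0 y * \<bar>y\<bar> powr (-1 - s)" for y
    by (simp add: D_def second_diff_def Z_def algebra_simps)
  have iD: "integrable lborel D" unfolding Deq using iW iU by auto
  have pB: "0 < (\<integral>y. (2 - 2 * cos y) * \<bar>y\<bar> powr (-1 - s) \<partial>lborel)" by (rule cos_powr_pos[OF s])
  have flW: "fl s W x0 = kap s * h x0"
    unfolding W_def using fl_convolution(1)[OF h s _ riesz_decay_integrable[OF s], of x0] riesz_inverse[OF h s, of x0] by simp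
  \<comment> \<open>\<open>D\<close> is nonnegative at the minimum, while its integral is a positive
    multiple of kap s * (fl s U x0 - h x0) \<le> 0; hence \<open>D\<close> vanishes almost
    everywhere.\<close>
  have "(\<integral>y. D y \<partial>lborel) = kap s * (\<integral>y. second_diff U x0 y * \<bar>y\<bar> powr (-1 - s) \<partial>lborel) - (\<integral>y. second_diff W x0 y * \<bar>y\<bar> powr (-1 - s) \<partial>lborel)"
    unfolding Deq using iW iU by simp
  also have "\<dots> = (\<integral>y. (2 - 2 * cos y) * \<bar>y\<bar> powr (-1 - s) \<partial>lborel) * (kap s * fl s U x0 - fl s W x0)"
    using pB by (simp add: fl_def field_simps)
  also have "\<dots> \<le> 0"
    using pB kap_pos[OF s] le[OF x0(1)] unfolding flW by (intro mult_nonneg_nonpos) auto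
  finally have "(\<integral>y. D y \<partial>lborel) = 0" using D0 by (intro antisym integral_nonneg_AE) auto
  then have ae: "AE y in lborel. D y = 0"
    by (subst (asm) integral_nonneg_eq_0_iff_AE[OF iD]) (use D0 in auto)
  \<comment> \<open>For such y both x0 + y and x0 - y leave [A, B], where \<open>Z\<close> is at
    least 0; so \<open>D\<close> is nonzero on an interval of length 1.\<close>
  have pos: "D y \<noteq> 0" if "y \<in> {B - A<..<B - A + 1}" for y
  proof -
    have y: "0 < y" "x0 + y \<notin> {A..B}" "x0 - y \<notin> {A..B}" using that x0(1) by auto
    have "second_diff Z x0 y < 0" using out[OF y(2)] out[OF y(3)] neg by (simp add: second_diff_def)
    then show ?thesis using y(1) by (simp add: D_def)
  qed
  have "AE y in lborel. y \<notin> {B - A<..<B - A + 1}" using ae by eventually_elim (use pos in blast)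
  then have "emeasure lborel {B - A<..<B - A + 1} = 0"
    by (subst (asm) AE_iff_measurable[OF _ refl]) (auto simp: greaterThanLessThan_def greaterThan_def lessThan_def Collect_conj_eq[symmetric])
  then show False by simp
qed

subsection \<open>Hoelder inequalities and the lemma of Garsia and Adams\<close>

locale conjugate_exponents =
  fixes p q s :: real
  assumes p: "1 < p" and q_def: "q = p / (p - 1)" and s_def: "s = 1 / p"
begin

lemma q: "1 < q" and pq: "1 / p + 1 / q = 1" and s: "0 < s" "s < 1"
  and s_minus_one: "s - 1 = - (1 / q)" and sp: "s * p = 1" and q_over_p: "q / p = q - 1"
  using p by (auto simp: q_def s_def field_simps)

lemma young: "0 \<le> a \<Longrightarrow> 0 \<le> b \<Longrightarrow> a * b \<le> a powr p / p + b powr q / q"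
  by (rule Youngs_inequality) (use p q pq in auto)

lemma powr_p_inverse [simp]: "0 \<le> x \<Longrightarrow> (x powr (1 / p)) powr p = x" "0 \<le> x \<Longrightarrow> (x powr p) powr (1 / p) = x"
  "0 \<le> x \<Longrightarrow> (x powr (1 / q)) powr q = x" "0 \<le> x \<Longrightarrow> (x powr q) powr (1 / q) = x"
  using p q by (auto simp: powr_powr)

text \<open>Young's inequality for t and c powr (p - 1) says that the graph of the p-th power lies
  above its tangent at c. It takes the place of Jensen's inequality in \<open>mollify_powr\<close>
  and gives the first-order bound \<open>powr_p_add_le\<close>.\<close>

lemma powr_tangent:
  assumes "0 \<le> t" "0 \<le> c" shows "p * c powr (p - 1) * t \<le> t powr p + (p - 1) * c powr p"
proof -
  have "t * c powr (p - 1) \<le> t powr p / p + (c powr (p - 1)) powr q / q" using assms by (intro young) auto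
  also have "(c powr (p - 1)) powr q = c powr p" using p by (simp add: powr_powr q_def)
  finally have "p * (t * c powr (p - 1)) \<le> p * (t powr p / p + c powr p / q)" using p by (intro mult_left_mono) auto
  also have "\<dots> = t powr p + (p - 1) * c powr p" using p by (simp add: q_def field_simps)
  finally show ?thesis by (simp add: mult_ac)
qed

text \<open>Division by the two norms u and v reduces this to two instances of Young's inequality;
  if a norm is 0, its pair vanishes.\<close>

lemma holder2:
  assumes "0 \<le> a" "0 \<le> b" "0 \<le> X" "0 \<le> Y"
  shows "a * X + b * Y \<le> (a powr q + b powr q) powr (1 / q) * (X powr p + Y powr p) powr (1 / p)"
proof -
  define u v where "u = (a powr q + b powr q) powr (1 / q)" and "v = (X powr p + Y powr p) powr (1 / p)"
  have uq: "u powr q = a powr q + b powr q" and vp: "v powr p = X powr p + Y powr p"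
    by (simp_all add: u_def v_def)
  show ?thesis
  proof (cases "u = 0 \<or> v = 0")
    case True
    then have "(a powr q = 0 \<and> b powr q = 0) \<or> (X powr p = 0 \<and> Y powr p = 0)"
      using uq vp p q by (metis add_nonneg_eq_0_iff powr_0 powr_ge_zero)
    then have "(a = 0 \<and> b = 0) \<or> (X = 0 \<and> Y = 0)" using p q by auto
    then show ?thesis by auto
  next
    case False
    then have uv: "0 < u" "0 < v" by (auto simp: u_def v_def order_less_le)
    have "(X / v) * (a / u) + (Y / v) * (b / u) \<le> ((X / v) powr p / p + (a / u) powr q / q) + ((Y / v) powr p / p + (b / u) powr q / q)"
      using assms uv by (intro add_mono young) auto
    also have "\<dots> = (X powr p + Y powr p) / v powr p / p + (a powr q + b powr q) / u powr q / q"
      using assms uv by (simp add: powr_divide add_divide_distrib)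
    also have "\<dots> = 1" unfolding uq[symmetric] vp[symmetric] using uv pq by simp
    finally show ?thesis unfolding u_def[symmetric] v_def[symmetric] using uv by (simp add: field_simps)
  qed
qed

lemma holder:
  fixes f g :: "'a \<Rightarrow> real"
  assumes [measurable]: "f \<in> borel_measurable M" "g \<in> borel_measurable M"
    and f0: "\<And>x. 0 \<le> f x" and g0: "\<And>x. 0 \<le> g x" and X: "0 \<le> X" and Y: "0 \<le> Y"
    and f: "(\<integral>\<^sup>+x. ennreal (f x powr p) \<partial>M) \<le> ennreal (X powr p)"
    and g: "(\<integral>\<^sup>+x. ennreal (g x powr q) \<partial>M) \<le> ennreal (Y powr q)"
  shows "(\<integral>\<^sup>+x. ennreal (f x * g x) \<partial>M) \<le> ennreal (X * Y)"
proof (cases "X = 0 \<or> Y = 0")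
  case True
  then have "(\<integral>\<^sup>+x. ennreal (f x powr p) \<partial>M) = 0 \<or> (\<integral>\<^sup>+x. ennreal (g x powr q) \<partial>M) = 0"
    using f g p q by auto
  then have "AE x in M. f x * g x = 0"
  proof
    assume "(\<integral>\<^sup>+x. ennreal (f x powr p) \<partial>M) = 0"
    then have "AE x in M. ennreal (f x powr p) = 0" by (subst (asm) nn_integral_0_iff_AE) auto
    then show ?thesis by eventually_elim (use p f0 in \<open>simp add: ennreal_eq_0_iff powr_nonneg_iff\<close>)
  next
    assume "(\<integral>\<^sup>+x. ennreal (g x powr q) \<partial>M) = 0"
    then have "AE x in M. ennreal (g x powr q) = 0" by (subst (asm) nn_integral_0_iff_AE) auto
    then show ?thesis by eventually_elim (use q g0 in \<open>simp add: ennreal_eq_0_iff powr_nonneg_iff\<close>)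
  qed
  then have "(\<integral>\<^sup>+x. ennreal (f x * g x) \<partial>M) = (\<integral>\<^sup>+x. 0 \<partial>M)" by (intro nn_integral_cong_AE) auto
  then show ?thesis by simp
next
  case False
  then have XY: "0 < X" "0 < Y" using X Y by auto
  \<comment> \<open>The weights arise from Young's inequality for f / X and g / Y, multiplied by X *
    Y; with them the two integrals contribute at most X * Y / p and X * Y / q.\<close>
  define a b where "a = X * Y / (p * X powr p)" and "b = X * Y / (q * Y powr q)"
  have ab: "0 \<le> a" "0 \<le> b" using XY p q by (auto simp: a_def b_def)
  have "f x * g x \<le> a * f x powr p + b * g x powr q" for x
  proof -
    have "(f x / X) * (g x / Y) \<le> (f x / X) powr p / p + (g x / Y) powr q / q"
      using f0[of x] g0[of x] XY by (intro young) auto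
    then have "(X * Y) * ((f x / X) * (g x / Y)) \<le> (X * Y) * ((f x / X) powr p / p + (g x / Y) powr q / q)"
      using XY by (intro mult_left_mono) auto
    then show ?thesis using XY f0[of x] g0[of x] by (simp add: a_def b_def powr_divide field_simps)
  qed
  then have "(\<integral>\<^sup>+x. ennreal (f x * g x) \<partial>M) \<le> (\<integral>\<^sup>+x. ennreal a * ennreal (f x powr p) + ennreal b * ennreal (g x powr q) \<partial>M)"
    using ab by (intro nn_integral_mono) (simp add: ennreal_mult'[symmetric] ennreal_plus[symmetric] ennreal_leI del: ennreal_plus)
  also have "\<dots> = ennreal a * (\<integral>\<^sup>+x. ennreal (f x powr p) \<partial>M) + ennreal b * (\<integral>\<^sup>+x. ennreal (g x powr q) \<partial>M)"
    by (simp add: nn_integral_add nn_integral_cmult)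
  also have "\<dots> \<le> ennreal a * ennreal (X powr p) + ennreal b * ennreal (Y powr q)"
    by (intro add_mono mult_left_mono f g) auto
  also have "\<dots> = ennreal (a * X powr p + b * Y powr q)" using ab by (simp add: ennreal_mult'[symmetric])
  also have "a * X powr p + b * Y powr q = X * Y * (1 / p + 1 / q)"
    using XY p q by (simp add: a_def b_def field_simps)
  finally show ?thesis by (simp only: pq mult_1_right)
qed

lemma powr_add_le: "0 \<le> a \<Longrightarrow> 0 \<le> b \<Longrightarrow> (a + b) powr q \<le> 2 powr q * (a powr q + b powr q)"
proof -
  assume ab: "0 \<le> a" "0 \<le> b"
  have "(a + b) powr q \<le> (2 * max a b) powr q" using ab q by (intro powr_mono2) auto
  also have "\<dots> = 2 powr q * max a b powr q" using ab by (simp add: powr_mult)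
  also have "max a b powr q \<le> a powr q + b powr q" by (simp add: max_def)
  finally show ?thesis by (simp add: mult_left_mono)
qed

lemma one_plus_powr_le:
  fixes r x :: real
  assumes "0 < r" "0 \<le> x" "x \<le> 1" shows "(1 + x) powr r \<le> 1 + r * 2 powr r * x"
proof (cases "x = 0")
  case False
  then have "\<exists>z. 1 < z \<and> z < 1 + x \<and> (1 + x) powr r - 1 powr r = ((1 + x) - 1) * (r * z powr (r - 1))"
    using assms by (intro MVT2) (auto intro!: derivative_eq_intros)
  then obtain z where z: "1 < z" "z < 1 + x" "(1 + x) powr r = 1 + x * (r * z powr (r - 1))" by auto
  have "z powr (r - 1) \<le> z powr r" using z by (intro powr_mono) auto
  also have "\<dots> \<le> 2 powr r" using z assms by (intro powr_mono2) auto
  finally show ?thesis using assms z(3) by (simp add: mult_left_mono mult_ac)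
qed simp

text \<open>Here \<theta> stands for ln (L / t) and X for the norm of the rearrangement near 0. The
  pair (X, (1 - X powr p) powr (1 / p)) has p-norm 1, so \<open>holder2\<close> gives G powr q \<le>
  C powr q + 2 * \<theta>.\<close>

lemma garsia_lower:
  assumes "0 \<le> C" "0 \<le> \<theta>" "0 \<le> X" "X \<le> 1" "0 \<le> G"
    and "G \<le> C * X + (2 * \<theta>) powr (1 / q) * (1 - X powr p) powr (1 / p)"
  shows "- (C powr q / 2) \<le> \<theta> - G powr q / 2"
proof -
  have X: "X powr p \<le> 1" using assms p by (intro powr_le1) auto
  have "C * X + (2 * \<theta>) powr (1 / q) * (1 - X powr p) powr (1 / p)
    \<le> (C powr q + ((2 * \<theta>) powr (1 / q)) powr q) powr (1 / q) * (X powr p + ((1 - X powr p) powr (1 / p)) powr p) powr (1 / p)"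
    using assms by (intro holder2) auto
  also have "\<dots> = (C powr q + 2 * \<theta>) powr (1 / q)" using assms X by simp
  finally have "G powr q \<le> ((C powr q + 2 * \<theta>) powr (1 / q)) powr q"
    using assms q by (intro powr_mono2) auto
  then show ?thesis using assms by simp
qed

text \<open>The core of Garsia's lemma: two large values of \<open>\<theta>\<close> at which \<open>\<theta> - G powr q / 2\<close> is at most \<open>n\<close>
  are close to each other, since at the smaller one almost no mass of the rearrangement is left.\<close>

lemma garsia_close:
  assumes C: "0 \<le> C"
  obtains A where "1 \<le> A" "\<And>n \<theta>1 \<theta>2 X G1 G2. \<lbrakk>0 \<le> n; A * (1 + n) < \<theta>1; \<theta>1 \<le> \<theta>2; 0 \<le> X; X \<le> 1; 0 \<le> G1; 0 \<le> G2;
     G1 \<le> C * X + (2 * \<theta>1) powr (1 / q) * (1 - X powr p) powr (1 / p);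
     G2 \<le> (C + (2 * (\<theta>2 - \<theta>1)) powr (1 / q)) * X + (2 * \<theta>1) powr (1 / q) * (1 - X powr p) powr (1 / p);
     \<theta>1 - G1 powr q / 2 \<le> n; \<theta>2 - G2 powr q / 2 \<le> n\<rbrakk> \<Longrightarrow> \<theta>2 - \<theta>1 \<le> A * (1 + n)"
proof -
  define cr where "cr = (q - 1) * 2 powr (q - 1)"
  have cr: "0 < cr" using q by (simp add: cr_def)
  \<comment> \<open>\<open>K1\<close> will bound m * \<theta>1 / (1 + n) with m = X powr p: the mass
    near 0 is at most of order (1 + n) / \<theta>1.\<close>
  define K1 where "K1 = (2 * p * C) powr q + 2 * p"
  \<comment> \<open>\<epsilon> is tuned so that \<theta>2 - \<theta>1 appears with coefficient 1 in
    the upper bound for G2 powr q, against coefficient 2 in the lower bound; the difference is what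
    bounds it.\<close>
  define \<epsilon> where "\<epsilon> = (1 / ((1 + cr) * 2 powr q * 2)) powr (1 / q)"
  have \<epsilon>: "0 < \<epsilon>" "\<epsilon> powr q * (1 + cr) * 2 powr q = 1 / 2"
  proof -
    define E where "E = (1 + cr) * 2 powr q"
    have E: "0 < E" unfolding E_def using cr by simp
    have e: "\<epsilon> = (1 / (E * 2)) powr (1 / q)" by (simp add: \<epsilon>_def E_def)
    show "0 < \<epsilon>" unfolding e using E by simp
    have "\<epsilon> powr q = 1 / (E * 2)" unfolding e using E by simp
    then have "\<epsilon> powr q * E = 1 / 2" using E by simp
    then show "\<epsilon> powr q * (1 + cr) * 2 powr q = 1 / 2" by (simp add: E_def mult.assoc)
  qed
  define K2 where "K2 = 2 * cr * \<epsilon> powr (- p) * K1"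
  have K1: "0 < K1" unfolding K1_def using p by (simp add: add_nonneg_pos)
  have K2: "0 < K2" unfolding K2_def using cr \<epsilon> K1 by simp
  define A where "A = 1 + K1 * \<epsilon> powr (- p) + K2 + 2 + C powr q / 2"
  have A: "1 \<le> A" "K1 * \<epsilon> powr (- p) \<le> A" "K2 + 2 + C powr q / 2 \<le> A"
    unfolding A_def using K1 K2 \<epsilon> by auto
  show ?thesis
  proof (rule that[OF A(1)])
    fix n \<theta>1 \<theta>2 X G1 G2 :: real
    assume n: "0 \<le> n" and \<theta>: "A * (1 + n) < \<theta>1" "\<theta>1 \<le> \<theta>2" and X: "0 \<le> X" "X \<le> 1" and G: "0 \<le> G1" "0 \<le> G2"
      and G1: "G1 \<le> C * X + (2 * \<theta>1) powr (1 / q) * (1 - X powr p) powr (1 / p)"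
      and G2: "G2 \<le> (C + (2 * (\<theta>2 - \<theta>1)) powr (1 / q)) * X + (2 * \<theta>1) powr (1 / q) * (1 - X powr p) powr (1 / p)"
      and T1: "\<theta>1 - G1 powr q / 2 \<le> n" and T2: "\<theta>2 - G2 powr q / 2 \<le> n"
    have "1 * (1 + n) \<le> A * (1 + n)" using A(1) n by (intro mult_right_mono) auto
    from le_less_trans[OF this \<theta>(1)] have "1 + n < \<theta>1" by simp
    then have \<theta>1: "0 < \<theta>1" "n < \<theta>1" using n by simp_all
    define m where "m = X powr p"
    have m: "0 \<le> m" "m \<le> 1" "X = m powr (1 / p)" using X p by (auto simp: m_def intro!: powr_le1)
    define w where "w = (2 * \<theta>1) powr (1 / q)"
    have w: "0 < w" "w powr q = 2 * \<theta>1" using \<theta>1 by (auto simp: w_def)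
    define Y where "Y = (1 - m) powr (1 / p)"
    have Y: "0 \<le> Y" "Y powr p = 1 - m" using m by (auto simp: Y_def)
    have Y1: "Y \<le> 1 - m / p"
      using young[of Y 1] Y pq by (simp add: diff_divide_distrib)
    \<comment> \<open>The lower bound on G1 forced by \<open>T1\<close> is compared with the assumed
      upper bound. Since Y \<le> 1 - m / p, mass m near 0 costs w * m / p, which has to be made up
      by C * X + w * n / \<theta>1.\<close>
    have m\<theta>: "m * \<theta>1 \<le> K1 * (1 + n)"
    proof -
      have "w * (1 - n / \<theta>1) \<le> w * (1 - n / \<theta>1) powr (1 / q)"
        using powr_mono'[of "1 / q" 1 "1 - n / \<theta>1"] \<theta>1 n q w by (intro mult_left_mono) auto
      also have "\<dots> = (2 * \<theta>1 * (1 - n / \<theta>1)) powr (1 / q)"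
        using \<theta>1 n unfolding w_def by (subst powr_mult[symmetric]) auto
      also have "2 * \<theta>1 * (1 - n / \<theta>1) = 2 * (\<theta>1 - n)" using \<theta>1 by (simp add: field_simps)
      also have "(2 * (\<theta>1 - n)) powr (1 / q) \<le> (G1 powr q) powr (1 / q)"
        using T1 \<theta>1 q by (intro powr_mono2) auto
      also have "\<dots> = G1" using G by simp
      also have "G1 \<le> C * X + w * Y" using G1 by (simp add: w_def Y_def m_def)
      also have "\<dots> \<le> C * X + w * (1 - m / p)" using Y1 w by simp
      finally have "w * m / p \<le> C * X + w * n / \<theta>1" by (simp add: algebra_simps)
      then have "(w * m / p) * (p * \<theta>1 / w) \<le> (C * X + w * n / \<theta>1) * (p * \<theta>1 / w)"
        using p \<theta>1 w by (intro mult_right_mono) auto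
      moreover have "(w * m / p) * (p * \<theta>1 / w) = m * \<theta>1" using p w by simp
      moreover have "(C * X + w * n / \<theta>1) * (p * \<theta>1 / w) = p * C * (X * (\<theta>1 / w)) + p * n"
      proof -
        have "(C * X) * (p * \<theta>1 / w) = p * C * (X * (\<theta>1 / w))" "(w * n / \<theta>1) * (p * \<theta>1 / w) = p * n" using \<theta>1 w by simp_all
        then show ?thesis by (simp only: distrib_right)
      qed
      ultimately have "m * \<theta>1 \<le> p * C * (X * (\<theta>1 / w)) + p * n" by linarith
      also have "X * (\<theta>1 / w) \<le> (m * \<theta>1) powr (1 / p)"
      proof -
        have "\<theta>1 powr (1 / q) \<le> w" unfolding w_def using \<theta>1 q by (intro powr_mono2) auto
        moreover have "\<theta>1 = \<theta>1 powr (1 / p) * \<theta>1 powr (1 / q)" using \<theta>1 pq by (simp flip: powr_add)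
        ultimately have "\<theta>1 \<le> \<theta>1 powr (1 / p) * w" by (metis mult_left_mono powr_ge_zero)
        then have "\<theta>1 / w \<le> \<theta>1 powr (1 / p)" using w by (simp add: pos_divide_le_eq)
        then have "X * (\<theta>1 / w) \<le> m powr (1 / p) * \<theta>1 powr (1 / p)" unfolding m(3) using mult_left_mono powr_ge_zero by blast
        then show ?thesis using m \<theta>1 by (simp add: powr_mult)
      qed
      finally have z: "m * \<theta>1 \<le> p * C * (m * \<theta>1) powr (1 / p) + p * n" using p C by (simp add: mult_left_mono)
      define z where "z = m * \<theta>1"
      have z0: "0 \<le> z" using m \<theta>1 by (simp add: z_def)
      \<comment> \<open>A self-bounding inequality z \<le> p * C * z powr (1 / p) + p * n: the
        larger of the two summands is at least z / 2.\<close>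
      have "z \<le> (2 * p * C) powr q + 2 * p * n"
      proof (cases "z \<le> 2 * p * C * z powr (1 / p)")
        case True
        have "z \<le> (2 * p * C) powr q"
        proof (cases "z = 0")
          case False
          then have zp: "0 < z" using z0 by simp
          have "z powr (1 / q) * z powr (1 / p) = z" using zp pq by (simp add: add.commute flip: powr_add)
          then have "z powr (1 / q) * z powr (1 / p) \<le> 2 * p * C * z powr (1 / p)" using True by simp
          then have "z powr (1 / q) \<le> 2 * p * C" using zp by simp
          then have "(z powr (1 / q)) powr q \<le> (2 * p * C) powr q" using q by (intro powr_mono2) auto
          then show ?thesis using z0 by simp
        qed simp
        then show ?thesis using p n by (simp add: add_increasing2)
      next
        case False
        then have "z \<le> 2 * p * n" using z unfolding z_def[symmetric] by simp
        then show ?thesis by (simp add: add_increasing)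
      qed
      also have "\<dots> \<le> K1 * (1 + n)"
        unfolding K1_def using n p by (simp add: algebra_simps)
      finally show ?thesis by (simp add: z_def)
    qed
    define \<Delta> where "\<Delta> = \<theta>2 - \<theta>1"
    define Z where "Z = C + (2 * \<Delta>) powr (1 / q)"
    have \<Delta>: "0 \<le> \<Delta>" using \<theta> by (simp add: \<Delta>_def)
    have Z: "0 \<le> Z" "Z powr q \<le> 2 powr q * (C powr q + 2 * \<Delta>)"
      using powr_add_le[of C "(2 * \<Delta>) powr (1 / q)"] C \<Delta> by (auto simp: Z_def)
    define x where "x = m * \<epsilon> powr (- p)"
    have x: "0 \<le> x" "x \<le> 1"
    proof -
      have "K1 * \<epsilon> powr (- p) * (1 + n) \<le> A * (1 + n)" using A(2) n by (intro mult_right_mono) auto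
      then have "K1 * (1 + n) * \<epsilon> powr (- p) \<le> \<theta>1" using \<theta>(1) by (simp add: mult_ac)
      moreover have "m * \<theta>1 * \<epsilon> powr (- p) \<le> K1 * (1 + n) * \<epsilon> powr (- p)" using m\<theta> by (intro mult_right_mono) auto
      ultimately have "(m * \<epsilon> powr (- p)) * \<theta>1 \<le> 1 * \<theta>1" by (simp add: mult_ac)
      then show "x \<le> 1" using \<theta>1 unfolding x_def by simp
    qed (use m in \<open>simp add: x_def\<close>)
    have XY1: "(X / \<epsilon>) powr p + Y powr p \<le> 1 + x"
      using m X \<epsilon>(1) Y by (simp add: powr_divide m_def[symmetric] x_def powr_minus_divide)
    have t1: "(\<epsilon> * Z) powr q * (1 + cr * x) \<le> C powr q / 2 + \<Delta>"
    proof -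
      have "(\<epsilon> * Z) powr q * (1 + cr * x) \<le> (\<epsilon> * Z) powr q * (1 + cr)" using cr x by (intro mult_left_mono) auto
      also have "\<dots> = \<epsilon> powr q * (1 + cr) * Z powr q" using \<epsilon> Z by (simp add: powr_mult)
      also have "\<dots> \<le> \<epsilon> powr q * (1 + cr) * (2 powr q * (C powr q + 2 * \<Delta>))" using Z cr by (intro mult_left_mono) auto
      also have "\<dots> = (\<epsilon> powr q * (1 + cr) * 2 powr q) * (C powr q + 2 * \<Delta>)" by simp
      also have "\<dots> = C powr q / 2 + \<Delta>" unfolding \<epsilon>(2) by simp
      finally show ?thesis .
    qed
    have t2: "2 * cr * (x * \<theta>1) \<le> K2 * (1 + n)"
    proof -
      have "2 * cr * \<epsilon> powr (- p) * (m * \<theta>1) \<le> 2 * cr * \<epsilon> powr (- p) * (K1 * (1 + n))"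
        using m\<theta> cr by (intro mult_left_mono) auto
      then show ?thesis by (simp add: x_def K2_def mult_ac)
    qed
    have "2 * (\<theta>2 - n) \<le> G2 powr q" using T2 by simp
    \<comment> \<open>The mass is reweighted by \<epsilon> before Hoelder: \<open>Z\<close>, which
      contains the unknown \<theta>2 - \<theta>1, becomes small, while the other factor grows only
      to 1 + x, harmless because x * \<theta>1 is of order 1 + n.\<close>
    also have "G2 powr q \<le> ((\<epsilon> * Z) * (X / \<epsilon>) + w * Y) powr q"
    proof (rule powr_mono2)
      show "G2 \<le> (\<epsilon> * Z) * (X / \<epsilon>) + w * Y" using G2 \<epsilon>(1) by (simp add: w_def Y_def m_def Z_def \<Delta>_def)
    qed (use G q in auto)
    also have "\<dots> \<le> (((\<epsilon> * Z) powr q + w powr q) powr (1 / q) * ((X / \<epsilon>) powr p + Y powr p) powr (1 / p)) powr q"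
      using Z X Y w \<epsilon> q by (intro powr_mono2 holder2 add_nonneg_nonneg mult_nonneg_nonneg) auto
    also have "\<dots> = ((\<epsilon> * Z) powr q + w powr q) * ((X / \<epsilon>) powr p + Y powr p) powr (q - 1)"
      using q by (simp add: powr_mult powr_powr q_over_p)
    also have "\<dots> \<le> ((\<epsilon> * Z) powr q + w powr q) * (1 + x) powr (q - 1)"
      using XY1 q by (intro mult_left_mono powr_mono2) auto
    also have "\<dots> \<le> ((\<epsilon> * Z) powr q + w powr q) * (1 + cr * x)"
      unfolding cr_def using one_plus_powr_le[of "q - 1" x] q x by (intro mult_left_mono) auto
    also have "\<dots> = (\<epsilon> * Z) powr q * (1 + cr * x) + 2 * \<theta>1 + 2 * cr * (x * \<theta>1)"
      unfolding w(2) by (simp add: algebra_simps)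
    finally have "2 * (\<theta>2 - n) \<le> C powr q / 2 + \<Delta> + 2 * \<theta>1 + K2 * (1 + n)" using t1 t2 by linarith
    \<comment> \<open>As 2 * \<theta>2 = 2 * \<Delta> + 2 * \<theta>1, one of the two copies of
      \<Delta> is absorbed and \<theta>1 drops out.\<close>
    then have "\<Delta> \<le> K2 * (1 + n) + 2 * n + C powr q / 2" by (simp add: \<Delta>_def)
    also have "\<dots> \<le> (K2 + 2 + C powr q / 2) * (1 + n)"
    proof -
      have "(K2 + 2 + C powr q / 2) * (1 + n) = (K2 * (1 + n) + 2 * n + C powr q / 2) + (2 + n * (C powr q / 2))"
        by (simp add: algebra_simps)
      moreover have "0 \<le> 2 + n * (C powr q / 2)" using n by (intro add_nonneg_nonneg mult_nonneg_nonneg) auto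
      ultimately show ?thesis by (metis le_add_same_cancel1)
    qed
    also have "\<dots> \<le> A * (1 + n)" using A(3) n by (intro mult_right_mono) auto
    finally show "\<theta>2 - \<theta>1 \<le> A * (1 + n)" by (simp add: \<Delta>_def)
  qed
qed

end

subsection \<open>The inequality of Adams on the line\<close>

context conjugate_exponents
begin

text \<open>The Riesz potential of an interval of length t at its centre is
  \<open>C1 * t powr s\<close>.\<close>

definition C1 :: real where "C1 = 2 powr (1 - s) / s"

text \<open>The conclusion of \<open>garsia_close\<close> for C = C1 is given a name so that one
  \<open>A\<close>, fixed before the interval and the density, can be carried through the locale
  below.\<close>

definition garsia_const :: "real \<Rightarrow> bool" where
  "garsia_const A \<longleftrightarrow> 1 \<le> A \<and> (\<forall>n \<theta>1 \<theta>2 X G1 G2. 0 \<le> n \<longrightarrow> A * (1 + n) < \<theta>1 \<longrightarrow> \<theta>1 \<le> \<theta>2 \<longrightarrow> 0 \<le> X \<longrightarrow> X \<le> 1 \<longrightarrow> 0 \<le> G1 \<longrightarrow> 0 \<le> G2 \<longrightarrow>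
     G1 \<le> C1 * X + (2 * \<theta>1) powr (1 / q) * (1 - X powr p) powr (1 / p) \<longrightarrow>
     G2 \<le> (C1 + (2 * (\<theta>2 - \<theta>1)) powr (1 / q)) * X + (2 * \<theta>1) powr (1 / q) * (1 - X powr p) powr (1 / p) \<longrightarrow>
     \<theta>1 - G1 powr q / 2 \<le> n \<longrightarrow> \<theta>2 - G2 powr q / 2 \<le> n \<longrightarrow> \<theta>2 - \<theta>1 \<le> A * (1 + n))"

lemma C1_pos: "0 < C1" using s by (simp add: C1_def)

lemma garsia_const_exists: obtains A where "garsia_const A"
proof -
  obtain A where "1 \<le> A" "\<And>n \<theta>1 \<theta>2 X G1 G2. \<lbrakk>0 \<le> n; A * (1 + n) < \<theta>1; \<theta>1 \<le> \<theta>2; 0 \<le> X; X \<le> 1; 0 \<le> G1; 0 \<le> G2;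
     G1 \<le> C1 * X + (2 * \<theta>1) powr (1 / q) * (1 - X powr p) powr (1 / p);
     G2 \<le> (C1 + (2 * (\<theta>2 - \<theta>1)) powr (1 / q)) * X + (2 * \<theta>1) powr (1 / q) * (1 - X powr p) powr (1 / p);
     \<theta>1 - G1 powr q / 2 \<le> n; \<theta>2 - G2 powr q / 2 \<le> n\<rbrakk> \<Longrightarrow> \<theta>2 - \<theta>1 \<le> A * (1 + n)"
    using garsia_close[OF less_imp_le[OF C1_pos]] by metis
  then have "garsia_const A" unfolding garsia_const_def by blast
  then show ?thesis by (rule that)
qed

text \<open>The kernel decreases away from x, so the centred interval of the same measure is
  extremal.\<close>

lemma bathtub:
  assumes [measurable]: "D \<in> sets borel" and D: "emeasure lborel D = ennreal \<delta>" "0 \<le> \<delta>"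
  shows "(\<integral>\<^sup>+y. ennreal (\<bar>x - y\<bar> powr (s - 1)) * indicator D y \<partial>lborel) \<le> ennreal (2 / s * (\<delta> / 2) powr s)"
proof (cases "\<delta> = 0")
  case True
  then have "AE y in lborel. y \<notin> D" using D by (intro AE_not_in) (auto simp: null_sets_def)
  then have "AE y in lborel. ennreal (\<bar>x - y\<bar> powr (s - 1)) * indicator D y = 0" by eventually_elim simp
  then have "(\<integral>\<^sup>+y. ennreal (\<bar>x - y\<bar> powr (s - 1)) * indicator D y \<partial>lborel) = 0"
    by (subst nn_integral_0_iff_AE) auto
  then show ?thesis by simp
next
  case False
  define r where "r = \<delta> / 2"
  have r: "0 < r" using False D by (simp add: r_def)
  define B where "B = {x - r..x + r}"
  have [measurable]: "B \<in> sets borel" by (simp add: B_def)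
  define X where "X = (\<integral>\<^sup>+y. ennreal (\<bar>x - y\<bar> powr (s - 1)) * indicator D y \<partial>lborel)"
  have eB: "emeasure lborel B = ennreal \<delta>" using r by (simp add: B_def r_def)
  \<comment> \<open>Adding r powr (s - 1) times the common measure of D and B permits a pointwise
    comparison without subtraction in \<open>ennreal\<close>: inside B the kernel is above its
    boundary value, outside below.\<close>
  have "X + ennreal (r powr (s - 1)) * ennreal \<delta> = (\<integral>\<^sup>+y. ennreal (\<bar>x - y\<bar> powr (s - 1)) * indicator D y + ennreal (r powr (s - 1)) * indicator B y \<partial>lborel)"
    unfolding X_def eB[symmetric] by (simp add: nn_integral_add nn_integral_cmult)
  also have "\<dots> \<le> (\<integral>\<^sup>+y. ennreal (\<bar>x - y\<bar> powr (s - 1)) * indicator B y + ennreal (r powr (s - 1)) * indicator D y \<partial>lborel)"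
  proof (intro nn_integral_mono_AE)
    have "AE y in lborel. y \<noteq> x" by (rule AE_lborel_singleton)
    then show "AE y in lborel. ennreal (\<bar>x - y\<bar> powr (s - 1)) * indicator D y + ennreal (r powr (s - 1)) * indicator B y
      \<le> ennreal (\<bar>x - y\<bar> powr (s - 1)) * indicator B y + ennreal (r powr (s - 1)) * indicator D y"
    proof eventually_elim
      fix y assume y: "y \<noteq> x"
      show "ennreal (\<bar>x - y\<bar> powr (s - 1)) * indicator D y + ennreal (r powr (s - 1)) * indicator B y
      \<le> ennreal (\<bar>x - y\<bar> powr (s - 1)) * indicator B y + ennreal (r powr (s - 1)) * indicator D y"
      proof (cases "y \<in> B")
        case True
        then have "\<bar>x - y\<bar> \<le> r" by (auto simp: B_def)
        then have "r powr (s - 1) \<le> \<bar>x - y\<bar> powr (s - 1)" using y s by (intro powr_mono2') auto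
        then show ?thesis using True by (auto simp: indicator_def ennreal_leI)
      next
        case False
        then have "r \<le> \<bar>x - y\<bar>" by (auto simp: B_def)
        then have "\<bar>x - y\<bar> powr (s - 1) \<le> r powr (s - 1)" using r s by (intro powr_mono2') auto
        then show ?thesis using False by (auto simp: indicator_def ennreal_leI)
      qed
    qed
  qed
  also have "\<dots> = (\<integral>\<^sup>+y. ennreal (\<bar>x - y\<bar> powr (s - 1)) * indicator B y \<partial>lborel) + ennreal (r powr (s - 1)) * ennreal \<delta>"
    unfolding D(1)[symmetric] by (simp add: nn_integral_add nn_integral_cmult)
  also have "(\<integral>\<^sup>+y. ennreal (\<bar>x - y\<bar> powr (s - 1)) * indicator B y \<partial>lborel) = (\<integral>\<^sup>+y. ennreal (\<bar>x - y\<bar> powr (s - 1)) * indicator {-r..r} (x - y) \<partial>lborel)"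
    by (intro nn_integral_cong) (auto simp: B_def indicator_def)
  also have "\<dots> = ennreal (2 * r powr s / s)"
    using nn_integral_shift(4)[of "\<lambda>y. ennreal (\<bar>y\<bar> powr (s - 1)) * indicator {-r..r} y" x] nn_integral_abs_powr_0[of s r] s r by simp
  finally have "X + ennreal (r powr (s - 1)) * ennreal \<delta> \<le> ennreal (2 * r powr s / s) + ennreal (r powr (s - 1)) * ennreal \<delta>" .
  then have "X \<le> ennreal (2 * r powr s / s)"
    by (metis ennreal_add_left_cancel_le add.commute ennreal_mult_eq_top_iff ennreal_neq_top infinity_ennreal_def)
  then show ?thesis unfolding X_def r_def by simp
qed

text \<open>\<open>\<Phi> t \<delta>\<close> bounds the mean, over a set of measure \<open>t\<close>, of the Riesz potential of a set of measure \<open>\<delta>\<close>: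
  the two entries of the minimum apply the bathtub principle in either variable.\<close>

definition \<Phi> :: "real \<Rightarrow> real \<Rightarrow> real" where
  "\<Phi> t \<delta> = min (2 / s * (\<delta> / 2) powr s) (\<delta> / t * (2 / s * (t / 2) powr s))"

text \<open>(\<tau> / 2) powr (s - 1) is the decreasing rearrangement of |x| powr (s - 1); for
  \<tau> \<le> t it is replaced by its mean over (0, t), which is C1 * t powr (s - 1). This is the
  two-part kernel of O'Neil's convolution inequality.\<close>

definition kernel :: "real \<Rightarrow> real \<Rightarrow> real" where
  "kernel t \<tau> = (if \<tau> \<le> t then C1 * t powr (s - 1) else (\<tau> / 2) powr (s - 1))"

lemma kernel_nonneg: "0 \<le> kernel t \<tau>" using C1_pos by (simp add: kernel_def)

lemma kernel_measurable [measurable]: "kernel t \<in> borel_measurable borel" unfolding kernel_def[abs_def] by measurable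

lemma C1_eq: "0 < t \<Longrightarrow> 2 / s * (t / 2) powr s = C1 * t powr s"
  using s by (simp add: C1_def powr_divide powr_diff)

lemma \<Phi>_antimono:
  assumes "0 < t" "t \<le> t'" "0 \<le> \<delta>" shows "\<Phi> t' \<delta> \<le> \<Phi> t \<delta>"
proof -
  have e: "\<delta> / u * (2 / s * (u / 2) powr s) = \<delta> * C1 * u powr (s - 1)" if "0 < u" for u
    unfolding C1_eq[OF that] using that by (simp add: powr_diff)
  have "t' powr (s - 1) \<le> t powr (s - 1)" using assms s by (intro powr_mono2') auto
  then have "\<delta> * C1 * t' powr (s - 1) \<le> \<delta> * C1 * t powr (s - 1)" using assms C1_pos by (intro mult_left_mono) auto
  then have "\<delta> / t' * (2 / s * (t' / 2) powr s) \<le> \<delta> / t * (2 / s * (t / 2) powr s)"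
    using e[of t] e[of t'] assms by linarith
  then show ?thesis unfolding \<Phi>_def by (intro min.mono) auto
qed

text \<open>In the second integral (s - 1) * q = -1 reduces the integrand to 2 / \<tau>; this
  logarithm with its factor 2 decides the critical exponent.\<close>

lemma nn_integral_kernel_tail:
  assumes "0 < a" "a \<le> b"
  shows "(\<integral>\<^sup>+\<tau>. ennreal ((\<tau> / 2) powr (s - 1)) * indicator {a<..b} \<tau> \<partial>lborel) = ennreal (2 / s * (b / 2) powr s - 2 / s * (a / 2) powr s)"
    and "(\<integral>\<^sup>+\<tau>. ennreal (((\<tau> / 2) powr (s - 1)) powr q) * indicator {a<..b} \<tau> \<partial>lborel) = ennreal (2 * ln (b / a))"
proof -
  have oc: "(\<integral>\<^sup>+\<tau>. F \<tau> * indicator {a<..b} \<tau> \<partial>lborel) = (\<integral>\<^sup>+\<tau>. F \<tau> * indicator {a..b} \<tau> \<partial>lborel)" for F :: "real \<Rightarrow> ennreal"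
    by (intro nn_integral_cong_AE AE_I[of _ _ "{a}"]) (auto simp: indicator_def)
  have "(\<integral>\<^sup>+\<tau>. ennreal ((\<tau> / 2) powr (s - 1)) * indicator {a..b} \<tau> \<partial>lborel) = ennreal (2 / s * (b / 2) powr s - 2 / s * (a / 2) powr s)"
  proof (rule nn_integral_FTC_Icc[where F="\<lambda>\<tau>. 2 / s * (\<tau> / 2) powr s"])
    show "((\<lambda>\<tau>. 2 / s * (\<tau> / 2) powr s) has_real_derivative (\<tau> / 2) powr (s - 1)) (at \<tau>)" if "\<tau> \<in> {a..b}" for \<tau>
      using that assms s by (auto intro!: derivative_eq_intros simp: field_simps powr_diff)
  qed (use assms in auto)
  then show "(\<integral>\<^sup>+\<tau>. ennreal ((\<tau> / 2) powr (s - 1)) * indicator {a<..b} \<tau> \<partial>lborel) = ennreal (2 / s * (b / 2) powr s - 2 / s * (a / 2) powr s)"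
    by (simp only: oc)
  have "(\<integral>\<^sup>+\<tau>. ennreal (2 / \<tau>) * indicator {a..b} \<tau> \<partial>lborel) = ennreal (2 * ln b - 2 * ln a)"
  proof (rule nn_integral_FTC_Icc[where F="\<lambda>\<tau>. 2 * ln \<tau>"])
    show "((\<lambda>\<tau>. 2 * ln \<tau>) has_real_derivative 2 / \<tau>) (at \<tau>)" if "\<tau> \<in> {a..b}" for \<tau>
      using that assms by (auto intro!: derivative_eq_intros simp: field_simps)
  qed (use assms in auto)
  moreover have "(\<integral>\<^sup>+\<tau>. ennreal (((\<tau> / 2) powr (s - 1)) powr q) * indicator {a..b} \<tau> \<partial>lborel) = (\<integral>\<^sup>+\<tau>. ennreal (2 / \<tau>) * indicator {a..b} \<tau> \<partial>lborel)"
  proof (intro nn_integral_cong)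
    fix \<tau>
    show "ennreal (((\<tau> / 2) powr (s - 1)) powr q) * indicator {a..b} \<tau> = ennreal (2 / \<tau>) * indicator {a..b} \<tau>"
    proof (cases "\<tau> \<in> {a..b}")
      case True
      then have "((\<tau> / 2) powr (s - 1)) powr q = (\<tau> / 2) powr (-1)"
        using q by (simp add: powr_powr s_minus_one)
      also have "\<dots> = 2 / \<tau>" using True assms powr_minus_divide[of "\<tau> / 2" 1] by simp
      finally show ?thesis by simp
    qed simp
  qed
  ultimately show "(\<integral>\<^sup>+\<tau>. ennreal (((\<tau> / 2) powr (s - 1)) powr q) * indicator {a<..b} \<tau> \<partial>lborel) = ennreal (2 * ln (b / a))"
    using assms by (simp only: oc) (simp add: ln_div right_diff_distrib)
qed

text \<open>For \<delta> \<le> t the integral equals the second entry of the minimum; for \<delta> >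
  t the flat part and the tail add up to the first.\<close>

lemma \<Phi>_le_kernel:
  assumes t: "0 < t" and \<delta>: "0 \<le> \<delta>"
  shows "ennreal (\<Phi> t \<delta>) \<le> (\<integral>\<^sup>+\<tau>. ennreal (kernel t \<tau>) * indicator {0<..<\<delta>} \<tau> \<partial>lborel)"
proof -
  have cl: "(\<integral>\<^sup>+\<tau>. ennreal (kernel t \<tau>) * indicator {0<..<\<delta>} \<tau> \<partial>lborel) = (\<integral>\<^sup>+\<tau>. ennreal (kernel t \<tau>) * indicator {0<..\<delta>} \<tau> \<partial>lborel)"
    by (intro nn_integral_cong_AE AE_I[of _ _ "{\<delta>}"]) (auto simp: indicator_def)
  show ?thesis
  proof (cases "\<delta> \<le> t")
    case True
    have "(\<integral>\<^sup>+\<tau>. ennreal (kernel t \<tau>) * indicator {0<..\<delta>} \<tau> \<partial>lborel) = (\<integral>\<^sup>+\<tau>. ennreal (C1 * t powr (s - 1)) * indicator {0<..\<delta>} \<tau> \<partial>lborel)"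
      using True by (intro nn_integral_cong) (auto simp: indicator_def kernel_def)
    also have "\<dots> = ennreal (C1 * t powr (s - 1) * \<delta>)" using \<delta> C1_pos by (simp add: nn_integral_cmult ennreal_mult'[symmetric])
    also have "C1 * t powr (s - 1) * \<delta> = \<delta> / t * (2 / s * (t / 2) powr s)" unfolding C1_eq[OF t] using t by (simp add: powr_diff)
    finally show ?thesis unfolding cl by (auto simp: \<Phi>_def intro!: ennreal_leI)
  next
    case False
    have "(\<integral>\<^sup>+\<tau>. ennreal (kernel t \<tau>) * indicator {0<..\<delta>} \<tau> \<partial>lborel)
      = (\<integral>\<^sup>+\<tau>. ennreal (C1 * t powr (s - 1)) * indicator {0<..t} \<tau> + ennreal ((\<tau> / 2) powr (s - 1)) * indicator {t<..\<delta>} \<tau> \<partial>lborel)"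
      using False t by (intro nn_integral_cong) (auto simp: indicator_def kernel_def)
    also have "\<dots> = ennreal (C1 * t powr (s - 1) * t) + ennreal (2 / s * (\<delta> / 2) powr s - 2 / s * (t / 2) powr s)"
      using t False C1_pos nn_integral_kernel_tail(1)[of t \<delta>] by (simp add: nn_integral_add nn_integral_cmult ennreal_mult'[symmetric])
    also have "\<dots> = ennreal (2 / s * (\<delta> / 2) powr s)"
    proof -
      have "C1 * t powr (s - 1) * t = 2 / s * (t / 2) powr s" unfolding C1_eq[OF t] using t by (simp add: powr_diff)
      moreover have "2 / s * (t / 2) powr s \<le> 2 / s * (\<delta> / 2) powr s" using t False s by (intro mult_left_mono powr_mono2) auto
      ultimately show ?thesis using s by (simp add: ennreal_plus[symmetric] del: ennreal_plus)
    qed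
    finally show ?thesis unfolding cl by (auto simp: \<Phi>_def intro!: ennreal_leI)
  qed
qed

text \<open>The n-th term is the weight exp (C1 powr q / 2 + 1 - n) attached to the n-th level set,
  times the bound 3 * A * (1 + n) for that set in the measure dt / t.\<close>

definition adams_const :: "real \<Rightarrow> ennreal" where
  "adams_const A = (\<Sum>n. ennreal (exp (C1 powr q / 2 + 1) * exp (- real n) * (3 * (A * (1 + real n)))))"

lemma adams_const_finite: "adams_const A < \<infinity>"
proof -
  have "summable (\<lambda>n. (1 + real n) * exp (- real n))"
  proof (rule summable_comparison_test_bigo)
    show "summable (\<lambda>n. norm (inverse (real n ^ 2)))" using inverse_power_summable[of 2] by simp
    show "(\<lambda>n. (1 + real n) * exp (- real n)) \<in> O(\<lambda>n. inverse (real n ^ 2))" by real_asymp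
  qed
  then have "summable (\<lambda>n. exp (C1 powr q / 2 + 1) * 3 * \<bar>A\<bar> * ((1 + real n) * exp (- real n)))" by (rule summable_mult)
  moreover have "exp (C1 powr q / 2 + 1) * 3 * \<bar>A\<bar> * ((1 + real n) * exp (- real n)) = exp (C1 powr q / 2 + 1) * exp (- real n) * (3 * (\<bar>A\<bar> * (1 + real n)))" for n
    by simp
  ultimately have S: "summable (\<lambda>n. exp (C1 powr q / 2 + 1) * exp (- real n) * (3 * (\<bar>A\<bar> * (1 + real n))))" by (simp only:)
  have "(\<Sum>n. ennreal (exp (C1 powr q / 2 + 1) * exp (- real n) * (3 * (A * (1 + real n)))))
    \<le> (\<Sum>n. ennreal (exp (C1 powr q / 2 + 1) * exp (- real n) * (3 * (\<bar>A\<bar> * (1 + real n)))))"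
    by (intro suminf_le ennreal_leI mult_left_mono mult_right_mono) auto
  also have "\<dots> = ennreal (\<Sum>n. exp (C1 powr q / 2 + 1) * exp (- real n) * (3 * (\<bar>A\<bar> * (1 + real n))))"
    by (rule suminf_ennreal2[OF _ S]) auto
  finally show ?thesis unfolding adams_const_def by (simp add: order_le_less_trans)
qed

end

text \<open>Boundedness and a support of finite measure keep the distribution function and the
  rearrangement real valued. \<open>L\<close> will also bound the set over which the exponential is
  integrated, and it enters the result only as a factor.\<close>

locale adams = conjugate_exponents +
  fixes f :: "real \<Rightarrow> real" and M L :: real
  assumes f_measurable [measurable]: "f \<in> borel_measurable borel"
    and f_bounds: "\<And>x. 0 \<le> f x" "\<And>x. f x \<le> M"
    and L: "0 < L" and f_supp: "emeasure lborel {x. 0 < f x} \<le> ennreal L"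
    and f_norm: "(\<integral>\<^sup>+x. ennreal (f x powr p) \<partial>lborel) \<le> 1"
begin

text \<open>\<open>d\<close> is the distribution function of \<open>f\<close> and \<open>fs\<close> its decreasing rearrangement.\<close>

definition d :: "real \<Rightarrow> real" where "d \<mu> = measure lborel {x. max 0 \<mu> < f x}"

definition fs :: "real \<Rightarrow> real" where "fs \<tau> = measure lborel {\<mu>. \<mu> \<in> {0..M} \<and> \<tau> < d \<mu>}"

lemma em_finite: "emeasure lborel {x. max 0 \<mu> < f x} \<le> ennreal L"
proof -
  have "emeasure lborel {x. max 0 \<mu> < f x} \<le> emeasure lborel {x. 0 < f x}" by (intro emeasure_mono) auto
  also note f_supp
  finally show ?thesis .
qed

lemma d_em: "emeasure lborel {x. max 0 \<mu> < f x} = ennreal (d \<mu>)"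
  unfolding d_def using em_finite[of \<mu>] by (intro emeasure_eq_ennreal_measure) (auto simp: top_unique)

lemma d_nonneg: "0 \<le> d \<mu>" by (simp add: d_def)

lemma d_le_L: "d \<mu> \<le> L" using em_finite[of \<mu>] L unfolding d_em by simp

lemma d_antimono: "\<mu> \<le> \<nu> \<Longrightarrow> d \<nu> \<le> d \<mu>"
proof -
  assume "\<mu> \<le> \<nu>"
  then have "emeasure lborel {x. max 0 \<nu> < f x} \<le> emeasure lborel {x. max 0 \<mu> < f x}" by (intro emeasure_mono) auto
  then show "d \<nu> \<le> d \<mu>" unfolding d_em using d_nonneg by simp
qed

lemma d_measurable [measurable]: "d \<in> borel_measurable borel"
proof -
  have "(\<lambda>\<mu>. - d \<mu>) \<in> borel_measurable borel" by (intro borel_measurable_mono monoI) (simp add: d_antimono)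
  then have "(\<lambda>\<mu>. - (- d \<mu>)) \<in> borel_measurable borel" by measurable
  then show ?thesis by simp
qed

lemma fs_em: "emeasure lborel {\<mu>. \<mu> \<in> {0..M} \<and> \<tau> < d \<mu>} = ennreal (fs \<tau>)"
proof -
  have "emeasure lborel {\<mu>. \<mu> \<in> {0..M} \<and> \<tau> < d \<mu>} \<le> emeasure lborel {0..M}" by (intro emeasure_mono) auto
  then show ?thesis unfolding fs_def by (intro emeasure_eq_ennreal_measure) (auto simp: top_unique emeasure_lborel_Icc_eq)
qed

lemma fs_nonneg: "0 \<le> fs \<tau>" by (simp add: fs_def)

lemma fs_measurable [measurable]: "fs \<in> borel_measurable borel"
proof -
  have "fs \<tau>' \<le> fs \<tau>" if "\<tau> \<le> \<tau>'" for \<tau> \<tau>'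
  proof -
    have "emeasure lborel {\<mu>. \<mu> \<in> {0..M} \<and> \<tau>' < d \<mu>} \<le> emeasure lborel {\<mu>. \<mu> \<in> {0..M} \<and> \<tau> < d \<mu>}"
      using that by (intro emeasure_mono) auto
    then show ?thesis unfolding fs_em using fs_nonneg by simp
  qed
  then have "(\<lambda>\<mu>. - fs \<mu>) \<in> borel_measurable borel" by (intro borel_measurable_mono monoI) simp
  then have "(\<lambda>\<mu>. - (- fs \<mu>)) \<in> borel_measurable borel" by measurable
  then show ?thesis by simp
qed

text \<open>If d \<mu> \<le> \<tau>, monotonicity of \<open>d\<close> leaves only heights up to
  \<mu> in the set measured by \<open>fs \<tau>\<close>, which then cannot exceed \<mu>.\<close>

lemma fs_gt: "0 \<le> \<mu> \<Longrightarrow> \<mu> < fs \<tau> \<Longrightarrow> \<tau> < d \<mu>"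
proof (rule ccontr)
  assume \<mu>: "0 \<le> \<mu>" "\<mu> < fs \<tau>" and "\<not> \<tau> < d \<mu>"
  then have "d \<nu> \<le> \<tau>" if "\<mu> \<le> \<nu>" for \<nu> using d_antimono[OF that] by linarith
  then have "{\<nu>. \<nu> \<in> {0..M} \<and> \<tau> < d \<nu>} \<subseteq> {0..\<mu>}" by (auto simp: not_le) (meson linorder_not_le nle_le)
  then have "emeasure lborel {\<nu>. \<nu> \<in> {0..M} \<and> \<tau> < d \<nu>} \<le> emeasure lborel {0..\<mu>}" by (intro emeasure_mono) auto
  then show False using \<mu> unfolding fs_em by simp
qed

lemma fs_eq_0: "L \<le> \<tau> \<Longrightarrow> fs \<tau> = 0"
proof -
  assume "L \<le> \<tau>"
  then have "\<not> \<tau> < d \<mu>" for \<mu> using d_le_L[of \<mu>] by linarith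
  then have "{\<mu>. \<mu> \<in> {0..M} \<and> \<tau> < d \<mu>} = {}" by simp
  then show ?thesis unfolding fs_def by (metis measure_empty)
qed

lemma layer_powr:
  assumes "0 \<le> (u::real)"
  shows "ennreal (u powr p) = (\<integral>\<^sup>+\<mu>. ennreal (p * \<mu> powr (p - 1)) * indicator {0..<u} \<mu> \<partial>lborel)"
proof -
  have "(\<integral>\<^sup>+\<mu>. ennreal (p * \<mu> powr (p - 1)) * indicator {0..<u} \<mu> \<partial>lborel) = (\<integral>\<^sup>+\<mu>. ennreal p * (ennreal (\<mu> powr (p - 1)) * indicator {0..u} \<mu>) \<partial>lborel)"
    using p by (intro nn_integral_cong_AE AE_I[of _ _ "{u}"]) (auto simp: indicator_def ennreal_mult')
  also have "\<dots> = ennreal p * ennreal (u powr p / p)"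
    using nn_integral_powr_0[of p u] assms p by (simp add: nn_integral_cmult)
  also have "\<dots> = ennreal (u powr p)" using p by (simp flip: ennreal_mult')
  finally show ?thesis ..
qed

text \<open>Layer cake on both sides: for a height \<mu> the admissible \<tau> fill an interval of
  length d \<mu>, which is the measure of the set where f exceeds \<mu>.\<close>

lemma fs_norm: "(\<integral>\<^sup>+\<tau>. ennreal (fs \<tau> powr p) * indicator {0<..} \<tau> \<partial>lborel) \<le> 1"
proof -
  have "(\<integral>\<^sup>+\<tau>. ennreal (fs \<tau> powr p) * indicator {0<..} \<tau> \<partial>lborel)
      = (\<integral>\<^sup>+\<tau>. \<integral>\<^sup>+\<mu>. ennreal (p * \<mu> powr (p - 1)) * indicator {0..<fs \<tau>} \<mu> * indicator {0<..} \<tau> \<partial>lborel \<partial>lborel)"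
    unfolding layer_powr[OF fs_nonneg] by (intro nn_integral_cong nn_integral_multc[symmetric]) measurable
  also have "\<dots> \<le> (\<integral>\<^sup>+\<tau>. \<integral>\<^sup>+\<mu>. ennreal (p * \<mu> powr (p - 1)) * indicator {0..} \<mu> * (indicator {0<..} \<tau> * indicator {\<tau><..} (d \<mu>)) \<partial>lborel \<partial>lborel)"
    by (intro nn_integral_mono) (auto simp: indicator_def dest: fs_gt)
  also have "\<dots> = (\<integral>\<^sup>+\<mu>. \<integral>\<^sup>+\<tau>. ennreal (p * \<mu> powr (p - 1)) * indicator {0..} \<mu> * (indicator {0<..} \<tau> * indicator {\<tau><..} (d \<mu>)) \<partial>lborel \<partial>lborel)"
    by (rule lborel_Tonelli) (simp add: greaterThan_def, measurable)
  also have "\<dots> = (\<integral>\<^sup>+\<mu>. \<integral>\<^sup>+y. ennreal (p * \<mu> powr (p - 1)) * indicator {0..<f y} \<mu> \<partial>lborel \<partial>lborel)"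
  proof (rule nn_integral_cong)
    fix \<mu>
    have "(\<integral>\<^sup>+\<tau>. ennreal (p * \<mu> powr (p - 1)) * indicator {0..} \<mu> * (indicator {0<..} \<tau> * indicator {\<tau><..} (d \<mu>)) \<partial>lborel)
       = (\<integral>\<^sup>+\<tau>. ennreal (p * \<mu> powr (p - 1)) * indicator {0..} \<mu> * indicator {0<..<d \<mu>} \<tau> \<partial>lborel)"
      by (intro nn_integral_cong) (auto simp: indicator_def)
    also have "\<dots> = ennreal (p * \<mu> powr (p - 1)) * indicator {0..} \<mu> * ennreal (d \<mu>)"
      using d_nonneg[of \<mu>] by (subst nn_integral_cmult) auto
    also have "\<dots> = ennreal (p * \<mu> powr (p - 1)) * indicator {0..} \<mu> * (\<integral>\<^sup>+y. indicator {x. max 0 \<mu> < f x} y \<partial>lborel)"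
      unfolding d_em[symmetric] by simp
    also have "\<dots> = (\<integral>\<^sup>+y. ennreal (p * \<mu> powr (p - 1)) * indicator {0..} \<mu> * indicator {x. max 0 \<mu> < f x} y \<partial>lborel)"
      by (rule nn_integral_cmult[symmetric]) measurable
    also have "\<dots> = (\<integral>\<^sup>+y. ennreal (p * \<mu> powr (p - 1)) * indicator {0..<f y} \<mu> \<partial>lborel)"
      by (intro nn_integral_cong) (auto simp: indicator_def)
    finally show "(\<integral>\<^sup>+\<tau>. ennreal (p * \<mu> powr (p - 1)) * indicator {0..} \<mu> * (indicator {0<..} \<tau> * indicator {\<tau><..} (d \<mu>)) \<partial>lborel)
        = (\<integral>\<^sup>+y. ennreal (p * \<mu> powr (p - 1)) * indicator {0..<f y} \<mu> \<partial>lborel)" .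
  qed
  also have "\<dots> = (\<integral>\<^sup>+y. \<integral>\<^sup>+\<mu>. ennreal (p * \<mu> powr (p - 1)) * indicator {0..<f y} \<mu> \<partial>lborel \<partial>lborel)"
    by (rule lborel_Tonelli) (simp add: atLeastLessThan_def lessThan_def atLeast_def indicator_def, measurable)
  also have "\<dots> = (\<integral>\<^sup>+y. ennreal (f y powr p) \<partial>lborel)" unfolding layer_powr[OF f_bounds(1)] ..
  also note f_norm
  finally show ?thesis .
qed

text \<open>Adding up the layer bound over the superlevel sets of \<open>f\<close> majorises the
  mean of its Riesz potential over every set of measure t (\<open>potential_on_set\<close>).\<close>

definition G :: "real \<Rightarrow> ennreal" where "G t = (\<integral>\<^sup>+\<mu>. ennreal (\<Phi> t (d \<mu>)) * indicator {0..M} \<mu> \<partial>lborel)"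

lemma G_antimono: "0 < t \<Longrightarrow> t \<le> t' \<Longrightarrow> G t' \<le> G t"
  unfolding G_def by (intro nn_integral_mono mult_right_mono ennreal_leI \<Phi>_antimono d_nonneg) auto

text \<open>With \<open>f\<close> a superposition of indicators of its superlevel sets D, each layer
  is a double integral of a symmetric kernel over D and E; \<open>bathtub\<close> in y or in x gives
  the two entries of \<open>\<Phi>\<close>. Integrating over E, in place of a pointwise estimate, is
  what makes the second one available.\<close>

lemma potential_on_set:
  assumes E[measurable]: "E \<in> sets borel" and t: "emeasure lborel E = ennreal t" "0 < t"
  shows "(\<integral>\<^sup>+x. (\<integral>\<^sup>+y. ennreal (\<bar>x - y\<bar> powr (s - 1)) * ennreal (f y) \<partial>lborel) * indicator E x \<partial>lborel) \<le> ennreal t * G t"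
proof -
  define K where "K x y \<mu> = ennreal (\<bar>x - y\<bar> powr (s - 1)) * indicator {0..<f y} \<mu> * indicator E x" for x y \<mu> :: real
  have K1: "K x y \<mu> = ennreal (\<bar>x - y\<bar> powr (s - 1)) * (if 0 \<le> \<mu> \<and> \<mu> < f y then 1 else 0) * indicator E x" for x y \<mu>
    by (simp add: K_def indicator_def)
  have fy: "ennreal (f y) = (\<integral>\<^sup>+\<mu>. indicator {0..<f y} \<mu> \<partial>lborel)" for y using f_bounds(1)[of y] by simp
  have "(\<integral>\<^sup>+x. (\<integral>\<^sup>+y. ennreal (\<bar>x - y\<bar> powr (s - 1)) * ennreal (f y) \<partial>lborel) * indicator E x \<partial>lborel)
     = (\<integral>\<^sup>+x. \<integral>\<^sup>+y. \<integral>\<^sup>+\<mu>. K x y \<mu> \<partial>lborel \<partial>lborel \<partial>lborel)"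
  proof (rule nn_integral_cong)
    fix x
    have "(\<integral>\<^sup>+\<mu>. K x y \<mu> \<partial>lborel) = ennreal (\<bar>x - y\<bar> powr (s - 1)) * ennreal (f y) * indicator E x" for y
      unfolding K_def fy by (subst nn_integral_multc, measurable, subst nn_integral_cmult, measurable)
    then show "(\<integral>\<^sup>+y. ennreal (\<bar>x - y\<bar> powr (s - 1)) * ennreal (f y) \<partial>lborel) * indicator E x = (\<integral>\<^sup>+y. \<integral>\<^sup>+\<mu>. K x y \<mu> \<partial>lborel \<partial>lborel)"
      by (simp add: nn_integral_multc)
  qed
  also have "\<dots> = (\<integral>\<^sup>+x. \<integral>\<^sup>+\<mu>. \<integral>\<^sup>+y. K x y \<mu> \<partial>lborel \<partial>lborel \<partial>lborel)"
    unfolding K1 by (intro nn_integral_cong lborel_Tonelli) measurable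
  also have "\<dots> = (\<integral>\<^sup>+\<mu>. \<integral>\<^sup>+x. \<integral>\<^sup>+y. K x y \<mu> \<partial>lborel \<partial>lborel \<partial>lborel)"
    unfolding K1 by (rule lborel_Tonelli) measurable
  also have "\<dots> \<le> (\<integral>\<^sup>+\<mu>. ennreal t * (ennreal (\<Phi> t (d \<mu>)) * indicator {0..M} \<mu>) \<partial>lborel)"
  proof (rule nn_integral_mono)
    fix \<mu>
    show "(\<integral>\<^sup>+x. \<integral>\<^sup>+y. K x y \<mu> \<partial>lborel \<partial>lborel) \<le> ennreal t * (ennreal (\<Phi> t (d \<mu>)) * indicator {0..M} \<mu>)"
    proof (cases "\<mu> \<in> {0..M}")
      case False
      then have "K x y \<mu> = 0" for x y using f_bounds[of y] by (auto simp: K_def indicator_def)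
      then show ?thesis by simp
    next
      case True
      define D where "D = {x. max 0 \<mu> < f x}"
      have [measurable]: "D \<in> sets borel" unfolding D_def by measurable
      have eD: "emeasure lborel D = ennreal (d \<mu>)" unfolding D_def by (rule d_em)
      have K: "K x y \<mu> = ennreal (\<bar>x - y\<bar> powr (s - 1)) * indicator D y * indicator E x" for x y
        using True by (auto simp: K_def D_def indicator_def)
      have K': "K x y \<mu> = ennreal (\<bar>y - x\<bar> powr (s - 1)) * indicator E x * indicator D y" for x y
        unfolding K by (simp add: abs_minus_commute mult_ac)
      have "(\<integral>\<^sup>+x. \<integral>\<^sup>+y. K x y \<mu> \<partial>lborel \<partial>lborel) \<le> (\<integral>\<^sup>+x. ennreal (2 / s * (d \<mu> / 2) powr s) * indicator E x \<partial>lborel)"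
        unfolding K by (intro nn_integral_mono, subst nn_integral_multc, measurable)
          (intro mult_right_mono bathtub d_nonneg eD, auto)
      also have "\<dots> = ennreal (t * (2 / s * (d \<mu> / 2) powr s))" by (subst nn_integral_cmult_indicator) (use t s in \<open>auto simp: ennreal_mult'[symmetric] mult_ac\<close>)
      finally have 1: "(\<integral>\<^sup>+x. \<integral>\<^sup>+y. K x y \<mu> \<partial>lborel \<partial>lborel) \<le> ennreal (t * (2 / s * (d \<mu> / 2) powr s))" .
      have "(\<integral>\<^sup>+x. \<integral>\<^sup>+y. K x y \<mu> \<partial>lborel \<partial>lborel) = (\<integral>\<^sup>+y. \<integral>\<^sup>+x. K x y \<mu> \<partial>lborel \<partial>lborel)"
        unfolding K by (rule lborel_Tonelli) measurable
      also have "\<dots> \<le> (\<integral>\<^sup>+y. ennreal (2 / s * (t / 2) powr s) * indicator D y \<partial>lborel)"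
        unfolding K' by (intro nn_integral_mono, subst nn_integral_multc, measurable)
          (intro mult_right_mono bathtub, use t in auto)
      also have "\<dots> = ennreal (t * (d \<mu> / t * (2 / s * (t / 2) powr s)))"
        by (subst nn_integral_cmult_indicator) (use t s d_nonneg[of \<mu>] in \<open>auto simp: eD ennreal_mult'[symmetric] mult_ac\<close>)
      finally have 2: "(\<integral>\<^sup>+x. \<integral>\<^sup>+y. K x y \<mu> \<partial>lborel \<partial>lborel) \<le> ennreal (t * (d \<mu> / t * (2 / s * (t / 2) powr s)))" .
      have "ennreal t * (ennreal (\<Phi> t (d \<mu>)) * indicator {0..M} \<mu>) = ennreal (t * \<Phi> t (d \<mu>))"
        using True t by (simp add: ennreal_mult'[symmetric])
      then show ?thesis using 1 2 unfolding \<Phi>_def by (auto simp: min_def)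
    qed
  qed
  also have "\<dots> = ennreal t * G t" unfolding G_def \<Phi>_def by (rule nn_integral_cmult) measurable
  finally show ?thesis .
qed

text \<open>After the integrals are exchanged, the heights \<mu> with \<tau> < d \<mu> have total
  length \<open>fs \<tau>\<close>. This is the step from layers to the rearrangement in an
  inequality of O'Neil's type.\<close>

lemma G_le_kernel: "0 < t \<Longrightarrow> G t \<le> (\<integral>\<^sup>+\<tau>. ennreal (kernel t \<tau> * fs \<tau>) * indicator {0<..} \<tau> \<partial>lborel)"
proof -
  assume t: "0 < t"
  define K where "K \<mu> \<tau> = ennreal (kernel t \<tau>) * ((if 0 < \<tau> \<and> \<tau> < d \<mu> then 1 else 0) * indicator {0..M} \<mu>)" for \<mu> \<tau> :: real
  have "G t \<le> (\<integral>\<^sup>+\<mu>. \<integral>\<^sup>+\<tau>. K \<mu> \<tau> \<partial>lborel \<partial>lborel)"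
    unfolding G_def
  proof (rule nn_integral_mono)
    fix \<mu>
    have "ennreal (\<Phi> t (d \<mu>)) * indicator {0..M} \<mu> \<le> (\<integral>\<^sup>+\<tau>. ennreal (kernel t \<tau>) * indicator {0<..<d \<mu>} \<tau> \<partial>lborel) * indicator {0..M} \<mu>"
      by (intro mult_right_mono \<Phi>_le_kernel t d_nonneg) auto
    also have "\<dots> = (\<integral>\<^sup>+\<tau>. K \<mu> \<tau> \<partial>lborel)"
      by (cases "\<mu> \<in> {0..M}") (auto simp: K_def indicator_def intro!: nn_integral_cong)
    finally show "ennreal (\<Phi> t (d \<mu>)) * indicator {0..M} \<mu> \<le> (\<integral>\<^sup>+\<tau>. K \<mu> \<tau> \<partial>lborel)" .
  qed
  also have "\<dots> = (\<integral>\<^sup>+\<tau>. \<integral>\<^sup>+\<mu>. K \<mu> \<tau> \<partial>lborel \<partial>lborel)" unfolding K_def by (rule lborel_Tonelli) measurable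
  also have "\<dots> = (\<integral>\<^sup>+\<tau>. ennreal (kernel t \<tau> * fs \<tau>) * indicator {0<..} \<tau> \<partial>lborel)"
  proof (rule nn_integral_cong)
    fix \<tau> :: real
    have "(\<integral>\<^sup>+\<mu>. K \<mu> \<tau> \<partial>lborel) = (\<integral>\<^sup>+\<mu>. (ennreal (kernel t \<tau>) * indicator {0<..} \<tau>) * indicator {\<mu>. \<mu> \<in> {0..M} \<and> \<tau> < d \<mu>} \<mu> \<partial>lborel)"
      by (intro nn_integral_cong) (auto simp: K_def indicator_def)
    also have "\<dots> = ennreal (kernel t \<tau>) * indicator {0<..} \<tau> * ennreal (fs \<tau>)"
      unfolding fs_em[symmetric] by (subst nn_integral_cmult) auto
    finally show "(\<integral>\<^sup>+\<mu>. K \<mu> \<tau> \<partial>lborel) = ennreal (kernel t \<tau> * fs \<tau>) * indicator {0<..} \<tau>"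
      by (simp only: ennreal_mult'[OF kernel_nonneg]) (simp add: mult_ac)
  qed
  finally show ?thesis .
qed

text \<open>The p-norm of the rearrangement on (0, t]. The total being at most 1, the part beyond t
  has p-th power at most 1 - X t powr p; this is the pair fed into Garsia's estimates.\<close>

definition X :: "real \<Rightarrow> real" where
  "X t = (enn2real (\<integral>\<^sup>+\<tau>. ennreal (fs \<tau> powr p) * indicator {0<..t} \<tau> \<partial>lborel)) powr (1 / p)"

lemma X_props: "0 \<le> X t" "X t \<le> 1"
    "(\<integral>\<^sup>+\<tau>. ennreal (fs \<tau> powr p) * indicator {0<..t} \<tau> \<partial>lborel) = ennreal (X t powr p)"
  and X_tail: "0 < t \<Longrightarrow> (\<integral>\<^sup>+\<tau>. ennreal (fs \<tau> powr p) * indicator {t<..} \<tau> \<partial>lborel) \<le> ennreal (1 - X t powr p)"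
proof -
  define m where "m t = (\<integral>\<^sup>+\<tau>. ennreal (fs \<tau> powr p) * indicator {0<..t} \<tau> \<partial>lborel)" for t
  have "m t \<le> (\<integral>\<^sup>+\<tau>. ennreal (fs \<tau> powr p) * indicator {0<..} \<tau> \<partial>lborel)" for t
    unfolding m_def by (intro nn_integral_mono mult_left_mono) (auto simp: indicator_def)
  then have m1: "m t \<le> 1" for t using fs_norm order_trans by blast
  then have m: "m t = ennreal (enn2real (m t))" for t by (metis ennreal_enn2real ennreal_one_less_top order_le_less_trans)
  show X0: "0 \<le> X t" for t by (simp add: X_def)
  have Xp: "X t powr p = enn2real (m t)" for t unfolding X_def m_def[symmetric] by simp
  show eq: "(\<integral>\<^sup>+\<tau>. ennreal (fs \<tau> powr p) * indicator {0<..t} \<tau> \<partial>lborel) = ennreal (X t powr p)" for t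
    unfolding Xp m_def[symmetric] by (rule m)
  have Xp1: "X t powr p \<le> 1" for t unfolding Xp using m1[of t] by (simp add: enn2real_leI)
  show "X t \<le> 1" for t
  proof -
    have "(X t powr p) powr (1 / p) \<le> 1 powr (1 / p)" using Xp1[of t] p by (intro powr_mono2) auto
    then show ?thesis using X0[of t] by simp
  qed
  assume t: "0 < t"
  have "ennreal (X t powr p) + (\<integral>\<^sup>+\<tau>. ennreal (fs \<tau> powr p) * indicator {t<..} \<tau> \<partial>lborel)
    = (\<integral>\<^sup>+\<tau>. ennreal (fs \<tau> powr p) * indicator {0<..t} \<tau> + ennreal (fs \<tau> powr p) * indicator {t<..} \<tau> \<partial>lborel)"
    unfolding eq[symmetric] by (rule nn_integral_add[symmetric]) auto
  also have "\<dots> = (\<integral>\<^sup>+\<tau>. ennreal (fs \<tau> powr p) * indicator {0<..} \<tau> \<partial>lborel)"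
    using t by (intro nn_integral_cong) (auto simp: indicator_def)
  also have "\<dots> \<le> ennreal (X t powr p) + ennreal (1 - X t powr p)"
    using fs_norm Xp1[of t] by (simp add: ennreal_plus[symmetric] del: ennreal_plus)
  finally show "(\<integral>\<^sup>+\<tau>. ennreal (fs \<tau> powr p) * indicator {t<..} \<tau> \<partial>lborel) \<le> ennreal (1 - X t powr p)"
    by (simp add: ennreal_add_left_cancel_le)
qed

lemma holder_tail:
  assumes "0 < a" "a \<le> b" "0 \<le> Z" "(\<integral>\<^sup>+\<tau>. ennreal (fs \<tau> powr p) * indicator {a<..b} \<tau> \<partial>lborel) \<le> ennreal (Z powr p)"
  shows "(\<integral>\<^sup>+\<tau>. ennreal ((\<tau> / 2) powr (s - 1) * fs \<tau>) * indicator {a<..b} \<tau> \<partial>lborel) \<le> ennreal ((2 * ln (b / a)) powr (1 / q) * Z)"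
proof -
  have ln0: "0 \<le> ln (b / a)" using assms by simp
  have "(\<integral>\<^sup>+\<tau>. ennreal ((fs \<tau> * indicator {a<..b} \<tau>) * ((\<tau> / 2) powr (s - 1) * indicator {a<..b} \<tau>)) \<partial>lborel) \<le> ennreal (Z * (2 * ln (b / a)) powr (1 / q))"
  proof (rule holder)
    have "(\<integral>\<^sup>+\<tau>. ennreal ((fs \<tau> * indicator {a<..b} \<tau>) powr p) \<partial>lborel) = (\<integral>\<^sup>+\<tau>. ennreal (fs \<tau> powr p) * indicator {a<..b} \<tau> \<partial>lborel)"
      using p by (intro nn_integral_cong) (auto simp: indicator_def)
    then show "(\<integral>\<^sup>+\<tau>. ennreal ((fs \<tau> * indicator {a<..b} \<tau>) powr p) \<partial>lborel) \<le> ennreal (Z powr p)" using assms by simp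
    have "(\<integral>\<^sup>+\<tau>. ennreal (((\<tau> / 2) powr (s - 1) * indicator {a<..b} \<tau>) powr q) \<partial>lborel) = (\<integral>\<^sup>+\<tau>. ennreal (((\<tau> / 2) powr (s - 1)) powr q) * indicator {a<..b} \<tau> \<partial>lborel)"
      using q by (intro nn_integral_cong) (auto simp: indicator_def)
    then show "(\<integral>\<^sup>+\<tau>. ennreal (((\<tau> / 2) powr (s - 1) * indicator {a<..b} \<tau>) powr q) \<partial>lborel) \<le> ennreal (((2 * ln (b / a)) powr (1 / q)) powr q)"
      using nn_integral_kernel_tail(2)[OF assms(1,2)] ln0 by simp
  qed (use fs_nonneg assms in auto)
  moreover have "ennreal ((fs \<tau> * indicator {a<..b} \<tau>) * ((\<tau> / 2) powr (s - 1) * indicator {a<..b} \<tau>)) = ennreal ((\<tau> / 2) powr (s - 1) * fs \<tau>) * indicator {a<..b} \<tau>" for \<tau>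
    by (auto simp: indicator_def mult.commute)
  ultimately show ?thesis by (simp add: mult.commute)
qed

text \<open>Since (s - 1) * q = -1, the constant C1 * t powr (s - 1) has q-norm C1 on (0, t]
  whatever t is. The norm of \<open>fs\<close> is enlarged to (0, t1] in order to share
  \<open>X t1\<close> with the adjacent piece in \<open>G_bound\<close>.\<close>

lemma holder_head:
  assumes "0 < t" "t \<le> t1"
  shows "(\<integral>\<^sup>+\<tau>. ennreal (C1 * t powr (s - 1) * fs \<tau>) * indicator {0<..t} \<tau> \<partial>lborel) \<le> ennreal (C1 * X t1)"
proof -
  have "(\<integral>\<^sup>+\<tau>. ennreal ((fs \<tau> * indicator {0<..t} \<tau>) * (C1 * t powr (s - 1) * indicator {0<..t} \<tau>)) \<partial>lborel) \<le> ennreal (X t1 * C1)"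
  proof (rule holder)
    have "(\<integral>\<^sup>+\<tau>. ennreal ((fs \<tau> * indicator {0<..t} \<tau>) powr p) \<partial>lborel) \<le> (\<integral>\<^sup>+\<tau>. ennreal (fs \<tau> powr p) * indicator {0<..t1} \<tau> \<partial>lborel)"
      using p assms by (intro nn_integral_mono) (auto simp: indicator_def)
    then show "(\<integral>\<^sup>+\<tau>. ennreal ((fs \<tau> * indicator {0<..t} \<tau>) powr p) \<partial>lborel) \<le> ennreal (X t1 powr p)" using X_props(3)[of t1] by simp
    have "(t powr (s - 1)) powr q * t = 1"
    proof -
      have "(t powr (s - 1)) powr q = t powr (-1)" using q by (simp add: powr_powr s_minus_one)
      then show ?thesis using assms powr_minus_divide[of t 1] by simp
    qed
    then have e: "(C1 * t powr (s - 1)) powr q * t = C1 powr q" using C1_pos by (simp add: powr_mult mult.assoc)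
    have "(\<integral>\<^sup>+\<tau>. ennreal ((C1 * t powr (s - 1) * indicator {0<..t} \<tau>) powr q) \<partial>lborel) = (\<integral>\<^sup>+\<tau>. ennreal ((C1 * t powr (s - 1)) powr q) * indicator {0<..t} \<tau> \<partial>lborel)"
      using q by (intro nn_integral_cong) (auto simp: indicator_def)
    also have "\<dots> = ennreal ((C1 * t powr (s - 1)) powr q * t)" using assms by (simp add: nn_integral_cmult ennreal_mult'[symmetric])
    finally show "(\<integral>\<^sup>+\<tau>. ennreal ((C1 * t powr (s - 1) * indicator {0<..t} \<tau>) powr q) \<partial>lborel) \<le> ennreal (C1 powr q)" unfolding e by simp
  qed (use fs_nonneg X_props C1_pos in auto)
  moreover have "ennreal ((fs \<tau> * indicator {0<..t} \<tau>) * (C1 * t powr (s - 1) * indicator {0<..t} \<tau>)) = ennreal (C1 * t powr (s - 1) * fs \<tau>) * indicator {0<..t} \<tau>" for \<tau>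
    by (auto simp: indicator_def mult.commute)
  ultimately show ?thesis by (simp add: mult.commute)
qed

text \<open>(0, L] is cut at t2 and t1. The first two pieces draw on the same mass
  \<open>X t1\<close>, the last on the remainder, and \<open>fs\<close> vanishes from L on. With t1
  = t2 this is the one-point bound for \<open>garsia_lower\<close>, with t2 < t1 the two-point bound
  for \<open>garsia_close\<close>.\<close>

lemma G_bound:
  assumes t: "0 < t2" "t2 \<le> t1" "t1 \<le> L"
  shows "G t2 \<le> ennreal ((C1 + (2 * ln (t1 / t2)) powr (1 / q)) * X t1 + (2 * ln (L / t1)) powr (1 / q) * (1 - X t1 powr p) powr (1 / p))"
proof -
  have X1: "X t1 powr p \<le> 1" using X_props[of t1] p by (intro powr_le1) auto
  have "G t2 \<le> (\<integral>\<^sup>+\<tau>. ennreal (kernel t2 \<tau> * fs \<tau>) * indicator {0<..} \<tau> \<partial>lborel)" by (rule G_le_kernel[OF t(1)])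
  also have "\<dots> = (\<integral>\<^sup>+\<tau>. (ennreal (C1 * t2 powr (s - 1) * fs \<tau>) * indicator {0<..t2} \<tau> + ennreal ((\<tau> / 2) powr (s - 1) * fs \<tau>) * indicator {t2<..t1} \<tau>)
      + ennreal ((\<tau> / 2) powr (s - 1) * fs \<tau>) * indicator {t1<..L} \<tau> \<partial>lborel)"
    using t fs_eq_0 by (intro nn_integral_cong) (auto simp: indicator_def kernel_def)
  also have "\<dots> = (\<integral>\<^sup>+\<tau>. ennreal (C1 * t2 powr (s - 1) * fs \<tau>) * indicator {0<..t2} \<tau> \<partial>lborel) + (\<integral>\<^sup>+\<tau>. ennreal ((\<tau> / 2) powr (s - 1) * fs \<tau>) * indicator {t2<..t1} \<tau> \<partial>lborel)
      + (\<integral>\<^sup>+\<tau>. ennreal ((\<tau> / 2) powr (s - 1) * fs \<tau>) * indicator {t1<..L} \<tau> \<partial>lborel)"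
    by (subst nn_integral_add, measurable, subst nn_integral_add, measurable)
  also have "\<dots> \<le> ennreal (C1 * X t1) + ennreal ((2 * ln (t1 / t2)) powr (1 / q) * X t1) + ennreal ((2 * ln (L / t1)) powr (1 / q) * (1 - X t1 powr p) powr (1 / p))"
  proof (intro add_mono holder_head holder_tail)
    have "(\<integral>\<^sup>+\<tau>. ennreal (fs \<tau> powr p) * indicator {t2<..t1} \<tau> \<partial>lborel) \<le> (\<integral>\<^sup>+\<tau>. ennreal (fs \<tau> powr p) * indicator {0<..t1} \<tau> \<partial>lborel)"
      using t by (intro nn_integral_mono mult_left_mono) (auto simp: indicator_def)
    then show "(\<integral>\<^sup>+\<tau>. ennreal (fs \<tau> powr p) * indicator {t2<..t1} \<tau> \<partial>lborel) \<le> ennreal (X t1 powr p)" using X_props(3)[of t1] by simp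
    have "(\<integral>\<^sup>+\<tau>. ennreal (fs \<tau> powr p) * indicator {t1<..L} \<tau> \<partial>lborel) \<le> (\<integral>\<^sup>+\<tau>. ennreal (fs \<tau> powr p) * indicator {t1<..} \<tau> \<partial>lborel)"
      by (intro nn_integral_mono mult_left_mono) (auto simp: indicator_def)
    also have "\<dots> \<le> ennreal (1 - X t1 powr p)" using t by (intro X_tail) auto
    finally show "(\<integral>\<^sup>+\<tau>. ennreal (fs \<tau> powr p) * indicator {t1<..L} \<tau> \<partial>lborel) \<le> ennreal (((1 - X t1 powr p) powr (1 / p)) powr p)"
      using X1 by simp
  qed (use t X_props in auto)
  also have "\<dots> = ennreal ((C1 + (2 * ln (t1 / t2)) powr (1 / q)) * X t1 + (2 * ln (L / t1)) powr (1 / q) * (1 - X t1 powr p) powr (1 / p))"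
    using C1_pos X_props(1)[of t1] by (simp add: ennreal_plus[symmetric] distrib_right del: ennreal_plus)
  finally show ?thesis .
qed

section \<open>Garsia's lemma applied to the majorant of the potential\<close>

definition Gr :: "real \<Rightarrow> real" where "Gr t = enn2real (G t)"

lemma Gr: "0 < t \<Longrightarrow> t \<le> L \<Longrightarrow> G t = ennreal (Gr t)" and Gr_nonneg: "0 \<le> Gr t"
  using G_bound[of t t] unfolding Gr_def
  by (auto intro!: ennreal_enn2real[symmetric] dest: order_le_less_trans[OF _ ennreal_less_top])

lemma Gr_bound:
  assumes t: "0 < t2" "t2 \<le> t1" "t1 \<le> L"
  shows "Gr t2 \<le> (C1 + (2 * (ln (L / t2) - ln (L / t1))) powr (1 / q)) * X t1 + (2 * ln (L / t1)) powr (1 / q) * (1 - X t1 powr p) powr (1 / p)"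
proof -
  have e: "ln (L / t2) - ln (L / t1) = ln (t1 / t2)" using t L by (simp add: ln_div)
  have "0 \<le> (C1 + (2 * ln (t1 / t2)) powr (1 / q)) * X t1 + (2 * ln (L / t1)) powr (1 / q) * (1 - X t1 powr p) powr (1 / p)"
    using C1_pos X_props(1)[of t1] by (intro add_nonneg_nonneg mult_nonneg_nonneg) auto
  then show ?thesis unfolding e using G_bound[OF t] unfolding Gr[OF t(1) order_trans[OF t(2,3)]]
    by (simp only: ennreal_le_iff)
qed

lemma Gr_antimono: "0 < t \<Longrightarrow> t \<le> t' \<Longrightarrow> t' \<le> L \<Longrightarrow> Gr t' \<le> Gr t"
  using G_antimono[of t t'] Gr[of t] Gr[of t'] Gr_nonneg by simp

lemma G_measurable [measurable]: "G \<in> borel_measurable borel"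
  unfolding G_def[abs_def] \<Phi>_def by measurable

lemma Gr_measurable [measurable]: "Gr \<in> borel_measurable borel"
  unfolding Gr_def[abs_def] by measurable

lemma Gr_same:
  assumes "0 < t" "t \<le> L" shows "Gr t \<le> C1 * X t + (2 * ln (L / t)) powr (1 / q) * (1 - X t powr p) powr (1 / p)"
  using Gr_bound[of t t] assms by simp

text \<open>In \<theta> = ln (L / t) the measure dt / t is Lebesgue measure. The range [0, a]
  contributes a; beyond a any two points of the set are within a of each other, by the choice of
  \<open>A\<close>, so all of them lie in a window of length 2 * a around one. Hence the factor
  3.\<close>

lemma level_integral:
  assumes A: "garsia_const A" and n: "0 \<le> n"
  shows "(\<integral>\<^sup>+t. ennreal (1 / t) * indicator {t. t \<in> {0<..<L} \<and> ln (L / t) - Gr t powr q / 2 \<le> n} t \<partial>lborel) \<le> ennreal (3 * (A * (1 + n)))"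
proof -
  define a where "a = A * (1 + n)"
  have a: "0 < a" using A n by (auto simp: garsia_const_def a_def)
  define T where "T = {t. t \<in> {0<..<L} \<and> ln (L / t) - Gr t powr q / 2 \<le> n}"
  have [measurable]: "T \<in> sets borel" unfolding T_def by measurable
  have lnint: "(\<integral>\<^sup>+t. ennreal (1 / t) * indicator {x..y} t \<partial>lborel) = ennreal (ln y - ln x)" if "0 < x" "x \<le> y" for x y
  proof (rule nn_integral_FTC_Icc[where F=ln])
    show "(ln has_real_derivative 1 / t) (at t)" if "t \<in> {x..y}" for t
      using that \<open>0 < x\<close> by (auto intro!: derivative_eq_intros simp: field_simps)
  qed (use that in auto)
  have close: "ln (L / t2) - ln (L / t1) \<le> a" if t: "t1 \<in> T" "t2 \<in> T" "t2 \<le> t1" "a < ln (L / t1)" for t1 t2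
  proof -
    have "ln (L / t1) \<le> ln (L / t2)" using t by (auto simp: T_def ln_div)
    moreover have "Gr t1 \<le> C1 * X t1 + (2 * ln (L / t1)) powr (1 / q) * (1 - X t1 powr p) powr (1 / p)"
      using t by (intro Gr_same) (auto simp: T_def)
    moreover have "Gr t2 \<le> (C1 + (2 * (ln (L / t2) - ln (L / t1))) powr (1 / q)) * X t1 + (2 * ln (L / t1)) powr (1 / q) * (1 - X t1 powr p) powr (1 / p)"
      using t by (intro Gr_bound) (auto simp: T_def)
    ultimately show ?thesis
      using A n t X_props(1,2)[of t1] Gr_nonneg unfolding garsia_const_def a_def T_def by blast
  qed
  define S where "S = {t. t \<in> T \<and> a < ln (L / t)}"
  have [measurable]: "S \<in> sets borel" unfolding S_def by measurable
  have "(\<integral>\<^sup>+t. ennreal (1 / t) * indicator T t \<partial>lborel) \<le> (\<integral>\<^sup>+t. ennreal (1 / t) * indicator {L * exp (- a)..L} t + ennreal (1 / t) * indicator S t \<partial>lborel)"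
  proof (rule nn_integral_mono)
    fix t
    have "t \<in> {L * exp (- a)..L} \<or> t \<in> S" if "t \<in> T"
    proof (cases "a < ln (L / t)")
      case False
      have t: "0 < t" "t < L" using that by (auto simp: T_def)
      then have "ln L - a \<le> ln t" using False L by (simp add: ln_div)
      then have "exp (ln L - a) \<le> exp (ln t)" by simp
      then have "L * exp (- a) \<le> t" using t L by (simp add: exp_diff exp_minus field_simps)
      then show ?thesis using t by auto
    qed (use that in \<open>auto simp: S_def\<close>)
    then show "ennreal (1 / t) * indicator T t \<le> ennreal (1 / t) * indicator {L * exp (- a)..L} t + ennreal (1 / t) * indicator S t"
      by (auto simp: indicator_def)
  qed
  also have "\<dots> = ennreal a + (\<integral>\<^sup>+t. ennreal (1 / t) * indicator S t \<partial>lborel)"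
    using lnint[of "L * exp (- a)" L] L a by (subst nn_integral_add) (auto simp: ln_mult)
  also have "(\<integral>\<^sup>+t. ennreal (1 / t) * indicator S t \<partial>lborel) \<le> ennreal (2 * a)"
  proof (cases "S = {}")
    case False
    then obtain t0 where t0: "t0 \<in> S" by auto
    then have t0p: "0 < t0" by (auto simp: S_def T_def)
    have "S \<subseteq> {t0 * exp (- a)..t0 * exp a}"
    proof
      fix t assume t: "t \<in> S"
      then have tp: "0 < t" by (auto simp: S_def T_def)
      have "\<bar>ln t - ln t0\<bar> \<le> a"
        using close[of t0 t] close[of t t0] t t0 tp t0p L by (cases "t \<le> t0") (auto simp: S_def ln_div)
      then have "exp (ln t0 - a) \<le> exp (ln t)" "exp (ln t) \<le> exp (ln t0 + a)" by auto
      then show "t \<in> {t0 * exp (- a)..t0 * exp a}" using tp t0p by (simp add: exp_diff exp_add exp_minus field_simps)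
    qed
    then have "(\<integral>\<^sup>+t. ennreal (1 / t) * indicator S t \<partial>lborel) \<le> (\<integral>\<^sup>+t. ennreal (1 / t) * indicator {t0 * exp (- a)..t0 * exp a} t \<partial>lborel)"
      by (intro nn_integral_mono mult_left_mono) (auto simp: indicator_def)
    also have "\<dots> = ennreal (2 * a)" using lnint[of "t0 * exp (- a)" "t0 * exp a"] t0p a by (simp add: ln_mult)
    finally show ?thesis .
  qed simp
  finally show ?thesis using a unfolding T_def[symmetric] a_def[symmetric]
    by (simp add: ennreal_plus[symmetric] add_left_mono del: ennreal_plus)
qed

text \<open>With \<Psi> = ln (L / t) - Gr t powr q / 2 the integrand is (L / t) * exp (- \<Psi>). In
  the sum over levels of \<Psi> the exponential decay beats the linear growth of the level
  sets.\<close>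

lemma exp_Gr_integral:
  assumes A: "garsia_const A"
  shows "(\<integral>\<^sup>+t. ennreal (exp (Gr t powr q / 2)) * indicator {0<..<L} t \<partial>lborel) \<le> ennreal L * adams_const A"
proof -
  define c0 where "c0 = C1 powr q / 2"
  define T where "T n = {t. t \<in> {0<..<L} \<and> ln (L / t) - Gr t powr q / 2 \<le> real n}" for n :: nat
  have [measurable]: "T n \<in> sets borel" for n unfolding T_def by measurable
  have c0: "0 \<le> c0" by (simp add: c0_def)
  have "(\<integral>\<^sup>+t. ennreal (exp (Gr t powr q / 2)) * indicator {0<..<L} t \<partial>lborel)
    \<le> (\<integral>\<^sup>+t. (\<Sum>n. ennreal (L * exp (c0 + 1) * exp (- real n)) * (ennreal (1 / t) * indicator (T n) t)) \<partial>lborel)"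
  proof (rule nn_integral_mono)
    fix t
    show "ennreal (exp (Gr t powr q / 2)) * indicator {0<..<L} t \<le> (\<Sum>n. ennreal (L * exp (c0 + 1) * exp (- real n)) * (ennreal (1 / t) * indicator (T n) t))"
    proof (cases "t \<in> {0<..<L}")
      case True
      then have t: "0 < t" "t < L" by auto
      define \<Psi> where "\<Psi> = ln (L / t) - Gr t powr q / 2"
      have \<Psi>0: "- c0 \<le> \<Psi>" unfolding \<Psi>_def c0_def
        by (rule garsia_lower[OF _ _ X_props(1,2) Gr_nonneg Gr_same]) (use t C1_pos in auto)
      \<comment> \<open>Negative \<Psi>, which is at least - c0, goes into level 0, and rounding up
        costs at most 1; together this is the factor exp (c0 + 1).\<close>
      define n where "n = nat \<lceil>\<Psi>\<rceil>"
      have n: "\<Psi> \<le> real n" "real n \<le> max 0 \<Psi> + 1" unfolding n_def by linarith+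
      have "exp (- \<Psi>) = exp (Gr t powr q / 2) * exp (- ln (L / t))" unfolding \<Psi>_def exp_add[symmetric] by simp
      also have "exp (- ln (L / t)) = t / L" using t L by (simp add: exp_minus)
      finally have "exp (Gr t powr q / 2) = (L / t) * exp (- \<Psi>)" using t L by simp
      also have "\<dots> \<le> (L / t) * exp (c0 + 1 - real n)"
        using t \<Psi>0 n c0 by (intro mult_left_mono) auto
      also have "\<dots> = L * exp (c0 + 1) * exp (- real n) * (1 / t)" by (simp add: exp_diff exp_minus field_simps)
      finally have "ennreal (exp (Gr t powr q / 2)) \<le> ennreal (L * exp (c0 + 1) * exp (- real n)) * (ennreal (1 / t) * indicator (T n) t)"
        using True n(1) L by (simp add: T_def \<Psi>_def ennreal_mult'[symmetric] ennreal_leI)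
      also have "\<dots> \<le> (\<Sum>n. ennreal (L * exp (c0 + 1) * exp (- real n)) * (ennreal (1 / t) * indicator (T n) t))"
        using sum_le_suminf[of "\<lambda>n. ennreal (L * exp (c0 + 1) * exp (- real n)) * (ennreal (1 / t) * indicator (T n) t)" "{n}"] by simp
      finally show ?thesis using True by simp
    qed simp
  qed
  also have "\<dots> = (\<Sum>n. ennreal (L * exp (c0 + 1) * exp (- real n)) * (\<integral>\<^sup>+t. ennreal (1 / t) * indicator (T n) t \<partial>lborel))"
    by (subst nn_integral_suminf) (auto simp: nn_integral_cmult)
  also have "\<dots> \<le> (\<Sum>n. ennreal (L * exp (c0 + 1) * exp (- real n)) * ennreal (3 * (A * (1 + real n))))"
    unfolding T_def by (intro suminf_le mult_left_mono level_integral A) auto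
  also have "\<dots> = (\<Sum>n. ennreal L * ennreal (exp (c0 + 1) * exp (- real n) * (3 * (A * (1 + real n)))))"
    using A L by (intro suminf_cong) (simp add: ennreal_mult'[symmetric] garsia_const_def mult_ac)
  also have "\<dots> = ennreal L * adams_const A" unfolding adams_const_def c0_def by (rule ennreal_suminf_cmult)
  finally show ?thesis .
qed

text \<open>Distribution functions are compared. If v is at least c on a set E of measure t, then c
  is at most the mean of the potential over E, hence at most \<open>Gr t\<close>; as
  \<open>Gr\<close> decreases, all of (0, t) lies in the corresponding superlevel set of
  \<open>k\<close>. In this way v itself is never rearranged.\<close>

theorem adams_inequality:
  assumes A: "garsia_const A" and [measurable]: "J \<in> sets borel" "v \<in> borel_measurable borel"
    and J: "emeasure lborel J \<le> ennreal L" and v0: "\<And>x. 0 \<le> v x"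
    and v: "\<And>x. x \<in> J \<Longrightarrow> ennreal (v x) \<le> (\<integral>\<^sup>+y. ennreal (\<bar>x - y\<bar> powr (s - 1)) * ennreal (f y) \<partial>lborel)"
  shows "(\<integral>\<^sup>+x. ennreal (exp (v x powr q / 2)) * indicator J x \<partial>lborel) \<le> ennreal L * adams_const A"
proof -
  \<comment> \<open>The strict layer cake is for \<open>g\<close>, the weak one for
    \<open>k\<close>: from y < g x on a set, the mean value argument yields only y \<le> k
    t.\<close>
  have lc1: "ennreal c = (\<integral>\<^sup>+y. (if 0 < y \<and> y < c then 1 else 0) \<partial>lborel)" if "0 \<le> c" for c :: real
  proof -
    have "(\<integral>\<^sup>+y. (if 0 < y \<and> y < c then 1 else 0) \<partial>lborel) = (\<integral>\<^sup>+y. indicator {0<..<c} y \<partial>lborel)"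
      by (intro nn_integral_cong) (auto simp: indicator_def)
    then show ?thesis using that by simp
  qed
  have lc2: "ennreal c = (\<integral>\<^sup>+y. (if 0 < y \<and> y \<le> c then 1 else 0) \<partial>lborel)" if "0 \<le> c" for c :: real
  proof -
    have "(\<integral>\<^sup>+y. (if 0 < y \<and> y \<le> c then 1 else 0) \<partial>lborel) = (\<integral>\<^sup>+y. indicator {0<..c} y \<partial>lborel)"
      by (intro nn_integral_cong) (auto simp: indicator_def)
    then show ?thesis using that by simp
  qed
  define g where "g x = exp (v x powr q / 2)" for x
  define k where "k t = exp (Gr t powr q / 2)" for t
  have [measurable]: "g \<in> borel_measurable borel" "k \<in> borel_measurable borel" unfolding g_def[abs_def] k_def[abs_def] by measurable
  have "(\<integral>\<^sup>+x. ennreal (g x) * indicator J x \<partial>lborel) = (\<integral>\<^sup>+x. \<integral>\<^sup>+y. (if 0 < y \<and> y < g x then 1 else 0) * indicator J x \<partial>lborel \<partial>lborel)"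
    by (subst lc1) (auto simp: g_def intro!: nn_integral_cong nn_integral_multc[symmetric])
  also have "\<dots> = (\<integral>\<^sup>+y. \<integral>\<^sup>+x. (if 0 < y \<and> y < g x then 1 else 0) * indicator J x \<partial>lborel \<partial>lborel)"
    by (rule lborel_Tonelli) measurable
  also have "\<dots> \<le> (\<integral>\<^sup>+y. \<integral>\<^sup>+t. (if 0 < y \<and> y \<le> k t then 1 else 0) * indicator {0<..<L} t \<partial>lborel \<partial>lborel)"
  proof (rule nn_integral_mono)
    fix y :: real
    define E where "E = {x. x \<in> J \<and> y < g x}"
    define E' where "E' = {t. t \<in> {0<..<L} \<and> y \<le> k t}"
    have [measurable]: "E \<in> sets borel" "E' \<in> sets borel" unfolding E_def E'_def by measurable
    show "(\<integral>\<^sup>+x. (if 0 < y \<and> y < g x then 1 else 0) * indicator J x \<partial>lborel) \<le> (\<integral>\<^sup>+t. (if 0 < y \<and> y \<le> k t then 1 else 0) * indicator {0<..<L} t \<partial>lborel)"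
    proof (cases "0 < y")
      case y: True
      have "(\<integral>\<^sup>+x. (if 0 < y \<and> y < g x then 1 else 0) * indicator J x \<partial>lborel) = (\<integral>\<^sup>+x. indicator E x \<partial>lborel)"
        using y by (intro nn_integral_cong) (auto simp: E_def indicator_def)
      also have "\<dots> = emeasure lborel E" by simp
      also have "\<dots> \<le> emeasure lborel E'"
      proof (cases "emeasure lborel E = 0")
        case False
        have EL: "emeasure lborel E \<le> ennreal L"
          using J order_trans emeasure_mono[of E J lborel] by (auto simp: E_def)
        define t where "t = measure lborel E"
        have Et: "emeasure lborel E = ennreal t" unfolding t_def using EL by (intro emeasure_eq_ennreal_measure) (auto simp: top_unique)
        have t: "0 < t" "t \<le> L" using False EL L unfolding Et by (auto simp: t_def ennreal_eq_0_iff not_le zero_less_measure_iff)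
        \<comment> \<open>Heights y \<le> 1 are reached trivially since k \<ge> 1; for y > 1 the
          corresponding level of v is c = (2 * ln y) powr (1 / q).\<close>
        have yk: "y \<le> k t"
        proof (cases "y \<le> 1")
          case True
          have "1 \<le> k t" by (simp add: k_def)
          then show ?thesis using True by linarith
        next
          case F: False
          define c where "c = (2 * ln y) powr (1 / q)"
          have cq: "c powr q = 2 * ln y" using F by (simp add: c_def)
          have cv: "c \<le> v x" if "x \<in> E" for x
          proof -
            have "ln y < v x powr q / 2" using that F ln_less_cancel_iff[of y "g x"] unfolding E_def g_def by simp
            then have "c \<le> (v x powr q) powr (1 / q)" unfolding c_def using F q by (intro powr_mono2) auto
            then show ?thesis using v0 by simp
          qed
          have "ennreal t * ennreal c = (\<integral>\<^sup>+x. ennreal c * indicator E x \<partial>lborel)" by (simp add: nn_integral_cmult Et mult.commute)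
          also have "\<dots> \<le> (\<integral>\<^sup>+x. (\<integral>\<^sup>+y. ennreal (\<bar>x - y\<bar> powr (s - 1)) * ennreal (f y) \<partial>lborel) * indicator E x \<partial>lborel)"
            using cv v by (intro nn_integral_mono) (auto simp: indicator_def E_def intro: order_trans[OF ennreal_leI])
          also have "\<dots> \<le> ennreal t * G t" by (rule potential_on_set) (use Et t in auto)
          also have "\<dots> = ennreal t * ennreal (Gr t)" using Gr t by simp
          finally have "t * c \<le> t * Gr t" using t Gr_nonneg[of t] by (simp add: ennreal_mult'[symmetric])
          then have "c powr q \<le> Gr t powr q" using t q by (intro powr_mono2) (auto simp: c_def)
          then have "ln y \<le> Gr t powr q / 2" unfolding cq by simp
          then show ?thesis using y unfolding k_def by (metis exp_le_cancel_iff exp_ln)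
        qed
        have "{0<..<t} \<subseteq> E'"
        proof
          fix u assume u: "u \<in> {0<..<t}"
          then have "Gr t powr q \<le> Gr u powr q" using t q Gr_nonneg by (intro powr_mono2 Gr_antimono) auto
          then have "k t \<le> k u" by (simp add: k_def)
          then show "u \<in> E'" using yk u t by (auto simp: E'_def)
        qed
        then have "emeasure lborel {0<..<t} \<le> emeasure lborel E'" by (intro emeasure_mono) auto
        then show ?thesis using t unfolding Et by simp
      qed simp
      also have "\<dots> = (\<integral>\<^sup>+t. indicator E' t \<partial>lborel)" by simp
      also have "\<dots> = (\<integral>\<^sup>+t. (if 0 < y \<and> y \<le> k t then 1 else 0) * indicator {0<..<L} t \<partial>lborel)"
        using y by (intro nn_integral_cong) (auto simp: E'_def indicator_def)
      finally show ?thesis .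
    qed simp
  qed
  also have "\<dots> = (\<integral>\<^sup>+t. \<integral>\<^sup>+y. (if 0 < y \<and> y \<le> k t then 1 else 0) * indicator {0<..<L} t \<partial>lborel \<partial>lborel)"
    by (rule lborel_Tonelli) measurable
  also have "\<dots> = (\<integral>\<^sup>+t. ennreal (k t) * indicator {0<..<L} t \<partial>lborel)"
  proof (rule nn_integral_cong)
    fix t
    have "(\<integral>\<^sup>+y. (if 0 < y \<and> y \<le> k t then 1 else 0) * indicator {0<..<L} t \<partial>lborel) = (\<integral>\<^sup>+y. (if 0 < y \<and> y \<le> k t then 1 else 0) \<partial>lborel) * indicator {0<..<L} t"
      by (rule nn_integral_multc) measurable
    also have "(\<integral>\<^sup>+y. (if 0 < y \<and> y \<le> k t then 1 else 0) \<partial>lborel) = ennreal (k t)" by (rule lc2[symmetric]) (simp add: k_def)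
    finally show "(\<integral>\<^sup>+y. (if 0 < y \<and> y \<le> k t then 1 else 0) * indicator {0<..<L} t \<partial>lborel) = ennreal (k t) * indicator {0<..<L} t" .
  qed
  also have "\<dots> \<le> ennreal L * adams_const A" unfolding k_def by (rule exp_Gr_integral[OF A])
  finally show ?thesis unfolding g_def .
qed

end

subsection \<open>Mollification\<close>

definition translation_continuous :: "(real \<Rightarrow> real) \<Rightarrow> bool" where
  "translation_continuous u \<longleftrightarrow> (\<forall>X. X \<longlonglongrightarrow> 0 \<longrightarrow> (\<lambda>n. \<integral>x. \<bar>u (x - X n) - u x\<bar> \<partial>lborel) \<longlonglongrightarrow> 0)"

lemma translation_continuous_approx:
  assumes u: "integrable lborel u"
    and ap: "\<And>e. 0 < e \<Longrightarrow> \<exists>v. integrable lborel v \<and> translation_continuous v \<and> (\<integral>x. \<bar>u x - v x\<bar> \<partial>lborel) < e"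
  shows "translation_continuous u"
  unfolding translation_continuous_def
proof (intro allI impI LIMSEQ_I)
  fix X :: "nat \<Rightarrow> real" and e :: real assume X: "X \<longlonglongrightarrow> 0" and e: "0 < e"
  obtain v where v: "integrable lborel v" "translation_continuous v" "(\<integral>x. \<bar>u x - v x\<bar> \<partial>lborel) < e / 3"
    using ap[of "e / 3"] e by auto
  have "(\<lambda>n. \<integral>x. \<bar>v (x - X n) - v x\<bar> \<partial>lborel) \<longlonglongrightarrow> 0" using v(2) X by (simp add: translation_continuous_def)
  from LIMSEQ_D[OF this, of "e / 3"] e obtain N where N: "\<And>n. n \<ge> N \<Longrightarrow> \<bar>\<integral>x. \<bar>v (x - X n) - v x\<bar> \<partial>lborel\<bar> < e / 3" by auto
  have "norm ((\<integral>x. \<bar>u (x - X n) - u x\<bar> \<partial>lborel) - 0) < e" if "n \<ge> N" for n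
  proof -
    have iu: "integrable lborel (\<lambda>x. u (x - X n))" and iv: "integrable lborel (\<lambda>x. v (x - X n))"
      using u v(1) by (simp_all add: integrable_shift)
    have "(\<integral>x. \<bar>u (x - X n) - u x\<bar> \<partial>lborel) \<le> (\<integral>x. \<bar>u (x - X n) - v (x - X n)\<bar> + \<bar>v (x - X n) - v x\<bar> + \<bar>u x - v x\<bar> \<partial>lborel)"
      using u v(1) iu iv by (intro integral_mono) auto
    also have "\<dots> = (\<integral>x. \<bar>u (x - X n) - v (x - X n)\<bar> \<partial>lborel) + (\<integral>x. \<bar>v (x - X n) - v x\<bar> \<partial>lborel) + (\<integral>x. \<bar>u x - v x\<bar> \<partial>lborel)"
      using u v(1) iu iv by simp
    also have "(\<integral>x. \<bar>u (x - X n) - v (x - X n)\<bar> \<partial>lborel) = (\<integral>x. \<bar>u x - v x\<bar> \<partial>lborel)"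
      by (rule integral_shift(3)[of "\<lambda>x. \<bar>u x - v x\<bar>"])
    also have "(\<integral>x. \<bar>u x - v x\<bar> \<partial>lborel) + (\<integral>x. \<bar>v (x - X n) - v x\<bar> \<partial>lborel) + (\<integral>x. \<bar>u x - v x\<bar> \<partial>lborel) < e"
      using v(3) N[OF that] by linarith
    finally show ?thesis by (simp add: integral_nonneg_AE)
  qed
  then show "\<exists>N. \<forall>n\<ge>N. norm ((\<integral>x. \<bar>u (x - X n) - u x\<bar> \<partial>lborel) - 0) < e" by blast
qed

text \<open>Openness gives convergence at points of U, which stay in U under small shifts. The
  opposite part of the symmetric difference has the same measure by translation invariance, whence
  the factor 2.\<close>

lemma translation_continuous_open:
  assumes U: "open U" and fin: "emeasure lborel U < \<infinity>"
  shows "translation_continuous (indicator U)"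
  unfolding translation_continuous_def
proof (intro allI impI)
  fix X :: "nat \<Rightarrow> real" assume X: "X \<longlonglongrightarrow> 0"
  have [measurable]: "U \<in> sets borel" using U by simp
  have i: "integrable lborel (indicator U :: real \<Rightarrow> real)" using fin by (simp add: integrable_indicator_iff)
  have ih: "integrable lborel (\<lambda>x. indicator U (x - h) :: real)" for h using i by (simp add: integrable_shift)
  have "(\<lambda>n. \<integral>x. max 0 (indicator U x - indicator U (x - X n) :: real) \<partial>lborel) \<longlonglongrightarrow> (\<integral>x. 0 \<partial>(lborel :: real measure))"
  proof (rule integral_dominated_convergence[where w="indicator U"])
    show "AE x in lborel. (\<lambda>n. max 0 (indicator U x - indicator U (x - X n) :: real)) \<longlonglongrightarrow> 0"
    proof (rule AE_I2)
      fix x :: real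
      show "(\<lambda>n. max 0 (indicator U x - indicator U (x - X n) :: real)) \<longlonglongrightarrow> 0"
      proof (cases "x \<in> U")
        case True
        have "(\<lambda>n. x - X n) \<longlonglongrightarrow> x - 0" by (intro tendsto_intros X)
        then have "eventually (\<lambda>n. x - X n \<in> U) sequentially" using U True by (intro topological_tendstoD) auto
        then have "eventually (\<lambda>n. max 0 (indicator U x - indicator U (x - X n) :: real) = 0) sequentially"
          by eventually_elim (simp add: True)
        then show ?thesis by (rule tendsto_eventually)
      next
        case False
        then have "max 0 (indicator U x - indicator U (x - X n) :: real) = 0" for n by (simp add: indicator_def)
        then show ?thesis by simp
      qed
    qed
    show "AE x in lborel. norm (max 0 (indicator U x - indicator U (x - X n) :: real)) \<le> indicator U x" for n
      by (auto simp: indicator_def)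
  qed (use i in auto)
  moreover have "(\<integral>x. \<bar>indicator U (x - h) - indicator U x :: real\<bar> \<partial>lborel) = 2 * (\<integral>x. max 0 (indicator U x - indicator U (x - h) :: real) \<partial>lborel)" for h
  proof -
    have "(\<integral>x. \<bar>indicator U (x - h) - indicator U x :: real\<bar> \<partial>lborel) = (\<integral>x. (indicator U (x - h) - indicator U x) + 2 * max 0 (indicator U x - indicator U (x - h) :: real) \<partial>lborel)"
      by (intro Bochner_Integration.integral_cong) (auto simp: indicator_def)
    also have "\<dots> = (\<integral>x. indicator U (x - h) \<partial>lborel) - (\<integral>x. indicator U x \<partial>lborel) + 2 * (\<integral>x. max 0 (indicator U x - indicator U (x - h) :: real) \<partial>lborel)"
      using i ih[of h] by simp
    finally show ?thesis using integral_shift(3)[of "indicator U :: real \<Rightarrow> real" h] by simp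
  qed
  ultimately show "(\<lambda>n. \<integral>x. \<bar>indicator U (x - X n) - indicator U x :: real\<bar> \<partial>lborel) \<longlonglongrightarrow> 0"
    using tendsto_mult_right_zero[of _ sequentially 2] by simp
qed

lemma translation_continuous_mult:
  assumes "translation_continuous u" shows "translation_continuous (\<lambda>x. u x * c)"
proof -
  have "\<bar>u (x - h) * c - u x * c\<bar> = \<bar>u (x - h) - u x\<bar> * \<bar>c\<bar>" for x h by (simp add: left_diff_distrib[symmetric] abs_mult)
  then show ?thesis using assms unfolding translation_continuous_def by (auto intro: tendsto_mult_left_zero)
qed

text \<open>Continuity of translations in L1, by induction over integrable functions: Borel sets of
  finite measure by outer regularity from open ones, sums by the triangle inequality, dominated
  limits by approximation.\<close>

lemma integrable_translation_continuous:
  assumes "integrable lborel u" shows "translation_continuous u"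
  using assms
proof (induction rule: integrable_induct)
  case (base A c)
  then have [measurable]: "A \<in> sets borel" and fin: "emeasure lborel A < \<infinity>" by auto
  have "translation_continuous (indicator A)"
  proof (rule translation_continuous_approx)
    show "integrable lborel (indicator A :: real \<Rightarrow> real)" using fin by (simp add: integrable_indicator_iff)
    fix e :: real assume e: "0 < e"
    obtain U where U: "open U" "A \<subseteq> U" "emeasure lborel (U - A) < ennreal e"
      using outer_regular_lborel[of A e] e by auto
    have [measurable]: "U \<in> sets borel" using U by simp
    have "emeasure lborel U = emeasure lborel A + emeasure lborel (U - A)"
      using U(2) by (subst plus_emeasure) (auto simp: Un_absorb1)
    also have "\<dots> < \<infinity>" using fin U(3) by (auto simp: less_top[symmetric] top_unique)
    finally have Ufin: "emeasure lborel U < \<infinity>" .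
    have "(\<integral>x. \<bar>indicator A x - indicator U x :: real\<bar> \<partial>lborel) = (\<integral>x. indicator (U - A) x \<partial>lborel)"
      using U(2) by (intro Bochner_Integration.integral_cong) (auto simp: indicator_def)
    also have "\<dots> = measure lborel (U - A)" by simp
    also have "\<dots> < e"
    proof -
      have "emeasure lborel (U - A) < \<infinity>" using order.strict_trans[OF U(3) ennreal_less_top] by simp
      then have "emeasure lborel (U - A) = ennreal (measure lborel (U - A))" by (intro emeasure_eq_ennreal_measure) auto
      then show ?thesis using U(3) e by (simp add: ennreal_less_iff)
    qed
    finally show "\<exists>v. integrable lborel v \<and> translation_continuous v \<and> (\<integral>x. \<bar>indicator A x - v x :: real\<bar> \<partial>lborel) < e"
      using Ufin translation_continuous_open[OF U(1) Ufin] by (intro exI[of _ "indicator U"]) (simp add: integrable_indicator_iff)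
  qed
  from translation_continuous_mult[OF this, of c] show ?case by simp
next
  case (add f g)
  show ?case unfolding translation_continuous_def
  proof (intro allI impI)
    fix X :: "nat \<Rightarrow> real" assume X: "X \<longlonglongrightarrow> 0"
    have fi: "integrable lborel (\<lambda>x. f (x - h))" "integrable lborel (\<lambda>x. g (x - h))" for h using add by (simp_all add: integrable_shift)
    have "(\<lambda>n. (\<integral>x. \<bar>f (x - X n) - f x\<bar> \<partial>lborel) + (\<integral>x. \<bar>g (x - X n) - g x\<bar> \<partial>lborel)) \<longlonglongrightarrow> 0 + 0"
      using add X by (intro tendsto_add) (auto simp: translation_continuous_def)
    moreover have b: "norm (\<integral>x. \<bar>f (x - h) + g (x - h) - (f x + g x)\<bar> \<partial>lborel) \<le> (\<integral>x. \<bar>f (x - h) - f x\<bar> \<partial>lborel) + (\<integral>x. \<bar>g (x - h) - g x\<bar> \<partial>lborel)" for h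
    proof -
      have "(\<integral>x. \<bar>f (x - h) + g (x - h) - (f x + g x)\<bar> \<partial>lborel) \<le> (\<integral>x. \<bar>f (x - h) - f x\<bar> + \<bar>g (x - h) - g x\<bar> \<partial>lborel)"
        using add fi by (intro integral_mono) auto
      also have "\<dots> = (\<integral>x. \<bar>f (x - h) - f x\<bar> \<partial>lborel) + (\<integral>x. \<bar>g (x - h) - g x\<bar> \<partial>lborel)" using add fi by simp
      finally show ?thesis by (simp add: integral_nonneg_AE)
    qed
    ultimately show "(\<lambda>n. \<integral>x. \<bar>f (x - X n) + g (x - X n) - (f x + g x)\<bar> \<partial>lborel) \<longlonglongrightarrow> 0"
      by (intro Lim_null_comparison[OF always_eventually[OF allI[OF b]]]) simp
  qed
next
  case (lim f S)
  show ?case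
  proof (rule translation_continuous_approx[OF lim.hyps(4)])
    fix e :: real assume e: "0 < e"
    have "(\<lambda>i. \<integral>x. \<bar>f x - S i x\<bar> \<partial>lborel) \<longlonglongrightarrow> (\<integral>x. 0 \<partial>(lborel :: real measure))"
    proof (rule integral_dominated_convergence[where w="\<lambda>x. 3 * \<bar>f x\<bar>"])
      show "AE x in lborel. (\<lambda>i. \<bar>f x - S i x\<bar>) \<longlonglongrightarrow> 0"
      proof (rule AE_I2)
        fix x
        have "(\<lambda>i. \<bar>f x - S i x\<bar>) \<longlonglongrightarrow> \<bar>f x - f x\<bar>" using lim.hyps(2)[of x] by (intro tendsto_intros) auto
        then show "(\<lambda>i. \<bar>f x - S i x\<bar>) \<longlonglongrightarrow> 0" by simp
      qed
      show "AE x in lborel. norm \<bar>f x - S i x\<bar> \<le> 3 * \<bar>f x\<bar>" for i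
      proof (rule AE_I2)
        fix x show "norm \<bar>f x - S i x\<bar> \<le> 3 * \<bar>f x\<bar>" using lim.hyps(3)[of x i] by simp
      qed
    qed (use lim.hyps in auto)
    then have "(\<lambda>i. \<integral>x. \<bar>f x - S i x\<bar> \<partial>lborel) \<longlonglongrightarrow> 0" by simp
    from order_tendstoD(2)[OF this e] obtain i where "(\<integral>x. \<bar>f x - S i x\<bar> \<partial>lborel) < e"
      by (auto simp: eventually_sequentially)
    then show "\<exists>v. integrable lborel v \<and> translation_continuous v \<and> (\<integral>x. \<bar>f x - v x\<bar> \<partial>lborel) < e"
      using lim by blast
  qed
qed

section \<open>Approximate identities\<close>

definition mollifier :: "real \<Rightarrow> (real \<Rightarrow> real) \<Rightarrow> bool" where
  "mollifier d r \<longleftrightarrow> test_fun r \<and> (\<forall>x. 0 \<le> r x) \<and> (\<forall>x. r (- x) = r x) \<and> (\<forall>x. d \<le> \<bar>x\<bar> \<longrightarrow> r x = 0) \<and> (\<integral>x. r x \<partial>lborel) = 1"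

lemma mollifier_exists: assumes "0 < d" obtains r where "mollifier d r"
proof -
  obtain \<rho> :: "real \<Rightarrow> real" where \<rho>: "test_fun \<rho>" "\<And>x. 0 \<le> \<rho> x" "\<rho> 0 = 1" "\<And>x. \<rho> (- x) = \<rho> x" "\<And>x. 1 \<le> \<bar>x\<bar> \<Longrightarrow> \<rho> x = 0"
    using bump_exists by blast
  define N where "N = (\<integral>x. \<rho> x \<partial>lborel)"
  have N0: "0 \<le> N" unfolding N_def using \<rho> by (intro integral_nonneg_AE) auto
  \<comment> \<open>A zero integral would make the open set where \<rho> is nonzero a null set, yet
    it contains a ball around 0.\<close>
  have "N \<noteq> 0"
  proof
    assume "N = 0"
    then have ae: "AE x in lborel. \<rho> x = 0"
      unfolding N_def by (subst (asm) integral_nonneg_eq_0_iff_AE[OF test_fun_integrable[OF \<rho>(1)]]) (use \<rho> in auto)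
    have op: "open {x. \<rho> x \<noteq> 0}" by (intro open_Collect_neq test_fun_continuous[OF \<rho>(1)] continuous_on_const)
    then have "emeasure lborel {x. \<rho> x \<noteq> 0} = 0"
      using ae by (subst (asm) AE_iff_measurable[OF _ refl]) auto
    moreover have "0 \<in> {x. \<rho> x \<noteq> 0}" using \<rho>(3) by simp
    then obtain e where e: "0 < e" "cball 0 e \<subseteq> {x. \<rho> x \<noteq> 0}"
      using op unfolding open_contains_cball by blast
    moreover have "emeasure lborel (cball (0::real) e) \<le> emeasure lborel {x. \<rho> x \<noteq> 0}"
      using op e(2) by - (rule emeasure_mono, simp, metis borel_open sets_lborel)
    moreover have "cball (0::real) e = {- e..e}" by (auto simp: dist_real_def)
    ultimately have "emeasure lborel {- e..e} = 0" by (metis le_zero_eq)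
    then show False using e(1) by simp
  qed
  then have N: "0 < N" using N0 by simp
  define r where "r x = 1 / (d * N) * \<rho> (0 + (1 / d) * x)" for x
  have "test_fun r" unfolding r_def by (rule test_fun_affine) (use \<rho> assms in auto)
  moreover have "(\<integral>x. r x \<partial>lborel) = 1"
  proof -
    have "N = \<bar>1 / d\<bar> *\<^sub>R (\<integral>x. \<rho> (0 + (1 / d) * x) \<partial>lborel)" unfolding N_def by (rule lborel_integral_real_affine) (use assms in simp)
    then have "(\<integral>x. \<rho> (0 + (1 / d) * x) \<partial>lborel) = d * N" using assms by (simp add: field_simps)
    then have "1 / (d * N) * (\<integral>x. \<rho> (0 + (1 / d) * x) \<partial>lborel) = 1" using assms N by (metis mult_pos_pos nonzero_eq_divide_eq order_less_irrefl times_divide_eq_left mult_1)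
    then have "(\<integral>x. 1 / (d * N) * \<rho> (0 + (1 / d) * x) \<partial>lborel) = 1" by (metis (no_types) integral_mult_right_zero)
    then show ?thesis unfolding r_def .
  qed
  moreover have "r x = 0" if "d \<le> \<bar>x\<bar>" for x
    using that assms \<rho>(5)[of "x / d"] by (simp add: r_def abs_div field_simps)
  moreover have "0 \<le> r x" "r (- x) = r x" for x
    using \<rho>(2)[of "x / d"] \<rho>(4)[of "x / d"] N assms by (simp_all add: r_def)
  ultimately have "mollifier d r" unfolding mollifier_def by blast
  then show ?thesis by (rule that)
qed

lemma mollifierD:
  assumes "mollifier d r"
  shows "test_fun r" "0 \<le> r x" "r (- x) = r x" "d \<le> \<bar>x\<bar> \<Longrightarrow> r x = 0" "(\<integral>x. r x \<partial>lborel) = 1" "integrable lborel r"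
    "(\<integral>\<^sup>+x. ennreal (r x) \<partial>lborel) = 1" "r \<in> borel_measurable borel"
proof -
  note m = assms[unfolded mollifier_def]
  show i: "integrable lborel r" using m test_fun_integrable by blast
  show "(\<integral>\<^sup>+x. ennreal (r x) \<partial>lborel) = 1" using m by (subst nn_integral_eq_integral[OF i]) auto
  show "r \<in> borel_measurable borel" using m test_fun_measurable by blast
qed (use assms[unfolded mollifier_def] in blast)+

text \<open>Tonelli bounds the error by an average of the L1 modulus of continuity over |h| <
  \<delta>. The width is chosen before the mollifier, so that narrower mollifiers may be substituted
  afterwards.\<close>

lemma mollifier_L1:
  assumes u: "integrable lborel u" and e: "0 < e"
  obtains \<delta> where "0 < \<delta>" "\<And>r. mollifier \<delta> r \<Longrightarrow> (\<integral>\<^sup>+x. ennreal \<bar>(\<integral>y. u y * r (x - y) \<partial>lborel) - u x\<bar> \<partial>lborel) \<le> ennreal e"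
proof -
  note [measurable] = borel_measurable_integrable[OF u]
  define \<omega> where "\<omega> h = (\<integral>x. \<bar>u (x - h) - u x\<bar> \<partial>lborel)" for h
  have "(\<omega> \<longlongrightarrow> 0) (at 0)"
    using integrable_translation_continuous[OF u]
    by (auto simp: translation_continuous_def tendsto_at_iff_sequentially comp_def \<omega>_def)
  then obtain \<delta> where \<delta>: "0 < \<delta>" "\<And>h. h \<noteq> 0 \<Longrightarrow> \<bar>h\<bar> < \<delta> \<Longrightarrow> \<omega> h < e"
  proof -
    have "\<forall>\<^sub>F h in at 0. \<omega> h < e" using \<open>(\<omega> \<longlongrightarrow> 0) (at 0)\<close> e by (rule order_tendstoD(2))
    then obtain \<delta> where "0 < \<delta>" "\<forall>h. h \<noteq> 0 \<and> dist h 0 < \<delta> \<longrightarrow> \<omega> h < e" by (auto simp: eventually_at)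
    then show ?thesis by (intro that[of \<delta>]) auto
  qed
  have \<omega>: "\<omega> h \<le> e" if "\<bar>h\<bar> < \<delta>" for h
    using \<delta>(2)[of h] that e by (cases "h = 0") (auto simp: \<omega>_def less_imp_le)
  have n\<omega>: "(\<integral>\<^sup>+x. ennreal \<bar>u (x - h) - u x\<bar> \<partial>lborel) = ennreal (\<omega> h)" for h
    unfolding \<omega>_def using u by (intro nn_integral_eq_integral) (auto simp: integrable_shift)
  show ?thesis
  proof (rule that[OF \<delta>(1)])
    fix r assume r: "mollifier \<delta> r"
    note [measurable] = mollifierD(8)[OF r]
    have ui: "integrable lborel (\<lambda>y. u y * r (x - y))" for x
      using test_fun_bounded_integrable_mult[OF mollifierD(1)[OF r] u, of x "-1"] by simp
    have ui': "integrable lborel (\<lambda>y. u (x - y) * r y)" for x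
      using ui[of x] integrable_shift(4)[of "\<lambda>y. u y * r (x - y)" x] by simp
    have "(\<integral>\<^sup>+x. ennreal \<bar>(\<integral>y. u y * r (x - y) \<partial>lborel) - u x\<bar> \<partial>lborel) \<le> (\<integral>\<^sup>+x. \<integral>\<^sup>+y. ennreal (\<bar>u (x - y) - u x\<bar> * r y) \<partial>lborel \<partial>lborel)"
    proof (rule nn_integral_mono)
      fix x
      have "(\<integral>y. u y * r (x - y) \<partial>lborel) = (\<integral>y. u (x - y) * r y \<partial>lborel)"
        using integral_shift(4)[of "\<lambda>y. u y * r (x - y)" x] by simp
      then have "(\<integral>y. u y * r (x - y) \<partial>lborel) - u x = (\<integral>y. u (x - y) * r y - u x * r y \<partial>lborel)"
        using ui'[of x] mollifierD(5,6)[OF r] by simp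
      also have "\<dots> = (\<integral>y. (u (x - y) - u x) * r y \<partial>lborel)" by (simp add: left_diff_distrib)
      finally have e: "(\<integral>y. u y * r (x - y) \<partial>lborel) - u x = (\<integral>y. (u (x - y) - u x) * r y \<partial>lborel)" .
      have "integrable lborel (\<lambda>y. (u (x - y) - u x) * r y)" using ui'[of x] mollifierD(6)[OF r] by (simp add: left_diff_distrib)
      from integral_norm_bound_ennreal[OF this]
      show "ennreal \<bar>(\<integral>y. u y * r (x - y) \<partial>lborel) - u x\<bar> \<le> (\<integral>\<^sup>+y. ennreal (\<bar>u (x - y) - u x\<bar> * r y) \<partial>lborel)"
        unfolding e using mollifierD(2)[OF r] by (simp add: abs_mult)
    qed
    also have "\<dots> = (\<integral>\<^sup>+y. \<integral>\<^sup>+x. ennreal (\<bar>u (x - y) - u x\<bar> * r y) \<partial>lborel \<partial>lborel)"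
      by (rule lborel_Tonelli) measurable
    also have "\<dots> = (\<integral>\<^sup>+y. ennreal (\<omega> y) * ennreal (r y) \<partial>lborel)"
      using mollifierD(2)[OF r] by (intro nn_integral_cong) (simp add: ennreal_mult'' nn_integral_multc n\<omega>)
    also have "\<dots> \<le> (\<integral>\<^sup>+y. ennreal e * ennreal (r y) \<partial>lborel)"
    proof (rule nn_integral_mono)
      fix y show "ennreal (\<omega> y) * ennreal (r y) \<le> ennreal e * ennreal (r y)"
        using \<omega>[of y] mollifierD(4)[OF r, of y] by (cases "\<bar>y\<bar> < \<delta>") (auto intro!: mult_right_mono ennreal_leI)
    qed
    also have "\<dots> = ennreal e" by (simp add: nn_integral_cmult mollifierD(7)[OF r])
    finally show "(\<integral>\<^sup>+x. ennreal \<bar>(\<integral>y. u y * r (x - y) \<partial>lborel) - u x\<bar> \<partial>lborel) \<le> ennreal e" .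
  qed
qed

subsection \<open>The upper bound\<close>

context conjugate_exponents
begin

text \<open>Jensen's inequality for the probability density r (x - y), by means of the tangent at
  the average c: after integration the terms (p - 1) * c powr p cancel. Tonelli in x then removes
  the mollifier.\<close>

lemma mollify_powr:
  assumes r: "mollifier d r" and [measurable]: "f \<in> borel_measurable borel" and f0: "\<And>x. 0 \<le> f x" and f: "integrable lborel f"
  shows "(\<integral>\<^sup>+x. ennreal ((\<integral>y. f y * r (x - y) \<partial>lborel) powr p) \<partial>lborel) \<le> (\<integral>\<^sup>+y. ennreal (f y powr p) \<partial>lborel)"
proof -
  note [measurable] = mollifierD(8)[OF r]
  have fi: "integrable lborel (\<lambda>y. f y * r (x - y))" for x
    using test_fun_bounded_integrable_mult[OF mollifierD(1)[OF r] f, of x "-1"] by simp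
  have "ennreal ((\<integral>y. f y * r (x - y) \<partial>lborel) powr p) \<le> (\<integral>\<^sup>+y. ennreal (f y powr p) * ennreal (r (x - y)) \<partial>lborel)" for x
  proof -
    define c where "c = (\<integral>y. f y * r (x - y) \<partial>lborel)"
    have c0: "0 \<le> c" unfolding c_def using f0 mollifierD(2)[OF r] by (intro integral_nonneg_AE) auto
    define k where "k = p * c powr (p - 1)"
    have k0: "0 \<le> k" using p by (simp add: k_def)
    have tangent: "k * t \<le> t powr p + (p - 1) * c powr p" if "0 \<le> t" for t
      unfolding k_def by (rule powr_tangent[OF that c0])
    have ir: "(\<integral>\<^sup>+y. ennreal (r (x - y)) \<partial>lborel) = 1"
      using nn_integral_shift(4)[of "\<lambda>y. ennreal (r y)" x] mollifierD(7)[OF r] by simp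
    have "ennreal (k * c) = ennreal k * (\<integral>\<^sup>+y. ennreal (f y * r (x - y)) \<partial>lborel)"
      using fi[of x] f0 mollifierD(2)[OF r] k0 by (subst nn_integral_eq_integral) (auto simp: c_def ennreal_mult')
    also have "\<dots> = (\<integral>\<^sup>+y. ennreal k * ennreal (f y * r (x - y)) \<partial>lborel)" by (rule nn_integral_cmult[symmetric]) measurable
    also have "\<dots> \<le> (\<integral>\<^sup>+y. ennreal (f y powr p) * ennreal (r (x - y)) + ennreal ((p - 1) * c powr p) * ennreal (r (x - y)) \<partial>lborel)"
    proof (rule nn_integral_mono)
      fix y
      have "(k * f y) * r (x - y) \<le> (f y powr p + (p - 1) * c powr p) * r (x - y)"
        using tangent[OF f0[of y]] mollifierD(2)[OF r] by (intro mult_right_mono) auto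
      then have "ennreal (k * (f y * r (x - y))) \<le> ennreal (f y powr p * r (x - y) + (p - 1) * c powr p * r (x - y))"
        by (intro ennreal_leI) (simp add: algebra_simps)
      then show "ennreal k * ennreal (f y * r (x - y)) \<le> ennreal (f y powr p) * ennreal (r (x - y)) + ennreal ((p - 1) * c powr p) * ennreal (r (x - y))"
        using k0 p mollifierD(2)[OF r] by (simp add: ennreal_mult'[symmetric])
    qed
    also have "\<dots> = (\<integral>\<^sup>+y. ennreal (f y powr p) * ennreal (r (x - y)) \<partial>lborel) + ennreal ((p - 1) * c powr p)"
      using ir by (simp add: nn_integral_add nn_integral_cmult)
    finally have "ennreal (k * c) \<le> (\<integral>\<^sup>+y. ennreal (f y powr p) * ennreal (r (x - y)) \<partial>lborel) + ennreal ((p - 1) * c powr p)" .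
    moreover have "k * c = c powr p + (p - 1) * c powr p"
      using powr_mult_base[OF c0, of "p - 1"] by (simp add: k_def mult_ac algebra_simps)
    ultimately have "ennreal ((p - 1) * c powr p) + ennreal (c powr p) \<le> ennreal ((p - 1) * c powr p) + (\<integral>\<^sup>+y. ennreal (f y powr p) * ennreal (r (x - y)) \<partial>lborel)"
      using p by (simp add: add.commute)
    then show ?thesis unfolding c_def by (simp add: ennreal_add_left_cancel_le)
  qed
  then have "(\<integral>\<^sup>+x. ennreal ((\<integral>y. f y * r (x - y) \<partial>lborel) powr p) \<partial>lborel) \<le> (\<integral>\<^sup>+x. \<integral>\<^sup>+y. ennreal (f y powr p) * ennreal (r (x - y)) \<partial>lborel \<partial>lborel)"
    by (rule nn_integral_mono)
  also have "\<dots> = (\<integral>\<^sup>+y. \<integral>\<^sup>+x. ennreal (f y powr p) * ennreal (r (x - y)) \<partial>lborel \<partial>lborel)" by (rule lborel_Tonelli) measurable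
  also have "\<dots> = (\<integral>\<^sup>+y. ennreal (f y powr p) \<partial>lborel)"
    using nn_integral_shift(3)[of "\<lambda>x. ennreal (r x)"] mollifierD(7)[OF r] by (simp add: nn_integral_cmult)
  finally show ?thesis .
qed

lemma set_integrable_Lp:
  assumes "Lp p g" shows "integrable lborel (\<lambda>x. \<bar>g x\<bar> * indicator {x1..x2} x)"
proof (rule Bochner_Integration.integrable_bound)
  have [measurable]: "g \<in> borel_measurable borel" using assms by (simp add: Lp_def)
  show "integrable lborel (\<lambda>x. indicator {x1..x2} x + \<bar>g x\<bar> powr p)"
    using assms by (intro Bochner_Integration.integrable_add integrable_real_indicator) (auto simp: Lp_def emeasure_lborel_Icc_eq)
  show "AE x in lborel. norm (\<bar>g x\<bar> * indicator {x1..x2} x) \<le> norm (indicator {x1..x2} x + \<bar>g x\<bar> powr p)"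
  proof (rule AE_I2)
    fix x
    have "\<bar>g x\<bar> \<le> 1 + \<bar>g x\<bar> powr p"
    proof (cases "\<bar>g x\<bar> \<le> 1")
      case False
      then have "\<bar>g x\<bar> powr 1 \<le> \<bar>g x\<bar> powr p" using p by (intro powr_mono) auto
      then show ?thesis using False by simp
    qed (simp add: add_increasing2)
    then show "norm (\<bar>g x\<bar> * indicator {x1..x2} x) \<le> norm (indicator {x1..x2} x + \<bar>g x\<bar> powr p)"
      by (auto simp: indicator_def)
  qed
  show "(\<lambda>x. \<bar>g x\<bar> * indicator {x1..x2} x) \<in> borel_measurable lborel" by measurable
qed

text \<open>The reflected translate of r in y is a test function, so the distributional identity
  becomes a pointwise one for the mollified function; \<open>fl_convolution\<close> moves the
  operator from r to the convolution.\<close>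

lemma fl_mollified:
  assumes u: "integrable lborel u" and g: "fraclap_dist (s / 2) u g" and r: "mollifier d r"
  shows "fl s (\<lambda>x. \<integral>y. u y * r (x - y) \<partial>lborel) x = (\<integral>y. g y * r (x - y) \<partial>lborel)"
proof -
  note r_test = mollifierD(1)[OF r]
  have t: "test_fun (\<lambda>y. r (x - y))" using test_fun_affine[OF r_test, of "-1" 1 x] by simp
  have "fraclap (s / 2) (\<lambda>y. complex_of_real (r (x - y))) y = complex_of_real (fl s r (x - y))" for y
    using fraclap_singular_integral[OF t s] by (simp add: fl_translate_reflect)
  moreover have "(\<integral>y. complex_of_real (u y) * fraclap (s / 2) (\<lambda>y. complex_of_real (r (x - y))) y \<partial>lborel)
     = (\<integral>y. complex_of_real (g y) * complex_of_real (r (x - y)) \<partial>lborel)"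
    using g test_fun_schwartz[OF t] unfolding fraclap_dist_def by blast
  ultimately have "complex_of_real (\<integral>y. u y * fl s r (x - y) \<partial>lborel) = complex_of_real (\<integral>y. g y * r (x - y) \<partial>lborel)"
    by (simp only: of_real_mult[symmetric] integral_complex_of_real)
  then have "(\<integral>y. u y * fl s r (x - y) \<partial>lborel) = (\<integral>y. g y * r (x - y) \<partial>lborel)" by (simp only: of_real_eq_iff)
  moreover have "integrable lborel (\<lambda>z. u z * (1 / (1 + \<bar>x - z\<bar> powr (1 + s))))" for x
  proof (rule Bochner_Integration.integrable_bound[OF u])
    note [measurable] = borel_measurable_integrable[OF u]
    show "(\<lambda>z. u z * (1 / (1 + \<bar>x - z\<bar> powr (1 + s)))) \<in> borel_measurable lborel" by measurable
    show "AE z in lborel. norm (u z * (1 / (1 + \<bar>x - z\<bar> powr (1 + s)))) \<le> norm (u z)"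
    proof (rule AE_I2)
      fix z
      have "0 < 1 + \<bar>x - z\<bar> powr (1 + s)" by (simp add: add_pos_nonneg)
      then have "\<bar>1 / (1 + \<bar>x - z\<bar> powr (1 + s))\<bar> \<le> 1" by (simp add: divide_le_eq)
      then show "norm (u z * (1 / (1 + \<bar>x - z\<bar> powr (1 + s)))) \<le> norm (u z)"
        unfolding real_norm_def abs_mult by (rule mult_left_le[OF _ abs_ge_zero])
    qed
  qed
  from fl_convolution(1)[OF r_test s _ this] have "fl s (\<lambda>x. \<integral>y. u y * r (x - y) \<partial>lborel) x = (\<integral>y. u y * fl s r (x - y) \<partial>lborel)"
    using borel_measurable_integrable[OF u] by simp
  ultimately show ?thesis by simp
qed

text \<open>The widths: the mollified function U lives on [a - d, b + d]; there its fractional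
  Laplacian sees g only on [a - 2 * d, b + 2 * d], where |g| is kept as \<open>f\<close>; the
  mollification \<open>h\<close> of \<open>f\<close> lives on [a - 3 * d, b + 3 * d], whose length
  is the \<open>L\<close> of the inequality of Adams. Comparison is applied to U and to its
  negative, and division by N normalises the density.\<close>

lemma mollified_exp_bound:
  assumes A: "garsia_const A" and u: "integrable lborel u" and usupp: "\<And>x. x \<notin> {a<..<b} \<Longrightarrow> u x = 0"
    and ab: "a < b" and g: "Lp p g" "fraclap_dist (s / 2) u g" and d: "0 < d" and r: "mollifier d r"
    and N: "1 \<le> N" "(\<integral>\<^sup>+x. ennreal (\<bar>g x\<bar> powr p) * indicator {a - 2 * d..b + 2 * d} x \<partial>lborel) \<le> ennreal (N powr p)"
  shows "(\<integral>\<^sup>+x. ennreal (exp ((kap s * \<bar>\<integral>y. u y * r (x - y) \<partial>lborel\<bar> / N) powr q / 2)) * indicator {a<..<b} x \<partial>lborel)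
     \<le> ennreal (b - a + 6 * d) * adams_const A"
proof -
  define U where "U x = (\<integral>y. u y * r (x - y) \<partial>lborel)" for x
  define f where "f x = \<bar>g x\<bar> * indicator {a - 2 * d..b + 2 * d} x" for x
  define h where "h x = (\<integral>y. f y * r (x - y) \<partial>lborel)" for x
  have [measurable]: "g \<in> borel_measurable borel" using g by (simp add: Lp_def)
  have f: "integrable lborel f" unfolding f_def[abs_def] by (rule set_integrable_Lp[OF g(1)])
  have fm[measurable]: "f \<in> borel_measurable borel" unfolding f_def[abs_def] by measurable
  have f0: "0 \<le> f x" for x by (simp add: f_def)
  note r_test = mollifierD(1)[OF r]
  have U_test: "test_fun U" unfolding U_def
  proof (rule test_fun_convolution[OF r_test u, of "max \<bar>a\<bar> \<bar>b\<bar>"])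
    fix x assume "max \<bar>a\<bar> \<bar>b\<bar> < \<bar>x\<bar>"
    then show "u x = 0" unfolding max_less_iff_conj by (intro usupp) (auto simp: abs_if split: if_splits)
  qed
  have h_test: "test_fun h" unfolding h_def
    by (rule test_fun_convolution[OF r_test f, of "max \<bar>a - 2 * d\<bar> \<bar>b + 2 * d\<bar>"]) (auto simp: f_def indicator_def)
  note [measurable] = test_fun_measurable[OF U_test] test_fun_measurable[OF h_test]
  have h0: "0 \<le> h x" for x unfolding h_def using f0 mollifierD(2)[OF r] by (intro integral_nonneg_AE) auto
  have U_supp: "U x = 0" if "x \<notin> {a - d..b + d}" for x
  proof -
    have "u y * r (x - y) = 0" for y
    proof (cases "y \<in> {a<..<b}")
      case True
      then have "d \<le> \<bar>x - y\<bar>" using that unfolding atLeastAtMost_iff greaterThanLessThan_iff by linarith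
      then show ?thesis by (simp add: mollifierD(4)[OF r])
    qed (simp add: usupp)
    then have "(\<lambda>y. u y * r (x - y)) = (\<lambda>y. 0)" by blast
    then show ?thesis unfolding U_def by simp
  qed
  have h_supp: "h x = 0" if "x \<notin> {a - 3 * d..b + 3 * d}" for x
  proof -
    have "f y * r (x - y) = 0" for y
    proof (cases "y \<in> {a - 2 * d..b + 2 * d}")
      case True
      then have "d \<le> \<bar>x - y\<bar>" using that unfolding atLeastAtMost_iff by linarith
      then show ?thesis by (simp add: mollifierD(4)[OF r])
    qed (simp add: f_def)
    then have "(\<lambda>y. f y * r (x - y)) = (\<lambda>y. 0)" by blast
    then show ?thesis unfolding h_def by simp
  qed
  have flU: "\<bar>fl s U x\<bar> \<le> h x" if x: "x \<in> {a - d..b + d}" for x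
  proof -
    have e: "\<bar>g y * r (x - y)\<bar> = f y * r (x - y)" for y
    proof (cases "y \<in> {a - 2 * d..b + 2 * d}")
      case False
      then have "d \<le> \<bar>x - y\<bar>" using x unfolding atLeastAtMost_iff by linarith
      then show ?thesis by (simp add: mollifierD(4)[OF r])
    qed (use mollifierD(2)[OF r, of "x - y"] in \<open>simp add: f_def abs_mult\<close>)
    have "\<bar>fl s U x\<bar> = \<bar>\<integral>y. g y * r (x - y) \<partial>lborel\<bar>" unfolding U_def fl_mollified[OF u g(2) r] ..
    also have "\<dots> \<le> (\<integral>y. \<bar>g y * r (x - y)\<bar> \<partial>lborel)" by (rule integral_abs_bound)
    also have "\<dots> = h x" unfolding e h_def ..
    finally show ?thesis .
  qed
  have flm: "fl s (\<lambda>x. - U x) x = - fl s U x" for x using fl_mult[of s "-1" U x] by simp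
  have cmp: "kap s * \<bar>U x\<bar> \<le> (\<integral>z. \<bar>z\<bar> powr (s - 1) * h (x - z) \<partial>lborel)" for x
  proof -
    have "kap s * U x \<le> (\<integral>z. \<bar>z\<bar> powr (s - 1) * h (x - z) \<partial>lborel)"
    proof (rule riesz_comparison[OF U_test h_test s, where A="a - d" and B="b + d"])
      show "fl s U y \<le> h y" if "y \<in> {a - d..b + d}" for y using flU[OF that] by (rule abs_le_D1)
    qed (use U_supp h0 in blast)+
    moreover have "kap s * (- U x) \<le> (\<integral>z. \<bar>z\<bar> powr (s - 1) * h (x - z) \<partial>lborel)"
    proof (rule riesz_comparison[OF test_fun_uminus[OF U_test] h_test s, where A="a - d" and B="b + d"])
      show "fl s (\<lambda>x. - U x) y \<le> h y" if "y \<in> {a - d..b + d}" for y using flU[OF that] unfolding flm by (rule abs_le_D2)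
      show "- U y = 0" if "y \<notin> {a - d..b + d}" for y using U_supp[OF that] by simp
    qed (rule h0)
    ultimately show ?thesis by (simp add: abs_if)
  qed
  obtain M where M: "0 < M" "\<And>x. \<bar>h x\<bar> \<le> M" using test_fun_bounded[OF h_test] by blast
  define F where "F x = h x / N" for x
  have Nnn: "0 < N" using N by simp
  interpret Ad: adams p q s F "M / N" "b - a + 6 * d"
  proof
    show "F \<in> borel_measurable borel" unfolding F_def[abs_def] by measurable
    show "0 \<le> F x" for x using h0 Nnn by (simp add: F_def)
    show "F x \<le> M / N" for x using M(2)[of x] Nnn by (simp add: F_def divide_right_mono)
    show "0 < b - a + 6 * d" using ab d by simp
    have "{x. 0 < F x} \<subseteq> {a - 3 * d..b + 3 * d}"
    proof
      fix x assume "x \<in> {x. 0 < F x}"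
      then have "h x \<noteq> 0" by (auto simp: F_def)
      then show "x \<in> {a - 3 * d..b + 3 * d}" using h_supp by blast
    qed
    then have "emeasure lborel {x. 0 < F x} \<le> emeasure lborel {a - 3 * d..b + 3 * d}" by (rule emeasure_mono) simp
    also have "\<dots> = ennreal ((b + 3 * d) - (a - 3 * d))" using ab d by (subst emeasure_lborel_Icc) auto
    also have "(b + 3 * d) - (a - 3 * d) = b - a + 6 * d" by simp
    finally show "emeasure lborel {x. 0 < F x} \<le> ennreal (b - a + 6 * d)" .
    have "(\<integral>\<^sup>+x. ennreal (h x powr p) \<partial>lborel) \<le> (\<integral>\<^sup>+x. ennreal (f x powr p) \<partial>lborel)"
      unfolding h_def by (rule mollify_powr[OF r fm f0 f])
    also have "\<dots> = (\<integral>\<^sup>+x. ennreal (\<bar>g x\<bar> powr p) * indicator {a - 2 * d..b + 2 * d} x \<partial>lborel)"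
      using p by (intro nn_integral_cong) (auto simp: f_def indicator_def)
    also note N(2)
    finally have "ennreal (1 / N powr p) * (\<integral>\<^sup>+x. ennreal (h x powr p) \<partial>lborel) \<le> ennreal (1 / N powr p) * ennreal (N powr p)"
      by (intro mult_left_mono) auto
    also have "\<dots> = 1" using Nnn by (simp add: ennreal_mult'[symmetric])
    also have "ennreal (1 / N powr p) * (\<integral>\<^sup>+x. ennreal (h x powr p) \<partial>lborel) = (\<integral>\<^sup>+x. ennreal (F x powr p) \<partial>lborel)"
      using h0 Nnn by (subst nn_integral_cmult[symmetric]) (auto simp: F_def powr_divide ennreal_mult'[symmetric] intro!: nn_integral_cong)
    finally show "(\<integral>\<^sup>+x. ennreal (F x powr p) \<partial>lborel) \<le> 1" .
  qed
  show ?thesis unfolding U_def[symmetric]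
  proof (rule Ad.adams_inequality[OF A])
    show "emeasure lborel {a<..<b} \<le> ennreal (b - a + 6 * d)" using ab d by (simp add: ennreal_leI)
    show "0 \<le> kap s * \<bar>U x\<bar> / N" for x using kap_pos[OF s] Nnn by simp
    fix x
    obtain C0 where C0: "0 < C0" "\<And>x. \<bar>h x\<bar> \<le> C0 / (1 + \<bar>x\<bar> powr (1 + s))" using test_fun_decay[OF h_test s(1)] by blast
    have i: "integrable lborel (\<lambda>z. \<bar>z\<bar> powr (s - 1) * h (x - z))"
      by (rule integrable_mult_decay[OF riesz_decay_integrable[OF s] _ _ C0(2)]) measurable
    have "ennreal (kap s * \<bar>U x\<bar> / N) \<le> ennreal ((\<integral>z. \<bar>z\<bar> powr (s - 1) * h (x - z) \<partial>lborel) / N)"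
      using cmp[of x] Nnn by (intro ennreal_leI divide_right_mono) auto
    also have "(\<integral>z. \<bar>z\<bar> powr (s - 1) * h (x - z) \<partial>lborel) / N = (\<integral>z. \<bar>z\<bar> powr (s - 1) * F (x - z) \<partial>lborel)"
      by (simp add: F_def)
    also have "ennreal \<dots> = (\<integral>\<^sup>+z. ennreal (\<bar>z\<bar> powr (s - 1) * F (x - z)) \<partial>lborel)"
      using i by (intro nn_integral_eq_integral[symmetric]) (auto simp: F_def intro!: AE_I2 divide_nonneg_nonneg mult_nonneg_nonneg h0 less_imp_le[OF Nnn])
    also have "\<dots> = (\<integral>\<^sup>+y. ennreal (\<bar>x - y\<bar> powr (s - 1) * F y) \<partial>lborel)"
      using nn_integral_shift(4)[of "\<lambda>z. ennreal (\<bar>z\<bar> powr (s - 1) * F (x - z))" x] by simp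
    also have "\<dots> = (\<integral>\<^sup>+y. ennreal (\<bar>x - y\<bar> powr (s - 1)) * ennreal (F y) \<partial>lborel)" by (simp add: ennreal_mult')
    finally show "ennreal (kap s * \<bar>U x\<bar> / N) \<le> (\<integral>\<^sup>+y. ennreal (\<bar>x - y\<bar> powr (s - 1)) * ennreal (F y) \<partial>lborel)" .
  qed measurable
qed

lemma fraclap_dist_cong_AE:
  assumes "AE x in lborel. u x = v x" "u \<in> borel_measurable borel" "v \<in> borel_measurable borel" "fraclap_dist t u g"
    and meas: "\<And>\<phi>. schwartz \<phi> \<Longrightarrow> fraclap t \<phi> \<in> borel_measurable borel"
  shows "fraclap_dist t v g"
  unfolding fraclap_dist_def
proof (intro conjI allI impI)
  note [measurable] = assms(2,3)
  show "integrable lborel (\<lambda>x. \<bar>v x\<bar> / (1 + \<bar>x\<bar> powr (1 + 2 * t)))"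
    by (rule Bochner_Integration.integrable_cong_AE_imp[of _ "\<lambda>x. \<bar>u x\<bar> / (1 + \<bar>x\<bar> powr (1 + 2 * t))"])
       (use assms in \<open>auto simp: fraclap_dist_def\<close>)
  fix \<phi> assume \<phi>: "schwartz \<phi>"
  note [measurable] = meas[OF \<phi>]
  have "(\<integral>x. complex_of_real (v x) * fraclap t \<phi> x \<partial>lborel) = (\<integral>x. complex_of_real (u x) * fraclap t \<phi> x \<partial>lborel)"
    by (rule integral_cong_AE) (use assms(1) in auto)
  then show "(\<integral>x. complex_of_real (v x) * fraclap t \<phi> x \<partial>lborel) = (\<integral>x. complex_of_real (g x) * \<phi> x \<partial>lborel)"
    using assms(4) \<phi> unfolding fraclap_dist_def by simp
qed

lemma fraclap_measurable:
  assumes "schwartz \<phi>" shows "fraclap t \<phi> \<in> borel_measurable borel"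
proof -
  note [measurable] = schwartz_measurable[OF assms]
  have "(\<lambda>x. \<integral>\<xi>. cis (x * \<xi>) * (complex_of_real (\<bar>\<xi>\<bar> powr (2 * t)) * fourier \<phi> \<xi>) \<partial>lborel) \<in> borel_measurable borel"
    by (rule lborel.borel_measurable_lebesgue_integral) measurable
  then show ?thesis unfolding fraclap_def inv_fourier_def by measurable
qed

lemma alpha_p_eq: "0 \<le> t \<Longrightarrow> alpha_p p * t powr q = (kap s * t) powr q / 2"
proof -
  assume t: "0 \<le> t"
  have "alpha_p p = kap s powr q / 2" unfolding alpha_p_def kap_def q_def s_def by (simp add: mult.commute)
  then show ?thesis using t kap_pos[OF s] by (simp add: powr_mult)
qed

text \<open>As the width tends to 0 the mollified functions converge almost everywhere along a
  subsequence, and Fatou's lemma carries the bound over. The norms on the enlarged intervals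
  converge because |g| powr p is integrable on the whole line.\<close>

theorem exp_bound:
  assumes A: "garsia_const A" and ab: "a < b" and adm: "admissible p a b u"
  shows "(\<integral>\<^sup>+x. ennreal (exp (alpha_p p * \<bar>u x\<bar> powr q)) * indicator {a<..<b} x \<partial>lborel) \<le> ennreal (b - a) * adams_const A"
proof -
  have um[measurable]: "u \<in> borel_measurable borel" and uLp: "Lp p u" and u0: "AE x in lborel. x \<notin> {a<..<b} \<longrightarrow> u x = 0"
    using adm by (auto simp: admissible_def Hsp_tilde_def Hsp_def Lp_def)
  obtain g where g: "Lp p g" "fraclap_dist (1 / (2 * p)) u g" "(\<integral>\<^sup>+x. ennreal (\<bar>g x\<bar> powr p) * indicator {a<..<b} x \<partial>lborel) \<le> 1"
    using adm by (auto simp: admissible_def)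
  have [measurable]: "g \<in> borel_measurable borel" using g by (simp add: Lp_def)
  \<comment> \<open>The support condition holds only almost everywhere; \<open>v\<close> vanishes
    identically off the interval, which makes its mollifications compactly supported.\<close>
  define v where "v x = u x * indicator {a<..<b} x" for x
  have vm[measurable]: "v \<in> borel_measurable borel" unfolding v_def[abs_def] by measurable
  have uv: "AE x in lborel. u x = v x" using u0 by eventually_elim (auto simp: v_def indicator_def)
  have v: "integrable lborel v"
  proof (rule Bochner_Integration.integrable_bound[OF set_integrable_Lp[OF uLp, of a b]])
    show "AE x in lborel. norm (v x) \<le> norm (\<bar>u x\<bar> * indicator {a..b} x)" by (auto simp: v_def indicator_def)
  qed measurable
  have s2: "1 / (2 * p) = s / 2" by (simp add: s_def)
  have vg: "fraclap_dist (s / 2) v g"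
    using fraclap_dist_cong_AE[OF uv um vm g(2)] fraclap_measurable unfolding s2 by blast
  have "\<exists>\<delta> r. 0 < \<delta> \<and> \<delta> \<le> 1 / (real n + 1) \<and> mollifier \<delta> r \<and> (\<integral>\<^sup>+x. ennreal \<bar>(\<integral>y. v y * r (x - y) \<partial>lborel) - v x\<bar> \<partial>lborel) \<le> ennreal (1 / (real n + 1))" for n :: nat
  proof -
    obtain \<delta> where \<delta>: "0 < \<delta>" "\<And>r. mollifier \<delta> r \<Longrightarrow> (\<integral>\<^sup>+x. ennreal \<bar>(\<integral>y. v y * r (x - y) \<partial>lborel) - v x\<bar> \<partial>lborel) \<le> ennreal (1 / (real n + 1))"
    proof (rule mollifier_L1[OF v])
      show "0 < 1 / (real n + 1)" by simp
    qed (rule that)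
    \<comment> \<open>Shrinking the width keeps the L1 estimate, as a mollifier of width \<delta>'
      is also one of width \<delta>.\<close>
    define \<delta>' where "\<delta>' = min \<delta> (1 / (real n + 1))"
    have \<delta>': "0 < \<delta>'" "\<delta>' \<le> \<delta>" "\<delta>' \<le> 1 / (real n + 1)" using \<delta>(1) by (auto simp: \<delta>'_def)
    obtain r where r: "mollifier \<delta>' r" using mollifier_exists[OF \<delta>'(1)] by blast
    then have "mollifier \<delta> r" using \<delta>'(2) by (auto simp: mollifier_def)
    from \<delta>(2)[OF this] show ?thesis using \<delta>' r by blast
  qed
  then obtain \<delta> r where \<delta>: "\<And>n. 0 < \<delta> n" "\<And>n. \<delta> n \<le> 1 / (real n + 1)" and r: "\<And>n. mollifier (\<delta> n) (r n)"
    and L1: "\<And>n. (\<integral>\<^sup>+x. ennreal \<bar>(\<integral>y. v y * r n (x - y) \<partial>lborel) - v x\<bar> \<partial>lborel) \<le> ennreal (1 / (real n + 1))"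
  proof -
    assume P: "\<And>n. \<exists>\<delta> r. 0 < \<delta> \<and> \<delta> \<le> 1 / (real n + 1) \<and> mollifier \<delta> r \<and> (\<integral>\<^sup>+x. ennreal \<bar>(\<integral>y. v y * r (x - y) \<partial>lborel) - v x\<bar> \<partial>lborel) \<le> ennreal (1 / (real n + 1))"
    define P where "P n \<delta> r \<longleftrightarrow> 0 < \<delta> \<and> \<delta> \<le> 1 / (real n + 1) \<and> mollifier \<delta> r \<and> (\<integral>\<^sup>+x. ennreal \<bar>(\<integral>y. v y * r (x - y) \<partial>lborel) - v x\<bar> \<partial>lborel) \<le> ennreal (1 / (real n + 1))" for n :: nat and \<delta> r
    have "\<forall>n. \<exists>\<delta> r. P n \<delta> r" using P unfolding P_def by blast
    then obtain \<delta> where "\<forall>n. \<exists>r. P n (\<delta> n) r" by metis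
    then obtain r where "\<forall>n. P n (\<delta> n) (r n)" by metis
    then show ?thesis unfolding P_def by (intro that[of \<delta> r]) blast+
  qed
  define U where "U n x = (\<integral>y. v y * r n (x - y) \<partial>lborel)" for n x
  have U_test: "test_fun (U n)" for n unfolding U_def
  proof (rule test_fun_convolution[OF mollifierD(1)[OF r] v, of "max \<bar>a\<bar> \<bar>b\<bar>"])
    fix x assume "max \<bar>a\<bar> \<bar>b\<bar> < \<bar>x\<bar>"
    then have "x \<notin> {a<..<b}" unfolding max_less_iff_conj by (auto simp: abs_if split: if_splits)
    then show "v x = 0" by (simp add: v_def)
  qed
  have Um[measurable]: "U n \<in> borel_measurable borel" for n by (rule test_fun_measurable[OF U_test])
  have Uv: "integrable lborel (\<lambda>x. U n x - v x)" for n using test_fun_integrable[OF U_test] v by auto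
  have \<delta>0: "\<delta> \<longlonglongrightarrow> 0"
    by (rule real_tendsto_sandwich[of "\<lambda>_. 0" _ _ "\<lambda>n. 1 / (real n + 1)"]) (use \<delta> in \<open>auto intro!: always_eventually less_imp_le tendsto_const\<close>, real_asymp)
  have "(\<lambda>n. \<integral>x. norm (U n x - v x) \<partial>lborel) \<longlonglongrightarrow> 0"
  proof (rule real_tendsto_sandwich[of "\<lambda>_. 0" _ _ "\<lambda>n. 1 / (real n + 1)"])
    have "(\<integral>x. norm (U n x - v x) \<partial>lborel) \<le> 1 / (real n + 1)" for n
    proof -
      have "ennreal (\<integral>x. norm (U n x - v x) \<partial>lborel) = (\<integral>\<^sup>+x. ennreal \<bar>U n x - v x\<bar> \<partial>lborel)"
        using Uv[of n] by (subst nn_integral_eq_integral) auto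
      also have "\<dots> \<le> ennreal (1 / (real n + 1))" unfolding U_def by (rule L1)
      finally show ?thesis by (subst (asm) ennreal_le_iff) auto
    qed
    then show "\<forall>\<^sub>F n in sequentially. (\<integral>x. norm (U n x - v x) \<partial>lborel) \<le> 1 / (real n + 1)" by simp
    show "(\<lambda>n. 1 / (real n + 1)) \<longlonglongrightarrow> 0" by real_asymp
  qed auto
  from tendsto_L1_AE_subseq[OF Uv this] obtain k where k: "strict_mono k" "AE x in lborel. (\<lambda>n. U (k n) x - v x) \<longlonglongrightarrow> 0" by blast
  define Np where "Np n = enn2real (\<integral>\<^sup>+x. ennreal (\<bar>g x\<bar> powr p) * indicator {a - 2 * \<delta> n..b + 2 * \<delta> n} x \<partial>lborel)" for n
  have gp: "integrable lborel (\<lambda>x. \<bar>g x\<bar> powr p)" using g(1) by (simp add: Lp_def)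
  have Np: "Np n = (\<integral>x. \<bar>g x\<bar> powr p * indicator {a - 2 * \<delta> n..b + 2 * \<delta> n} x \<partial>lborel)"
     "(\<integral>\<^sup>+x. ennreal (\<bar>g x\<bar> powr p) * indicator {a - 2 * \<delta> n..b + 2 * \<delta> n} x \<partial>lborel) = ennreal (Np n)" for n
  proof -
    have i: "integrable lborel (\<lambda>x. \<bar>g x\<bar> powr p * indicator {a - 2 * \<delta> n..b + 2 * \<delta> n} x)"
      using gp by (intro integrable_real_mult_indicator) auto
    have "(\<integral>\<^sup>+x. ennreal (\<bar>g x\<bar> powr p) * indicator {a - 2 * \<delta> n..b + 2 * \<delta> n} x \<partial>lborel) = (\<integral>\<^sup>+x. ennreal (\<bar>g x\<bar> powr p * indicator {a - 2 * \<delta> n..b + 2 * \<delta> n} x) \<partial>lborel)"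
      by (intro nn_integral_cong) (auto simp: indicator_def)
    also have "\<dots> = ennreal (\<integral>x. \<bar>g x\<bar> powr p * indicator {a - 2 * \<delta> n..b + 2 * \<delta> n} x \<partial>lborel)"
      using i by (intro nn_integral_eq_integral) auto
    finally have e: "(\<integral>\<^sup>+x. ennreal (\<bar>g x\<bar> powr p) * indicator {a - 2 * \<delta> n..b + 2 * \<delta> n} x \<partial>lborel) = ennreal (\<integral>x. \<bar>g x\<bar> powr p * indicator {a - 2 * \<delta> n..b + 2 * \<delta> n} x \<partial>lborel)" .
    show "Np n = (\<integral>x. \<bar>g x\<bar> powr p * indicator {a - 2 * \<delta> n..b + 2 * \<delta> n} x \<partial>lborel)"
      unfolding Np_def e by (intro enn2real_ennreal integral_nonneg_AE) auto
    with e show "(\<integral>\<^sup>+x. ennreal (\<bar>g x\<bar> powr p) * indicator {a - 2 * \<delta> n..b + 2 * \<delta> n} x \<partial>lborel) = ennreal (Np n)" by simp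
  qed
  define I where "I = (\<integral>x. \<bar>g x\<bar> powr p * indicator {a..b} x \<partial>lborel)"
  have I1: "I \<le> 1"
  proof -
    have "ennreal I = (\<integral>\<^sup>+x. ennreal (\<bar>g x\<bar> powr p * indicator {a..b} x) \<partial>lborel)"
      unfolding I_def using gp by (intro nn_integral_eq_integral[symmetric] integrable_real_mult_indicator) auto
    also have "\<dots> = (\<integral>\<^sup>+x. ennreal (\<bar>g x\<bar> powr p) * indicator {a<..<b} x \<partial>lborel)"
      by (intro nn_integral_cong_AE AE_I[of _ _ "{a, b}"]) (auto simp: indicator_def intro!: emeasure_lborel_countable)
    also note g(3)
    finally show ?thesis by (simp add: ennreal_le_1)
  qed
  have NpI: "Np \<longlonglongrightarrow> I"
    unfolding Np(1)[abs_def] I_def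
  proof (rule integral_dominated_convergence[where w="\<lambda>x. \<bar>g x\<bar> powr p"])
    show "AE x in lborel. (\<lambda>n. \<bar>g x\<bar> powr p * indicator {a - 2 * \<delta> n..b + 2 * \<delta> n} x) \<longlonglongrightarrow> \<bar>g x\<bar> powr p * indicator {a..b} x"
    proof (rule AE_I2, rule tendsto_mult[OF tendsto_const], rule tendsto_eventually)
      fix x
      show "\<forall>\<^sub>F n in sequentially. indicator {a - 2 * \<delta> n..b + 2 * \<delta> n} x = (indicator {a..b} x :: real)"
      proof (cases "x \<in> {a..b}")
        case True
        then show ?thesis using \<delta>(1) by (auto simp: indicator_def intro!: always_eventually) (metis add_increasing2 less_imp_le mult_nonneg_nonneg zero_le_numeral diff_le_eq)+
      next
        case False
        define e where "e = max (a - x) (x - b)"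
        have e: "0 < e" using False by (auto simp: e_def)
        have "(\<lambda>n. 2 * \<delta> n) \<longlonglongrightarrow> 2 * 0" by (intro tendsto_intros \<delta>0)
        then have "\<forall>\<^sub>F n in sequentially. 2 * \<delta> n < e" using e by (intro order_tendstoD(2)) auto
        then show ?thesis by eventually_elim (use False in \<open>auto simp: e_def indicator_def max_def split: if_splits\<close>)
      qed
    qed
  qed (use gp in \<open>auto simp: indicator_def intro!: AE_I2\<close>)
  \<comment> \<open>The maximum with 1 keeps the divisor away from 0 when g vanishes near the
    interval; as the limit I is at most 1, \<open>N\<close> still tends to 1.\<close>
  define N where "N n = max 1 (Np n powr (1 / p))" for n
  have Np0: "0 \<le> Np n" for n by (simp add: Np_def)
  have NpN: "Np n \<le> N n powr p" for n
  proof -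
    have "(Np n powr (1 / p)) powr p \<le> N n powr p" unfolding N_def using p by (intro powr_mono2) auto
    then show ?thesis using Np0[of n] by simp
  qed
  have N1: "1 \<le> N n" for n by (simp add: N_def)
  have I0: "0 \<le> I" unfolding I_def by (intro integral_nonneg_AE) auto
  have NL: "N \<longlonglongrightarrow> 1"
  proof -
    have "(\<lambda>n. Np n powr (1 / p)) \<longlonglongrightarrow> I powr (1 / p)"
      using NpI Np0 p by (intro tendsto_powr') auto
    then have "N \<longlonglongrightarrow> max 1 (I powr (1 / p))" unfolding N_def[abs_def] by (intro tendsto_max tendsto_const)
    moreover have "I powr (1 / p) \<le> 1" using I0 I1 p by (intro powr_le1) auto
    ultimately show ?thesis by (simp add: max_def split: if_splits)
  qed
  have bound: "(\<integral>\<^sup>+x. ennreal (exp ((kap s * \<bar>U n x\<bar> / N n) powr q / 2)) * indicator {a<..<b} x \<partial>lborel) \<le> ennreal (b - a + 6 * \<delta> n) * adams_const A" for n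
    unfolding U_def
  proof (rule mollified_exp_bound[OF A v _ ab g(1) vg \<delta>(1) r N1])
    show "(\<integral>\<^sup>+x. ennreal (\<bar>g x\<bar> powr p) * indicator {a - 2 * \<delta> n..b + 2 * \<delta> n} x \<partial>lborel) \<le> ennreal (N n powr p)"
      unfolding Np(2) by (intro ennreal_leI NpN)
  qed (simp add: v_def)
  have kk: "(\<lambda>n. f (k n)) \<longlonglongrightarrow> l" if "f \<longlonglongrightarrow> l" for f :: "nat \<Rightarrow> real" and l
    using LIMSEQ_subseq_LIMSEQ[OF that k(1)] by (simp add: comp_def)
  have "(\<integral>\<^sup>+x. ennreal (exp (alpha_p p * \<bar>u x\<bar> powr q)) * indicator {a<..<b} x \<partial>lborel)
    = (\<integral>\<^sup>+x. liminf (\<lambda>n. ennreal (exp ((kap s * \<bar>U (k n) x\<bar> / N (k n)) powr q / 2)) * indicator {a<..<b} x) \<partial>lborel)"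
  proof (rule nn_integral_cong_AE, use k(2) uv in eventually_elim)
    fix x assume x: "(\<lambda>n. U (k n) x - v x) \<longlonglongrightarrow> 0" "u x = v x"
    have "(\<lambda>n. (U (k n) x - v x) + v x) \<longlonglongrightarrow> 0 + v x" by (intro tendsto_intros x)
    then have Ux: "(\<lambda>n. U (k n) x) \<longlonglongrightarrow> u x" using x(2) by simp
    have "(\<lambda>n. kap s * \<bar>U (k n) x\<bar> / N (k n)) \<longlonglongrightarrow> kap s * \<bar>u x\<bar> / 1"
      by (intro tendsto_intros Ux kk[OF NL]) simp
    then have "(\<lambda>n. kap s * \<bar>U (k n) x\<bar> / N (k n)) \<longlonglongrightarrow> kap s * \<bar>u x\<bar>" by simp
    then have "(\<lambda>n. (kap s * \<bar>U (k n) x\<bar> / N (k n)) powr q) \<longlonglongrightarrow> (kap s * \<bar>u x\<bar>) powr q"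
    proof (rule tendsto_powr')
      show "kap s * \<bar>u x\<bar> \<noteq> 0 \<or> 0 < q \<and> (\<forall>\<^sub>F n in sequentially. 0 \<le> kap s * \<bar>U (k n) x\<bar> / N (k n))"
        using q kap_pos[OF s] N1 by (intro disjI2 conjI always_eventually allI divide_nonneg_nonneg) (auto intro: order_trans[of 0 1])
    qed (rule tendsto_const)
    then have "(\<lambda>n. exp ((kap s * \<bar>U (k n) x\<bar> / N (k n)) powr q / 2)) \<longlonglongrightarrow> exp ((kap s * \<bar>u x\<bar>) powr q / 2)"
      by (intro tendsto_exp tendsto_divide tendsto_const) simp_all
    then have "(\<lambda>n. exp ((kap s * \<bar>U (k n) x\<bar> / N (k n)) powr q / 2)) \<longlonglongrightarrow> exp (alpha_p p * \<bar>u x\<bar> powr q)"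
      by (simp add: alpha_p_eq)
    then have "(\<lambda>n. ennreal (exp ((kap s * \<bar>U (k n) x\<bar> / N (k n)) powr q / 2)) * indicator {a<..<b} x) \<longlonglongrightarrow> ennreal (exp (alpha_p p * \<bar>u x\<bar> powr q)) * indicator {a<..<b} x"
      by (cases "x \<in> {a<..<b}") (auto intro: tendsto_ennrealI)
    then show "ennreal (exp (alpha_p p * \<bar>u x\<bar> powr q)) * indicator {a<..<b} x = liminf (\<lambda>n. ennreal (exp ((kap s * \<bar>U (k n) x\<bar> / N (k n)) powr q / 2)) * indicator {a<..<b} x)"
      by (intro lim_imp_Liminf[symmetric]) auto
  qed
  also have "\<dots> \<le> liminf (\<lambda>n. \<integral>\<^sup>+x. ennreal (exp ((kap s * \<bar>U (k n) x\<bar> / N (k n)) powr q / 2)) * indicator {a<..<b} x \<partial>lborel)"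
    by (rule nn_integral_liminf) measurable
  also have "\<dots> \<le> liminf (\<lambda>n. ennreal (b - a + 6 * \<delta> (k n)) * adams_const A)"
    by (intro Liminf_mono always_eventually allI bound)
  also have "\<dots> = ennreal (b - a) * adams_const A"
  proof (rule lim_imp_Liminf)
    have "(\<lambda>n. b - a + 6 * \<delta> (k n)) \<longlonglongrightarrow> b - a + 6 * 0" by (intro tendsto_intros kk[OF \<delta>0])
    then have "(\<lambda>n. ennreal (b - a + 6 * \<delta> (k n))) \<longlonglongrightarrow> ennreal (b - a)" by (intro tendsto_ennrealI) simp
    then show "(\<lambda>n. ennreal (b - a + 6 * \<delta> (k n)) * adams_const A) \<longlonglongrightarrow> ennreal (b - a) * adams_const A"
      using ab by (intro tendsto_mult_ennreal tendsto_const) auto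
  qed simp
  finally show ?thesis .
qed

text \<open>The integrand increases with \<alpha>, so the critical value is enough; discarding the
  -1 is harmless because the bound is of order b - a anyway.\<close>

theorem upper_bound:
  "\<exists>C :: real. \<forall>a b \<alpha> u. a < b \<longrightarrow> \<alpha> \<le> alpha_p p \<longrightarrow> admissible p a b u \<longrightarrow>
     (\<integral>\<^sup>+x\<in>{a<..<b}. ennreal (exp (\<alpha> * \<bar>u x\<bar> powr q) - 1) \<partial>lborel) \<le> ennreal (C * (b - a))"
proof -
  obtain A where A: "garsia_const A" by (rule garsia_const_exists)
  have K: "adams_const A = ennreal (enn2real (adams_const A))" using adams_const_finite[of A] by simp
  show ?thesis
  proof (intro exI[of _ "enn2real (adams_const A)"] allI impI)
    fix a b \<alpha> u assume ab: "a < b" and \<alpha>: "\<alpha> \<le> alpha_p p" and u: "admissible p a b u"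
    have "(\<integral>\<^sup>+x\<in>{a<..<b}. ennreal (exp (\<alpha> * \<bar>u x\<bar> powr q) - 1) \<partial>lborel) \<le> (\<integral>\<^sup>+x. ennreal (exp (alpha_p p * \<bar>u x\<bar> powr q)) * indicator {a<..<b} x \<partial>lborel)"
    proof (intro nn_integral_mono mult_right_mono ennreal_leI)
      fix x
      have "\<alpha> * \<bar>u x\<bar> powr q \<le> alpha_p p * \<bar>u x\<bar> powr q" using \<alpha> by (intro mult_right_mono) auto
      then have "exp (\<alpha> * \<bar>u x\<bar> powr q) \<le> exp (alpha_p p * \<bar>u x\<bar> powr q)" by simp
      then show "exp (\<alpha> * \<bar>u x\<bar> powr q) - 1 \<le> exp (alpha_p p * \<bar>u x\<bar> powr q)" by linarith
    qed auto
    also have "\<dots> \<le> ennreal (b - a) * adams_const A" by (rule exp_bound[OF A ab u])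
    also have "\<dots> = ennreal (enn2real (adams_const A) * (b - a))" using ab by (subst K) (simp add: ennreal_mult'[symmetric] mult.commute)
    finally show "(\<integral>\<^sup>+x\<in>{a<..<b}. ennreal (exp (\<alpha> * \<bar>u x\<bar> powr q) - 1) \<partial>lborel) \<le> ennreal (enn2real (adams_const A) * (b - a))" .
  qed
qed

end

subsection \<open>The lower bound\<close>

lemma nn_integral_exp_tail:
  fixes c x :: real
  assumes "0 < c"
  shows "(\<integral>\<^sup>+t. ennreal (exp (- (c * t))) * indicator {x..} t \<partial>lborel) = ennreal (exp (- (c * x)) / c)"
    and "(\<integral>\<^sup>+t. ennreal (exp (c * t)) * indicator {..x} t \<partial>lborel) = ennreal (exp (c * x) / c)"
proof -
  have 1: "(\<integral>\<^sup>+t. ennreal (exp (- (c * t))) * indicator {x..} t \<partial>lborel) = ennreal (exp (- (c * x)) / c)" for x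
  proof -
    have "(\<integral>\<^sup>+t. ennreal (exp (- (c * t))) * indicator {x..} t \<partial>lborel) = ennreal (0 - - exp (- (c * x)) / c)"
    proof (rule nn_integral_FTC_atLeast[where F="\<lambda>t. - exp (- (c * t)) / c"])
      show "((\<lambda>t. - exp (- (c * t)) / c) has_real_derivative exp (- (c * t))) (at t)" for t
        using assms by (auto intro!: derivative_eq_intros)
      show "((\<lambda>t. - exp (- (c * t)) / c) \<longlongrightarrow> 0) at_top" using assms by real_asymp
    qed auto
    then show ?thesis by simp
  qed
  show "(\<integral>\<^sup>+t. ennreal (exp (- (c * t))) * indicator {x..} t \<partial>lborel) = ennreal (exp (- (c * x)) / c)" by (rule 1)
  have "(\<integral>\<^sup>+t. ennreal (exp (c * t)) * indicator {..x} t \<partial>lborel) = (\<integral>\<^sup>+t. ennreal (exp (c * - t)) * indicator {..x} (- t) \<partial>lborel)"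
    by (rule nn_integral_shift(5)[symmetric]) measurable
  also have "\<dots> = (\<integral>\<^sup>+t. ennreal (exp (- (c * t))) * indicator {- x..} t \<partial>lborel)"
    by (intro nn_integral_cong) (auto simp: indicator_def)
  finally show "(\<integral>\<^sup>+t. ennreal (exp (c * t)) * indicator {..x} t \<partial>lborel) = ennreal (exp (c * x) / c)" by (simp add: 1)
qed

lemma abs_integral_le:
  fixes f :: "real \<Rightarrow> real"
  assumes "integrable lborel f" "(\<integral>\<^sup>+t. ennreal \<bar>f t\<bar> \<partial>lborel) \<le> ennreal c" "0 \<le> c"
  shows "\<bar>\<integral>t. f t \<partial>lborel\<bar> \<le> c"
proof -
  have "ennreal \<bar>\<integral>t. f t \<partial>lborel\<bar> \<le> (\<integral>\<^sup>+t. ennreal \<bar>f t\<bar> \<partial>lborel)" using integral_norm_bound_ennreal[OF assms(1)] by simp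
  also note assms(2)
  finally show ?thesis using assms(3) by simp
qed

context conjugate_exponents
begin

text \<open>Decay of order |x| powr (-1 - s) puts V and \<open>fl s V\<close> in L^p, and
  \<open>fraclap_symmetric\<close> shows that \<open>fl s V\<close> represents the distribution; the
  constraint over the interval is left to \<open>nrm\<close>.\<close>

lemma admissible_test_fun:
  assumes V: "test_fun V" and supp: "\<And>x. x \<notin> {a<..<b} \<Longrightarrow> V x = 0"
    and nrm: "(\<integral>\<^sup>+x. ennreal (\<bar>fl s V x\<bar> powr p) * indicator {a<..<b} x \<partial>lborel) \<le> 1"
  shows "admissible p a b V"
proof -
  note [measurable] = test_fun_measurable[OF V]
  have LpI: "Lp p f" if m: "f \<in> borel_measurable borel" and C: "\<And>x. \<bar>f x\<bar> \<le> C / (1 + \<bar>x\<bar> powr (1 + s))" for f :: "real \<Rightarrow> real" and C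
    unfolding Lp_def
  proof
    show "integrable lborel (\<lambda>x. \<bar>f x\<bar> powr p)"
    proof (rule integrable_decay[of _ "\<bar>C\<bar> powr p" s])
      fix x :: real
      have w: "1 \<le> 1 + \<bar>x\<bar> powr (1 + s)" "0 < 1 + \<bar>x\<bar> powr (1 + s)" by (simp_all add: add_pos_nonneg)
      have "\<bar>f x\<bar> \<le> \<bar>C\<bar> / (1 + \<bar>x\<bar> powr (1 + s))" using C[of x] w by (smt (verit) divide_right_mono)
      then have "\<bar>f x\<bar> powr p \<le> (\<bar>C\<bar> / (1 + \<bar>x\<bar> powr (1 + s))) powr p" using p by (intro powr_mono2) auto
      also have "\<dots> = \<bar>C\<bar> powr p / (1 + \<bar>x\<bar> powr (1 + s)) powr p" using w by (subst powr_divide) auto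
      also have "\<dots> \<le> \<bar>C\<bar> powr p / (1 + \<bar>x\<bar> powr (1 + s))"
      proof (rule divide_left_mono)
        have "(1 + \<bar>x\<bar> powr (1 + s)) powr 1 \<le> (1 + \<bar>x\<bar> powr (1 + s)) powr p" using p w by (intro powr_mono) auto
        then show "1 + \<bar>x\<bar> powr (1 + s) \<le> (1 + \<bar>x\<bar> powr (1 + s)) powr p" using w by simp
        show "0 < (1 + \<bar>x\<bar> powr (1 + s)) powr p * (1 + \<bar>x\<bar> powr (1 + s))" using w(2) by (intro mult_pos_pos) auto
      qed simp
      finally show "norm (\<bar>f x\<bar> powr p) \<le> \<bar>C\<bar> powr p / (1 + \<bar>x\<bar> powr (1 + s))" by simp
    qed (use s m in measurable)
  qed (use m in simp)
  obtain C1 where "0 < C1" "\<And>x. \<bar>V x\<bar> \<le> C1 / (1 + \<bar>x\<bar> powr (1 + s))" using test_fun_decay[OF V s(1)] by blast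
  then have LV: "Lp p V" by (intro LpI) auto
  obtain C2 where "0 < C2" "\<And>x. \<bar>fl s V x\<bar> \<le> C2 / (1 + \<bar>x\<bar> powr (1 + s))" using fl_decay[OF V s] by blast
  then have Lg: "Lp p (fl s V)" by (intro LpI) auto
  have D: "fraclap_dist (s / 2) V (fl s V)"
    unfolding fraclap_dist_def
  proof (intro conjI allI impI)
    show "integrable lborel (\<lambda>x. \<bar>V x\<bar> / (1 + \<bar>x\<bar> powr (1 + 2 * (s / 2))))"
    proof (rule Bochner_Integration.integrable_bound[OF test_fun_integrable[OF V]])
      show "AE x in lborel. norm (\<bar>V x\<bar> / (1 + \<bar>x\<bar> powr (1 + 2 * (s / 2)))) \<le> norm (V x)"
      proof (rule AE_I2)
        fix x
        have w: "1 \<le> 1 + \<bar>x\<bar> powr (1 + 2 * (s / 2))" "0 < 1 + \<bar>x\<bar> powr (1 + 2 * (s / 2))" by (simp_all add: add_pos_nonneg)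
        have "\<bar>V x\<bar> / (1 + \<bar>x\<bar> powr (1 + 2 * (s / 2))) \<le> \<bar>V x\<bar> / 1" using w(2) by (intro divide_left_mono w(1)) auto
        then show "norm (\<bar>V x\<bar> / (1 + \<bar>x\<bar> powr (1 + 2 * (s / 2)))) \<le> norm (V x)" using w by simp
      qed
    qed measurable
    fix \<phi> assume \<phi>: "schwartz \<phi>"
    show "(\<integral>x. complex_of_real (V x) * fraclap (s / 2) \<phi> x \<partial>lborel) = (\<integral>x. complex_of_real (fl s V x) * \<phi> x \<partial>lborel)"
      using fraclap_symmetric[OF \<phi> test_fun_schwartz[OF V] s] by (simp only: fraclap_singular_integral[OF V s])
  qed
  have s2: "1 / p / 2 = s / 2" "1 / (2 * p) = s / 2" by (simp_all add: s_def)
  show ?thesis unfolding admissible_def Hsp_tilde_def Hsp_def s2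
    using LV Lg D nrm supp by (auto intro!: AE_I2)
qed

section \<open>The logarithmic profile and its fractional Laplacian\<close>

lemma fl_even: "(\<And>x. f (- x) = f x) \<Longrightarrow> fl s f (- x) = fl s f x"
  using fl_translate_reflect[of s f 0 x] by simp

text \<open>The integrand of the Riesz potential at \<open>0\<close> over the half-line, in the variable \<open>t = ln r\<close>.\<close>

definition E :: "(real \<Rightarrow> real) \<Rightarrow> real \<Rightarrow> real" where "E \<psi> t = exp (s * t) * \<psi> (exp t)"

text \<open>This is \<open>riesz_inverse\<close> at the origin, halved by evenness and rewritten
  with r = exp t. The value kap s / 2 decides the leading constant in the norm of the extremal
  profile.\<close>

lemma integral_E:
  assumes f: "test_fun f" and even: "\<And>x. f (- x) = f x"
  shows "integrable lborel (E (fl s f))" and "(\<integral>t. E (fl s f) t \<partial>lborel) = kap s / 2 * f 0"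
proof -
  define \<psi> where "\<psi> = fl s f"
  have [measurable]: "\<psi> \<in> borel_measurable borel" unfolding \<psi>_def using test_fun_measurable[OF f] by measurable
  have \<psi>e: "\<psi> (- x) = \<psi> x" for x unfolding \<psi>_def by (rule fl_even[of f x, OF even])
  define k where "k r = \<bar>r\<bar> powr (s - 1) * \<psi> r" for r
  have [measurable]: "k \<in> borel_measurable borel" unfolding k_def[abs_def] by measurable
  have ke: "k (- r) = k r" for r by (simp add: k_def \<psi>e)
  have ki: "integrable lborel k" and kint: "(\<integral>r. k r \<partial>lborel) = kap s * f 0"
    using riesz_fl_integrable[OF f s, of 0] riesz_inverse[OF f s, of 0] by (simp_all add: k_def[abs_def] \<psi>e flip: \<psi>_def)
  have kp: "integrable lborel (\<lambda>r. indicator {0<..} r * k r)" using integrable_mult_indicator[of "{0<..}" lborel k] ki by simp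
  have km: "integrable lborel (\<lambda>r. indicator {..<0} r * k r)" using integrable_mult_indicator[of "{..<0}" lborel k] ki by simp
  have "(\<integral>r. k r \<partial>lborel) = (\<integral>r. indicator {0<..} r * k r + indicator {..<0} r * k r \<partial>lborel)"
    by (intro integral_cong_AE AE_I[of _ _ "{0}"]) (auto simp: indicator_def)
  also have "\<dots> = (\<integral>r. indicator {0<..} r * k r \<partial>lborel) + (\<integral>r. indicator {..<0} r * k r \<partial>lborel)" using kp km by simp
  also have "(\<integral>r. indicator {..<0} r * k r \<partial>lborel) = (\<integral>r. indicator {..<0} (- r) * k (- r) \<partial>lborel)" by (rule integral_shift(5)[symmetric])
  also have "\<dots> = (\<integral>r. indicator {0<..} r * k r \<partial>lborel)"
    by (intro Bochner_Integration.integral_cong) (auto simp: indicator_def ke)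
  finally have half: "(\<integral>r. indicator {0<..} r * k r \<partial>lborel) = kap s / 2 * f 0" unfolding kint by simp
  have "((\<lambda>r. indicator {0<..} r * k r) has_integral kap s / 2 * f 0) UNIV"
    using has_integral_integral_lborel[OF kp] unfolding half .
  moreover have "(\<lambda>r. indicator {0<..} r * k r) = (\<lambda>r. if r \<in> {0<..} then k r else 0)" by (auto simp: indicator_def)
  ultimately have hi: "(k has_integral kap s / 2 * f 0) {0<..}" by (simp only: has_integral_restrict_UNIV)
  have "set_integrable lebesgue {0<..} k"
    unfolding set_integrable_def using kp by (subst integrable_completion) auto
  moreover have "range (exp :: real \<Rightarrow> real) = {0<..}"
  proof safe
    fix x :: real assume "0 < x" then show "x \<in> range exp" by (intro image_eqI[of _ _ "ln x"]) auto
  qed auto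
  ultimately have "k absolutely_integrable_on (exp ` UNIV) \<and> integral (exp ` UNIV) k = kap s / 2 * f 0"
    using hi by (simp add: integral_unique)
  then have H: "(\<lambda>t. \<bar>exp t\<bar> * k (exp t)) absolutely_integrable_on UNIV \<and> integral UNIV (\<lambda>t. \<bar>exp t\<bar> * k (exp t)) = kap s / 2 * f 0"
    by (subst has_absolute_integral_change_of_variables_1') (auto intro!: derivative_eq_intros simp: inj_on_def)
  have e: "(\<lambda>t. \<bar>exp t\<bar> * k (exp t)) = E \<psi>"
  proof
    fix t :: real
    have "exp t * exp t powr (s - 1) = exp (s * t)" by (simp add: powr_def algebra_simps flip: exp_add)
    then show "\<bar>exp t\<bar> * k (exp t) = E \<psi> t" by (simp add: k_def E_def mult.assoc[symmetric])
  qed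
  have [measurable]: "E \<psi> \<in> borel_measurable borel" unfolding E_def[abs_def] by measurable
  have "integrable lebesgue (E \<psi>)" using H unfolding e set_integrable_def by simp
  then show i: "integrable lborel (E (fl s f))" unfolding \<psi>_def[symmetric] by (subst (asm) integrable_completion) auto
  show "(\<integral>t. E (fl s f) t \<partial>lborel) = kap s / 2 * f 0"
    using has_integral_integral_lborel[OF i] H unfolding e \<psi>_def[symmetric] by (simp add: integral_unique)
qed

text \<open>Superposing dilates of a bump gives a truncated logarithm; its fractional Laplacian is \<open>|x| powr (- s)\<close>
  times the integral of \<open>E\<close> over a window of length \<open>\<Lambda>\<close>, which is almost the full integral for most \<open>x\<close>.
  The \<open>min\<close>, idle on the support of the indicator, keeps the dilation factors bounded.\<close>

definition Ulog :: "(real \<Rightarrow> real) \<Rightarrow> real \<Rightarrow> real \<Rightarrow> real" where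
  "Ulog \<rho> \<Lambda> x = (\<integral>t. indicator {0..\<Lambda>} t * \<rho> (0 + exp (min \<Lambda> t) * x) \<partial>lborel)"

lemma Ulog_test:
  assumes \<rho>: "test_fun \<rho>" and supp: "\<And>x. 1 \<le> \<bar>x\<bar> \<Longrightarrow> \<rho> x = 0"
  shows "test_fun (Ulog \<rho> \<Lambda>)" and "1 \<le> \<bar>x\<bar> \<Longrightarrow> Ulog \<rho> \<Lambda> x = 0"
proof -
  have z: "(\<integral>t. indicator {0..\<Lambda>} t * \<rho> (0 + exp (min \<Lambda> t) * x) \<partial>lborel) = 0" if "1 \<le> \<bar>x\<bar>" for x
  proof -
    have "indicator {0..\<Lambda>} t * \<rho> (0 + exp (min \<Lambda> t) * x) = 0" for t
    proof (cases "t \<in> {0..\<Lambda>}")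
      case True
      then have "1 * 1 \<le> exp (min \<Lambda> t) * \<bar>x\<bar>" using that by (intro mult_mono) auto
      then have "\<rho> (0 + exp (min \<Lambda> t) * x) = 0" by (intro supp) (simp add: abs_mult)
      then show ?thesis by simp
    qed simp
    then have "(\<lambda>t. indicator {0..\<Lambda>} t * \<rho> (0 + exp (min \<Lambda> t) * x)) = (\<lambda>t. 0)" by blast
    then show ?thesis by simp
  qed
  then show "1 \<le> \<bar>x\<bar> \<Longrightarrow> Ulog \<rho> \<Lambda> x = 0" by (simp add: Ulog_def)
  show "test_fun (Ulog \<rho> \<Lambda>)" unfolding Ulog_def
    by (rule test_fun_integral[OF \<rho>, of _ _ _ _ "exp \<Lambda>" 1]) (use z in \<open>auto simp: emeasure_lborel_Icc_eq\<close>)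
qed

lemma fl_Ulog:
  assumes \<rho>: "test_fun \<rho>" and even: "\<And>x. \<rho> (- x) = \<rho> x" and x: "x \<noteq> 0"
  shows "fl s (Ulog \<rho> \<Lambda>) x = \<bar>x\<bar> powr (- s) * (\<integral>t. indicator {ln \<bar>x\<bar>..ln \<bar>x\<bar> + \<Lambda>} t * E (fl s \<rho>) t \<partial>lborel)"
proof -
  note [measurable] = test_fun_measurable[OF \<rho>]
  define B where "B = (\<integral>y. (2 - 2 * cos y) * \<bar>y\<bar> powr (-1 - s) \<partial>lborel)"
  have B: "0 < B" unfolding B_def by (rule cos_powr_pos[OF s])
  obtain M where M: "0 < M" "\<And>x y. \<bar>second_diff \<rho> x y\<bar> \<le> M * min 1 (y\<^sup>2)" using second_diff_bound[OF \<rho>] by blast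
  obtain M0 where M0: "0 < M0" "\<And>x. \<bar>\<rho> x\<bar> \<le> M0" using test_fun_bounded[OF \<rho>] by blast
  define b where "b t = exp (min \<Lambda> t)" for t
  have [measurable]: "b \<in> borel_measurable borel" unfolding b_def[abs_def] by measurable
  have bpos: "0 < b t" "b t \<le> exp \<Lambda>" for t by (auto simp: b_def)
  define K where "K t y = indicator {0..\<Lambda>} t * (second_diff \<rho> (b t * x) (b t * y) * \<bar>y\<bar> powr (-1 - s))" for t y
  have [measurable]: "case_prod K \<in> borel_measurable (borel \<Otimes>\<^sub>M borel)" unfolding K_def by measurable
  have i: "integrable lborel (\<lambda>t. indicator {0..\<Lambda>} t * \<rho> (0 + b t * z))" for z
  proof (rule Bochner_Integration.integrable_bound[of _ "\<lambda>t. M0 * indicator {0..\<Lambda>} t"])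
    show "AE t in lborel. norm (indicator {0..\<Lambda>} t * \<rho> (0 + b t * z)) \<le> norm (M0 * indicator {0..\<Lambda>} t)"
      using M0 by (auto simp: indicator_def)
  qed (auto simp: emeasure_lborel_Icc_eq)
  have sd: "second_diff (Ulog \<rho> \<Lambda>) x y * \<bar>y\<bar> powr (-1 - s) = (\<integral>t. K t y \<partial>lborel)" for y
  proof -
    have "(\<integral>t. K t y \<partial>lborel) = (\<integral>t. (2 * (indicator {0..\<Lambda>} t * \<rho> (0 + b t * x)) - indicator {0..\<Lambda>} t * \<rho> (0 + b t * (x + y)) - indicator {0..\<Lambda>} t * \<rho> (0 + b t * (x - y))) * \<bar>y\<bar> powr (-1 - s) \<partial>lborel)"
      by (intro Bochner_Integration.integral_cong refl) (simp add: K_def second_diff_def algebra_simps)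
    also have "\<dots> = (2 * (\<integral>t. indicator {0..\<Lambda>} t * \<rho> (0 + b t * x) \<partial>lborel) - (\<integral>t. indicator {0..\<Lambda>} t * \<rho> (0 + b t * (x + y)) \<partial>lborel) - (\<integral>t. indicator {0..\<Lambda>} t * \<rho> (0 + b t * (x - y)) \<partial>lborel)) * \<bar>y\<bar> powr (-1 - s)"
      using i by (simp del: add_0)
    finally show ?thesis by (simp add: second_diff_def Ulog_def b_def)
  qed
  have "(\<integral>\<^sup>+t. \<integral>\<^sup>+y. ennreal (norm (K t y)) \<partial>lborel \<partial>lborel)
     \<le> (\<integral>\<^sup>+t. \<integral>\<^sup>+y. ennreal (M * (1 + (exp \<Lambda>)\<^sup>2)) * indicator {0..\<Lambda>} t * ennreal (min 1 (y\<^sup>2) * \<bar>y\<bar> powr (-1 - s)) \<partial>lborel \<partial>lborel)"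
  proof (intro nn_integral_mono)
    fix t y :: real
    \<comment> \<open>The bound b t \<le> exp \<Lambda> turns the quadratic estimate of the second
      difference into a majorant uniform in t, as Fubini requires.\<close>
    have bt: "(b t)\<^sup>2 \<le> (exp \<Lambda>)\<^sup>2" using bpos[of t] by (intro power_mono) auto
    have "min 1 ((b t * y)\<^sup>2) \<le> (1 + (exp \<Lambda>)\<^sup>2) * min 1 (y\<^sup>2)"
    proof (cases "1 \<le> y\<^sup>2")
      case False
      have "(b t * y)\<^sup>2 \<le> (exp \<Lambda>)\<^sup>2 * y\<^sup>2" using bt by (simp add: power_mult_distrib mult_right_mono)
      also have "\<dots> \<le> (1 + (exp \<Lambda>)\<^sup>2) * y\<^sup>2" by (intro mult_right_mono) auto
      finally show ?thesis using False by (simp add: min_def)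
    qed (simp add: min_def add_increasing2)
    then have "M * min 1 ((b t * y)\<^sup>2) \<le> M * ((1 + (exp \<Lambda>)\<^sup>2) * min 1 (y\<^sup>2))" using M(1) by (intro mult_left_mono) auto
    then have "\<bar>second_diff \<rho> (b t * x) (b t * y)\<bar> \<le> M * (1 + (exp \<Lambda>)\<^sup>2) * min 1 (y\<^sup>2)" using M(2)[of "b t * x" "b t * y"] by linarith
    then have "\<bar>second_diff \<rho> (b t * x) (b t * y)\<bar> * \<bar>y\<bar> powr (-1 - s) \<le> M * (1 + (exp \<Lambda>)\<^sup>2) * min 1 (y\<^sup>2) * \<bar>y\<bar> powr (-1 - s)" by (intro mult_right_mono) auto
    then show "ennreal (norm (K t y)) \<le> ennreal (M * (1 + (exp \<Lambda>)\<^sup>2)) * indicator {0..\<Lambda>} t * ennreal (min 1 (y\<^sup>2) * \<bar>y\<bar> powr (-1 - s))"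
      using M(1) by (cases "t \<in> {0..\<Lambda>}") (auto simp: K_def abs_mult ennreal_mult'[symmetric] mult.assoc intro!: ennreal_leI)
  qed
  also have "\<dots> = ennreal (M * (1 + (exp \<Lambda>)\<^sup>2)) * emeasure lborel {0..\<Lambda>} * (\<integral>\<^sup>+y. ennreal (min 1 (y\<^sup>2) * \<bar>y\<bar> powr (-1 - s)) \<partial>lborel)"
    by (simp add: nn_integral_cmult nn_integral_multc)
  also have "\<dots> < \<infinity>"
  proof -
    have "(\<integral>\<^sup>+y. ennreal (min 1 (y\<^sup>2) * \<bar>y\<bar> powr (-1 - s)) \<partial>lborel) < \<infinity>"
      using integrable_min_powr[OF s] by (subst nn_integral_eq_integral) (auto simp: min_def)
    then show ?thesis by (simp add: ennreal_mult_less_top emeasure_lborel_Icc_eq)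
  qed
  finally have fin: "(\<integral>\<^sup>+t. \<integral>\<^sup>+y. ennreal (norm (K t y)) \<partial>lborel \<partial>lborel) < \<infinity>" .
  have Ky: "(\<integral>y. K t y \<partial>lborel) = B * (indicator {0..\<Lambda>} t * (exp (s * t) * fl s \<rho> (exp t * x)))" for t
  proof (cases "t \<in> {0..\<Lambda>}")
    case True
    then have bt: "b t = exp t" by (simp add: b_def min_def)
    have "fl s (\<lambda>x. \<rho> ((x - 0) / exp (- t))) x = exp (- t) powr (- s) * fl s \<rho> ((x - 0) / exp (- t))" by (rule fl_scale) simp
    moreover have "exp (- t) powr (- s) = exp (s * t)" by (simp add: powr_def)
    moreover have "z / exp (- t) = exp t * z" for z by (simp add: exp_minus field_simps)
    ultimately have "fl s (\<lambda>x. \<rho> (exp t * x)) x = exp (s * t) * fl s \<rho> (exp t * x)" by simp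
    moreover have "second_diff (\<lambda>x. \<rho> (exp t * x)) x y = second_diff \<rho> (b t * x) (b t * y)" for y
      by (simp add: second_diff_def bt algebra_simps)
    ultimately have "(\<integral>y. second_diff \<rho> (b t * x) (b t * y) * \<bar>y\<bar> powr (-1 - s) \<partial>lborel) / B = exp (s * t) * fl s \<rho> (exp t * x)"
      by (simp add: fl_def[of s "\<lambda>x. \<rho> (exp t * x)"] B_def)
    then show ?thesis using True B by (simp add: K_def field_simps)
  qed (simp add: K_def)
  have "B * fl s (Ulog \<rho> \<Lambda>) x = (\<integral>y. \<integral>t. K t y \<partial>lborel \<partial>lborel)" unfolding fl_def B_def[symmetric] sd using B by simp
  also have "\<dots> = (\<integral>t. \<integral>y. K t y \<partial>lborel \<partial>lborel)" by (rule lborel_Fubini(1)[symmetric]) (use fin in auto)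
  also have "\<dots> = B * (\<integral>t. indicator {0..\<Lambda>} t * (exp (s * t) * fl s \<rho> (exp t * x)) \<partial>lborel)" unfolding Ky by simp
  finally have "fl s (Ulog \<rho> \<Lambda>) x = (\<integral>t. indicator {0..\<Lambda>} t * (exp (s * t) * fl s \<rho> (exp t * x)) \<partial>lborel)" using B by simp
  also have "\<dots> = (\<integral>t. indicator {0..\<Lambda>} (t - ln \<bar>x\<bar>) * (exp (s * (t - ln \<bar>x\<bar>)) * fl s \<rho> (exp (t - ln \<bar>x\<bar>) * x)) \<partial>lborel)"
    by (rule integral_shift(3)[symmetric])
  also have "\<dots> = (\<integral>t. \<bar>x\<bar> powr (- s) * (indicator {ln \<bar>x\<bar>..ln \<bar>x\<bar> + \<Lambda>} t * E (fl s \<rho>) t) \<partial>lborel)"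
  proof (intro Bochner_Integration.integral_cong refl)
    fix t
    have "exp (s * (t - ln \<bar>x\<bar>)) = \<bar>x\<bar> powr (- s) * exp (s * t)" using x by (simp add: powr_def algebra_simps flip: exp_add)
    moreover have "fl s \<rho> (exp (t - ln \<bar>x\<bar>) * x) = fl s \<rho> (exp t)"
    proof (cases "0 < x")
      case True
      then show ?thesis by (simp add: exp_diff)
    next
      case False
      then have "exp (t - ln \<bar>x\<bar>) * x = - exp t" using x by (simp add: exp_diff)
      then show ?thesis using fl_even[of \<rho> "exp t", OF even] by simp
    qed
    ultimately show "indicator {0..\<Lambda>} (t - ln \<bar>x\<bar>) * (exp (s * (t - ln \<bar>x\<bar>)) * fl s \<rho> (exp (t - ln \<bar>x\<bar>) * x)) = \<bar>x\<bar> powr (- s) * (indicator {ln \<bar>x\<bar>..ln \<bar>x\<bar> + \<Lambda>} t * E (fl s \<rho>) t)"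
      by (auto simp: E_def indicator_def)
  qed
  finally show ?thesis by simp
qed

text \<open>The tangent to the p-th power at K + c, evaluated at K; its slope is then estimated by
  the one at K + D.\<close>

lemma powr_p_add_le:
  assumes "0 \<le> K" "0 \<le> c" "c \<le> D" shows "(K + c) powr p \<le> K powr p + p * (K + D) powr (p - 1) * c"
proof -
  define y where "y = K + c"
  have y: "0 \<le> y" using assms by (simp add: y_def)
  have "y powr p = y * y powr (p - 1)" using powr_mult_base[OF y, of "p - 1"] by simp
  then have "p * y powr (p - 1) * K = p * y powr p - p * y powr (p - 1) * c"
    by (simp add: y_def algebra_simps)
  then have "y powr p \<le> K powr p + p * y powr (p - 1) * c"
    using powr_tangent[OF assms(1) y] by (simp add: algebra_simps)
  also have "p * y powr (p - 1) * c \<le> p * (K + D) powr (p - 1) * c"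
    unfolding y_def using assms p by (intro mult_right_mono mult_left_mono powr_mono2) auto
  finally show ?thesis by (simp add: y_def)
qed

end

section \<open>Estimates for the profile and optimality\<close>

context conjugate_exponents
begin

text \<open>For |x| \<le> exp (- \<Lambda>) the Lipschitz bound gives |1 - \<rho> (exp t * x)| \<le>
  B * exp (t - \<Lambda>), and integration over t \<le> \<Lambda> leaves B, a Lipschitz constant of
  \<rho>, whatever \<Lambda> is.\<close>

lemma Ulog_lower:
  assumes \<rho>: "test_fun \<rho>" "\<rho> 0 = 1"
  obtains B where "0 \<le> B" "\<And>\<Lambda> x. 0 \<le> \<Lambda> \<Longrightarrow> \<bar>x\<bar> \<le> exp (- \<Lambda>) \<Longrightarrow> \<Lambda> - B \<le> Ulog \<rho> \<Lambda> x"
proof -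
  obtain B where B: "0 < B" "\<And>x y. \<bar>\<rho> x - \<rho> y\<bar> \<le> B * \<bar>x - y\<bar>" using test_fun_lipschitz[OF \<rho>(1)] by blast
  obtain M where M: "0 < M" "\<And>x. \<bar>\<rho> x\<bar> \<le> M" using test_fun_bounded[OF \<rho>(1)] by blast
  note [measurable] = test_fun_measurable[OF \<rho>(1)]
  have "\<Lambda> - B \<le> Ulog \<rho> \<Lambda> x" if \<Lambda>: "0 \<le> \<Lambda>" and x: "\<bar>x\<bar> \<le> exp (- \<Lambda>)" for \<Lambda> x
  proof -
    define F where "F t = indicator {0..\<Lambda>} t * \<rho> (0 + exp (min \<Lambda> t) * x)" for t
    have [measurable]: "F \<in> borel_measurable borel" unfolding F_def[abs_def] by measurable
    have i1: "integrable lborel (indicator {0..\<Lambda>} :: real \<Rightarrow> real)" by (intro integrable_real_indicator) (auto simp: emeasure_lborel_Icc_eq)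
    have i2: "integrable lborel F"
    proof (rule Bochner_Integration.integrable_bound[OF integrable_mult_right[OF i1, of M]])
      have "\<bar>F t\<bar> \<le> \<bar>M * indicator {0..\<Lambda>} t\<bar>" for t
        using M(2)[of "exp (min \<Lambda> t) * x"] M(1) by (cases "t \<in> {0..\<Lambda>}") (simp_all add: F_def)
      then show "AE t in lborel. norm (F t) \<le> norm (M * indicator {0..\<Lambda>} t)" by simp
    qed measurable
    have "(\<integral>t. indicator {0..\<Lambda>} t - F t \<partial>lborel) = \<Lambda> - Ulog \<rho> \<Lambda> x"
      using i1 i2 \<Lambda> by (simp add: F_def[abs_def] Ulog_def)
    moreover have "\<bar>\<integral>t. indicator {0..\<Lambda>} t - F t \<partial>lborel\<bar> \<le> B"
    proof (rule abs_integral_le)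
      have "(\<integral>\<^sup>+t. ennreal \<bar>indicator {0..\<Lambda>} t - F t\<bar> \<partial>lborel) \<le> (\<integral>\<^sup>+t. ennreal (B * exp (- \<Lambda>)) * (ennreal (exp (1 * t)) * indicator {..\<Lambda>} t) \<partial>lborel)"
      proof (rule nn_integral_mono)
        fix t
        show "ennreal \<bar>indicator {0..\<Lambda>} t - F t\<bar> \<le> ennreal (B * exp (- \<Lambda>)) * (ennreal (exp (1 * t)) * indicator {..\<Lambda>} t)"
        proof (cases "t \<in> {0..\<Lambda>}")
          case True
          then have "min \<Lambda> t = t" by auto
          then have "\<bar>indicator {0..\<Lambda>} t - F t\<bar> = \<bar>\<rho> 0 - \<rho> (exp t * x)\<bar>" using True by (simp add: F_def \<rho>(2))
          also have "\<dots> \<le> B * \<bar>0 - exp t * x\<bar>" by (rule B(2))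
          also have "\<dots> = B * (exp t * \<bar>x\<bar>)" by (simp add: abs_mult)
          also have "\<dots> \<le> B * (exp t * exp (- \<Lambda>))" using x B(1) by (intro mult_left_mono) auto
          finally show ?thesis using True B(1) by (simp add: ennreal_mult'[symmetric] ennreal_leI mult_ac)
        qed (simp add: F_def)
      qed
      also have "\<dots> = ennreal (B * exp (- \<Lambda>)) * ennreal (exp (1 * \<Lambda>) / 1)"
        by (subst nn_integral_cmult) (auto simp: nn_integral_exp_tail(2)[of 1, simplified])
      also have "\<dots> = ennreal B" using B(1) by (simp add: ennreal_mult'[symmetric] mult.assoc flip: exp_add)
      finally show "(\<integral>\<^sup>+t. ennreal \<bar>indicator {0..\<Lambda>} t - F t\<bar> \<partial>lborel) \<le> ennreal B" .
    qed (use i1 i2 B in auto)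
    ultimately show ?thesis by linarith
  qed
  with B(1) show ?thesis by (intro that[of B]) auto
qed

text \<open>The window integral in \<open>fl_Ulog\<close> differs from the full integral kap s / 2
  by two tails: the one below ln |x| is of order |x| powr s, the one above ln |x| + \<Lambda> of
  order exp (- \<Lambda>) / |x|. The first bound, free of singular factors, covers the core |x|
  \<le> exp (- \<Lambda>), where the upper tail is not controlled.\<close>

lemma fl_Ulog_bounds:
  assumes \<rho>: "test_fun \<rho>" "\<rho> 0 = 1" "\<And>x. \<rho> (- x) = \<rho> x" "\<And>x. 1 \<le> \<bar>x\<bar> \<Longrightarrow> \<rho> x = 0"
  obtains C where "0 < C" "\<And>\<Lambda> x. 0 \<le> \<Lambda> \<Longrightarrow> x \<noteq> 0 \<Longrightarrow> \<bar>fl s (Ulog \<rho> \<Lambda>) x\<bar> \<le> C / s * exp (s * \<Lambda>)"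
    "\<And>\<Lambda> x. 0 \<le> \<Lambda> \<Longrightarrow> x \<noteq> 0 \<Longrightarrow> \<bar>fl s (Ulog \<rho> \<Lambda>) x\<bar> \<le> \<bar>x\<bar> powr (- s) * (kap s / 2 + (C / s * \<bar>x\<bar> powr s + C * exp (- \<Lambda>) / \<bar>x\<bar>))"
proof -
  define e where "e = E (fl s \<rho>)"
  have [measurable]: "fl s \<rho> \<in> borel_measurable borel" using test_fun_measurable[OF \<rho>(1)] by measurable
  have em[measurable]: "e \<in> borel_measurable borel" unfolding e_def E_def[abs_def] by measurable
  have ei: "integrable lborel e" and eint: "(\<integral>t. e t \<partial>lborel) = kap s / 2"
    using integral_E[OF \<rho>(1) \<rho>(3)] \<rho>(2) by (simp_all add: e_def)
  obtain C where C: "0 < C" "\<And>x. \<bar>fl s \<rho> x\<bar> \<le> C / (1 + \<bar>x\<bar> powr (1 + s))" using fl_decay[OF \<rho>(1) s] by blast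
  \<comment> \<open>Boundedness of \<open>fl s \<rho>\<close> controls the integrand as t tends to -
    \<infinity>, its decay of order 1 + s as t tends to \<infinity>.\<close>
  have e1: "\<bar>e t\<bar> \<le> C * exp (s * t)" and e2: "\<bar>e t\<bar> \<le> C * exp (- (1 * t))" for t
  proof -
    have w: "1 \<le> 1 + \<bar>exp t\<bar> powr (1 + s)" "exp ((1 + s) * t) \<le> 1 + \<bar>exp t\<bar> powr (1 + s)" "0 < 1 + \<bar>exp t\<bar> powr (1 + s)"
      by (simp_all add: powr_def add_pos_nonneg)
    have a: "\<bar>e t\<bar> = exp (s * t) * \<bar>fl s \<rho> (exp t)\<bar>" by (simp add: e_def E_def abs_mult)
    have "\<bar>fl s \<rho> (exp t)\<bar> \<le> C / 1"
      by (rule order.trans[OF C(2) divide_left_mono[OF w(1)]]) (use C(1) w(3) in auto)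
    then show "\<bar>e t\<bar> \<le> C * exp (s * t)" unfolding a by (simp add: mult.commute mult_left_mono)
    have "\<bar>fl s \<rho> (exp t)\<bar> \<le> C / exp ((1 + s) * t)"
      by (rule order.trans[OF C(2) divide_left_mono[OF w(2)]]) (use C(1) w(3) in auto)
    then have "\<bar>e t\<bar> \<le> exp (s * t) * (C / exp ((1 + s) * t))" unfolding a by (intro mult_left_mono) auto
    also have "\<dots> = C * exp (- (1 * t))" by (simp add: exp_minus field_simps flip: exp_add)
    finally show "\<bar>e t\<bar> \<le> C * exp (- (1 * t))" .
  qed
  have ii: "integrable lborel (\<lambda>t. indicator A t * e t)" if "A \<in> sets borel" for A
    using integrable_mult_indicator[of A lborel e] ei that by simp
  have left: "\<bar>\<integral>t. indicator A t * e t \<partial>lborel\<bar> \<le> C / s * exp (s * x)" if A: "A \<in> sets borel" "A \<subseteq> {..x}" for A x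
  proof (rule abs_integral_le[OF ii[OF A(1)]])
    have "(\<integral>\<^sup>+t. ennreal \<bar>indicator A t * e t\<bar> \<partial>lborel) \<le> (\<integral>\<^sup>+t. ennreal C * (ennreal (exp (s * t)) * indicator {..x} t) \<partial>lborel)"
      using e1 A(2) C(1) by (intro nn_integral_mono) (auto simp: indicator_def ennreal_mult'[symmetric] intro!: ennreal_leI)
    also have "\<dots> = ennreal (C / s * exp (s * x))"
      using nn_integral_exp_tail(2)[OF s(1), of x] C(1) by (simp add: nn_integral_cmult ennreal_mult'[symmetric])
    finally show "(\<integral>\<^sup>+t. ennreal \<bar>indicator A t * e t\<bar> \<partial>lborel) \<le> ennreal (C / s * exp (s * x))" .
  qed (use C s in simp)
  have right: "\<bar>\<integral>t. indicator A t * e t \<partial>lborel\<bar> \<le> C * exp (- x)" if A: "A \<in> sets borel" "A \<subseteq> {x..}" for A x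
  proof (rule abs_integral_le[OF ii[OF A(1)]])
    have "(\<integral>\<^sup>+t. ennreal \<bar>indicator A t * e t\<bar> \<partial>lborel) \<le> (\<integral>\<^sup>+t. ennreal C * (ennreal (exp (- (1 * t))) * indicator {x..} t) \<partial>lborel)"
      using e2 A(2) C(1) by (intro nn_integral_mono) (auto simp: indicator_def ennreal_mult'[symmetric] intro!: ennreal_leI)
    also have "\<dots> = ennreal C * ennreal (exp (- (1 * x)) / 1)"
      by (subst nn_integral_cmult) (simp_all only: nn_integral_exp_tail(1)[OF zero_less_one], measurable)
    also have "\<dots> = ennreal (C * exp (- x))" using C(1) by (simp add: ennreal_mult'[symmetric])
    finally show "(\<integral>\<^sup>+t. ennreal \<bar>indicator A t * e t\<bar> \<partial>lborel) \<le> ennreal (C * exp (- x))" .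
  qed (use C in simp)
  show ?thesis
  proof (rule that[OF C(1)])
    fix \<Lambda> x :: real assume \<Lambda>: "0 \<le> \<Lambda>" and x: "x \<noteq> 0"
    define \<sigma> where "\<sigma> = ln \<bar>x\<bar>"
    have fl: "fl s (Ulog \<rho> \<Lambda>) x = \<bar>x\<bar> powr (- s) * (\<integral>t. indicator {\<sigma>..\<sigma> + \<Lambda>} t * e t \<partial>lborel)"
      unfolding \<sigma>_def e_def by (rule fl_Ulog[OF \<rho>(1) \<rho>(3) x])
    have xs: "\<bar>x\<bar> powr (- s) * exp (s * \<sigma>) = 1" using x by (simp add: \<sigma>_def powr_def flip: exp_add)
    have "\<bar>fl s (Ulog \<rho> \<Lambda>) x\<bar> = \<bar>x\<bar> powr (- s) * \<bar>\<integral>t. indicator {\<sigma>..\<sigma> + \<Lambda>} t * e t \<partial>lborel\<bar>" unfolding fl by (simp add: abs_mult)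
    also have "\<dots> \<le> \<bar>x\<bar> powr (- s) * (C / s * exp (s * (\<sigma> + \<Lambda>)))" by (intro mult_left_mono left) auto
    also have "\<dots> = (\<bar>x\<bar> powr (- s) * exp (s * \<sigma>)) * (C / s * exp (s * \<Lambda>))" by (simp add: distrib_left exp_add)
    finally show "\<bar>fl s (Ulog \<rho> \<Lambda>) x\<bar> \<le> C / s * exp (s * \<Lambda>)" unfolding xs by simp
    have "(\<integral>t. e t \<partial>lborel) = (\<integral>t. indicator {..<\<sigma>} t * e t + indicator {\<sigma>..\<sigma> + \<Lambda>} t * e t + indicator {\<sigma> + \<Lambda><..} t * e t \<partial>lborel)"
      using \<Lambda> by (intro Bochner_Integration.integral_cong) (auto simp: indicator_def)
    also have "\<dots> = (\<integral>t. indicator {..<\<sigma>} t * e t \<partial>lborel) + (\<integral>t. indicator {\<sigma>..\<sigma> + \<Lambda>} t * e t \<partial>lborel) + (\<integral>t. indicator {\<sigma> + \<Lambda><..} t * e t \<partial>lborel)"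
      using ii by simp
    finally have "(\<integral>t. indicator {\<sigma>..\<sigma> + \<Lambda>} t * e t \<partial>lborel) = kap s / 2 - (\<integral>t. indicator {..<\<sigma>} t * e t \<partial>lborel) - (\<integral>t. indicator {\<sigma> + \<Lambda><..} t * e t \<partial>lborel)"
      using eint by linarith
    moreover have "\<bar>\<integral>t. indicator {..<\<sigma>} t * e t \<partial>lborel\<bar> \<le> C / s * exp (s * \<sigma>)" by (rule left) auto
    moreover have "\<bar>\<integral>t. indicator {\<sigma> + \<Lambda><..} t * e t \<partial>lborel\<bar> \<le> C * exp (- (\<sigma> + \<Lambda>))" by (rule right) auto
    moreover have "exp (s * \<sigma>) = \<bar>x\<bar> powr s" using x by (simp add: \<sigma>_def powr_def)
    moreover have "C * exp (- (\<sigma> + \<Lambda>)) = C * exp (- \<Lambda>) / \<bar>x\<bar>"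
    proof -
      have "exp (- (\<sigma> + \<Lambda>)) = exp (- \<Lambda>) * exp (- \<sigma>)" by (simp flip: exp_add)
      also have "exp (- \<sigma>) = 1 / \<bar>x\<bar>" using x by (simp add: \<sigma>_def exp_minus inverse_eq_divide)
      finally show ?thesis by simp
    qed
    ultimately have "\<bar>\<integral>t. indicator {\<sigma>..\<sigma> + \<Lambda>} t * e t \<partial>lborel\<bar> \<le> kap s / 2 + (C / s * \<bar>x\<bar> powr s + C * exp (- \<Lambda>) / \<bar>x\<bar>)"
      using kap_pos[OF s] by (simp only: abs_le_iff) linarith
    then show "\<bar>fl s (Ulog \<rho> \<Lambda>) x\<bar> \<le> \<bar>x\<bar> powr (- s) * (kap s / 2 + (C / s * \<bar>x\<bar> powr s + C * exp (- \<Lambda>) / \<bar>x\<bar>))"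
      unfolding fl by (simp add: abs_mult mult_left_mono)
  qed
qed

lemma powr_neg_s_powr_p: "0 < y \<Longrightarrow> (y powr (- s)) powr p = 1 / y"
proof -
  assume y: "0 < y"
  have "(y powr (- s)) powr p = y powr (- s * p)" by (rule powr_powr)
  also have "- s * p = - 1" using sp by simp
  also have "y powr (- 1) = 1 / y" using y by (simp add: powr_minus_divide)
  finally show ?thesis .
qed

text \<open>On |x| \<le> r = exp (- \<Lambda>) the uniform bound contributes a multiple of exp
  \<Lambda> * 2 * r, which is bounded. For r < |x| < 1 the p-th power is at most (kap s / 2) powr p
  / |x| plus an error whose integral is bounded uniformly in \<Lambda>; the main term gives (kap s /
  2) powr p * \<Lambda> on each half-line.\<close>

lemma Ulog_norm:
  assumes \<rho>: "test_fun \<rho>" "\<rho> 0 = 1" "\<And>x. \<rho> (- x) = \<rho> x" "\<And>x. 1 \<le> \<bar>x\<bar> \<Longrightarrow> \<rho> x = 0"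
  obtains C where "0 \<le> C" "\<And>\<Lambda>. 0 \<le> \<Lambda> \<Longrightarrow>
    (\<integral>\<^sup>+x. ennreal (\<bar>fl s (Ulog \<rho> \<Lambda>) x\<bar> powr p) * indicator {-1<..<1} x \<partial>lborel) \<le> ennreal (2 * (kap s / 2) powr p * \<Lambda> + C)"
proof -
  obtain C where C: "0 < C" "\<And>\<Lambda> x. 0 \<le> \<Lambda> \<Longrightarrow> x \<noteq> 0 \<Longrightarrow> \<bar>fl s (Ulog \<rho> \<Lambda>) x\<bar> \<le> C / s * exp (s * \<Lambda>)"
    "\<And>\<Lambda> x. 0 \<le> \<Lambda> \<Longrightarrow> x \<noteq> 0 \<Longrightarrow> \<bar>fl s (Ulog \<rho> \<Lambda>) x\<bar> \<le> \<bar>x\<bar> powr (- s) * (kap s / 2 + (C / s * \<bar>x\<bar> powr s + C * exp (- \<Lambda>) / \<bar>x\<bar>))"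
    using fl_Ulog_bounds[OF \<rho>] by blast
  define K where "K = kap s / 2"
  have K: "0 < K" using kap_pos[OF s] by (simp add: K_def)
  define D where "D = C / s + C"
  have Cs: "0 < C / s" using C(1) s by simp
  have D: "0 < D" "C / s \<le> D" "C \<le> D" using C(1) Cs by (simp_all add: D_def)
  define D3 where "D3 = p * (K + D) powr (p - 1) * D"
  have D3: "0 \<le> D3" using D p by (simp add: D3_def)
  define C4 where "C4 = 2 * (C / s) powr p + 2 * (D3 * (1 / s + 1))"
  show ?thesis
  proof (rule that[of C4])
    show "0 \<le> C4" using D3 s by (simp add: C4_def)
    fix \<Lambda> :: real assume \<Lambda>: "0 \<le> \<Lambda>"
    define r where "r = exp (- \<Lambda>)"
    have r: "0 < r" "r \<le> 1" using \<Lambda> by (auto simp: r_def)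
    \<comment> \<open>Since s * p = 1, the p-th power of |x| powr (- s) is 1 / |x|; divided by t,
      the two tails become t powr (s - 1) and r / t^2, each with an integral over [r, 1] bounded
      independently of r.\<close>
    define w where "w t = K powr p / t + D3 * (t powr (s - 1) + r / t\<^sup>2)" for t
    have [measurable]: "w \<in> borel_measurable borel" unfolding w_def[abs_def] by measurable
    have w0: "0 \<le> w t" if "0 < t" for t using that D3 r by (simp add: w_def)
    have le: "(\<integral>\<^sup>+x. ennreal (\<bar>fl s (Ulog \<rho> \<Lambda>) x\<bar> powr p) * indicator {-1<..<1} x \<partial>lborel)
      \<le> (\<integral>\<^sup>+x. ennreal ((C / s) powr p * exp \<Lambda>) * indicator {- r..r} x + ennreal (w \<bar>x\<bar>) * indicator {r..1} \<bar>x\<bar> \<partial>lborel)"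
    proof (rule nn_integral_mono_AE)
      have "AE x in lborel. (x::real) \<noteq> 0" by (rule AE_lborel_singleton)
      then show "AE x in lborel. ennreal (\<bar>fl s (Ulog \<rho> \<Lambda>) x\<bar> powr p) * indicator {-1<..<1} x
         \<le> ennreal ((C / s) powr p * exp \<Lambda>) * indicator {- r..r} x + ennreal (w \<bar>x\<bar>) * indicator {r..1} \<bar>x\<bar>"
      proof eventually_elim
        fix x :: real assume x: "x \<noteq> 0"
        show "ennreal (\<bar>fl s (Ulog \<rho> \<Lambda>) x\<bar> powr p) * indicator {-1<..<1} x
         \<le> ennreal ((C / s) powr p * exp \<Lambda>) * indicator {- r..r} x + ennreal (w \<bar>x\<bar>) * indicator {r..1} \<bar>x\<bar>"
        proof (cases "\<bar>x\<bar> \<le> r")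
          case True
          have "\<bar>fl s (Ulog \<rho> \<Lambda>) x\<bar> powr p \<le> (C / s * exp (s * \<Lambda>)) powr p" using C(2)[OF \<Lambda> x] p by (intro powr_mono2) auto
          also have "\<dots> = (C / s) powr p * exp (s * \<Lambda>) powr p" by (rule powr_mult)
          also have "exp (s * \<Lambda>) powr p = exp \<Lambda>" using sp by (simp add: powr_def mult.assoc[symmetric] mult.commute[of p])
          finally have "ennreal (\<bar>fl s (Ulog \<rho> \<Lambda>) x\<bar> powr p) \<le> ennreal ((C / s) powr p * exp \<Lambda>)" by (rule ennreal_leI)
          moreover have "x \<in> {- r..r}" using True by auto
          ultimately show ?thesis by (auto simp: indicator_def intro: add_increasing2)
        next
          case False
          show ?thesis
          proof (cases "\<bar>x\<bar> < 1")
            case x1: True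
            define y where "y = \<bar>x\<bar>"
            have y: "0 < y" "r \<le> y" "y \<le> 1" using x False x1 by (auto simp: y_def)
            define c where "c = C / s * y powr s + C * r / y"
            have ys: "y powr s \<le> 1" using y s by (intro powr_le1) auto
            have ry: "r / y \<le> 1" "0 \<le> r / y" using y r by (auto simp: divide_le_eq)
            have c0: "0 \<le> c" using C(1) s y r by (auto simp: c_def intro!: add_nonneg_nonneg)
            have "c = C / s * y powr s + C * (r / y)" by (simp add: c_def)
            moreover have "C / s * y powr s \<le> C / s * 1" using Cs ys by (intro mult_left_mono) auto
            moreover have "C * (r / y) \<le> C * 1" using C(1) ry by (intro mult_left_mono) auto
            ultimately have cD: "c \<le> D" by (simp add: D_def)
            have cD2: "c \<le> D * (y powr s + r / y)"
            proof -
              have "C / s * y powr s \<le> D * y powr s" using D by (intro mult_right_mono) auto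
              moreover have "C * (r / y) \<le> D * (r / y)" using D ry by (intro mult_right_mono) auto
              ultimately show ?thesis unfolding c_def by (simp add: distrib_left)
            qed
            have "\<bar>fl s (Ulog \<rho> \<Lambda>) x\<bar> \<le> y powr (- s) * (K + c)" using C(3)[OF \<Lambda> x] by (simp add: y_def K_def c_def r_def)
            then have "\<bar>fl s (Ulog \<rho> \<Lambda>) x\<bar> powr p \<le> (y powr (- s) * (K + c)) powr p" using p by (intro powr_mono2) auto
            also have "\<dots> = (y powr (- s)) powr p * (K + c) powr p" using K c0 by (simp add: powr_mult)
            also have "(y powr (- s)) powr p = 1 / y" using y(1) by (rule powr_neg_s_powr_p)
            also have "1 / y * (K + c) powr p \<le> 1 / y * (K powr p + p * (K + D) powr (p - 1) * c)"
              using powr_p_add_le[OF less_imp_le[OF K] c0 cD] y by (intro mult_left_mono) auto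
            also have "\<dots> \<le> 1 / y * (K powr p + p * (K + D) powr (p - 1) * (D * (y powr s + r / y)))"
              using cD2 y p by (intro mult_left_mono add_left_mono) auto
            also have "\<dots> = w y"
            proof -
              have "y powr s / y = y powr (s - 1)" using y by (simp add: powr_diff)
              then show ?thesis unfolding w_def D3_def power2_eq_square using y by (simp add: field_simps)
            qed
            finally have "ennreal (\<bar>fl s (Ulog \<rho> \<Lambda>) x\<bar> powr p) \<le> ennreal (w \<bar>x\<bar>)" unfolding y_def by (rule ennreal_leI)
            then show ?thesis using y by (auto simp: y_def indicator_def intro: add_increasing)
          qed (auto simp: indicator_def)
        qed
      qed
    qed
    have split: "(\<integral>\<^sup>+x. ennreal ((C / s) powr p * exp \<Lambda>) * indicator {- r..r} x + ennreal (w \<bar>x\<bar>) * indicator {r..1} \<bar>x\<bar> \<partial>lborel)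
      = ennreal ((C / s) powr p * exp \<Lambda>) * ennreal (2 * r) + (\<integral>\<^sup>+x. ennreal (w \<bar>x\<bar>) * indicator {r..1} \<bar>x\<bar> \<partial>lborel)"
      using r by (subst nn_integral_add) (auto simp: nn_integral_cmult_indicator)
    have refl: "(\<integral>\<^sup>+x. ennreal (w \<bar>x\<bar>) * indicator {r..1} \<bar>x\<bar> \<partial>lborel) = 2 * (\<integral>\<^sup>+x\<in>{0<..}. ennreal (w x) * indicator {r..1} x \<partial>lborel)"
      by (rule nn_integral_abs[of "\<lambda>x. ennreal (w x) * indicator {r..1} x"]) measurable
    have "(\<integral>\<^sup>+x\<in>{0<..}. ennreal (w x) * indicator {r..1} x \<partial>lborel) = (\<integral>\<^sup>+x. ennreal (w x * indicator {r..1} x) * indicator {r..1} x \<partial>lborel)"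
      using r by (intro nn_integral_cong) (auto simp: indicator_def)
    also have "\<dots> = ennreal ((K powr p * ln 1 + D3 * (1 powr s / s - r / 1)) - (K powr p * ln r + D3 * (r powr s / s - r / r)))"
    proof (rule nn_integral_FTC_Icc[where F="\<lambda>t. K powr p * ln t + D3 * (t powr s / s - r / t)"])
      fix t assume t: "t \<in> {r..1}"
      then have "0 < t" using r by auto
      then show "((\<lambda>t. K powr p * ln t + D3 * (t powr s / s - r / t)) has_real_derivative w t * indicator {r..1} t) (at t)"
        using t s by (auto intro!: derivative_eq_intros simp: w_def power2_eq_square field_simps)
      show "0 \<le> w t * indicator {r..1} t" using w0[OF \<open>0 < t\<close>] by simp
    qed (use r in measurable)
    also have "\<dots> \<le> ennreal (K powr p * \<Lambda> + D3 * (1 / s + 1))"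
    proof (rule ennreal_leI)
      have "ln r = - \<Lambda>" by (simp add: r_def)
      moreover have "0 \<le> D3 * (r + r powr s / s)" using D3 r s by (intro mult_nonneg_nonneg) auto
      ultimately show "(K powr p * ln 1 + D3 * (1 powr s / s - r / 1)) - (K powr p * ln r + D3 * (r powr s / s - r / r)) \<le> K powr p * \<Lambda> + D3 * (1 / s + 1)"
        using r by (simp add: algebra_simps)
    qed
    finally have wle: "(\<integral>\<^sup>+x\<in>{0<..}. ennreal (w x) * indicator {r..1} x \<partial>lborel) \<le> ennreal (K powr p * \<Lambda> + D3 * (1 / s + 1))" .
    have "ennreal ((C / s) powr p * exp \<Lambda>) * ennreal (2 * r) + 2 * ennreal (K powr p * \<Lambda> + D3 * (1 / s + 1)) = ennreal (2 * K powr p * \<Lambda> + C4)"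
    proof -
      have "ennreal ((C / s) powr p * exp \<Lambda>) * ennreal (2 * r) = ennreal (2 * (C / s) powr p)"
        using r by (simp add: ennreal_mult'[symmetric] r_def exp_minus)
      moreover have "2 * ennreal (K powr p * \<Lambda> + D3 * (1 / s + 1)) = ennreal (2 * (K powr p * \<Lambda> + D3 * (1 / s + 1)))"
        by (subst ennreal_mult'[of 2]) auto
      moreover have "0 \<le> 2 * (K powr p * \<Lambda> + D3 * (1 / s + 1))" using \<Lambda> D3 s by (intro mult_nonneg_nonneg add_nonneg_nonneg) auto
      ultimately show ?thesis by (simp only: ennreal_plus[symmetric] powr_ge_zero mult_nonneg_nonneg zero_le_numeral) (simp add: C4_def algebra_simps)
    qed
    with order.trans[OF le[unfolded split refl] add_left_mono[OF mult_left_mono[OF wle]]]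
    show "(\<integral>\<^sup>+x. ennreal (\<bar>fl s (Ulog \<rho> \<Lambda>) x\<bar> powr p) * indicator {-1<..<1} x \<partial>lborel) \<le> ennreal (2 * (kap s / 2) powr p * \<Lambda> + C4)"
      unfolding K_def by simp
  qed
qed

text \<open>The extremal profile loses only a bounded amount against the critical exponent: with the constant
  \<open>kap s / 2\<close> of \<open>integral_E\<close> the leading terms in \<open>\<Lambda>\<close> cancel exactly.\<close>

lemma extremal_exponent:
  assumes C: "0 \<le> C" and B: "0 \<le> B" and \<Lambda>: "B \<le> \<Lambda>" "0 < \<Lambda>" and N: "N = (2 * (kap s / 2) powr p * \<Lambda> + C) powr (1 / p)"
    and v: "(\<Lambda> - B) / N \<le> v"
  shows "\<Lambda> - (q * (B + C / (2 * (kap s / 2) powr p)) - C / (2 * (kap s / 2) powr p)) \<le> alpha_p p * v powr q" and "0 < N"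
proof -
  define c where "c = 2 * (kap s / 2) powr p"
  have kp: "0 < kap s" by (rule kap_pos[OF s])
  have c: "0 < c" using kp by (simp add: c_def)
  define D where "D = C / c"
  have D: "0 \<le> D" using C c by (simp add: D_def)
  define Y where "Y = \<Lambda> + D"
  have Y: "0 < Y" using D \<Lambda> by (simp add: Y_def)
  have cY: "2 * (kap s / 2) powr p * \<Lambda> + C = c * Y" using c by (simp add: c_def[symmetric] Y_def D_def distrib_left)
  have N': "N = (c * Y) powr (1 / p)" unfolding N cY ..
  show N0: "0 < N" unfolding N' using c Y by simp
  have Nq: "N powr q = c powr (q - 1) * Y powr (q - 1)"
    unfolding N' using c Y by (simp add: powr_powr q_over_p powr_mult)
  \<comment> \<open>This is where the constants meet: the factor equals \<open>alpha_p p\<close>, so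
    it cancels after division by N powr q.\<close>
  have cq: "c powr (q - 1) = kap s powr q / 2"
  proof -
    have "c powr (q - 1) = 2 powr (q - 1) * ((kap s / 2) powr p) powr (q - 1)" unfolding c_def using kp by (simp add: powr_mult)
    also have "((kap s / 2) powr p) powr (q - 1) = (kap s / 2) powr q"
    proof -
      have "p * (q - 1) = q" using p by (simp add: q_def field_simps)
      then show ?thesis by (simp add: powr_powr)
    qed
    also have "(kap s / 2) powr q = kap s powr q / 2 powr q" using kp by (simp add: powr_divide)
    also have "2 powr (q - 1) * (kap s powr q / 2 powr q) = kap s powr q / 2" by (simp add: powr_diff)
    finally show ?thesis .
  qed
  define t where "t = (\<Lambda> - B) / N"
  have t0: "0 \<le> t" using \<Lambda> N0 by (simp add: t_def)
  define y where "y = (\<Lambda> - B) / Y"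
  have y0: "0 \<le> y" using \<Lambda> Y by (simp add: y_def)
  \<comment> \<open>Bernoulli's inequality, from Young's inequality for 1 and y.\<close>
  have "1 + q * (y - 1) \<le> y powr q"
  proof -
    have "1 * y \<le> 1 powr p / p + y powr q / q" using y0 by (intro young) auto
    then have "q * y \<le> q * (1 / p + y powr q / q)" using q by (intro mult_left_mono) auto
    also have "\<dots> = q / p + y powr q" using q by (simp add: distrib_left)
    finally show ?thesis unfolding q_over_p by (simp add: right_diff_distrib)
  qed
  then have "Y * (1 + q * (y - 1)) \<le> Y * y powr q" using Y by (intro mult_left_mono) auto
  moreover have "Y * y powr q = alpha_p p * t powr q"
  proof -
    define k where "k = kap s powr q / 2"
    have k: "0 < k" using kp by (simp add: k_def)
    have "alpha_p p * t powr q = k * t powr q" unfolding alpha_p_eq[OF t0] k_def using kp t0 by (simp add: powr_mult)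
    also have "\<dots> = k * ((\<Lambda> - B) powr q / (k * Y powr (q - 1)))"
      unfolding t_def k_def using \<Lambda> N0 by (simp add: powr_divide Nq cq)
    also have "\<dots> = (\<Lambda> - B) powr q / Y powr (q - 1)"
      using k by simp
    also have "\<dots> = Y * y powr q"
      unfolding y_def using Y \<Lambda> by (simp add: powr_divide powr_diff)
    finally show ?thesis ..
  qed
  moreover have "Y * (1 + q * (y - 1)) = \<Lambda> - (q * (B + D) - D)"
  proof -
    have "Y * (1 + q * (y - 1)) = Y + q * (Y * y - Y)" by (simp add: algebra_simps)
    also have "Y * y = \<Lambda> - B" unfolding y_def using Y by simp
    finally show ?thesis by (simp add: Y_def algebra_simps)
  qed
  moreover have "alpha_p p * t powr q \<le> alpha_p p * v powr q"
  proof (rule mult_left_mono)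
    show "t powr q \<le> v powr q" using t0 v q unfolding t_def by (intro powr_mono2) auto
    show "0 \<le> alpha_p p" by (simp add: alpha_p_def)
  qed
  ultimately show "\<Lambda> - (q * (B + C / (2 * (kap s / 2) powr p)) - C / (2 * (kap s / 2) powr p)) \<le> alpha_p p * v powr q"
    unfolding c_def[symmetric] D_def[symmetric] by linarith
qed

text \<open>On an interval of length 2 * r * exp (- \<Lambda>) the exponential is at least exp
  (\<Lambda> - C5), so its integral there stays bounded below independently of \<Lambda>; the
  profile is large on the same interval, where h therefore exceeds any prescribed height.\<close>

theorem lower_bound:
  assumes ab: "a < b" and h0: "\<forall>t\<ge>0. (h :: real \<Rightarrow> real) t \<ge> 0" and h: "filterlim h at_top at_top"
  shows "(SUP u \<in> {u. admissible p a b u}.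
     \<integral>\<^sup>+x\<in>{a<..<b}. ennreal (h \<bar>u x\<bar> * (exp (alpha_p p * \<bar>u x\<bar> powr q) - 1)) \<partial>lborel) = \<infinity>"
proof -
  define J where "J u = (\<integral>\<^sup>+x\<in>{a<..<b}. ennreal (h \<bar>u x\<bar> * (exp (alpha_p p * \<bar>u x\<bar> powr q) - 1)) \<partial>lborel)" for u
  define m r where "m = (a + b) / 2" and "r = (b - a) / 2"
  have r: "0 < r" "a = m - r" "b = m + r" using ab by (simp_all add: m_def r_def field_simps)
  obtain \<rho> :: "real \<Rightarrow> real" where \<rho>: "test_fun \<rho>" "\<rho> 0 = 1" "\<And>x. \<rho> (- x) = \<rho> x" "\<And>x. 1 \<le> \<bar>x\<bar> \<Longrightarrow> \<rho> x = 0"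
    using bump_exists by metis
  obtain B where B: "0 \<le> B" "\<And>\<Lambda> x. 0 \<le> \<Lambda> \<Longrightarrow> \<bar>x\<bar> \<le> exp (- \<Lambda>) \<Longrightarrow> \<Lambda> - B \<le> Ulog \<rho> \<Lambda> x" using Ulog_lower[OF \<rho>(1,2)] by blast
  obtain C where C: "0 \<le> C" "\<And>\<Lambda>. 0 \<le> \<Lambda> \<Longrightarrow>
    (\<integral>\<^sup>+x. ennreal (\<bar>fl s (Ulog \<rho> \<Lambda>) x\<bar> powr p) * indicator {-1<..<1} x \<partial>lborel) \<le> ennreal (2 * (kap s / 2) powr p * \<Lambda> + C)"
    using Ulog_norm[OF \<rho>] by blast
  define C5 where "C5 = q * (B + C / (2 * (kap s / 2) powr p)) - C / (2 * (kap s / 2) powr p)"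
  have ap: "0 < alpha_p p" 
  proof -
    have "alpha_p p = kap s powr q / 2" using alpha_p_eq[of 1] by simp
    moreover have "0 < kap s powr q" using kap_pos[OF s] by simp
    ultimately show ?thesis by linarith
  qed
  have "\<exists>u. admissible p a b u \<and> of_nat n \<le> J u" for n :: nat
  proof -
    \<comment> \<open>The height of h which, multiplied by exp (\<Lambda> - C5) / 2 and by the
      length 2 * r * exp (- \<Lambda>), yields exactly n.\<close>
    define H where "H = real n * exp C5 / r"
    have H: "0 \<le> H" using r by (simp add: H_def)
    from h obtain T where T: "\<And>t. T \<le> t \<Longrightarrow> H \<le> h t"
      unfolding filterlim_at_top eventually_at_top_linorder by blast
    define T' where "T' = max T 0"
    have T'0: "0 \<le> T'" by (simp add: T'_def)
    \<comment> \<open>Three requirements: \<Lambda> \<ge> B for \<open>extremal_exponent\<close>;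
      \<Lambda> - C5 \<ge> 1, so that subtracting 1 costs at most half of exp (\<Lambda> - C5); and
      alpha_p p * T' powr q \<le> \<Lambda> - C5, which forces |V| \<ge> T' on
      \<open>S\<close>.\<close>
    define \<Lambda> where "\<Lambda> = 1 + B + \<bar>C5\<bar> + alpha_p p * T' powr q"
    have aT: "0 \<le> alpha_p p * T' powr q" using ap by simp
    have \<Lambda>: "0 < \<Lambda>" "B \<le> \<Lambda>" "1 \<le> \<Lambda> - C5" "alpha_p p * T' powr q \<le> \<Lambda> - C5" using B(1) aT by (auto simp: \<Lambda>_def)
    define N where "N = (2 * (kap s / 2) powr p * \<Lambda> + C) powr (1 / p)"
    define U where "U = Ulog \<rho> \<Lambda>"
    have U: "test_fun U" "\<And>x. 1 \<le> \<bar>x\<bar> \<Longrightarrow> U x = 0" unfolding U_def using Ulog_test[OF \<rho>(1) \<rho>(4)] by auto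
    \<comment> \<open>Dilation to (a, b) leaves the p-norm of the fractional Laplacian over the
      interval unchanged: (r powr (- s)) powr p = 1 / r cancels the Jacobian. Division by N then
      makes this norm at most 1.\<close>
    define V where "V x = 1 / N * U ((x - m) / r)" for x
    have N0: "0 < N" using extremal_exponent(2)[OF C(1) B(1) \<Lambda>(2,1) N_def order.refl] .
    have Np: "N powr p = 2 * (kap s / 2) powr p * \<Lambda> + C"
      unfolding N_def using C(1) \<Lambda>(1) by (intro powr_p_inverse(1)) (auto intro!: add_nonneg_nonneg)
    have V_test: "test_fun V"
    proof -
      have "test_fun (\<lambda>x. 1 / N * U (- m / r + 1 / r * x))" using r by (intro test_fun_affine U) auto
      moreover have "(\<lambda>x. 1 / N * U (- m / r + 1 / r * x)) = V" by (auto simp: V_def diff_divide_distrib)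
      ultimately show ?thesis by simp
    qed
    have flV: "fl s V x = 1 / N * (r powr (- s) * fl s U ((x - m) / r))" for x
      unfolding V_def[abs_def] fl_mult fl_scale[OF r(1)] ..
    note [measurable] = fl_measurable[OF test_fun_measurable[OF U(1)]] fl_measurable[OF test_fun_measurable[OF V_test]]
    have adm: "admissible p a b V"
    proof (rule admissible_test_fun[OF V_test])
      show "V x = 0" if "x \<notin> {a<..<b}" for x
      proof -
        have "r \<le> \<bar>x - m\<bar>" using that unfolding r(2,3) greaterThanLessThan_iff by linarith
        then have "1 \<le> \<bar>(x - m) / r\<bar>" using r(1) by (simp add: abs_div)
        then show ?thesis by (simp add: V_def U(2))
      qed
      have "(\<integral>\<^sup>+x. ennreal (\<bar>fl s V x\<bar> powr p) * indicator {a<..<b} x \<partial>lborel)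
        = ennreal \<bar>r\<bar> * (\<integral>\<^sup>+y. ennreal (\<bar>fl s V (m + r * y)\<bar> powr p) * indicator {a<..<b} (m + r * y) \<partial>lborel)"
        by (rule nn_integral_real_affine) (use r in auto)
      also have "\<dots> = (\<integral>\<^sup>+y. ennreal (1 / N powr p) * (ennreal (\<bar>fl s U y\<bar> powr p) * indicator {-1<..<1} y) \<partial>lborel)"
      proof (subst nn_integral_cmult[symmetric], measurable, rule nn_integral_cong)
        fix y
        have "\<bar>fl s V (m + r * y)\<bar> = (1 / N) * (r powr (- s) * \<bar>fl s U y\<bar>)"
          unfolding flV using r(1) N0 by (simp add: abs_mult)
        then have "\<bar>fl s V (m + r * y)\<bar> powr p = (1 / N) powr p * ((r powr (- s)) powr p * \<bar>fl s U y\<bar> powr p)"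
          using N0 by (simp only: powr_mult powr_ge_zero abs_ge_zero mult_nonneg_nonneg zero_le_divide_1_iff less_imp_le)
        also have "(r powr (- s)) powr p = 1 / r" using r(1) by (rule powr_neg_s_powr_p)
        also have "(1 / N) powr p = 1 / N powr p" using N0 by (simp add: powr_divide)
        finally have "r * \<bar>fl s V (m + r * y)\<bar> powr p = 1 / N powr p * \<bar>fl s U y\<bar> powr p" using r(1) by simp
        moreover have "indicator {a<..<b} (m + r * y) = (indicator {-1<..<1} y :: ennreal)"
        proof -
          have "- r < r * y \<longleftrightarrow> - 1 < y" "r * y < r \<longleftrightarrow> y < 1"
            using r(1) mult_less_cancel_left_pos[OF r(1), of "-1" y] mult_less_cancel_left_pos[OF r(1), of y 1] by simp_all
          then show ?thesis unfolding r(2,3) by (auto simp: indicator_def)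
        qed
        ultimately show "ennreal \<bar>r\<bar> * (ennreal (\<bar>fl s V (m + r * y)\<bar> powr p) * indicator {a<..<b} (m + r * y))
            = ennreal (1 / N powr p) * (ennreal (\<bar>fl s U y\<bar> powr p) * indicator {-1<..<1} y)"
          using r(1) by (simp add: mult.assoc[symmetric] ennreal_mult'[symmetric])
      qed
      also have "\<dots> = ennreal (1 / N powr p) * (\<integral>\<^sup>+y. ennreal (\<bar>fl s U y\<bar> powr p) * indicator {-1<..<1} y \<partial>lborel)"
        by (rule nn_integral_cmult) measurable
      also have "\<dots> \<le> ennreal (1 / N powr p) * ennreal (N powr p)"
        unfolding Np U_def using \<Lambda> by (intro mult_left_mono C(2)) auto
      also have "\<dots> = 1" using N0 by (simp add: ennreal_mult'[symmetric])
      finally show "(\<integral>\<^sup>+x. ennreal (\<bar>fl s V x\<bar> powr p) * indicator {a<..<b} x \<partial>lborel) \<le> 1" .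
    qed
    define S where "S = {m - r * exp (- \<Lambda>)<..<m + r * exp (- \<Lambda>)}"
    have e1: "exp (- \<Lambda>) \<le> 1" using \<Lambda>(1) by simp
    have re: "r * exp (- \<Lambda>) \<le> r" using r(1) e1 by (simp add: mult_left_le)
    have "ennreal (real n) = ennreal (H * (exp (\<Lambda> - C5) / 2)) * ennreal (2 * (r * exp (- \<Lambda>)))"
    proof -
      have "H * (exp (\<Lambda> - C5) / 2) * (2 * (r * exp (- \<Lambda>))) = (H * r) * (exp (\<Lambda> - C5) * exp (- \<Lambda>))" by simp
      also have "exp (\<Lambda> - C5) * exp (- \<Lambda>) = exp (- C5)" by (simp flip: exp_add)
      also have "H * r * exp (- C5) = real n" using r(1) by (simp add: H_def mult.assoc flip: exp_add)
      finally show ?thesis using H by (simp add: ennreal_mult'[symmetric])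
    qed
    also have "\<dots> = (\<integral>\<^sup>+x. ennreal (H * (exp (\<Lambda> - C5) / 2)) * indicator S x \<partial>lborel)"
      using r(1) by (subst nn_integral_cmult_indicator) (auto simp: S_def)
    also have "\<dots> \<le> J V"
      unfolding J_def
    proof (rule nn_integral_mono)
      fix x
      show "ennreal (H * (exp (\<Lambda> - C5) / 2)) * indicator S x \<le> ennreal (h \<bar>V x\<bar> * (exp (alpha_p p * \<bar>V x\<bar> powr q) - 1)) * indicator {a<..<b} x"
      proof (cases "x \<in> S")
        case True
        then have "\<bar>x - m\<bar> \<le> r * exp (- \<Lambda>)" by (auto simp: S_def)
        then have "\<bar>(x - m) / r\<bar> \<le> exp (- \<Lambda>)" using r(1) by (simp add: abs_div divide_le_eq mult.commute)
        then have "\<Lambda> - B \<le> U ((x - m) / r)" unfolding U_def using \<Lambda> by (intro B(2)) auto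
        then have "(\<Lambda> - B) / N \<le> V x" unfolding V_def using N0 by (simp add: divide_right_mono)
        then have v: "(\<Lambda> - B) / N \<le> \<bar>V x\<bar>" by linarith
        have ex: "\<Lambda> - C5 \<le> alpha_p p * \<bar>V x\<bar> powr q"
          unfolding C5_def by (rule extremal_exponent(1)[OF C(1) B(1) \<Lambda>(2,1) N_def v])
        have Tq: "T' powr q \<le> \<bar>V x\<bar> powr q" using order.trans[OF \<Lambda>(4) ex] ap by simp
        have "(T' powr q) powr (1 / q) \<le> (\<bar>V x\<bar> powr q) powr (1 / q)" by (rule powr_mono2[OF _ _ Tq]) (use q in auto)
        then have "T' \<le> \<bar>V x\<bar>" unfolding powr_p_inverse(4)[OF T'0] powr_p_inverse(4)[OF abs_ge_zero] .
        then have hV: "H \<le> h \<bar>V x\<bar>" by (intro T) (simp add: T'_def)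
        have "exp (\<Lambda> - C5) / 2 \<le> exp (\<Lambda> - C5) - 1"
        proof -
          have "1 + 1 \<le> exp (1::real)" by (rule exp_ge_add_one_self)
          also have "exp 1 \<le> exp (\<Lambda> - C5)" using \<Lambda>(3) by simp
          finally show ?thesis by simp
        qed
        also have "\<dots> \<le> exp (alpha_p p * \<bar>V x\<bar> powr q) - 1" using ex by simp
        finally have "H * (exp (\<Lambda> - C5) / 2) \<le> h \<bar>V x\<bar> * (exp (alpha_p p * \<bar>V x\<bar> powr q) - 1)"
          using H hV by (intro mult_mono) auto
        moreover have "x \<in> {a<..<b}" using True re unfolding S_def r(2,3) greaterThanLessThan_iff by linarith
        ultimately show ?thesis using True by (simp add: ennreal_leI)
      qed simp
    qed
    finally show ?thesis using adm by (auto simp: ennreal_of_nat_eq_real_of_nat)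
  qed
  then have le: "of_nat n \<le> (SUP u \<in> {u. admissible p a b u}. J u)" for n :: nat
    by (meson SUP_upper2 mem_Collect_eq)
  have "(SUP u \<in> {u. admissible p a b u}. J u) = \<infinity>"
  proof (rule ccontr)
    assume "(SUP u \<in> {u. admissible p a b u}. J u) \<noteq> \<infinity>"
    then have "(SUP u \<in> {u. admissible p a b u}. J u) < top" unfolding less_top[symmetric] by simp
    then obtain n :: nat where "(SUP u \<in> {u. admissible p a b u}. J u) < of_nat n"
      using ennreal_Ex_less_of_nat by blast
    then show False using le[of n] by simp
  qed
  then show ?thesis unfolding J_def .
qed

end

theorem theorem1p1:
  fixes p :: real
  assumes "1 < p"
  shows "(\<exists>C :: real. \<forall>a b \<alpha> u. a < b \<longrightarrow> \<alpha> \<le> alpha_p p \<longrightarrow> admissible p a b u \<longrightarrow>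
            (\<integral>\<^sup>+ x \<in> {a<..<b}. ennreal (exp (\<alpha> * \<bar>u x\<bar> powr (p / (p - 1))) - 1) \<partial>lborel)
              \<le> ennreal (C * (b - a)))
       \<and> (\<forall>a b (h :: real \<Rightarrow> real). a < b \<longrightarrow> (\<forall>t\<ge>0. h t \<ge> 0) \<longrightarrow> filterlim h at_top at_top \<longrightarrow>
            (SUP u \<in> {u. admissible p a b u}.
               \<integral>\<^sup>+ x \<in> {a<..<b}. ennreal (h \<bar>u x\<bar> * (exp (alpha_p p * \<bar>u x\<bar> powr (p / (p - 1))) - 1)) \<partial>lborel)
            = \<infinity>)"
proof -
  interpret conjugate_exponents p "p / (p - 1)" "1 / p"
    by unfold_locales (use assms in auto)
  show ?thesis
    using upper_bound lower_bound by blast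
qed

end
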